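(* Let $H_1\in\mathcal{C}_0$ be symmetric, $H:=H_0+H_1$, and assume: (A1) $H_0$ has a unique ground state $\Omega_0$ ($\|\Omega_0\|=1$) and $E_0(H_0)=0$; (A2) $H$ has a unique ground state $\Omega$ ($\|\Omega\|=1$); (A3) $\langle\Omega,\Omega_0\rangle\ne0$. Let $m\ge1$ and let $A_1,\dots,A_m$ be linear operators such that: (I) each $A_k$ is in $\mathcal{C}_0$; (II) for each $k$ there is an integer $r_k\ge0$ such that, for all $n\in\mathbb{N}$, $A_k$ maps $D(H^{n+r_k})$ into $D(H^n)$. Let $z_1,\dots,z_m\in\mathbb{C}$ with $\operatorname{Im}z_1\le\cdots\le\operatorname{Im}z_m$, let $\varepsilon>0$, and for each sufficiently large $T>0$ choose a piecewise continuously differentiable simple curve $\Gamma_T^\varepsilon$ from $-T(1-i\varepsilon)$ to $T(1-i\varepsilon)$ passing through $z_1,\dots,z_m$ and on which $z_1\succ\cdots\succ z_m$. Then the $m$-point Green's function $$G_m(z_1,\dots,z_m):=e^{i(z_1-z_m)E_0(H)}\big\langle\Omega,\,A_1\overline{W(z_1-z_2)}A_2\cdots A_{m-1}\overline{W(z_{m-1}-z_m)}A_m\Omega\big\rangle$$ is well-defined, and $$G_m(z_1,\dots,z_m)=\lim_{T\to\infty}\frac{\Big\langle\Omega_0,\ \mathcal{T}A_1(z_1)\cdots A_m(z_m)\exp\Big(-i\int_{\Gamma_T^\varepsilon}d\zeta\,H_1(\zeta)\Big)\Omega_0\Big\rangle}{\Big\langle\Omega_0,\ \mathcal{T}\ex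p\Big(-i\int_{\Gamma_T^\varepsilon}d\zeta\,H_1(\zeta)\Big)\Omega_0\Big\rangle}.$$
   Context: $\mathcal{H}$ is a complex Hilbert space (inner product antilinear in the first variable) and $H_0$ a non-negative self-adjoint operator in $\mathcal{H}$ with spectral measure $E_{H_0}$. For $E\ge0$ put $V_E:=R(E_{H_0}([0,E]))$, and $D_{\mathrm{fin}}:=\bigcup_{E\ge0}V_E$ (dense). A linear operator $T$ in $\mathcal{H}$ belongs to the class $\mathcal{C}_0$ if: (I) $T$ and $T^*$ are densely defined and closed; (II) $T$ and $T^*$ are $H_0^{1/2}$-bounded; (III) there is a constant $b\ge0$ such that for all $E\ge0$, $T$ and $T^*$ map $V_E$ into $V_{E+b}$. For $A\in\mathcal{C}_0$ and $z\in\mathbb{C}$, $A(z)$ denotes the closure of the closable operator $e^{izH_0}Ae^{-izH_0}$. Products and sums of operators have their natural domains. Complex time evolution: for $\operatorname{Im}z\le\operatorname{Im}z'$, $U(z,z')$ is the closable operator with domain $D_{\mathrm{fin}}$ given by $U(z,z')\Psi=\sum_{n\ge0}(-i)^n\int_{z'}^zd\zeta_1\int_{z'}^{\zeta_1}d\zeta_2\cdots\int_{z'}^{\zeta_{n-1}}d\zeta_n\,H_1(\zeta_1)\cdots H_1(\zeta_n)\Psi$ (path-independent line integrals of entire vector-valued functions; the series converges absolutely). For $\operatorname{Im}z\le0$, $W(z):=e^{-izH_0}\,\overline{U(z,0)}$. For symmetric $H_1\in\mathcal{C}_0$, $H$ is self-adjoint and bounded below and $\overline{W(z)}=e^{-izH}$.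 For a self-adjoint operator $S$ bounded from below, $E_0(S):=\inf\sigma(S)$; $S$ has a ground state if $E_0(S)$ is an eigenvalue, non-zero vectors of $\ker(S-E_0(S))$ are ground states, and the ground state is unique if $\dim\ker(S-E_0(S))=1$. Curves and ordering: a simple curve is a piecewise continuously differentiable injective map $\Gamma:[\alpha,\beta]\to\mathbb{C}$, from $\Gamma(\alpha)$ to $\Gamma(\beta)$; its image is also denoted $\Gamma$. For $\zeta_j=\Gamma(t_j)$, $\zeta_1\succ\zeta_2$ iff $t_1>t_2$. Integrals over $\Gamma^n$ are strong iterated line integrals. Time-ordered exponentials: let $F_1,\dots,F_k,F$ ($k\ge0$) be operator-valued functions and put $F_{k+1}=F_{k+2}=\cdots=F$. For fixed $\zeta_1,\dots,\zeta_k\in\Gamma$ and variables $\zeta_{k+1},\dots,\zeta_{k+n}\in\Gamma$ put $$\mathcal{T}(F_1(\zeta_1)\cdots F_{k+n}(\zeta_{k+n})):=\sum_{\sigma\in\mathfrak{S}_{k+n}}\chi_{P'_{n,\sigma}}(\zeta_{k+1},\dots,\zeta_{k+n})F_{\sigma(1)}(\zeta_{\sigma(1)})\cdots F_{\sigma(k+n)}(\zeta_{\sigma(k+n)}),$$ with $P'_{n,\sigma}=\{(\zeta_{k+1},\dots,\zeta_{k+n})\in\Gamma^n:\zeta_{\sigma(1)}\succ\cdots\succ\zeta_{\sigma(k+n)}\}$ and $\chi$ the characteristic function. Let $C(F_1,\dots,F_k,F)$ be the linear span of all $\Psi$ for which all maps $(\zeta_{k+1},\dots,\zeta_{k+n})\mapsto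 F_{\sigma(1)}(\zeta_{\sigma(1)})\cdots F_{\sigma(k+n)}(\zeta_{\sigma(k+n)})\Psi$ ($n\ge0$, $\sigma\in\mathfrak{S}_{k+n}$, $\zeta_1,\dots,\zeta_k$ fixed) are defined and strongly continuous. The operator $\mathcal{T}F_1(\zeta_1)\cdots F_k(\zeta_k)\exp(\int_\Gamma d\zeta\,F(\zeta))$ acts by $$\Psi\mapsto\sum_{n\ge0}\frac1{n!}\int_{\Gamma^n}d\zeta_{k+1}\cdots d\zeta_{k+n}\,\mathcal{T}\big(F_1(\zeta_1)\cdots F_k(\zeta_k)F(\zeta_{k+1})\cdots F(\zeta_{k+n})\big)\Psi$$ on the domain of all $\Psi\in C(F_1,\dots,F_k,F)$ for which this series converges absolutely in norm. For $k=0$ it is written $\mathcal{T}\exp(\int_\Gamma d\zeta\,F(\zeta))$. Here $F_j=A_j(\cdot)$ and $F=-iH_1(\cdot)$. *)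

theory Defs
  imports "HOL-Analysis.Analysis" "HOL-Combinatorics.Permutations"
begin

section \<open>Complex Hilbert spaces\<close>

text \<open>The inner product is antilinear in the first argument. Positive definiteness is
  contained in the last axiom, because the norm is a norm.\<close>

class complex_hilbert = banach +
  fixes scaleC :: "complex \<Rightarrow> 'a \<Rightarrow> 'a" (infixr "*\<^sub>C" 75)
    and cinner :: "'a \<Rightarrow> 'a \<Rightarrow> complex"
  assumes scaleC_add_right: "c *\<^sub>C (x + y) = c *\<^sub>C x + c *\<^sub>C y"
    and scaleC_add_left: "(c + d) *\<^sub>C x = c *\<^sub>C x + d *\<^sub>C x"
    and scaleC_scaleC: "c *\<^sub>C d *\<^sub>C x = (c * d) *\<^sub>C x"
    and scaleR_scaleC: "r *\<^sub>R x = complex_of_real r *\<^sub>C x"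
    and cinner_commute: "cinner x y = cnj (cinner y x)"
    and cinner_add_right: "cinner x (y + z) = cinner x y + cinner x z"
    and cinner_scaleC_right: "cinner x (c *\<^sub>C y) = c * cinner x y"
    and cinner_norm: "cinner x x = complex_of_real ((norm x)\<^sup>2)"

global_interpretation complex_vector:
  vector_space "scaleC :: complex \<Rightarrow> 'a \<Rightarrow> 'a :: complex_hilbert"
  defines csubspace = complex_vector.subspace
    and cspan = complex_vector.span
    and cdim = complex_vector.dim
proof
  show "1 *\<^sub>C x = x" for x :: 'a
    using scaleR_scaleC[of 1 x] by simp
qed (simp_all add: scaleC_add_right scaleC_add_left scaleC_scaleC)

instantiation complex :: complex_hilbert
begin

definition scaleC_complex :: "complex \<Rightarrow> complex \<Rightarrow> complex"
  where "scaleC_complex c x = c * x"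

definition cinner_complex :: "complex \<Rightarrow> complex \<Rightarrow> complex"
  where "cinner_complex x y = cnj x * y"

instance
proof
  show "cinner x x = complex_of_real ((norm x)\<^sup>2)" for x :: complex
    by (simp add: cinner_complex_def complex_norm_square mult.commute del: of_real_power)
qed (simp_all add: scaleC_complex_def cinner_complex_def ring_distribs scaleR_conv_of_real)

end

section \<open>Unbounded operators\<close>

text \<open>An operator is represented by its graph: its domain is \<^const>\<open>Domain\<close> of the graph, equality
  is equality of domains and of values, and the closure of an operator is the topological
  closure of its graph. \<open>op_app T x\<close> is meaningful only for \<open>x\<close> in the domain.\<close>

type_synonym 'a oper = "('a \<times> 'a) set"

definition linear_op :: "'a::complex_hilbert oper \<Rightarrow> bool" where
  "linear_op T \<longleftrightarrow> single_valued T \<and> (0, 0) \<in> T \<and>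
     (\<forall>x y u v. (x, y) \<in> T \<longrightarrow> (u, v) \<in> T \<longrightarrow> (x + u, y + v) \<in> T) \<and>
     (\<forall>c x y. (x, y) \<in> T \<longrightarrow> (c *\<^sub>C x, c *\<^sub>C y) \<in> T)"

definition op_app :: "'a oper \<Rightarrow> 'a \<Rightarrow> 'a" where
  "op_app T x = (THE y. (x, y) \<in> T)"

definition op_add :: "'a::complex_hilbert oper \<Rightarrow> 'a oper \<Rightarrow> 'a oper" where
  "op_add S T = {(x, y + z) |x y z. (x, y) \<in> S \<and> (x, z) \<in> T}"

definition op_scale :: "complex \<Rightarrow> 'a::complex_hilbert oper \<Rightarrow> 'a oper" where
  "op_scale c T = {(x, c *\<^sub>C y) |x y. (x, y) \<in> T}"

text \<open>The product \<open>S T\<close> applies \<open>T\<close> first.\<close>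

definition op_mult :: "'a oper \<Rightarrow> 'a oper \<Rightarrow> 'a oper" where
  "op_mult S T = T O S"

definition op_prod :: "'a oper list \<Rightarrow> 'a oper" where
  "op_prod Ts = foldr op_mult Ts Id"

definition densely_defined :: "'a::complex_hilbert oper \<Rightarrow> bool" where
  "densely_defined T \<longleftrightarrow> closure (Domain T) = UNIV"

text \<open>This is the graph of an operator when \<open>T\<close> is densely defined.\<close>

definition adj :: "'a::complex_hilbert oper \<Rightarrow> 'a oper" where
  "adj T = {(x, y). \<forall>(u, v) \<in> T. cinner x v = cinner y u}"

definition symmetric_op :: "'a::complex_hilbert oper \<Rightarrow> bool" where
  "symmetric_op T \<longleftrightarrow> linear_op T \<and> densely_defined T \<and> T \<subseteq> adj T"

definition selfadjoint_op :: "'a::complex_hilbert oper \<Rightarrow> bool" where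
  "selfadjoint_op T \<longleftrightarrow> linear_op T \<and> densely_defined T \<and> T = adj T"

definition nonneg_op :: "'a::complex_hilbert oper \<Rightarrow> bool" where
  "nonneg_op T \<longleftrightarrow> (\<forall>(x, y) \<in> T. 0 \<le> Re (cinner x y))"

definition op_bounded_by :: "'a::complex_hilbert oper \<Rightarrow> 'a oper \<Rightarrow> bool" where
  "op_bounded_by T S \<longleftrightarrow> Domain S \<subseteq> Domain T \<and>
     (\<exists>a\<ge>0. \<exists>b\<ge>0. \<forall>x\<in>Domain S. norm (op_app T x) \<le> a * norm (op_app S x) + b * norm x)"

definition maps_into :: "'a oper \<Rightarrow> 'a set \<Rightarrow> 'a set \<Rightarrow> bool" where
  "maps_into T X Y \<longleftrightarrow> X \<subseteq> Domain T \<and> (\<forall>x\<in>X. op_app T x \<in> Y)"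

section \<open>Spectrum and ground states\<close>

definition resolvent_set :: "'a::complex_hilbert oper \<Rightarrow> complex set" where
  "resolvent_set S = {l. \<exists>R. bounded_linear R \<and>
     (op_add S (op_scale (- l) Id))\<inverse> = {(y, R y) |y. True}}"

definition spectrum :: "'a::complex_hilbert oper \<Rightarrow> complex set" where
  "spectrum S = - resolvent_set S"

text \<open>Used only for self-adjoint operators bounded from below, whose spectrum is real.\<close>

definition E0 :: "'a::complex_hilbert oper \<Rightarrow> real" where
  "E0 S = Inf {x. complex_of_real x \<in> spectrum S}"

definition ground_space :: "'a::complex_hilbert oper \<Rightarrow> 'a set" where
  "ground_space S = {x. (x, complex_of_real (E0 S) *\<^sub>C x) \<in> S}"

definition ground_state :: "'a::complex_hilbert oper \<Rightarrow> 'a \<Rightarrow> bool" where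
  "ground_state S v \<longleftrightarrow> v \<noteq> 0 \<and> v \<in> ground_space S"

definition unique_ground_state :: "'a::complex_hilbert oper \<Rightarrow> 'a \<Rightarrow> bool" where
  "unique_ground_state S v \<longleftrightarrow> ground_state S v \<and> cdim (ground_space S) = 1"

section \<open>Spectral measures and functional calculus\<close>

definition orth_proj :: "('a::complex_hilbert \<Rightarrow> 'a) \<Rightarrow> bool" where
  "orth_proj Q \<longleftrightarrow> Vector_Spaces.linear scaleC scaleC Q \<and> Q \<circ> Q = Q \<and>
     (\<forall>x y. cinner (Q x) y = cinner x (Q y))"

definition pvm :: "(real set \<Rightarrow> 'a::complex_hilbert \<Rightarrow> 'a) \<Rightarrow> bool" where
  "pvm P \<longleftrightarrow> (\<forall>B\<in>sets borel. orth_proj (P B)) \<and> P UNIV = id \<and>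
     (\<forall>B :: nat \<Rightarrow> real set. range B \<subseteq> sets borel \<longrightarrow> disjoint_family B \<longrightarrow>
        (\<forall>x. (\<lambda>n. P (B n) x) sums P (\<Union>n. B n) x))"

text \<open>The measure \<open>B \<mapsto> \<langle>x, P B x\<rangle>\<close>.\<close>

definition vec_measure :: "(real set \<Rightarrow> 'a::complex_hilbert \<Rightarrow> 'a) \<Rightarrow> 'a \<Rightarrow> real measure" where
  "vec_measure P x = measure_of UNIV (sets borel) (\<lambda>B. ennreal (Re (cinner x (P B x))))"

text \<open>The integral of \<open>f\<close> against the complex measure \<open>B \<mapsto> \<langle>z, P B x\<rangle>\<close>, which is written out in
  terms of positive measures by polarization.\<close>

definition spectral_form ::
    "(real set \<Rightarrow> 'a::complex_hilbert \<Rightarrow> 'a) \<Rightarrow> (real \<Rightarrow> complex) \<Rightarrow> 'a \<Rightarrow> 'a \<Rightarrow> complex" where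
  "spectral_form P f z x =
     (\<Sum>j<4. (- \<i>) ^ j * integral\<^sup>L (vec_measure P (z + \<i> ^ j *\<^sub>C x)) f) / 4"

definition fcalc_dom ::
    "(real set \<Rightarrow> 'a::complex_hilbert \<Rightarrow> 'a) \<Rightarrow> (real \<Rightarrow> complex) \<Rightarrow> 'a set" where
  "fcalc_dom P f = {x. integrable (vec_measure P x) (\<lambda>l. (cmod (f l))\<^sup>2)}"

text \<open>The operator \<open>\<integral> f dP\<close>. Testing against the dense set \<open>fcalc_dom P f\<close> determines the value.\<close>

definition fcalc ::
    "(real set \<Rightarrow> 'a::complex_hilbert \<Rightarrow> 'a) \<Rightarrow> (real \<Rightarrow> complex) \<Rightarrow> 'a oper" where
  "fcalc P f = {(x, y). x \<in> fcalc_dom P f \<and>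
     (\<forall>z\<in>fcalc_dom P f. cinner z y = spectral_form P f z x)}"

definition spectral_measure_of ::
    "'a::complex_hilbert oper \<Rightarrow> (real set \<Rightarrow> 'a \<Rightarrow> 'a) \<Rightarrow> bool" where
  "spectral_measure_of S P \<longleftrightarrow> pvm P \<and> S = fcalc P complex_of_real"

text \<open>In the rest of this theory, \<open>P\<close> stands for the spectral measure of the free operator.\<close>

definition sqrt_op :: "(real set \<Rightarrow> 'a::complex_hilbert \<Rightarrow> 'a) \<Rightarrow> 'a oper" where
  "sqrt_op P = fcalc P (\<lambda>l. complex_of_real (sqrt l))"

definition exp_op :: "(real set \<Rightarrow> 'a::complex_hilbert \<Rightarrow> 'a) \<Rightarrow> complex \<Rightarrow> 'a oper" where
  "exp_op P z = fcalc P (\<lambda>l. exp (\<i> * z * complex_of_real l))"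

section \<open>The class of operators and complex time evolution\<close>

definition V :: "(real set \<Rightarrow> 'a::complex_hilbert \<Rightarrow> 'a) \<Rightarrow> real \<Rightarrow> 'a set" where
  "V P e = range (P {0..e})"

definition D_fin :: "(real set \<Rightarrow> 'a::complex_hilbert \<Rightarrow> 'a) \<Rightarrow> 'a set" where
  "D_fin P = (\<Union>e\<in>{0..}. V P e)"

definition class_C0 :: "(real set \<Rightarrow> 'a::complex_hilbert \<Rightarrow> 'a) \<Rightarrow> 'a oper set" where
  "class_C0 P = {T. linear_op T \<and>
     densely_defined T \<and> closed T \<and> densely_defined (adj T) \<and> closed (adj T) \<and>
     op_bounded_by T (sqrt_op P) \<and> op_bounded_by (adj T) (sqrt_op P) \<and>
     (\<exists>b\<ge>0. \<forall>e\<ge>0. maps_into T (V P e) (V P (e + b)) \<and> maps_into (adj T) (V P e) (V P (e + b)))}"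

definition at_time ::
    "(real set \<Rightarrow> 'a::complex_hilbert \<Rightarrow> 'a) \<Rightarrow> 'a oper \<Rightarrow> complex \<Rightarrow> 'a oper" where
  "at_time P A z = closure (op_prod [exp_op P z, A, exp_op P (- z)])"

definition segment_integral ::
    "complex \<Rightarrow> complex \<Rightarrow> (complex \<Rightarrow> 'a::complex_hilbert) \<Rightarrow> 'a" where
  "segment_integral a b f = (b - a) *\<^sub>C integral {0..1} (\<lambda>t. f (a + of_real t * (b - a)))"

text \<open>\<open>iter_integral n a z G\<close> is the integral of \<open>G [\<zeta>\<^sub>1, \<dots>, \<zeta>\<^sub>n]\<close>, with \<open>\<zeta>\<^sub>1\<close> running from \<open>a\<close> to \<open>z\<close>
  and \<open>\<zeta>\<^sub>j\<^sub>+\<^sub>1\<close> from \<open>a\<close> to \<open>\<zeta>\<^sub>j\<close>. The integrands of interest are entire, and straight segments are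
  chosen as the paths.\<close>

fun iter_integral ::
    "nat \<Rightarrow> complex \<Rightarrow> complex \<Rightarrow> (complex list \<Rightarrow> 'a::complex_hilbert) \<Rightarrow> 'a" where
  "iter_integral 0 a z G = G []"
| "iter_integral (Suc n) a z G =
     segment_integral a z (\<lambda>\<zeta>. iter_integral n a \<zeta> (\<lambda>\<zeta>s. G (\<zeta> # \<zeta>s)))"

definition evol_U ::
    "(real set \<Rightarrow> 'a::complex_hilbert \<Rightarrow> 'a) \<Rightarrow> 'a oper \<Rightarrow> complex \<Rightarrow> complex \<Rightarrow> 'a oper" where
  "evol_U P H1 z z' = {(x, y). x \<in> D_fin P \<and>
     (\<lambda>n. (- \<i>) ^ n *\<^sub>C
        iter_integral n z' z (\<lambda>\<zeta>s. op_app (op_prod (map (at_time P H1) \<zeta>s)) x)) sums y}"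

definition evol_W ::
    "(real set \<Rightarrow> 'a::complex_hilbert \<Rightarrow> 'a) \<Rightarrow> 'a oper \<Rightarrow> complex \<Rightarrow> 'a oper" where
  "evol_W P H1 z = op_mult (exp_op P (- z)) (closure (evol_U P H1 z 0))"

section \<open>Curves\<close>

text \<open>Continuously differentiable on every closed piece, that is, with one-sided derivatives at
  the break points. (The library's \<open>piecewise_C1_differentiable_on\<close> allows the derivative to be
  unbounded near a break point.)\<close>

definition piecewise_C1 :: "(real \<Rightarrow> complex) \<Rightarrow> real \<Rightarrow> real \<Rightarrow> bool" where
  "piecewise_C1 \<Gamma> a b \<longleftrightarrow> continuous_on {a..b} \<Gamma> \<and>
     (\<exists>(N::nat) t. t 0 = a \<and> t N = b \<and> (\<forall>i<N. t i < t (Suc i) \<and>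
        (\<exists>d. continuous_on {t i..t (Suc i)} d \<and>
          (\<forall>s\<in>{t i..t (Suc i)}. (\<Gamma> has_vector_derivative d s) (at s within {t i..t (Suc i)})))))"

definition simple_curve :: "(real \<Rightarrow> complex) \<Rightarrow> real \<Rightarrow> real \<Rightarrow> bool" where
  "simple_curve \<Gamma> a b \<longleftrightarrow> a < b \<and> piecewise_C1 \<Gamma> a b \<and> inj_on \<Gamma> {a..b}"

definition curve_succ ::
    "(real \<Rightarrow> complex) \<Rightarrow> real \<Rightarrow> real \<Rightarrow> complex \<Rightarrow> complex \<Rightarrow> bool" where
  "curve_succ \<Gamma> a b \<zeta> \<zeta>' \<longleftrightarrow> (\<exists>t\<in>{a..b}. \<exists>t'\<in>{a..b}. \<Gamma> t = \<zeta> \<and> \<Gamma> t' = \<zeta>' \<and> t > t')"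

definition curve_integral ::
    "(real \<Rightarrow> complex) \<Rightarrow> real \<Rightarrow> real \<Rightarrow> (complex \<Rightarrow> 'a::complex_hilbert) \<Rightarrow> 'a" where
  "curve_integral \<Gamma> a b f =
     integral {a..b} (\<lambda>t. vector_derivative \<Gamma> (at t within {a..b}) *\<^sub>C f (\<Gamma> t))"

text \<open>\<open>curve_iter_integral \<Gamma> a b k n G \<zeta>\<close> integrates \<open>G\<close> over the \<open>n\<close> arguments with indices
  \<open>k + 1, \<dots>, k + n\<close>; the other arguments keep the values given by \<open>\<zeta>\<close>.\<close>

fun curve_iter_integral ::
    "(real \<Rightarrow> complex) \<Rightarrow> real \<Rightarrow> real \<Rightarrow> nat \<Rightarrow> nat \<Rightarrow>
     ((nat \<Rightarrow> complex) \<Rightarrow> 'a::complex_hilbert) \<Rightarrow> (nat \<Rightarrow> complex) \<Rightarrow> 'a" where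
  "curve_iter_integral \<Gamma> a b k 0 G \<zeta> = G \<zeta>"
| "curve_iter_integral \<Gamma> a b k (Suc n) G \<zeta> =
     curve_integral \<Gamma> a b (\<lambda>w. curve_iter_integral \<Gamma> a b (Suc k) n G (\<zeta>(Suc k := w)))"

section \<open>Time-ordered exponentials\<close>

text \<open>The factors \<open>F\<^sub>1, \<dots>, F\<^sub>k, F, F, \<dots>\<close>, indexed from 1 on.\<close>

definition factor_seq ::
    "nat \<Rightarrow> (nat \<Rightarrow> complex \<Rightarrow> 'a oper) \<Rightarrow> (complex \<Rightarrow> 'a oper) \<Rightarrow> nat \<Rightarrow> complex \<Rightarrow> 'a oper" where
  "factor_seq k Fs F j = (if j \<le> k then Fs j else F)"

definition perm_prod ::
    "nat \<Rightarrow> (nat \<Rightarrow> complex \<Rightarrow> 'a oper) \<Rightarrow> (nat \<Rightarrow> nat) \<Rightarrow> (nat \<Rightarrow> complex) \<Rightarrow> 'a oper" where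
  "perm_prod N Fs \<sigma> \<zeta> = op_prod (map (\<lambda>j. Fs (\<sigma> j) (\<zeta> (\<sigma> j))) [1..<Suc N])"

definition time_ordered ::
    "(real \<Rightarrow> complex) \<Rightarrow> real \<Rightarrow> real \<Rightarrow> nat \<Rightarrow> (nat \<Rightarrow> complex \<Rightarrow> 'a::complex_hilbert oper) \<Rightarrow>
     (nat \<Rightarrow> complex) \<Rightarrow> 'a oper" where
  "time_ordered \<Gamma> a b N Fs \<zeta> =
     {(x, y). (\<forall>\<sigma>. \<sigma> permutes {1..N} \<longrightarrow> x \<in> Domain (perm_prod N Fs \<sigma> \<zeta>)) \<and>
        y = (\<Sum>\<sigma> | \<sigma> permutes {1..N}.
              if \<forall>i\<in>{1..<N}. curve_succ \<Gamma> a b (\<zeta> (\<sigma> i)) (\<zeta> (\<sigma> (Suc i)))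
              then op_app (perm_prod N Fs \<sigma> \<zeta>) x else 0)}"

text \<open>The points \<open>\<zeta>\<^sub>1, \<dots>, \<zeta>\<^sub>k\<close> are fixed by \<open>\<zeta>\<close>, the points \<open>\<zeta>\<^sub>k\<^sub>+\<^sub>1, \<dots>, \<zeta>\<^sub>k\<^sub>+\<^sub>n\<close> range over the curve.
  Extensional functions on \<open>{k+1..k+n}\<close>, with the product topology, play the role of
  \<open>n\<close>-tuples.\<close>

definition join_points :: "nat \<Rightarrow> (nat \<Rightarrow> complex) \<Rightarrow> (nat \<Rightarrow> complex) \<Rightarrow> nat \<Rightarrow> complex" where
  "join_points k \<zeta> \<eta> j = (if j \<le> k then \<zeta> j else \<eta> j)"

definition texp_core ::
    "(real \<Rightarrow> complex) \<Rightarrow> real \<Rightarrow> real \<Rightarrow> nat \<Rightarrow> (nat \<Rightarrow> complex \<Rightarrow> 'a::complex_hilbert oper) \<Rightarrow>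
     (nat \<Rightarrow> complex) \<Rightarrow> (complex \<Rightarrow> 'a oper) \<Rightarrow> 'a set" where
  "texp_core \<Gamma> a b k Fs \<zeta> F = cspan {x. \<forall>n \<sigma>. \<sigma> permutes {1..k+n} \<longrightarrow>
     (let C = PiE {k+1..k+n} (\<lambda>_. \<Gamma> ` {a..b});
          S = (\<lambda>\<eta>. perm_prod (k+n) (factor_seq k Fs F) \<sigma> (join_points k \<zeta> \<eta>))
      in (\<forall>\<eta>\<in>C. x \<in> Domain (S \<eta>)) \<and> continuous_on C (\<lambda>\<eta>. op_app (S \<eta>) x))}"

definition texp_term ::
    "(real \<Rightarrow> complex) \<Rightarrow> real \<Rightarrow> real \<Rightarrow> nat \<Rightarrow> (nat \<Rightarrow> complex \<Rightarrow> 'a::complex_hilbert oper) \<Rightarrow>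
     (nat \<Rightarrow> complex) \<Rightarrow> (complex \<Rightarrow> 'a oper) \<Rightarrow> 'a \<Rightarrow> nat \<Rightarrow> 'a" where
  "texp_term \<Gamma> a b k Fs \<zeta> F x n = complex_of_real (1 / fact n) *\<^sub>C
     curve_iter_integral \<Gamma> a b k n
       (\<lambda>\<eta>. op_app (time_ordered \<Gamma> a b (k+n) (factor_seq k Fs F) \<eta>) x) \<zeta>"

text \<open>The operator \<open>\<T> F\<^sub>1(\<zeta>\<^sub>1) \<dots> F\<^sub>k(\<zeta>\<^sub>k) exp (\<integral>\<^sub>\<Gamma> d\<zeta> F(\<zeta>))\<close>.\<close>

definition texp ::
    "(real \<Rightarrow> complex) \<Rightarrow> real \<Rightarrow> real \<Rightarrow> nat \<Rightarrow> (nat \<Rightarrow> complex \<Rightarrow> 'a::complex_hilbert oper) \<Rightarrow>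
     (nat \<Rightarrow> complex) \<Rightarrow> (complex \<Rightarrow> 'a oper) \<Rightarrow> 'a oper" where
  "texp \<Gamma> a b k Fs \<zeta> F = {(x, y). x \<in> texp_core \<Gamma> a b k Fs \<zeta> F \<and>
     summable (\<lambda>n. norm (texp_term \<Gamma> a b k Fs \<zeta> F x n)) \<and>
     y = (\<Sum>n. texp_term \<Gamma> a b k Fs \<zeta> F x n)}"

section \<open>Green's functions\<close>

text \<open>The operator \<open>\<T> A\<^sub>1(z\<^sub>1) \<dots> A\<^sub>k(z\<^sub>k) exp (- \<i> \<integral>\<^sub>\<Gamma> d\<zeta> H\<^sub>1(\<zeta>))\<close>; it does not depend on \<open>A\<close> and \<open>z\<close> if
  \<open>k = 0\<close>.\<close>

definition dyson_texp ::
    "(real set \<Rightarrow> 'a::complex_hilbert \<Rightarrow> 'a) \<Rightarrow> 'a oper \<Rightarrow> (real \<Rightarrow> complex) \<Rightarrow> real \<Rightarrow> real \<Rightarrow>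
     nat \<Rightarrow> (nat \<Rightarrow> 'a oper) \<Rightarrow> (nat \<Rightarrow> complex) \<Rightarrow> 'a oper" where
  "dyson_texp P H1 \<Gamma> a b k A z =
     texp \<Gamma> a b k (\<lambda>j. at_time P (A j)) z (\<lambda>\<zeta>. op_scale (- \<i>) (at_time P H1 \<zeta>))"

text \<open>\<open>A\<^sub>1 W(z\<^sub>1 - z\<^sub>2) A\<^sub>2 \<dots> A\<^sub>m\<^sub>-\<^sub>1 W(z\<^sub>m\<^sub>-\<^sub>1 - z\<^sub>m) A\<^sub>m\<close>, with the closures of the operators \<open>W\<close>.\<close>

definition green_op ::
    "(real set \<Rightarrow> 'a::complex_hilbert \<Rightarrow> 'a) \<Rightarrow> 'a oper \<Rightarrow> nat \<Rightarrow> (nat \<Rightarrow> 'a oper) \<Rightarrow>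
     (nat \<Rightarrow> complex) \<Rightarrow> 'a oper" where
  "green_op P H1 m A z = op_prod (A 1 #
     concat (map (\<lambda>j. [closure (evol_W P H1 (z j - z (Suc j))), A (Suc j)]) [1..<m]))"

text \<open>Meaningful if \<open>\<Omega>\<close> is in the domain of \<open>green_op P H1 m A z\<close>.\<close>

definition green_fun ::
    "(real set \<Rightarrow> 'a::complex_hilbert \<Rightarrow> 'a) \<Rightarrow> 'a oper \<Rightarrow> 'a oper \<Rightarrow> 'a \<Rightarrow> nat \<Rightarrow> (nat \<Rightarrow> 'a oper) \<Rightarrow>
     (nat \<Rightarrow> complex) \<Rightarrow> complex" where
  "green_fun P H0 H1 \<Omega> m A z =
     exp (\<i> * (z 1 - z m) * complex_of_real (E0 (op_add H0 H1))) *
     cinner \<Omega> (op_app (green_op P H1 m A z) \<Omega>)"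

end

theory Submission
  imports Defs "HOL-Complex_Analysis.Complex_Analysis"
begin

text \<open>On a curve from \<open>-\<theta>\<close> to \<open>\<theta>\<close>, inserting one more interaction anywhere on the curve into a
  time-ordered product of Dyson terms of order \<open>n\<close> and integrating over its position gives
  \<open>n + 1\<close> times the product of order \<open>n + 1\<close>. Hence the \<open>n\<close>-th term of the time-ordered
  exponential is a convolution of Dyson terms of the pieces of the curve between the points
  \<open>z\<^sub>j\<close>. These terms decay like \<open>R\<^sup>n / \<surd>(n!)\<close>, because \<open>H\<^sub>1\<close> raises the energy by at most \<open>b\<close> and
  grows like the square root of the energy, so the series sums to
  \<open>e\<^sup>-\<^sup>i\<^sup>(\<^sup>\<theta>\<^sup>-\<^sup>z\<^sub>1\<^sup>)\<^sup>H A\<^sub>1 \<dots> A\<^sub>m e\<^sup>-\<^sup>i\<^sup>(\<^sup>z\<^sub>m\<^sup>+\<^sup>\<theta>\<^sup>)\<^sup>H\<close> up to free evolutions, which leave \<open>\<Omega>\<^sub>0\<close> fixed. As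
  \<open>Im \<theta>\<close> tends to \<open>-\<infinity>\<close>, the outer exponentials, multiplied by \<open>e\<^sup>i\<^sup>(\<^sup>\<dots>\<^sup>)\<^sup>E\<close>, map \<open>\<Omega>\<^sub>0\<close> to
  \<open>\<langle>\<Omega>, \<Omega>\<^sub>0\<rangle> \<Omega>\<close> in the limit. The convergence holds in the graph norm of every power of \<open>H\<close>, for
  which each \<open>A\<^sub>j\<close> is continuous by assumption (II), and \<open>|\<langle>\<Omega>, \<Omega>\<^sub>0\<rangle>|\<^sup>2\<close> cancels in the quotient.\<close>

section \<open>Complex Hilbert spaces\<close>

text \<open>Only \<open>H0\<close> comes with a spectral measure, so nothing about \<open>H\<close>
  can be read off from a functional calculus. \<open>exp (- i z H)\<close> is built as the sum of
  the Dyson series on the finite-energy vectors. Its bound \<open>exp (E * Im z)\<close>, the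
  semigroup law and the adjoint relation come from differentiating inner products and from the
  symmetry of \<open>H\<close>. The convergence to the ground state comes from monotonicity in
  imaginary time, in place of dominated convergence under a spectral integral. The second obstacle
  is domains. The sum of the series may leave the finite-energy vectors, on which alone the
  interaction is controlled directly. Identities are therefore proved order by order, where every
  vector has bounded energy and every map is holomorphic in \<open>z\<close>, and are carried over
  to the sum by closedness of \<open>H\<close> or of \<open>A j\<close>. For large \<open>T\<close>
  bounded energy is lost altogether, and the domains of the powers of \<open>H\<close> take its
  place: each \<open>A j\<close> costs \<open>r\<close> powers, which is harmless because all powers
  are controlled at once.\<close>

lemma cinner_add_left: "cinner (x + y) z = cinner x z + cinner y z"
  by (metis cinner_add_right cinner_commute complex_cnj_add)

lemma cinner_scaleC_left: "cinner (c *\<^sub>C x) y = cnj c * cinner x y"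
  by (metis cinner_scaleC_right cinner_commute complex_cnj_mult)

lemma cinner_zero_right [simp]: "cinner x 0 = 0"
  using cinner_scaleC_right[of x 0 0] by simp

lemma cinner_zero_left [simp]: "cinner 0 x = 0"
  using cinner_scaleC_left[of 0 0 x] by simp

lemma scaleC_one [simp]: "1 *\<^sub>C x = x"
  using complex_vector.scale_one .

lemma scaleC_minus1: "(- 1) *\<^sub>C x = - x"
  by simp

lemma cinner_minus_right [simp]: "cinner x (- y) = - cinner x y"
  by (metis cinner_scaleC_right mult_minus1 scaleC_minus1)

lemma cinner_minus_left [simp]: "cinner (- x) y = - cinner x y"
  by (metis cinner_commute cinner_minus_right complex_cnj_minus)

lemma cinner_diff_right: "cinner x (y - z) = cinner x y - cinner x z"
  using cinner_add_right[of x y "- z"] by simp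

lemma cinner_diff_left: "cinner (x - y) z = cinner x z - cinner y z"
  using cinner_add_left[of x "- y" z] by simp

lemma Re_cinner_commute: "Re (cinner x y) = Re (cinner y x)"
  by (metis cinner_commute complex_cnj cnj.simps(1))

lemma Re_cinner_self: "Re (cinner x x) = (norm x)\<^sup>2"
  by (simp add: cinner_norm)

lemma norm_add_square: "(norm (x + y))\<^sup>2 = (norm x)\<^sup>2 + 2 * Re (cinner x y) + (norm y)\<^sup>2"
  for x y :: "'a::complex_hilbert"
proof -
  have "(norm (x + y))\<^sup>2 = Re (cinner (x + y) (x + y))"
    by (simp only: Re_cinner_self)
  also have "\<dots> = (norm x)\<^sup>2 + Re (cinner x y) + Re (cinner y x) + (norm y)\<^sup>2"
    by (simp only: cinner_add_left cinner_add_right plus_complex.sel Re_cinner_self)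
  finally show ?thesis
    using Re_cinner_commute[of x y] by simp
qed

lemma norm_diff_square: "(norm (x - y))\<^sup>2 = (norm x)\<^sup>2 - 2 * Re (cinner x y) + (norm y)\<^sup>2"
  for x y :: "'a::complex_hilbert"
  using norm_add_square[of x "- y"] by simp

lemma norm_scaleC: "norm (c *\<^sub>C x) = cmod c * norm x"
proof -
  have "complex_of_real ((norm (c *\<^sub>C x))\<^sup>2) = cnj c * (c * cinner x x)"
    unfolding cinner_norm[of "c *\<^sub>C x", symmetric] cinner_scaleC_left cinner_scaleC_right by simp
  also have "\<dots> = complex_of_real ((cmod c * norm x)\<^sup>2)"
    unfolding cinner_norm power_mult_distrib of_real_mult complex_norm_square[of c]
    by (simp only: mult_ac)
  finally have "complex_of_real ((norm (c *\<^sub>C x))\<^sup>2) = complex_of_real ((cmod c * norm x)\<^sup>2)" .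
  then have "(norm (c *\<^sub>C x))\<^sup>2 = (cmod c * norm x)\<^sup>2"
    using of_real_eq_iff by blast
  then show ?thesis
    by (simp add: power2_eq_iff_nonneg)
qed

lemma Cauchy_Schwarz: "cmod (cinner x y) \<le> norm x * norm y"
proof (cases "x = 0")
  case False
  define c where "c = cinner x y / (norm x)\<^sup>2"
  have nx: "norm x > 0"
    using False by simp
  have "0 \<le> (norm (y - c *\<^sub>C x))\<^sup>2"
    by simp
  also have "\<dots> = (norm y)\<^sup>2 - 2 * Re (c * cinner y x) + (cmod c * norm x)\<^sup>2"
    by (simp only: norm_diff_square cinner_scaleC_right norm_scaleC)
  also have "c * cinner y x = complex_of_real ((cmod (cinner x y))\<^sup>2 / (norm x)\<^sup>2)"
    unfolding c_def using cinner_commute[of y x]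
    by (simp add: complex_norm_square del: of_real_power)
  also have "(cmod c * norm x)\<^sup>2 = (cmod (cinner x y))\<^sup>2 / (norm x)\<^sup>2"
    using nx unfolding c_def by (simp add: norm_divide power_divide power_mult_distrib norm_mult power2_eq_square)
  finally have "(cmod (cinner x y))\<^sup>2 / (norm x)\<^sup>2 \<le> (norm y)\<^sup>2"
    by simp
  then have "(cmod (cinner x y))\<^sup>2 \<le> (norm x * norm y)\<^sup>2"
    using nx by (simp add: field_simps power_mult_distrib)
  then show ?thesis
    by (meson power2_le_imp_le mult_nonneg_nonneg norm_ge_zero)
qed simp

lemma bounded_bilinear_scaleC:
  "bounded_bilinear (scaleC :: complex \<Rightarrow> 'a \<Rightarrow> 'a::complex_hilbert)"
proof
  show "\<exists>K. \<forall>a b. norm (a *\<^sub>C (b::'a)) \<le> norm a * norm b * K"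
    by (rule exI[of _ 1]) (simp add: norm_scaleC)
next
  fix r :: real and a :: complex and b :: 'a
  show "(r *\<^sub>R a) *\<^sub>C b = r *\<^sub>R a *\<^sub>C b"
    unfolding scaleR_scaleC[of r "a *\<^sub>C b"] scaleC_scaleC by (simp add: scaleR_conv_of_real)
  show "a *\<^sub>C r *\<^sub>R b = r *\<^sub>R a *\<^sub>C b"
    unfolding scaleR_scaleC[of r "a *\<^sub>C b"] scaleR_scaleC[of r b] scaleC_scaleC
    by (simp add: mult.commute)
qed (simp_all add: scaleC_add_left scaleC_add_right)

lemma bounded_bilinear_cinner:
  "bounded_bilinear (cinner :: 'a::complex_hilbert \<Rightarrow> 'a \<Rightarrow> complex)"
proof
  show "\<exists>K. \<forall>a b. norm (cinner a (b::'a)) \<le> norm a * norm b * K"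
    by (rule exI[of _ 1]) (simp add: Cauchy_Schwarz)
next
  fix r :: real and a b :: 'a
  show "cinner (r *\<^sub>R a) b = r *\<^sub>R cinner a b"
    unfolding scaleR_scaleC[of r a] cinner_scaleC_left by (simp add: scaleR_conv_of_real)
  show "cinner a (r *\<^sub>R b) = r *\<^sub>R cinner a b"
    unfolding scaleR_scaleC[of r b] cinner_scaleC_right by (simp add: scaleR_conv_of_real)
qed (simp_all add: cinner_add_left cinner_add_right)

lemmas tendsto_scaleC [tendsto_intros] = bounded_bilinear.tendsto[OF bounded_bilinear_scaleC]
lemmas tendsto_cinner [tendsto_intros] = bounded_bilinear.tendsto[OF bounded_bilinear_cinner]
lemmas continuous_on_scaleC [continuous_intros] =
  bounded_bilinear.continuous_on[OF bounded_bilinear_scaleC]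
lemmas continuous_on_cinner [continuous_intros] =
  bounded_bilinear.continuous_on[OF bounded_bilinear_cinner]
lemmas bounded_linear_scaleC_right = bounded_bilinear.bounded_linear_right[OF bounded_bilinear_scaleC]
lemmas bounded_linear_scaleC_left = bounded_bilinear.bounded_linear_left[OF bounded_bilinear_scaleC]
lemmas bounded_linear_cinner_right = bounded_bilinear.bounded_linear_right[OF bounded_bilinear_cinner]
lemma cinner_eq_0_dense:
  assumes "closure D = UNIV" "\<And>y. y \<in> D \<Longrightarrow> cinner y x = 0"
  shows "x = 0"
proof -
  have "closed {y. cinner y x = 0}"
    by (intro closed_Collect_eq continuous_intros)
  then have "closure D \<subseteq> {y. cinner y x = 0}"
    using assms(2) by (intro closure_minimal) auto
  then have "cinner x x = 0"
    using assms(1) by auto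
  then show ?thesis
    by (simp add: cinner_norm)
qed

lemma cinner_eq_dense:
  assumes "closure D = UNIV" "\<And>y. y \<in> D \<Longrightarrow> cinner y x = cinner y x'"
  shows "x = x'"
  using cinner_eq_0_dense[OF assms(1), of "x - x'"] assms(2) by (simp add: cinner_diff_right)

lemma cinner_ext: "(\<And>y. cinner y x = cinner y x') \<Longrightarrow> x = x'"
  using cinner_eq_dense[of UNIV x x'] by simp

lemma norm_le_dense:
  assumes "closure D = UNIV" "0 \<le> C" "\<And>y. y \<in> D \<Longrightarrow> cmod (cinner y x) \<le> C * norm y"
  shows "norm x \<le> C"
proof -
  have "closed {y. cmod (cinner y x) \<le> C * norm y}"
    by (intro closed_Collect_le continuous_intros)
  then have "closure D \<subseteq> {y. cmod (cinner y x) \<le> C * norm y}"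
    using assms(3) by (intro closure_minimal) auto
  then have "cmod (cinner x x) \<le> C * norm x"
    using assms(1) by auto
  then have "norm x * norm x \<le> C * norm x"
    by (simp only: cinner_norm norm_of_real abs_power2 power2_eq_square abs_mult abs_norm_cancel)
  then show ?thesis
    using assms(2) by (cases "x = 0") auto
qed

text \<open>Linearity on a subset only: an operator enters as the total function
  \<open>op_app\<close>, whose values off the domain are arbitrary.\<close>

definition clinear_on :: "'a::complex_hilbert set \<Rightarrow> ('a \<Rightarrow> 'a) \<Rightarrow> bool" where
  "clinear_on S T \<longleftrightarrow> (\<forall>x\<in>S. \<forall>y\<in>S. T (x + y) = T x + T y) \<and> (\<forall>c. \<forall>x\<in>S. T (c *\<^sub>C x) = c *\<^sub>C T x)"

abbreviation clinear :: "('a::complex_hilbert \<Rightarrow> 'a) \<Rightarrow> bool" where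
  "clinear \<equiv> clinear_on UNIV"

lemma clinear_onD:
  assumes "clinear_on S T"
  shows "x \<in> S \<Longrightarrow> y \<in> S \<Longrightarrow> T (x + y) = T x + T y"
    and "x \<in> S \<Longrightarrow> T (c *\<^sub>C x) = c *\<^sub>C T x"
  using assms unfolding clinear_on_def by auto

lemma clinear_on_extra:
  assumes "clinear_on S T" "csubspace S"
  shows "T 0 = 0" and "x \<in> S \<Longrightarrow> T (- x) = - T x"
    and "x \<in> S \<Longrightarrow> y \<in> S \<Longrightarrow> T (x - y) = T x - T y"
    and "(\<And>i. i \<in> I \<Longrightarrow> f i \<in> S) \<Longrightarrow> T (sum f I) = (\<Sum>i\<in>I. T (f i))"
proof -
  have 0: "(0::'a) \<in> S"
    using assms(2) by (rule complex_vector.subspace_0)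
  show *: "T 0 = 0"
    using clinear_onD(2)[OF assms(1) 0, of 0] by simp
  show **: "T (- x) = - T x" if "x \<in> S" for x
    using clinear_onD(2)[OF assms(1) that, of "- 1"] by simp
  show "T (x - y) = T x - T y" if "x \<in> S" "y \<in> S"
    using clinear_onD(1)[OF assms(1) that(1) complex_vector.subspace_neg[OF assms(2) that(2)]]
      **[OF that(2)] by simp
  show "T (sum f I) = (\<Sum>i\<in>I. T (f i))" if "\<And>i. i \<in> I \<Longrightarrow> f i \<in> S"
    using that
    by (induction I rule: infinite_finite_induct)
      (auto simp: * clinear_onD[OF assms(1)] complex_vector.subspace_sum[OF assms(2)])
qed

lemma csubspace_UNIV [simp]: "csubspace UNIV"
  by (rule complex_vector.subspace_UNIV)

lemmas clinear_extra = clinear_on_extra[OF _ csubspace_UNIV, simplified]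

lemma clinear_bounded_linear:
  assumes "clinear T" "\<And>x. norm (T x) \<le> M * norm x"
  shows "bounded_linear T"
  by (rule bounded_linear_intro[where K = M])
    (use assms in \<open>auto simp: clinear_on_def scaleR_scaleC mult.commute\<close>)

lemma clinear_comp: "clinear S \<Longrightarrow> clinear T \<Longrightarrow> clinear (\<lambda>x. S (T x))"
  by (simp add: clinear_on_def)

text \<open>Orthogonality of the characters of the cyclic group of order four: after weighting by
  \<open>(- \<i>) ^ j\<close> only the coefficient of \<open>\<i> ^ j\<close> survives.\<close>

lemma power_i_four_sum:
  fixes a b c d :: complex
  shows "(\<Sum>j<4. (- \<i>) ^ j * (a + \<i> ^ j * b + cnj (\<i> ^ j) * c + d)) = 4 * b"
proof -
  have "{..<4::nat} = {0, 1, 2, 3}"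
    by auto
  then show ?thesis
    by (simp add: eval_nat_numeral algebra_simps)
qed

lemma polarization:
  assumes "clinear T"
  shows "(\<Sum>j<4. (- \<i>) ^ j * cinner (y + \<i> ^ j *\<^sub>C x) (T (y + \<i> ^ j *\<^sub>C x))) / 4 = cinner y (T x)"
proof -
  have "cinner (y + \<i> ^ j *\<^sub>C x) (T (y + \<i> ^ j *\<^sub>C x)) =
      cinner y (T y) + \<i> ^ j * cinner y (T x) + cnj (\<i> ^ j) * cinner x (T y) + cinner x (T x)" for j
  proof -
    have "cnj (\<i> ^ j) * \<i> ^ j = (cnj \<i> * \<i>) ^ j"
      by (simp only: complex_cnj_power power_mult_distrib)
    also have "cnj \<i> * \<i> = 1"
      by simp
    finally have "cnj (\<i> ^ j) * \<i> ^ j = 1"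
      by (simp only: power_one)
    then have *: "\<i> ^ j * (cnj (\<i> ^ j) * z) = z" for z
      by (metis mult.assoc mult.commute mult_1)
    show ?thesis
      by (simp only: clinear_onD[OF assms] UNIV_I cinner_add_left cinner_add_right
          cinner_scaleC_left cinner_scaleC_right * distrib_left) (simp only: add_ac)
  qed
  then show ?thesis
    by (simp only: power_i_four_sum) simp
qed

text \<open>Complex scalars matter here: over the reals the diagonal of a bilinear form does not
  determine the form.\<close>

lemma cinner_diag_ext:
  assumes "clinear S" "clinear T" "\<And>x. cinner x (S x) = cinner x (T x)"
  shows "S x = T x"
proof (rule cinner_ext)
  show "cinner y (S x) = cinner y (T x)" for y
    using polarization[OF assms(1), of y x] polarization[OF assms(2), of y x] assms(3) by simp
qed

section \<open>Complex derivatives of vector-valued functions\<close>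

text \<open>The real Frechet derivative, required to be multiplication by a vector. Every pairing
  with a fixed vector then becomes holomorphic, which opens the way to scalar complex
  analysis.\<close>

definition has_cderiv :: "(complex \<Rightarrow> 'a::complex_hilbert) \<Rightarrow> 'a \<Rightarrow> complex \<Rightarrow> bool" where
  "has_cderiv f d z \<longleftrightarrow> (f has_derivative (\<lambda>h. h *\<^sub>C d)) (at z)"

lemma has_cderiv_const: "has_cderiv (\<lambda>z. c) 0 z"
  unfolding has_cderiv_def by simp

lemma has_cderiv_add: "has_cderiv f d z \<Longrightarrow> has_cderiv g e z \<Longrightarrow> has_cderiv (\<lambda>z. f z + g z) (d + e) z"
  unfolding has_cderiv_def scaleC_add_right by (rule has_derivative_add)

lemma has_cderiv_linear:
  assumes "clinear T" "bounded_linear T" "has_cderiv f d z"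
  shows "has_cderiv (\<lambda>z. T (f z)) (T d) z"
  using bounded_linear.has_derivative[OF assms(2) assms(3)[unfolded has_cderiv_def]]
  unfolding has_cderiv_def by (simp add: clinear_onD[OF assms(1)])

lemma has_cderiv_affine:
  assumes "has_cderiv f d (a + c * z)"
  shows "has_cderiv (\<lambda>z. f (a + c * z)) (c *\<^sub>C d) z"
proof -
  have "((\<lambda>z. a + c * z) has_derivative (\<lambda>h. c * h)) (at z)"
    by (auto intro!: derivative_eq_intros)
  then have "(f \<circ> (\<lambda>z. a + c * z) has_derivative (\<lambda>h. h *\<^sub>C d) \<circ> (\<lambda>h. c * h)) (at z)"
    using assms unfolding has_cderiv_def by (rule diff_chain_at)
  then show ?thesis
    unfolding has_cderiv_def o_def by (simp add: scaleC_scaleC mult.commute)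
qed

lemma has_cderiv_continuous: "has_cderiv f d z \<Longrightarrow> isCont f z"
  unfolding has_cderiv_def by (rule has_derivative_continuous)

lemma has_cderiv_continuous_on: "(\<And>z. has_cderiv f (d z) z) \<Longrightarrow> continuous_on S f"
  by (meson continuous_at_imp_continuous_on has_cderiv_continuous)

lemma has_cderiv_vector_derivative:
  assumes "has_cderiv f d (g t)" "(g has_vector_derivative g') (at t within S)"
  shows "((\<lambda>t. f (g t)) has_vector_derivative g' *\<^sub>C d) (at t within S)"
proof -
  have "(f has_derivative (\<lambda>h. h *\<^sub>C d)) (at (g t) within g ` S)"
    using assms(1) unfolding has_cderiv_def by (rule has_derivative_at_withinI)
  from diff_chain_within[OF assms(2)[unfolded has_vector_derivative_def] this]
  show ?thesis
    unfolding has_vector_derivative_def o_def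
    by (simp add: bounded_bilinear.scaleR_left[OF bounded_bilinear_scaleC])
qed

lemma has_cderiv_cinner:
  assumes "has_cderiv f d z"
  shows "((\<lambda>z. cinner y (f z)) has_field_derivative cinner y d) (at z)"
proof -
  have "((\<lambda>z. cinner y (f z)) has_derivative (\<lambda>h. cinner y (h *\<^sub>C d))) (at z)"
    using assms unfolding has_cderiv_def
    by (rule bounded_linear.has_derivative[OF bounded_linear_cinner_right])
  then show ?thesis
    unfolding has_field_derivative_def
    by (auto simp: cinner_scaleC_right mult.commute elim!: has_derivative_eq_rhs)
qed

lemma has_cderiv_zero_constant:
  assumes "\<And>z. has_cderiv f 0 z"
  shows "f z = f w"
proof -
  have "(f has_derivative (\<lambda>h. 0)) (at x within UNIV)" for x
    using assms[of x] unfolding has_cderiv_def by simp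
  then show ?thesis
    using has_derivative_zero_unique_connected[of UNIV] by (metis UNIV_I connected_UNIV open_UNIV)
qed

text \<open>The form in which Taylor remainders arrive: a second-order bound on the unit disc
  replaces the limit.\<close>

lemma has_cderivI_quadratic:
  assumes "\<And>h. norm h \<le> 1 \<Longrightarrow> norm (f (z + h) - f z - h *\<^sub>C d) \<le> C * (norm h)\<^sup>2"
  shows "has_cderiv f d z"
  unfolding has_cderiv_def has_derivative_at
proof (intro conjI)
  show "bounded_linear (\<lambda>h. h *\<^sub>C d)"
    by (rule bounded_linear_scaleC_left)
  have "\<forall>\<^sub>F h in at (0::complex). norm h < 1"
    unfolding eventually_at by (intro exI[of _ 1]) simp
  then have "\<forall>\<^sub>F h in at 0. norm (norm (f (z + h) - f z - h *\<^sub>C d) / norm h) \<le> C * norm h"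
  proof eventually_elim
    case (elim h)
    then show ?case
      using assms[of h]
      by (cases "h = 0") (auto simp: divide_simps power2_eq_square mult_ac)
  qed
  then show "(\<lambda>h. norm (f (z + h) - f z - h *\<^sub>C d) / norm h) \<midarrow>0\<rightarrow> 0"
    by (rule Lim_null_comparison) (auto intro!: tendsto_eq_intros)
qed

text \<open>Pairing with \<open>y\<close> turns vector integrals into contour integrals; facts about
  the vectors are recovered through \<open>cinner_ext\<close>.\<close>

lemma segment_integral_cinner:
  assumes "continuous_on UNIV g"
  shows "contour_integral (linepath a b) (\<lambda>z. cinner y (g z)) = cinner y (segment_integral a b g)"
proof -
  have "continuous_on {0..1} (\<lambda>t. g (a + of_real t * (b - a)))"
    by (intro continuous_on_compose2[OF assms] continuous_intros) auto
  then have "(\<lambda>t. g (a + of_real t * (b - a))) integrable_on {0..1}"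
    by (rule integrable_continuous_interval)
  then have "integral {0..1} (\<lambda>t. cinner y (g (a + of_real t * (b - a)))) =
      cinner y (integral {0..1} (\<lambda>t. g (a + of_real t * (b - a))))"
    using integral_linear[OF _ bounded_linear_cinner_right] by (simp add: o_def)
  moreover have "linepath a b t = a + of_real t * (b - a)" for t
    by (simp add: linepath_def scaleR_conv_of_real algebra_simps)
  ultimately show ?thesis
    unfolding contour_integral_integral segment_integral_def
    by (simp add: cinner_scaleC_right mult.commute)
qed

lemma segment_integral_norm_le:
  assumes "continuous_on UNIV g" "\<And>t. t \<in> {0..1} \<Longrightarrow> norm (g (a + of_real t * (b - a))) \<le> B"
  shows "norm (segment_integral a b g) \<le> cmod (b - a) * B"
proof -
  have "continuous_on {0..1} (\<lambda>t. g (a + of_real t * (b - a)))"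
    by (intro continuous_on_compose2[OF assms(1)] continuous_intros) auto
  then have "norm (integral {0..1} (\<lambda>t. g (a + of_real t * (b - a)))) \<le> B * (1 - 0)"
    by (intro integral_bound) (use assms(2) in auto)
  then show ?thesis
    unfolding segment_integral_def norm_scaleC by (simp add: mult_left_mono)
qed

lemma segment_integral_linear:
  assumes "clinear T" "bounded_linear T" "continuous_on UNIV g"
  shows "segment_integral a b (\<lambda>z. T (g z)) = T (segment_integral a b g)"
proof -
  have "continuous_on {0..1} (\<lambda>t. g (a + of_real t * (b - a)))"
    by (intro continuous_on_compose2[OF assms(3)] continuous_intros) auto
  then have "(\<lambda>t. g (a + of_real t * (b - a))) integrable_on {0..1}"
    by (rule integrable_continuous_interval)
  then show ?thesis
    unfolding segment_integral_def clinear_onD(2)[OF assms(1) UNIV_I]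
    using integral_linear[OF _ assms(2), of "\<lambda>t. g (a + of_real t * (b - a))" "{0..1}"]
    by (simp add: o_def)
qed

lemma segment_integral_const: "segment_integral a b (\<lambda>z. c) = (b - a) *\<^sub>C c"
  unfolding segment_integral_def by simp

lemma segment_integral_diff:
  assumes "continuous_on UNIV f" "continuous_on UNIV g"
  shows "segment_integral a b (\<lambda>z. f z - g z) = segment_integral a b f - segment_integral a b g"
proof -
  have "(\<lambda>t. h (a + of_real t * (b - a))) integrable_on {0..1}" if "continuous_on UNIV h"
    for h :: "complex \<Rightarrow> 'a"
    by (intro integrable_continuous_interval continuous_on_compose2[OF that] continuous_intros) auto
  then show ?thesis
    unfolding segment_integral_def
    by (simp add: integral_diff assms complex_vector.scale_right_diff_distrib)
qed

lemma has_cderiv_segment_integral: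
  assumes "\<And>z. has_cderiv g (g' z) z"
  shows "has_cderiv (\<lambda>z. segment_integral a z g) (g z) z"
proof -
  have cont: "continuous_on UNIV g"
    using assms by (rule has_cderiv_continuous_on)
  \<comment> \<open>Path independence: the paired function is entire, hence has a primitive, and all
    three integrals are differences of its values.\<close>
  have add: "segment_integral a w g - segment_integral a z g = segment_integral z w g" for w
  proof (rule cinner_ext)
    fix y
    have "(\<lambda>z. cinner y (g z)) holomorphic_on UNIV"
      unfolding holomorphic_on_def field_differentiable_def
      using has_cderiv_cinner[OF assms] by auto
    then obtain G where G: "\<And>x. (G has_field_derivative cinner y (g x)) (at x)"
      using holomorphic_convex_primitive'[of UNIV "\<lambda>z. cinner y (g z)"] by auto
    have "contour_integral (linepath u v) (\<lambda>z. cinner y (g z)) = G v - G u" for u v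
      using contour_integral_primitive[of UNIV G "\<lambda>z. cinner y (g z)" "linepath u v"] G
      by (auto intro: contour_integral_unique)
    then show "cinner y (segment_integral a w g - segment_integral a z g) =
        cinner y (segment_integral z w g)"
      unfolding cinner_diff_right segment_integral_cinner[OF cont, symmetric] by simp
  qed
  show ?thesis
    unfolding has_cderiv_def has_derivative_at'
  proof (intro conjI allI impI)
    show "bounded_linear (\<lambda>h. h *\<^sub>C g z)"
      by (rule bounded_linear_scaleC_left)
    fix e :: real assume "0 < e"
    moreover have "isCont g z"
      using assms by (rule has_cderiv_continuous)
    ultimately obtain d where d: "0 < d" "\<And>w. dist w z < d \<Longrightarrow> dist (g w) (g z) < e / 2"
      unfolding continuous_at_eps_delta by (meson half_gt_zero)
    show "\<exists>d>0. \<forall>x'. 0 < norm (x' - z) \<and> norm (x' - z) < d \<longrightarrow>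
        norm (segment_integral a x' g - segment_integral a z g - (x' - z) *\<^sub>C g z) / norm (x' - z) < e"
    proof (intro exI[of _ d] conjI allI impI d(1))
      fix w assume w: "0 < norm (w - z) \<and> norm (w - z) < d"
      have "segment_integral a w g - segment_integral a z g - (w - z) *\<^sub>C g z =
          segment_integral z w (\<lambda>x. g x - g z)"
        by (simp add: add segment_integral_diff[OF cont continuous_on_const] segment_integral_const)
      also have "norm \<dots> \<le> cmod (w - z) * (e / 2)"
      proof (rule segment_integral_norm_le)
        show "continuous_on UNIV (\<lambda>x. g x - g z)"
          by (intro continuous_intros cont)
        fix t :: real assume t: "t \<in> {0..1}"
        have "dist (z + of_real t * (w - z)) z = t * cmod (w - z)"
          using t by (simp add: dist_norm norm_mult)
        also have "\<dots> \<le> 1 * cmod (w - z)"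
          using t by (intro mult_right_mono) auto
        also have "\<dots> < d"
          using w by simp
        finally have "dist (g (z + of_real t * (w - z))) (g z) < e / 2"
          by (rule d(2))
        then show "norm (g (z + of_real t * (w - z)) - g z) \<le> e / 2"
          by (simp add: dist_norm)
      qed
      finally have "norm (segment_integral a w g - segment_integral a z g - (w - z) *\<^sub>C g z)
          / norm (w - z) \<le> e / 2"
        using w by (simp add: divide_le_eq mult.commute)
      also have "\<dots> < e"
        using \<open>0 < e\<close> by simp
      finally show "norm (segment_integral a w g - segment_integral a z g - (w - z) *\<^sub>C g z)
          / norm (w - z) < e" .
    qed
  qed
qed

section \<open>Bounded Borel functional calculus\<close>

locale projection_measure =
  fixes P :: "real set \<Rightarrow> 'a::complex_hilbert \<Rightarrow> 'a"
  assumes pvm: "pvm P"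
begin

lemma orth_proj_P: "B \<in> sets borel \<Longrightarrow> orth_proj (P B)"
  using pvm unfolding pvm_def by blast

lemma clinear_P: "B \<in> sets borel \<Longrightarrow> clinear (P B)"
  using orth_proj_P[of B] unfolding orth_proj_def clinear_on_def
  by (auto simp: Vector_Spaces.linear_iff)

lemma P_idem: "B \<in> sets borel \<Longrightarrow> P B (P B x) = P B x"
  using orth_proj_P[of B] unfolding orth_proj_def by (metis comp_apply)

lemma P_sym: "B \<in> sets borel \<Longrightarrow> cinner (P B x) y = cinner x (P B y)"
  using orth_proj_P[of B] unfolding orth_proj_def by blast

lemma cinner_P: "B \<in> sets borel \<Longrightarrow> cinner x (P B x) = complex_of_real ((norm (P B x))\<^sup>2)"
  by (metis P_idem P_sym cinner_norm)

lemma norm_P_le: "B \<in> sets borel \<Longrightarrow> norm (P B x) \<le> norm x"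
proof -
  assume B: "B \<in> sets borel"
  have "(norm (P B x))\<^sup>2 = cmod (cinner x (P B x))"
    unfolding cinner_P[OF B] norm_of_real by simp
  also have "\<dots> \<le> norm x * norm (P B x)"
    by (rule Cauchy_Schwarz)
  finally show ?thesis
    unfolding power2_eq_square by (cases "P B x = 0") auto
qed

lemma bounded_linear_P: "B \<in> sets borel \<Longrightarrow> bounded_linear (P B)"
  using clinear_bounded_linear[OF clinear_P, of B 1] norm_P_le by simp

lemma P_UNIV [simp]: "P UNIV x = x"
  using pvm unfolding pvm_def by simp

lemma P_sums:
  "range B \<subseteq> sets borel \<Longrightarrow> disjoint_family B \<Longrightarrow> (\<lambda>n. P (B n) x) sums P (\<Union>n. B n) x"
  for B :: "nat \<Rightarrow> real set"
  using pvm unfolding pvm_def by blast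

lemma P_empty [simp]: "P {} x = 0"
proof -
  have "(\<lambda>n::nat. P {} x) sums P (\<Union>n::nat. {}) x"
    by (rule P_sums) (auto simp: disjoint_family_on_def)
  then have "(\<lambda>n::nat. P {} x) \<longlonglongrightarrow> 0"
    using summable_LIMSEQ_zero sums_summable by blast
  then show ?thesis
    using LIMSEQ_const_iff by blast
qed

lemma P_Un:
  assumes "A \<in> sets borel" "B \<in> sets borel" "A \<inter> B = {}"
  shows "P (A \<union> B) x = P A x + P B x"
proof -
  have "(\<lambda>n. P (binaryset A B n) x) sums P (\<Union>n. binaryset A B n) x"
    using assms by (intro P_sums) (auto simp: range_binaryset_eq disjoint_family_on_def binaryset_def)
  moreover have "(\<lambda>n. P (binaryset A B n) x) sums (P A x + P B x)"
    by (rule binaryset_sums[where f = "\<lambda>B. P B x"]) simp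
  ultimately show ?thesis
    unfolding UN_binaryset_eq by (rule sums_unique2)
qed

text \<open>Orthogonality of disjoint projections is not part of \<open>pvm\<close>. For
  \<open>y\<close> in the range of \<open>P A\<close>, the form of \<open>P (A \<union> B)\<close>
  at \<open>y\<close> is the squared norm of \<open>y\<close> plus that of \<open>P B y\<close>,
  while a contraction allows at most the former.\<close>

lemma P_disjoint:
  assumes "A \<in> sets borel" "B \<in> sets borel" "A \<inter> B = {}"
  shows "P B (P A x) = 0"
proof -
  let ?y = "P A x"
  have "(norm ?y)\<^sup>2 + (norm (P B ?y))\<^sup>2 = Re (cinner ?y (P (A \<union> B) ?y))"
    unfolding P_Un[OF assms] P_idem[OF assms(1)]
    by (simp add: cinner_add_right cinner_P assms Re_cinner_self)
  also have "\<dots> \<le> cmod (cinner ?y (P (A \<union> B) ?y))"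
    by (rule complex_Re_le_cmod)
  also have "\<dots> \<le> norm ?y * norm (P (A \<union> B) ?y)"
    by (rule Cauchy_Schwarz)
  also have "\<dots> \<le> norm ?y * norm ?y"
    using assms by (intro mult_left_mono norm_P_le) auto
  finally have "(norm (P B ?y))\<^sup>2 \<le> 0"
    by (simp add: power2_eq_square)
  then show ?thesis
    by simp
qed

lemma P_Int:
  assumes A: "A \<in> sets borel" and B: "B \<in> sets borel"
  shows "P A (P B x) = P (A \<inter> B) x"
proof -
  have "P ((A \<inter> B) \<union> (B - A)) x = P (A \<inter> B) x + P (B - A) x"
    by (rule P_Un) (use A B in auto)
  moreover have "(A \<inter> B) \<union> (B - A) = B"
    by auto
  ultimately have 1: "P B x = P (A \<inter> B) x + P (B - A) x"
    by simp
  have 2: "P A (P (B - A) x) = 0"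
    by (rule P_disjoint) (use A B in auto)
  have 3: "P (A - B) (P (A \<inter> B) x) = 0"
    by (rule P_disjoint) (use A B in auto)
  have "P ((A \<inter> B) \<union> (A - B)) (P (A \<inter> B) x) = P (A \<inter> B) (P (A \<inter> B) x) + P (A - B) (P (A \<inter> B) x)"
    by (rule P_Un) (use A B in auto)
  then have 4: "P A (P (A \<inter> B) x) = P (A \<inter> B) x"
    unfolding 3 using A B by (simp add: P_idem Int_Diff_Un)
  show ?thesis
    unfolding 1 clinear_onD(1)[OF clinear_P[OF A] UNIV_I UNIV_I] 2 4 by simp
qed

lemma sets_vec_measure [simp, measurable_cong]: "sets (vec_measure P x) = sets borel"
  unfolding vec_measure_def
  by (simp add: sets_measure_of_conv) (metis sets.sigma_sets_eq space_borel)

lemma space_vec_measure [simp]: "space (vec_measure P x) = UNIV"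
  unfolding vec_measure_def by (simp add: space_measure_of_conv)

lemma emeasure_vec_measure:
  assumes "B \<in> sets borel"
  shows "emeasure (vec_measure P x) B = ennreal ((norm (P B x))\<^sup>2)"
proof -
  have "emeasure (vec_measure P x) B = ennreal (Re (cinner x (P B x)))"
  proof (rule emeasure_measure_of[OF vec_measure_def])
    show "B \<in> sets (vec_measure P x)"
      using assms by simp
    show "positive (sets (vec_measure P x)) (\<lambda>B. ennreal (Re (cinner x (P B x))))"
      by (simp add: positive_def)
    show "countably_additive (sets (vec_measure P x)) (\<lambda>B. ennreal (Re (cinner x (P B x))))"
      unfolding countably_additive_def
    proof (intro allI impI)
      fix A :: "nat \<Rightarrow> real set"
      assume A: "range A \<subseteq> sets (vec_measure P x)" "disjoint_family A"
      then have "(\<lambda>n. Re (cinner x (P (A n) x))) sums Re (cinner x (P (\<Union>n. A n) x))"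
        by (intro bounded_linear.sums[OF bounded_linear_Re]
            bounded_linear.sums[OF bounded_linear_cinner_right] P_sums) auto
      moreover have "0 \<le> Re (cinner x (P (A n) x))" for n
        using A by (subst cinner_P) auto
      ultimately show "(\<Sum>n. ennreal (Re (cinner x (P (A n) x)))) =
          ennreal (Re (cinner x (P (\<Union>n. A n) x)))"
        by (intro suminf_ennreal_eq)
    qed
  qed auto
  then show ?thesis
    using assms by (simp add: cinner_P)
qed

lemma finite_measure_vec_measure: "finite_measure (vec_measure P x)"
  by (rule finite_measureI) (simp add: emeasure_vec_measure)

lemma measure_vec_measure: "B \<in> sets borel \<Longrightarrow> measure (vec_measure P x) B = (norm (P B x))\<^sup>2"
  by (simp add: measure_def emeasure_vec_measure)

section \<open>Bounded Borel functions and their uniform approximation by simple functions\<close>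

definition bounded_borel :: "(real \<Rightarrow> complex) \<Rightarrow> bool" where
  "bounded_borel f \<longleftrightarrow> f \<in> borel_measurable borel \<and> (\<exists>M. \<forall>l. cmod (f l) \<le> M)"

lemma bounded_borelI: "f \<in> borel_measurable borel \<Longrightarrow> (\<And>l. cmod (f l) \<le> M) \<Longrightarrow> bounded_borel f"
  unfolding bounded_borel_def by blast

lemma bounded_borel_measurable: "bounded_borel f \<Longrightarrow> f \<in> borel_measurable borel"
  unfolding bounded_borel_def by blast

lemma bounded_borelE:
  assumes "bounded_borel f"
  obtains M where "\<And>l. cmod (f l) \<le> M" "0 \<le> M"
  using assms unfolding bounded_borel_def by (metis norm_ge_zero order_trans)

lemma bounded_borel_const: "bounded_borel (\<lambda>l. c)"
  by (rule bounded_borelI[where M = "cmod c"]) auto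

lemma bounded_borel_add:
  assumes "bounded_borel f" "bounded_borel g"
  shows "bounded_borel (\<lambda>l. f l + g l)"
proof -
  obtain M N where "\<And>l. cmod (f l) \<le> M" "\<And>l. cmod (g l) \<le> N"
    using assms by (metis bounded_borelE)
  then have "cmod (f l + g l) \<le> M + N" for l
    by (meson add_mono norm_triangle_le)
  then show ?thesis
    by (rule bounded_borelI[rotated])
      (use assms[THEN bounded_borel_measurable] in measurable)
qed

lemma bounded_borel_mult:
  assumes "bounded_borel f" "bounded_borel g"
  shows "bounded_borel (\<lambda>l. f l * g l)"
proof -
  obtain M N where "\<And>l. cmod (f l) \<le> M" "\<And>l. cmod (g l) \<le> N" "0 \<le> M"
    using assms by (metis bounded_borelE)
  then have "cmod (f l * g l) \<le> M * N" for l
    by (simp add: mult_mono norm_mult)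
  then show ?thesis
    by (rule bounded_borelI[rotated])
      (use assms[THEN bounded_borel_measurable] in measurable)
qed

lemma bounded_borel_cmult: "bounded_borel f \<Longrightarrow> bounded_borel (\<lambda>l. c * f l)"
  by (rule bounded_borel_mult[OF bounded_borel_const])

lemma bounded_borel_diff: "bounded_borel f \<Longrightarrow> bounded_borel g \<Longrightarrow> bounded_borel (\<lambda>l. f l - g l)"
  using bounded_borel_add[OF _ bounded_borel_cmult[of g "- 1"]] by simp

lemma measurable_cnj: "f \<in> borel_measurable borel \<Longrightarrow> (\<lambda>l. cnj (f l)) \<in> borel_measurable borel"
  for f :: "real \<Rightarrow> complex"
  by (rule measurable_compose[OF _ borel_measurable_continuous_onI[OF continuous_on_cnj[OF continuous_on_id]]])

lemma bounded_borel_cnj: "bounded_borel f \<Longrightarrow> bounded_borel (\<lambda>l. cnj (f l))"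
  unfolding bounded_borel_def by (auto intro: measurable_cnj)

text \<open>Truncation by an indicator function: on the range of \<open>P B\<close> an unbounded
  function may be replaced by its truncation to \<open>B\<close>, if that is bounded.\<close>

definition cut :: "real set \<Rightarrow> (real \<Rightarrow> complex) \<Rightarrow> real \<Rightarrow> complex" where
  "cut B f l = (if l \<in> B then f l else 0)"

lemma cut_measurable [measurable]:
  "B \<in> sets borel \<Longrightarrow> f \<in> borel_measurable borel \<Longrightarrow> cut B f \<in> borel_measurable borel"
  unfolding cut_def[abs_def] by (rule measurable_If_set) auto

lemma bounded_borel_cutI:
  assumes "f \<in> borel_measurable borel" "B \<in> sets borel" "\<And>l. l \<in> B \<Longrightarrow> cmod (f l) \<le> M"
  shows "bounded_borel (cut B f)"
proof (rule bounded_borelI[where M = "max M 0"])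
  show "cmod (cut B f l) \<le> max M 0" for l
    using assms(3)[of l] by (auto simp: cut_def)
qed (use assms in simp)

lemma bounded_borel_cut: "bounded_borel f \<Longrightarrow> B \<in> sets borel \<Longrightarrow> bounded_borel (cut B f)"
  by (metis bounded_borelE bounded_borel_cutI bounded_borel_measurable)

text \<open>Simple functions are uniformly dense. The explicit rate lets every limit case follow
  from norm bounds on operators.\<close>

lemma bounded_borel_induct [consumes 1, case_names indicator add cmult limit]:
  assumes f: "bounded_borel f"
    and ind: "\<And>B. B \<in> sets borel \<Longrightarrow> Q (cut B (\<lambda>_. 1))"
    and add: "\<And>f g. bounded_borel f \<Longrightarrow> bounded_borel g \<Longrightarrow> Q f \<Longrightarrow> Q g \<Longrightarrow> Q (\<lambda>l. f l + g l)"
    and cmult: "\<And>c f. bounded_borel f \<Longrightarrow> Q f \<Longrightarrow> Q (\<lambda>l. c * f l)"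
    and lim: "\<And>F f. (\<And>n. bounded_borel (F n)) \<Longrightarrow> (\<And>n. Q (F n)) \<Longrightarrow> bounded_borel f \<Longrightarrow>
        (\<And>n l. cmod (F n l - f l) \<le> 1 / Suc n) \<Longrightarrow> Q f"
  shows "Q f"
proof -
  have sum: "finite I \<Longrightarrow> (\<And>i. i \<in> I \<Longrightarrow> B i \<in> sets borel) \<Longrightarrow>
      bounded_borel (\<lambda>l. \<Sum>i\<in>I. c i * cut (B i) (\<lambda>_. 1) l) \<and>
      Q (\<lambda>l. \<Sum>i\<in>I. c i * cut (B i) (\<lambda>_. 1) l)" for I :: "complex set" and c B
  proof (induction I rule: finite_induct)
    case empty
    have "Q (cut {} (\<lambda>_. 1))"
      by (rule ind) simp
    moreover have "cut {} (\<lambda>_. 1) = (\<lambda>l. 0)"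
      by (auto simp: cut_def)
    ultimately show ?case
      by (simp add: bounded_borel_const)
  next
    case (insert i I)
    then have "bounded_borel (\<lambda>l. c i * cut (B i) (\<lambda>_. 1) l)" "Q (\<lambda>l. c i * cut (B i) (\<lambda>_. 1) l)"
      by (auto intro!: bounded_borel_cmult bounded_borel_cut bounded_borel_const cmult ind)
    then show ?case
      using insert by (auto intro!: bounded_borel_add add)
  qed
  have fin: "Q g" if g: "g \<in> borel_measurable borel" "finite (range g)" for g
  proof -
    have "g = (\<lambda>l. \<Sum>c\<in>range g. c * cut (g -` {c}) (\<lambda>_. 1) l)"
    proof
      fix l
      have "(\<Sum>c\<in>range g. c * cut (g -` {c}) (\<lambda>_. 1) l) = (\<Sum>c\<in>range g. if c = g l then c else 0)"
        by (intro sum.cong) (auto simp: cut_def)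
      then show "g l = (\<Sum>c\<in>range g. c * cut (g -` {c}) (\<lambda>_. 1) l)"
        using g(2) by (simp add: sum.delta)
    qed
    moreover have "g -` {c} \<in> sets borel" for c
      using measurable_sets[OF g(1), of "{c}"] by simp
    ultimately show ?thesis
      using sum[OF g(2), of "\<lambda>c. g -` {c}" "\<lambda>c. c"] by metis
  qed
  obtain M where M: "\<And>l. cmod (f l) \<le> M"
    using f by (metis bounded_borelE)
  have [measurable]: "f \<in> borel_measurable borel"
    using f by (rule bounded_borel_measurable)
  \<comment> \<open>Real and imaginary part are rounded separately on a grid of mesh
    \<open>1 / N n\<close>; the factor 2 keeps the two errors together below
    \<open>1 / Suc n\<close>.\<close>
  define N where "N n = 2 * real (Suc n)" for n
  define F where "F n l = Complex (real_of_int \<lfloor>N n * Re (f l)\<rfloor> / N n) (real_of_int \<lfloor>N n * Im (f l)\<rfloor> / N n)"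
    for n l
  have F_meas: "F n \<in> borel_measurable borel" for n
    unfolding F_def[abs_def] complex_eq by measurable
  have fin_F: "finite (range (F n))" for n
  proof (rule finite_subset)
    let ?K = "{- \<lceil>N n * M\<rceil> - 1..\<lceil>N n * M\<rceil> + 1}"
    show "range (F n) \<subseteq> (\<lambda>(i, j). Complex (real_of_int i / N n) (real_of_int j / N n)) ` (?K \<times> ?K)"
    proof
      fix w assume "w \<in> range (F n)"
      then obtain l where l: "w = F n l" by auto
      have *: "\<lfloor>N n * r\<rfloor> \<in> ?K" if "\<bar>r\<bar> \<le> M" for r
      proof -
        have "\<bar>N n * r\<bar> \<le> N n * M"
          using that by (simp add: abs_mult N_def)
        then have "N n * r \<le> N n * M" "- (N n * M) \<le> N n * r"
          by linarith+
        then show ?thesis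
          by (auto simp: le_floor_iff floor_le_iff) linarith+
      qed
      have "\<bar>Re (f l)\<bar> \<le> M" "\<bar>Im (f l)\<bar> \<le> M"
        using M[of l] abs_Re_le_cmod[of "f l"] abs_Im_le_cmod[of "f l"] by linarith+
      then show "w \<in> (\<lambda>(i, j). Complex (real_of_int i / N n) (real_of_int j / N n)) ` (?K \<times> ?K)"
        using * unfolding l F_def by (intro image_eqI[where x = "(\<lfloor>N n * Re (f l)\<rfloor>, \<lfloor>N n * Im (f l)\<rfloor>)"]) auto
    qed
  qed auto
  have close: "cmod (F n l - f l) \<le> 1 / Suc n" for n l
  proof -
    have N: "N n > 0"
      unfolding N_def by simp
    have *: "\<bar>real_of_int \<lfloor>N n * r\<rfloor> / N n - r\<bar> \<le> 1 / N n" for r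
    proof -
      have "\<bar>real_of_int \<lfloor>N n * r\<rfloor> - N n * r\<bar> \<le> 1"
        by linarith
      then have "\<bar>real_of_int \<lfloor>N n * r\<rfloor> - N n * r\<bar> / N n \<le> 1 / N n"
        using N by (simp add: divide_right_mono)
      moreover have "real_of_int \<lfloor>N n * r\<rfloor> / N n - r = (real_of_int \<lfloor>N n * r\<rfloor> - N n * r) / N n"
        using N by (simp add: field_simps)
      ultimately show ?thesis
        using N by simp
    qed
    have "cmod (F n l - f l) \<le> \<bar>Re (F n l - f l)\<bar> + \<bar>Im (F n l - f l)\<bar>"
      by (rule cmod_le)
    also have "\<dots> \<le> 1 / N n + 1 / N n"
      using *[of "Re (f l)"] *[of "Im (f l)"] unfolding F_def by simp
    also have "\<dots> = 1 / Suc n"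
      unfolding N_def by (simp add: field_simps)
    finally show ?thesis .
  qed
  have bb: "bounded_borel (F n)" for n
    using F_meas fin_F[of n] finite_imp_bounded[OF fin_F[of n]]
    by (auto simp: bounded_borel_def bounded_iff)
  show ?thesis
    by (rule lim[OF bb fin[OF F_meas fin_F] f close])
qed

lemma measurable_vec_measure: "f \<in> borel_measurable borel \<Longrightarrow> f \<in> borel_measurable (vec_measure P x)"
  using measurable_cong_sets[OF sets_vec_measure refl] by blast

lemma integrable_bounded_borel:
  assumes "bounded_borel f"
  shows "integrable (vec_measure P x) f"
proof -
  obtain M where "\<And>l. cmod (f l) \<le> M"
    using assms by (metis bounded_borelE)
  then show ?thesis
    using assms
    by (intro finite_measure.integrable_const_bound[OF finite_measure_vec_measure, where B = M]
        measurable_vec_measure bounded_borel_measurable) auto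
qed

text \<open>Only the quadratic form is prescribed, because \<open>vec_measure P x\<close> is a
  positive measure; polarization supplies uniqueness.\<close>

definition represents :: "(real \<Rightarrow> complex) \<Rightarrow> ('a \<Rightarrow> 'a) \<Rightarrow> bool" where
  "represents f T \<longleftrightarrow> clinear T \<and> (\<forall>x. cinner x (T x) = integral\<^sup>L (vec_measure P x) f)"

lemma represents_unique: "represents f S \<Longrightarrow> represents f T \<Longrightarrow> S = T"
  unfolding represents_def by (metis cinner_diag_ext ext)

lemma represents_indicator:
  assumes "B \<in> sets borel"
  shows "represents (cut B (\<lambda>_. 1)) (P B)"
  unfolding represents_def
proof (intro conjI allI clinear_P assms)
  fix x
  have "cut B (\<lambda>_. 1) = (\<lambda>l. complex_of_real (indicator B l))"
    by (auto simp: cut_def)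
  then show "cinner x (P B x) = integral\<^sup>L (vec_measure P x) (cut B (\<lambda>_. 1))"
    using assms by (simp add: cinner_P measure_vec_measure)
qed

lemma represents_add:
  "bounded_borel f \<Longrightarrow> bounded_borel g \<Longrightarrow> represents f S \<Longrightarrow> represents g T \<Longrightarrow>
    represents (\<lambda>l. f l + g l) (\<lambda>x. S x + T x)"
  unfolding represents_def
  by (auto simp: clinear_on_def cinner_add_right scaleC_add_right integrable_bounded_borel)

lemma represents_cmult:
  "represents f T \<Longrightarrow> represents (\<lambda>l. c * f l) (\<lambda>x. c *\<^sub>C T x)"
  unfolding represents_def
  by (auto simp: clinear_on_def cinner_scaleC_right scaleC_add_right scaleC_scaleC mult.commute)

text \<open>The constant 4 is the price of polarization. It suffices for convergence; the sharp
  constant follows in \<open>bfc_bound\<close>, once multiplicativity is known.\<close>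

lemma represents_bound:
  assumes "represents f T" "bounded_borel f" "\<And>l. cmod (f l) \<le> M"
  shows "norm (T x) \<le> 4 * M * norm x"
proof (cases "x = 0 \<or> T x = 0")
  case False
  have M: "0 \<le> M"
    using assms(3) norm_ge_zero order_trans by blast
  have T: "clinear T"
    using assms(1) unfolding represents_def by blast
  have diag: "cmod (cinner v (T v)) \<le> M * (norm v)\<^sup>2" for v
  proof -
    have "cmod (cinner v (T v)) = cmod (integral\<^sup>L (vec_measure P v) f)"
      using assms(1) unfolding represents_def by simp
    also have "\<dots> \<le> (\<integral>l. cmod (f l) \<partial>vec_measure P v)"
      by simp
    also have "\<dots> \<le> (\<integral>l. M \<partial>vec_measure P v)"
      using finite_measure.integrable_const[OF finite_measure_vec_measure]
      by (intro integral_mono integrable_norm integrable_bounded_borel assms)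
    also have "\<dots> = M * (norm v)\<^sup>2"
      by (simp add: measure_vec_measure)
    finally show ?thesis .
  qed
  \<comment> \<open>Parallel to \<open>T x\<close> and as long as \<open>x\<close>: the pairing with
    \<open>T x\<close> is then maximal, and each polarized vector has length at most
    \<open>2 * norm x\<close>.\<close>
  define y where "y = (complex_of_real (norm x / norm (T x))) *\<^sub>C T x"
  have ny: "norm y = norm x"
    using False unfolding y_def norm_scaleC by (simp add: norm_divide)
  have "norm x * norm (T x) = cmod (cinner y (T x))"
    using False unfolding y_def cinner_scaleC_left cinner_norm
    by (simp add: norm_mult norm_divide norm_power power2_eq_square del: of_real_power)
  also have "\<dots> = cmod (\<Sum>j<4. (- \<i>) ^ j * cinner (y + \<i> ^ j *\<^sub>C x) (T (y + \<i> ^ j *\<^sub>C x))) / 4"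
    using polarization[OF T, of y x, symmetric] by (simp only: norm_divide) simp
  also have "\<dots> \<le> (\<Sum>j<4::nat. M * (2 * norm x)\<^sup>2) / 4"
  proof (intro divide_right_mono order_trans[OF norm_sum] sum_mono)
    fix j :: nat
    have "norm (y + \<i> ^ j *\<^sub>C x) \<le> 2 * norm x"
      using norm_triangle_ineq[of y "\<i> ^ j *\<^sub>C x"] ny by (simp add: norm_scaleC norm_power)
    then have "M * (norm (y + \<i> ^ j *\<^sub>C x))\<^sup>2 \<le> M * (2 * norm x)\<^sup>2"
      using M by (intro mult_left_mono power_mono) auto
    then show "cmod ((- \<i>) ^ j * cinner (y + \<i> ^ j *\<^sub>C x) (T (y + \<i> ^ j *\<^sub>C x))) \<le> M * (2 * norm x)\<^sup>2"
      using diag[of "y + \<i> ^ j *\<^sub>C x"] by (simp add: norm_mult norm_power)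
  qed simp
  also have "\<dots> = norm x * (4 * M * norm x)"
    by (simp add: power2_eq_square)
  finally show ?thesis
    using False by simp
next
  case True
  have "0 \<le> M"
    using assms(3) norm_ge_zero order_trans by blast
  moreover have "T 0 = 0"
    using assms(1) unfolding represents_def by (simp add: clinear_extra)
  ultimately show ?thesis
    using True by auto
qed

lemma represents_exists: "bounded_borel f \<Longrightarrow> \<exists>T. represents f T"
proof (induction rule: bounded_borel_induct)
  case (indicator B)
  then show ?case using represents_indicator by blast
next
  case (add f g)
  then show ?case using represents_add by blast
next
  case (cmult c f)
  then show ?case using represents_cmult by blast
next
  case (limit F f)
  then obtain T where T: "\<And>n. represents (F n) (T n)"
    by metis
  have lin: "clinear (T n)" for n
    using T unfolding represents_def by blast
  have F_diff: "cmod (F m l - F n l) \<le> 1 / Suc m + 1 / Suc n" for m n l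
    using limit.hyps(3)[of m l] limit.hyps(3)[of n l] norm_triangle_ineq4[of "F m l - f l" "F n l - f l"] by simp
  \<comment> \<open>Applied to differences of the approximants, the weak bound makes
    \<open>T n x\<close> a Cauchy sequence.\<close>
  have diff: "norm (T m x - T n x) \<le> 4 * (1 / Suc m + 1 / Suc n) * norm x" for m n x
  proof (rule represents_bound[where T = "\<lambda>x. T m x - T n x" and f = "\<lambda>l. F m l - F n l"])
    show "represents (\<lambda>l. F m l - F n l) (\<lambda>x. T m x - T n x)"
      using represents_add[OF limit.hyps(1)[of m] bounded_borel_cmult[OF limit.hyps(1)[of n]] T[of m]
          represents_cmult[OF T[of n]], of "- 1"] by simp
  qed (auto intro: bounded_borel_diff limit F_diff simp del: of_nat_Suc)
  have "Cauchy (\<lambda>n. T n x)" for x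
  proof (rule metric_CauchyI)
    fix e :: real assume "0 < e"
    have "(\<lambda>n. 8 * (1 / real (Suc n)) * norm x) \<longlonglongrightarrow> 8 * 0 * norm x"
      by (intro tendsto_intros LIMSEQ_Suc[OF lim_1_over_n])
    then have "\<forall>\<^sub>F n in sequentially. 8 * (1 / real (Suc n)) * norm x < e"
      using \<open>0 < e\<close> by (intro order_tendstoD) auto
    then obtain N where N: "8 * (1 / real (Suc N)) * norm x < e"
      unfolding eventually_sequentially by blast
    show "\<exists>M. \<forall>m\<ge>M. \<forall>n\<ge>M. dist (T m x) (T n x) < e"
    proof (intro exI[of _ N] allI impI)
      fix m n assume "N \<le> m" "N \<le> n"
      have "dist (T m x) (T n x) \<le> 4 * (1 / Suc m + 1 / Suc n) * norm x"
        using diff by (simp add: dist_norm)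
      also have "\<dots> \<le> 4 * (1 / Suc N + 1 / Suc N) * norm x"
        using \<open>N \<le> m\<close> \<open>N \<le> n\<close>
        by (intro mult_right_mono mult_left_mono add_mono divide_left_mono) auto
      also have "\<dots> < e"
        using N by simp
      finally show "dist (T m x) (T n x) < e" .
    qed
  qed
  then have conv: "(\<lambda>n. T n x) \<longlonglongrightarrow> lim (\<lambda>n. T n x)" for x
    using Cauchy_convergent convergent_LIMSEQ_iff by blast
  define S where "S x = lim (\<lambda>n. T n x)" for x
  have "S (x + y) = S x + S y" for x y
    using tendsto_add[OF conv[of x] conv[of y]] conv[of "x + y"] LIMSEQ_unique
    unfolding S_def clinear_onD(1)[OF lin UNIV_I UNIV_I] by blast
  moreover have "S (c *\<^sub>C x) = c *\<^sub>C S x" for c x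
    using tendsto_scaleC[OF tendsto_const conv[of x], of c] conv[of "c *\<^sub>C x"] LIMSEQ_unique
    unfolding S_def clinear_onD(2)[OF lin UNIV_I] by blast
  moreover have "cinner x (S x) = integral\<^sup>L (vec_measure P x) f" for x
  proof (rule LIMSEQ_unique)
    show "(\<lambda>n. cinner x (T n x)) \<longlonglongrightarrow> cinner x (S x)"
      unfolding S_def by (intro tendsto_intros conv)
    obtain M where M: "\<And>l. cmod (f l) \<le> M"
      using limit.hyps(2) by (metis bounded_borelE)
    have "(\<lambda>n. integral\<^sup>L (vec_measure P x) (F n)) \<longlonglongrightarrow> integral\<^sup>L (vec_measure P x) f"
    proof (rule integral_dominated_convergence[where w = "\<lambda>_. M + 1"])
      show "AE l in vec_measure P x. (\<lambda>n. F n l) \<longlonglongrightarrow> f l"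
      proof (rule AE_I2)
        fix l
        have "(\<lambda>n. F n l - f l) \<longlonglongrightarrow> 0"
          by (rule Lim_null_comparison[OF always_eventually[OF allI, OF limit.hyps(3)]])
            (rule LIMSEQ_Suc[OF lim_1_over_n])
        then show "(\<lambda>n. F n l) \<longlonglongrightarrow> f l"
          using LIM_zero_iff by blast
      qed
      show "AE l in vec_measure P x. cmod (F n l) \<le> M + 1" for n
      proof (rule AE_I2)
        fix l
        have "cmod (F n l) \<le> cmod (f l) + cmod (F n l - f l)"
          by (metis add.commute diff_add_cancel norm_triangle_ineq)
        moreover have "1 / real (Suc n) \<le> 1"
          by simp
        ultimately show "cmod (F n l) \<le> M + 1"
          using limit.hyps(3)[of n l] M[of l] by linarith
      qed
    qed (use limit bounded_borel_measurable in \<open>auto intro: finite_measure.integrable_const[OF finite_measure_vec_measure]\<close>)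
    then show "(\<lambda>n. cinner x (T n x)) \<longlonglongrightarrow> integral\<^sup>L (vec_measure P x) f"
      using T unfolding represents_def by simp
  qed
  ultimately have "represents f S"
    unfolding represents_def clinear_on_def by simp
  then show ?case by blast
qed

section \<open>Algebraic laws and bounds of the bounded functional calculus\<close>

definition bfc :: "(real \<Rightarrow> complex) \<Rightarrow> 'a \<Rightarrow> 'a" where
  "bfc f = (SOME T. represents f T)"

lemma represents_bfc: "bounded_borel f \<Longrightarrow> represents f (bfc f)"
  unfolding bfc_def using someI_ex[OF represents_exists] .

lemma bfc_eqI: "bounded_borel f \<Longrightarrow> represents f T \<Longrightarrow> bfc f = T"
  using represents_unique represents_bfc by blast

lemma clinear_bfc: "bounded_borel f \<Longrightarrow> clinear (bfc f)"
  using represents_bfc unfolding represents_def by blast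

lemma cinner_bfc: "bounded_borel f \<Longrightarrow> cinner x (bfc f x) = integral\<^sup>L (vec_measure P x) f"
  using represents_bfc unfolding represents_def by blast

lemma bfc_indicator: "B \<in> sets borel \<Longrightarrow> bfc (cut B (\<lambda>_. 1)) = P B"
  by (intro bfc_eqI represents_indicator bounded_borel_cut bounded_borel_const)

lemma bfc_add:
  "bounded_borel f \<Longrightarrow> bounded_borel g \<Longrightarrow> bfc (\<lambda>l. f l + g l) x = bfc f x + bfc g x"
  by (subst bfc_eqI[OF bounded_borel_add represents_add[OF _ _ represents_bfc represents_bfc]]) auto

lemma bfc_cmult: "bounded_borel f \<Longrightarrow> bfc (\<lambda>l. c * f l) x = c *\<^sub>C bfc f x"
  by (subst bfc_eqI[OF bounded_borel_cmult represents_cmult[OF represents_bfc]]) auto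

lemma bfc_diff:
  "bounded_borel f \<Longrightarrow> bounded_borel g \<Longrightarrow> bfc (\<lambda>l. f l - g l) x = bfc f x - bfc g x"
  using bfc_add[OF _ bounded_borel_cmult[of g "- 1"], of f x] bfc_cmult[of g "- 1" x] by simp

lemma bfc_bound_weak: "bounded_borel f \<Longrightarrow> (\<And>l. cmod (f l) \<le> M) \<Longrightarrow> norm (bfc f x) \<le> 4 * M * norm x"
  by (rule represents_bound[OF represents_bfc])

lemma bounded_linear_bfc: "bounded_borel f \<Longrightarrow> bounded_linear (bfc f)"
  by (metis bfc_bound_weak bounded_borelE clinear_bfc clinear_bounded_linear)

lemma bfc_limit:
  assumes "\<And>n. bounded_borel (F n)" "bounded_borel f" "\<And>n l. cmod (F n l - f l) \<le> e n" "e \<longlonglongrightarrow> 0"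
  shows "(\<lambda>n. bfc (F n) x) \<longlonglongrightarrow> bfc f x"
proof -
  have le: "norm (bfc (F n) x - bfc f x) \<le> 4 * e n * norm x" for n
    unfolding bfc_diff[OF assms(1,2), symmetric]
    by (rule bfc_bound_weak[OF bounded_borel_diff[OF assms(1,2)] assms(3)])
  have "(\<lambda>n. 4 * e n * norm x) \<longlonglongrightarrow> 0"
    using assms(4) by (auto intro!: tendsto_eq_intros)
  then have "(\<lambda>n. bfc (F n) x - bfc f x) \<longlonglongrightarrow> 0"
    by (rule Lim_null_comparison[OF always_eventually[OF allI, OF le]])
  then show ?thesis
    using LIM_zero_iff by blast
qed

lemma bfc_P: "bounded_borel g \<Longrightarrow> B \<in> sets borel \<Longrightarrow> P B (bfc g x) = bfc (cut B g) x"
proof (induction g arbitrary: x rule: bounded_borel_induct)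
  case (indicator A)
  have "cut B (cut A (\<lambda>_. 1)) = cut (B \<inter> A) (\<lambda>_. 1)"
    by (auto simp: cut_def)
  then show ?case
    using indicator by (simp add: bfc_indicator P_Int)
next
  case (add f g)
  have "cut B (\<lambda>l. f l + g l) = (\<lambda>l. cut B f l + cut B g l)"
    by (auto simp: cut_def)
  then show ?case
    using add by (simp add: bfc_add bounded_borel_cut clinear_onD[OF clinear_P])
next
  case (cmult c f)
  have "cut B (\<lambda>l. c * f l) = (\<lambda>l. c * cut B f l)"
    by (auto simp: cut_def)
  then show ?case
    using cmult by (simp add: bfc_cmult bounded_borel_cut clinear_onD[OF clinear_P])
next
  case (limit F f)
  have "(\<lambda>n. P B (bfc (F n) x)) \<longlonglongrightarrow> P B (bfc f x)"
    by (intro bounded_linear.tendsto[OF bounded_linear_P] bfc_limit[OF limit.hyps] limit.prems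
        LIMSEQ_Suc[OF lim_1_over_n])
  moreover have "(\<lambda>n. bfc (cut B (F n)) x) \<longlonglongrightarrow> bfc (cut B f) x"
  proof (rule bfc_limit)
    show "cmod (cut B (F n) l - cut B f l) \<le> 1 / real (Suc n)" for n l
      using limit.hyps(3)[of n l] by (auto simp: cut_def)
  qed (auto intro: bounded_borel_cut limit LIMSEQ_Suc[OF lim_1_over_n, simplified])
  ultimately show ?case
    using limit.IH[OF limit.prems] LIMSEQ_unique by simp
qed

text \<open>Induction on the left factor only: for an indicator function the claim is
  \<open>bfc_P\<close>, and the other cases are linear or limits.\<close>

lemma bfc_mult:
  "bounded_borel f \<Longrightarrow> bounded_borel g \<Longrightarrow> bfc (\<lambda>l. f l * g l) x = bfc f (bfc g x)"
proof (induction f arbitrary: x rule: bounded_borel_induct)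
  case (indicator B)
  have "(\<lambda>l. cut B (\<lambda>_. 1) l * g l) = cut B g"
    by (auto simp: cut_def)
  then show ?case
    using indicator by (simp add: bfc_indicator bfc_P)
next
  case (add f f')
  then show ?case
    by (simp add: distrib_right bfc_add bounded_borel_mult)
next
  case (cmult c f)
  then show ?case
    by (simp add: mult.assoc bfc_cmult bounded_borel_mult)
next
  case (limit F f)
  obtain M where M: "\<And>l. cmod (g l) \<le> M" "0 \<le> M"
    using limit.prems by (metis bounded_borelE)
  have "(\<lambda>n. bfc (\<lambda>l. F n l * g l) x) \<longlonglongrightarrow> bfc (\<lambda>l. f l * g l) x"
  proof (rule bfc_limit)
    show "cmod (F n l * g l - f l * g l) \<le> 1 / real (Suc n) * M" for n l
      using mult_mono[OF limit.hyps(3)[of n l] M(1)[of l]]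
      by (simp add: norm_mult flip: left_diff_distrib)
    show "(\<lambda>n. 1 / real (Suc n) * M) \<longlonglongrightarrow> 0"
      by (rule tendsto_mult_left_zero) (rule LIMSEQ_Suc[OF lim_1_over_n])
  qed (auto intro: bounded_borel_mult limit)
  moreover have "(\<lambda>n. bfc (F n) (bfc g x)) \<longlonglongrightarrow> bfc f (bfc g x)"
    by (intro bfc_limit[OF limit.hyps] LIMSEQ_Suc[OF lim_1_over_n])
  ultimately show ?case
    using limit.IH[OF limit.prems] LIMSEQ_unique by simp
qed

lemma bfc_commute:
  "bounded_borel f \<Longrightarrow> bounded_borel g \<Longrightarrow> bfc f (bfc g x) = bfc g (bfc f x)"
  by (metis (no_types, lifting) bfc_mult ext mult.commute)

lemma bfc_adjoint:
  "bounded_borel f \<Longrightarrow> cinner (bfc f x) y = cinner x (bfc (\<lambda>l. cnj (f l)) y)"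
proof (induction f rule: bounded_borel_induct)
  case (indicator B)
  have "(\<lambda>l. cnj (cut B (\<lambda>_. 1) l)) = cut B (\<lambda>_. 1)"
    by (auto simp: cut_def)
  then show ?case
    using indicator by (simp add: bfc_indicator P_sym)
next
  case (add f g)
  then show ?case
    by (simp add: bfc_add bounded_borel_cnj cinner_add_left cinner_add_right)
next
  case (cmult c f)
  then show ?case
    by (simp add: bfc_cmult bounded_borel_cnj cinner_scaleC_left cinner_scaleC_right)
next
  case (limit F f)
  have "(\<lambda>n. cinner (bfc (F n) x) y) \<longlonglongrightarrow> cinner (bfc f x) y"
    by (intro tendsto_intros bfc_limit[OF limit.hyps] LIMSEQ_Suc[OF lim_1_over_n])
  moreover have "(\<lambda>n. cinner x (bfc (\<lambda>l. cnj (F n l)) y)) \<longlonglongrightarrow> cinner x (bfc (\<lambda>l. cnj (f l)) y)"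
  proof (intro tendsto_intros bfc_limit)
    show "cmod (cnj (F n l) - cnj (f l)) \<le> 1 / real (Suc n)" for n l
      using limit.hyps(3)[of n l] complex_mod_cnj by (metis complex_cnj_diff)
  qed (auto intro: bounded_borel_cnj limit LIMSEQ_Suc[OF lim_1_over_n, simplified])
  ultimately show ?case
    using limit.IH LIMSEQ_unique by simp
qed

lemma norm_bfc_square:
  assumes "bounded_borel f"
  shows "(norm (bfc f x))\<^sup>2 = (\<integral>l. (cmod (f l))\<^sup>2 \<partial>vec_measure P x)"
proof -
  have *: "(\<lambda>l. cnj (f l) * f l) = (\<lambda>l. complex_of_real ((cmod (f l))\<^sup>2))"
    by (simp add: complex_norm_square mult.commute del: of_real_power)
  have "complex_of_real ((norm (bfc f x))\<^sup>2) = cinner x (bfc (\<lambda>l. cnj (f l)) (bfc f x))"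
    unfolding bfc_adjoint[OF assms, symmetric] cinner_norm ..
  also have "\<dots> = cinner x (bfc (\<lambda>l. cnj (f l) * f l) x)"
    by (simp add: bfc_mult bounded_borel_cnj assms)
  also have "\<dots> = complex_of_real (\<integral>l. (cmod (f l))\<^sup>2 \<partial>vec_measure P x)"
    using cinner_bfc[OF bounded_borel_mult[OF bounded_borel_cnj[OF assms] assms], of x]
    by (simp only: * integral_complex_of_real)
  finally show ?thesis
    using of_real_eq_iff by blast
qed

lemma bfc_cut_P:
  assumes "bounded_borel f" "B \<in> sets borel" "P B x = x"
  shows "bfc (cut B f) x = bfc f x"
proof -
  have "bfc f x = bfc f (bfc (cut B (\<lambda>_. 1)) x)"
    using assms by (simp add: bfc_indicator)
  also have "\<dots> = bfc (\<lambda>l. f l * cut B (\<lambda>_. 1) l) x"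
    using assms by (simp add: bfc_mult bounded_borel_cut bounded_borel_const)
  also have "(\<lambda>l. f l * cut B (\<lambda>_. 1) l) = cut B f"
    by (auto simp: cut_def)
  finally show ?thesis by simp
qed

lemma bfc_bound:
  assumes "bounded_borel f" "\<And>l. cmod (f l) \<le> M" "0 \<le> M"
  shows "norm (bfc f x) \<le> M * norm x"
proof -
  have "(norm (bfc f x))\<^sup>2 \<le> (\<integral>l. M\<^sup>2 \<partial>vec_measure P x)"
    unfolding norm_bfc_square[OF assms(1)]
  proof (rule integral_mono)
    show "integrable (vec_measure P x) (\<lambda>l. (cmod (f l))\<^sup>2)"
      using integrable_bounded_borel[OF bounded_borel_mult[OF bounded_borel_cnj[OF assms(1)] assms(1)],
          THEN integrable_norm] by (simp add: norm_mult power2_eq_square)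
    show "(cmod (f l))\<^sup>2 \<le> M\<^sup>2" for l
      using assms(2) by (simp add: power_mono)
  qed (rule finite_measure.integrable_const[OF finite_measure_vec_measure])
  also have "\<dots> = (M * norm x)\<^sup>2"
    by (simp add: measure_vec_measure power_mult_distrib)
  finally show ?thesis
    using assms(3) by (meson power2_le_imp_le mult_nonneg_nonneg norm_ge_zero)
qed

lemma bfc_bound_on:
  assumes "bounded_borel f" "B \<in> sets borel" "P B x = x" "\<And>l. l \<in> B \<Longrightarrow> cmod (f l) \<le> M" "0 \<le> M"
  shows "norm (bfc f x) \<le> M * norm x"
  unfolding bfc_cut_P[OF assms(1-3), symmetric]
  by (rule bfc_bound) (use assms in \<open>auto intro: bounded_borel_cut simp: cut_def\<close>)

section \<open>The spectral integral on spectral subspaces\<close>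

lemma power_mi_four_sum: "(\<Sum>j<4. (- \<i>) ^ j * (c::complex)) = 0"
proof -
  have "{..<4::nat} = {0, 1, 2, 3}"
    by auto
  then show ?thesis
    by (simp add: eval_nat_numeral)
qed

text \<open>Compares integrals of possibly unbounded functions over \<open>B\<close> for two vectors
  without evaluating them.\<close>

lemma density_vec_measure_eq:
  assumes "B \<in> sets borel" "\<And>A. A \<in> sets borel \<Longrightarrow> A \<subseteq> B \<Longrightarrow> norm (P A v) = norm (P A w)"
  shows "density (vec_measure P v) (\<lambda>l. ennreal (indicator B l)) =
    density (vec_measure P w) (\<lambda>l. ennreal (indicator B l))"
proof (rule measure_eqI)
  fix A assume "A \<in> sets (density (vec_measure P v) (\<lambda>l. ennreal (indicator B l)))"
  then have A: "A \<in> sets borel" by simp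
  have "emeasure (density (vec_measure P u) (\<lambda>l. ennreal (indicator B l))) A =
      ennreal ((norm (P (B \<inter> A) u))\<^sup>2)" for u
  proof -
    have "emeasure (density (vec_measure P u) (\<lambda>l. ennreal (indicator B l))) A =
        (\<integral>\<^sup>+ l. indicator (B \<inter> A) l \<partial>vec_measure P u)"
      using A assms(1)
      by (subst emeasure_density)
        (auto intro!: nn_integral_cong split: split_indicator simp del: nn_integral_indicator)
    then show ?thesis
      using A assms(1) by (simp add: emeasure_vec_measure)
  qed
  then show "emeasure (density (vec_measure P v) (\<lambda>l. ennreal (indicator B l))) A =
      emeasure (density (vec_measure P w) (\<lambda>l. ennreal (indicator B l))) A"
    using assms A by simp
qed simp

lemma integral_cut_cong:
  assumes "B \<in> sets borel" "f \<in> borel_measurable borel"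
    and "\<And>A. A \<in> sets borel \<Longrightarrow> A \<subseteq> B \<Longrightarrow> norm (P A v) = norm (P A w)"
  shows "integrable (vec_measure P v) (cut B f) \<longleftrightarrow> integrable (vec_measure P w) (cut B f)"
    and "integral\<^sup>L (vec_measure P v) (cut B f) = integral\<^sup>L (vec_measure P w) (cut B f)"
proof -
  have cut: "cut B f = (\<lambda>l. indicator B l *\<^sub>R f l)"
    by (auto simp: cut_def)
  have [measurable]: "f \<in> borel_measurable (vec_measure P u)" "B \<in> sets (vec_measure P u)" for u
    using assms by (simp_all add: measurable_vec_measure)
  note * = density_vec_measure_eq[OF assms(1,3)]
  show "integrable (vec_measure P v) (cut B f) \<longleftrightarrow> integrable (vec_measure P w) (cut B f)"
    unfolding cut using * by (subst (1 2) integrable_density[symmetric]) auto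
  show "integral\<^sup>L (vec_measure P v) (cut B f) = integral\<^sup>L (vec_measure P w) (cut B f)"
    unfolding cut using * by (subst (1 2) integral_density[symmetric]) auto
qed

lemma fcalc_dom_integrable:
  assumes "f \<in> borel_measurable borel" "z \<in> fcalc_dom P f"
  shows "integrable (vec_measure P z) f"
proof (rule Bochner_Integration.integrable_bound)
  show "integrable (vec_measure P z) (\<lambda>l. 1 + (cmod (f l))\<^sup>2)"
    using assms(2) unfolding fcalc_dom_def
    by (intro Bochner_Integration.integrable_add
        finite_measure.integrable_const[OF finite_measure_vec_measure]) auto
  show "f \<in> borel_measurable (vec_measure P z)"
    using assms(1) by (rule measurable_vec_measure)
  have "cmod (f l) \<le> 1 + (cmod (f l))\<^sup>2" for l
    using sum_squares_bound[of "cmod (f l)" 1] by (simp add: power2_eq_square)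
      (smt (verit) mult_nonneg_nonneg norm_ge_zero)
  then show "AE l in vec_measure P z. norm (f l) \<le> norm (1 + (cmod (f l))\<^sup>2)"
    by simp
qed

context
  fixes f :: "real \<Rightarrow> complex" and B :: "real set" and M :: real and x :: 'a
  assumes f [measurable]: "f \<in> borel_measurable borel" and B [measurable]: "B \<in> sets borel"
    and bound: "\<And>l. l \<in> B \<Longrightarrow> cmod (f l) \<le> M" and x: "P B x = x"
begin

lemma P_outside: "A \<in> sets borel \<Longrightarrow> A \<subseteq> - B \<Longrightarrow> P A x = 0"
  using P_disjoint[of B A x] x by (simp add: disjoint_eq_subset_Compl inf_commute)

lemma mem_fcalc_dom: "x \<in> fcalc_dom P f"
proof -
  have "emeasure (vec_measure P x) (- B) = 0"
    using P_outside[of "- B"] by (simp add: emeasure_vec_measure)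
  then have "AE l in vec_measure P x. l \<in> B"
    by (intro AE_I'[of "- B"]) (auto simp: null_sets_def)
  then have "AE l in vec_measure P x. norm ((cmod (f l))\<^sup>2) \<le> M\<^sup>2"
    by eventually_elim (use bound in \<open>simp add: power_mono\<close>)
  moreover have "(\<lambda>l. (cmod (f l))\<^sup>2) \<in> borel_measurable borel"
    by measurable
  ultimately show ?thesis
    unfolding fcalc_dom_def mem_Collect_eq
    by (intro finite_measure.integrable_const_bound[OF finite_measure_vec_measure])
      (auto intro: measurable_vec_measure)
qed

text \<open>Off \<open>B\<close> the polarized vectors all have the spectral measure of
  \<open>z\<close>. The part of \<open>f\<close> outside \<open>B\<close>, possibly unbounded,
  contributes the same number to all four terms, and the fourth roots of unity cancel it.\<close>

lemma spectral_form_cut: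
  assumes z: "z \<in> fcalc_dom P f"
    and v: "\<And>j A. A \<in> sets borel \<Longrightarrow> A \<subseteq> - B \<Longrightarrow> norm (P A (v j)) = norm (P A z)"
  shows "(\<Sum>j<4. (- \<i>) ^ j * integral\<^sup>L (vec_measure P (v j)) f) =
    (\<Sum>j<4. (- \<i>) ^ j * cinner (v j) (bfc (cut B f) (v j)))"
proof -
  have bb: "bounded_borel (cut B f)"
    using bound by (intro bounded_borel_cutI) auto
  have f_eq: "f = (\<lambda>l. cut B f l + cut (- B) f l)"
    by (auto simp: cut_def)
  have "integrable (vec_measure P z) (\<lambda>l. f l - cut B f l)"
    by (intro Bochner_Integration.integrable_diff fcalc_dom_integrable z integrable_bounded_borel bb f)
  also have "(\<lambda>l. f l - cut B f l) = cut (- B) f"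
    by (auto simp: cut_def)
  finally have int: "integrable (vec_measure P (v j)) (cut (- B) f)" for j
    using integral_cut_cong(1)[of "- B" f "v j" z] v by simp
  have "integral\<^sup>L (vec_measure P (v j)) f =
      cinner (v j) (bfc (cut B f) (v j)) + integral\<^sup>L (vec_measure P z) (cut (- B) f)" for j
    using integral_cut_cong(2)[of "- B" f "v j" z] v
      Bochner_Integration.integral_add[OF integrable_bounded_borel[OF bb] int]
    by (simp add: cinner_bfc[OF bb] f_eq[symmetric])
  then show ?thesis
    by (simp add: distrib_left sum.distrib power_mi_four_sum)
qed

lemma spectral_form_right:
  assumes z: "z \<in> fcalc_dom P f"
  shows "spectral_form P f z x = cinner z (bfc (cut B f) x)"
proof -
  have bb: "bounded_borel (cut B f)"
    using bound by (intro bounded_borel_cutI) auto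
  have "norm (P A (z + \<i> ^ j *\<^sub>C x)) = norm (P A z)" if "A \<in> sets borel" "A \<subseteq> - B" for j :: nat and A
    using P_outside[OF that] by (simp add: clinear_onD[OF clinear_P[OF that(1)]])
  then show ?thesis
    unfolding spectral_form_def
    by (subst spectral_form_cut[OF z]) (auto simp only: polarization[OF clinear_bfc[OF bb]])
qed

lemma spectral_form_left:
  assumes z: "z \<in> fcalc_dom P f"
  shows "spectral_form P f x z = cinner x (bfc (cut B f) z)"
proof -
  have bb: "bounded_borel (cut B f)"
    using bound by (intro bounded_borel_cutI) auto
  have "norm (P A (x + \<i> ^ j *\<^sub>C z)) = norm (P A z)" if "A \<in> sets borel" "A \<subseteq> - B" for j :: nat and A
    using P_outside[OF that] by (simp add: clinear_onD[OF clinear_P[OF that(1)]] norm_scaleC norm_power)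
  then show ?thesis
    unfolding spectral_form_def
    by (subst spectral_form_cut[OF z]) (auto simp only: polarization[OF clinear_bfc[OF bb]])
qed

lemma fcalcI: "(x, bfc (cut B f) x) \<in> fcalc P f"
  unfolding fcalc_def using mem_fcalc_dom spectral_form_right by auto

text \<open>A weak adjoint relation for arbitrary \<open>z\<close> in the domain: the definition of
  \<open>fcalc\<close> is tested against \<open>x\<close>, which lies in the range of
  \<open>P B\<close>, where \<open>f\<close> is bounded.\<close>

lemma fcalc_pairing:
  assumes "(z, y) \<in> fcalc P f"
  shows "cinner x y = cinner (bfc (cut B (\<lambda>l. cnj (f l))) x) z"
proof -
  have "bounded_borel (cut B (\<lambda>l. cnj (f l)))"
    using bound by (intro bounded_borel_cutI[where M = M] measurable_cnj) auto
  moreover have "(\<lambda>l. cnj (cut B (\<lambda>l. cnj (f l)) l)) = cut B f"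
    by (auto simp: cut_def)
  moreover have "cinner x y = spectral_form P f x z" "z \<in> fcalc_dom P f"
    using assms mem_fcalc_dom unfolding fcalc_def by auto
  ultimately show ?thesis
    by (simp add: bfc_adjoint spectral_form_left)
qed

end

end

section \<open>Unbounded operators\<close>

lemma op_app_eq: "single_valued T \<Longrightarrow> (x, y) \<in> T \<Longrightarrow> op_app T x = y"
  unfolding op_app_def single_valued_def by blast

lemma op_app_mem: "single_valued T \<Longrightarrow> x \<in> Domain T \<Longrightarrow> (x, op_app T x) \<in> T"
  by (metis DomainE op_app_eq)

lemma linear_opD:
  assumes "linear_op T"
  shows "single_valued T" "(0, 0) \<in> T" "(x, y) \<in> T \<Longrightarrow> (u, v) \<in> T \<Longrightarrow> (x + u, y + v) \<in> T"
    "(x, y) \<in> T \<Longrightarrow> (c *\<^sub>C x, c *\<^sub>C y) \<in> T"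
  using assms unfolding linear_op_def by blast+

lemma linear_op_diff:
  assumes "linear_op T" "(x, y) \<in> T" "(u, v) \<in> T"
  shows "(x - u, y - v) \<in> T"
  using linear_opD(3)[OF assms(1,2) linear_opD(4)[OF assms(1,3), of "- 1"]] by simp

lemma clinear_on_op_app:
  assumes "linear_op T" "S \<subseteq> Domain T"
  shows "clinear_on S (op_app T)"
  unfolding clinear_on_def
proof (intro conjI ballI allI)
  note T = linear_opD[OF assms(1)]
  fix x assume x: "x \<in> S"
  show "op_app T (c *\<^sub>C x) = c *\<^sub>C op_app T x" for c
    using x assms(2) by (intro op_app_eq T op_app_mem) auto
  show "op_app T (x + y) = op_app T x + op_app T y" if "y \<in> S" for y
    using x that assms(2) by (intro op_app_eq T op_app_mem) auto
qed

lemma single_valued_adj: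
  assumes "closure (Domain T) = UNIV"
  shows "single_valued (adj T)"
proof (rule single_valuedI)
  fix x y z assume yz: "(x, y) \<in> adj T" "(x, z) \<in> adj T"
  show "y = z"
  proof (rule cinner_eq_dense[OF assms])
    fix u assume "u \<in> Domain T"
    then obtain v where "(u, v) \<in> T" by blast
    then have "cinner y u = cinner z u"
      using yz unfolding adj_def by (auto simp: case_prod_beta)
    then show "cinner u y = cinner u z"
      by (metis cinner_commute)
  qed
qed

lemma closed_adj: "closed (adj T)"
proof -
  have "adj T = (\<Inter>(u, v)\<in>T. {p. cinner (fst p) v = cinner (snd p) u})"
    unfolding adj_def by auto
  moreover have "closed {p. cinner (fst p) v = cinner (snd p) u}" for u v :: 'a
    by (intro closed_Collect_eq continuous_intros)
  ultimately show ?thesis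
    by (auto intro: closed_INT)
qed

lemma closed_opD:
  assumes "closed T" "\<And>n. (x n, y n) \<in> T" "x \<longlonglongrightarrow> a" "y \<longlonglongrightarrow> b"
  shows "(a, b) \<in> T"
  using closed_sequentially[OF assms(1), of "\<lambda>n. (x n, y n)"] assms tendsto_Pair by blast

section \<open>The free Hamiltonian\<close>

lemma (in projection_measure) P_incseq:
  assumes B: "\<And>n::nat. B n \<in> sets borel" "incseq B"
  shows "(\<lambda>n. P (B n) x) \<longlonglongrightarrow> P (\<Union>n. B n) x"
proof -
  let ?U = "\<Union>n. B n"
  have U: "?U \<in> sets borel"
    using B by auto
  have "(norm (P (B n) x - P ?U x))\<^sup>2 = measure (vec_measure P x) ?U - measure (vec_measure P x) (B n)" for n
  proof -
    have "B n \<inter> ?U = B n"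
      by auto
    then have "cinner (P (B n) x) (P ?U x) = cinner x (P (B n) x)"
      using B U by (simp add: P_sym P_Int)
    then show ?thesis
      unfolding norm_diff_square using B U by (simp add: cinner_P measure_vec_measure)
  qed
  moreover have "(\<lambda>n. measure (vec_measure P x) (B n)) \<longlonglongrightarrow> measure (vec_measure P x) ?U"
    using B by (intro finite_measure.finite_Lim_measure_incseq[OF finite_measure_vec_measure]) auto
  ultimately have "(\<lambda>n. (norm (P (B n) x - P ?U x))\<^sup>2) \<longlonglongrightarrow> 0"
    by (auto intro!: tendsto_eq_intros)
  then have "(\<lambda>n. P (B n) x - P ?U x) \<longlonglongrightarrow> 0"
    using tendsto_real_sqrt[of _ 0] by (fastforce simp: tendsto_norm_zero_iff)
  then show ?thesis
    using LIM_zero_iff by blast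
qed

locale free_hamiltonian = projection_measure P for P :: "real set \<Rightarrow> 'a::complex_hilbert \<Rightarrow> 'a" +
  fixes H0 :: "'a oper"
  assumes selfadjoint_H0: "selfadjoint_op H0" and nonneg_H0: "nonneg_op H0"
    and H0_eq: "H0 = fcalc P complex_of_real"
begin

lemma linear_H0: "linear_op H0" and closed_H0: "closed H0"
  using selfadjoint_H0 closed_adj[of H0] unfolding selfadjoint_op_def by auto

lemma H0_symmetric: "(x, y) \<in> H0 \<Longrightarrow> (u, v) \<in> H0 \<Longrightarrow> cinner x v = cinner y u"
  using selfadjoint_H0 unfolding selfadjoint_op_def adj_def by blast

text \<open>On \<open>[- N, - 1 / N]\<close> the operator \<open>H0 + N\<close> has norm at most
  \<open>N - 1 / N\<close>. So the expectation of \<open>H0\<close> at a vector \<open>v\<close> of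
  this spectral subspace is at most \<open>- 1 / N\<close> times the squared norm of
  \<open>v\<close>, against nonnegativity unless \<open>v = 0\<close>.\<close>

lemma P_negative: "P {..<0} x = 0"
proof -
  define B where "B n = {- real (Suc n)..- 1 / real (Suc n)}" for n
  have "P (B n) x = 0" for n
  proof -
    define v where "v = P (B n) x"
    define N where "N = real (Suc n)"
    have N: "N \<ge> 1" "B n = {- N..- 1 / N}"
      unfolding N_def B_def by auto
    have B: "B n \<in> sets borel"
      unfolding B_def by simp
    have v: "P (B n) v = v"
      unfolding v_def by (rule P_idem[OF B])
    have bound: "cmod (complex_of_real l) \<le> N" if "l \<in> B n" for l
      using that N by (auto simp: abs_le_iff) (smt (verit) divide_nonneg_nonneg)
    have bb: "bounded_borel (cut (B n) complex_of_real)"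
      using bound by (intro bounded_borel_cutI B) auto
    have bb1: "bounded_borel (cut (B n) (\<lambda>_. complex_of_real N))"
      by (intro bounded_borel_cut bounded_borel_const B)
    let ?T = "bfc (cut (B n) complex_of_real) v"
    have "(v, ?T) \<in> H0"
      unfolding H0_eq by (rule fcalcI[OF _ B bound v]) auto
    then have "0 \<le> Re (cinner v ?T)"
      using nonneg_H0 unfolding nonneg_op_def by auto
    moreover have "norm (bfc (\<lambda>l. cut (B n) complex_of_real l + cut (B n) (\<lambda>_. complex_of_real N) l) v)
        \<le> (N - 1 / N) * norm v"
    proof (rule bfc_bound)
      have "1 / N \<le> 1"
        using N(1) by simp
      then show "0 \<le> N - 1 / N"
        using N(1) by linarith
      fix l
      have "\<bar>l + N\<bar> \<le> N - 1 / N" if "l \<in> B n"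
        using that N by auto
      then show "cmod (cut (B n) complex_of_real l + cut (B n) (\<lambda>_. complex_of_real N) l) \<le> N - 1 / N"
        using \<open>0 \<le> N - 1 / N\<close> by (auto simp: cut_def simp flip: of_real_add)
    qed (intro bounded_borel_add bb bb1)
    moreover have "bfc (cut (B n) (\<lambda>_. complex_of_real N)) v = complex_of_real N *\<^sub>C v"
    proof -
      have "cut (B n) (\<lambda>_. complex_of_real N) = (\<lambda>l. complex_of_real N * cut (B n) (\<lambda>_. 1) l)"
        by (auto simp: cut_def)
      then show ?thesis
        using v by (simp add: bfc_cmult bounded_borel_cut[OF bounded_borel_const] B bfc_indicator)
    qed
    ultimately have "norm (?T + complex_of_real N *\<^sub>C v) \<le> (N - 1 / N) * norm v"
      by (simp add: bfc_add bb bb1)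
    then have "norm v * norm (?T + complex_of_real N *\<^sub>C v) \<le> norm v * ((N - 1 / N) * norm v)"
      by (rule mult_left_mono) simp
    moreover have "Re (cinner v (?T + complex_of_real N *\<^sub>C v)) \<le> norm v * norm (?T + complex_of_real N *\<^sub>C v)"
      using complex_Re_le_cmod Cauchy_Schwarz order_trans by blast
    moreover have "Re (cinner v (?T + complex_of_real N *\<^sub>C v)) = Re (cinner v ?T) + N * (norm v)\<^sup>2"
      by (simp add: cinner_add_right cinner_scaleC_right cinner_norm del: of_real_power)
    ultimately have "(norm v)\<^sup>2 / N \<le> 0"
      using \<open>0 \<le> Re (cinner v ?T)\<close> by (simp add: algebra_simps power2_eq_square)
    then show ?thesis
      using N unfolding v_def[symmetric] by (simp add: divide_le_0_iff)
  qed
  moreover have "(\<lambda>n. P (B n) x) \<longlonglongrightarrow> P (\<Union>n. B n) x"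
  proof (rule P_incseq)
    show "incseq B"
      unfolding B_def incseq_Suc_iff by (auto simp: field_simps)
  qed (simp add: B_def)
  moreover have "(\<Union>n. B n) = {..<0}"
  proof (intro equalityI subsetI)
    fix l :: real assume "l \<in> {..<0}"
    then have l: "- l > 0" by simp
    obtain n1 where n1: "inverse (real (Suc n1)) < - l"
      using reals_Archimedean[OF l] by blast
    obtain n2 where n2: "- l < real n2"
      using reals_Archimedean2 by blast
    have "inverse (real (Suc (max n1 n2))) \<le> inverse (real (Suc n1))"
      by (intro le_imp_inverse_le) auto
    then have "l \<in> B (max n1 n2)"
      using n1 n2 unfolding B_def by (auto simp: inverse_eq_divide)
    then show "l \<in> (\<Union>n. B n)"
      by blast
  qed (auto simp: B_def, smt (verit) divide_pos_pos of_nat_0_le_iff)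
  ultimately show ?thesis
    by (simp add: LIMSEQ_const_iff)
qed

lemma P_nonneg [simp]: "P {0..} x = x"
proof -
  have "P ({..<0} \<union> {0..}) x = P {..<0} x + P {0..} x"
    by (rule P_Un) auto
  moreover have "{..<0} \<union> {0..} = (UNIV :: real set)"
    by auto
  ultimately show ?thesis
    by (simp add: P_negative)
qed

section \<open>Spectral subspaces of bounded energy and their dense union\<close>

abbreviation pr :: "real \<Rightarrow> 'a \<Rightarrow> 'a" where "pr e \<equiv> P {0..e}"

abbreviation D :: "'a set" where "D \<equiv> D_fin P"

lemma V_iff: "x \<in> V P e \<longleftrightarrow> pr e x = x"
  unfolding V_def by (metis P_idem atLeastAtMost_borel rangeE rangeI)

lemma pr_V [simp]: "pr e x \<in> V P e"
  unfolding V_def by blast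

lemma clinear_pr: "clinear (pr e)"
  by (rule clinear_P) simp

lemma bounded_linear_pr: "bounded_linear (pr e)"
  by (rule bounded_linear_P) simp

lemma norm_pr_le: "norm (pr e x) \<le> norm x"
  by (rule norm_P_le) simp

lemma pr_sym: "cinner (pr e x) y = cinner x (pr e y)"
  by (rule P_sym) simp

lemma V_subspace: "csubspace (V P e)"
  unfolding complex_vector.subspace_def
  by (auto simp: V_iff clinear_extra[OF clinear_pr] clinear_onD[OF clinear_pr])

lemma V_mono: "d \<le> e \<Longrightarrow> x \<in> V P d \<Longrightarrow> x \<in> V P e"
  unfolding V_iff by (metis Icc_subset_Ici_iff Int_absorb1 P_Int atLeastAtMost_borel atLeastatMost_subset_iff order_refl)

lemma D_iff: "x \<in> D \<longleftrightarrow> (\<exists>e\<ge>0. x \<in> V P e)"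
  unfolding D_fin_def by auto

lemma V_D: "x \<in> V P e \<Longrightarrow> x \<in> D"
  unfolding D_iff by (meson V_mono max.cobounded1 max.cobounded2)

lemma pr_D [simp]: "pr e x \<in> D"
  using V_D pr_V by blast

lemma D_common:
  assumes "x \<in> D" "y \<in> D"
  obtains e where "0 \<le> e" "x \<in> V P e" "y \<in> V P e"
  using assms unfolding D_iff by (metis V_mono linorder_linear)

lemma D_subspace: "csubspace D"
  unfolding complex_vector.subspace_def
proof (intro conjI allI impI ballI)
  show "0 \<in> D"
    using V_D complex_vector.subspace_0[OF V_subspace] by blast
  show "x + y \<in> D" if "x \<in> D" "y \<in> D" for x y
    using that by (meson D_common V_D complex_vector.subspace_add[OF V_subspace])
  show "c *\<^sub>C x \<in> D" if "x \<in> D" for c x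
    using that unfolding D_iff by (meson complex_vector.subspace_scale[OF V_subspace])
qed

lemmas D_closure [simp] = complex_vector.subspace_0[OF D_subspace] complex_vector.subspace_add[OF D_subspace]
  complex_vector.subspace_scale[OF D_subspace] complex_vector.subspace_diff[OF D_subspace]
  complex_vector.subspace_neg[OF D_subspace]

lemmas V_closure [simp] = complex_vector.subspace_0[OF V_subspace] complex_vector.subspace_add[OF V_subspace]
  complex_vector.subspace_scale[OF V_subspace] complex_vector.subspace_diff[OF V_subspace]
  complex_vector.subspace_neg[OF V_subspace]

lemma pr_tendsto: "(\<lambda>n. pr (real n) x) \<longlonglongrightarrow> x"
proof -
  have "(\<lambda>n. pr (real n) x) \<longlonglongrightarrow> P (\<Union>n. {0..real n}) x"
    by (rule P_incseq) (auto simp: incseq_def)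
  moreover have "(\<Union>n. {0..real n}) = {0..}"
    using real_arch_simple by auto
  ultimately show ?thesis
    by simp
qed

lemma closure_D: "closure D = UNIV"
  using pr_tendsto pr_D closure_sequential by (metis UNIV_eq_I)

subsection \<open>Functions of the free Hamiltonian on the finite-energy vectors\<close>

text \<open>Continuity of \<open>f\<close> is all that is asked later: it bounds \<open>f\<close> on
  \<open>{0..e}\<close>, so that \<open>f\<close> acts boundedly on \<open>V P e\<close> however
  fast it grows at infinity.\<close>

definition fD :: "(real \<Rightarrow> complex) \<Rightarrow> 'a \<Rightarrow> 'a" where
  "fD f x = op_app (fcalc P f) x"

lemma continuous_bound:
  assumes "continuous_on UNIV (f :: real \<Rightarrow> complex)"
  obtains M where "\<And>l. l \<in> {0..e} \<Longrightarrow> cmod (f l) \<le> M"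
proof -
  have "compact (f ` {0..e})"
    by (intro compact_continuous_image continuous_on_subset[OF assms]) auto
  then show ?thesis
    using that compact_imp_bounded bounded_iff by (metis imageI)
qed

lemma borel_continuous: "continuous_on UNIV (f :: real \<Rightarrow> complex) \<Longrightarrow> f \<in> borel_measurable borel"
  by (rule borel_measurable_continuous_onI)

lemma bounded_borel_cut_continuous:
  assumes "continuous_on UNIV f"
  shows "bounded_borel (cut {0..e} f)"
  by (metis assms atLeastAtMost_borel borel_continuous bounded_borel_cutI continuous_bound)

lemma fcalc_V:
  assumes "continuous_on UNIV f" "x \<in> V P e"
  shows "(x, bfc (cut {0..e} f) x) \<in> fcalc P f"
  using assms continuous_bound[OF assms(1), of e] V_iff
  by (metis (no_types, lifting) atLeastAtMost_borel borel_continuous fcalcI)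

lemma single_valued_fcalc:
  assumes "continuous_on UNIV f"
  shows "single_valued (fcalc P f)"
proof (rule single_valuedI)
  fix x y z assume "(x, y) \<in> fcalc P f" "(x, z) \<in> fcalc P f"
  then have "\<forall>u\<in>fcalc_dom P f. cinner u y = cinner u z"
    unfolding fcalc_def by simp
  moreover have "u \<in> fcalc_dom P f" if "u \<in> D" for u
    using that fcalc_V[OF assms] unfolding D_iff fcalc_def by blast
  ultimately show "y = z"
    by (intro cinner_eq_dense[OF closure_D]) auto
qed

lemma fD_eq:
  assumes "continuous_on UNIV f" "x \<in> V P e"
  shows "fD f x = bfc (cut {0..e} f) x"
  unfolding fD_def by (rule op_app_eq[OF single_valued_fcalc fcalc_V]) fact+

lemma fD_mem: "continuous_on UNIV f \<Longrightarrow> x \<in> D \<Longrightarrow> (x, fD f x) \<in> fcalc P f"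
  unfolding D_iff using fD_eq fcalc_V by metis

lemma fD_V [simp]:
  assumes "continuous_on UNIV f" "x \<in> V P e"
  shows "fD f x \<in> V P e"
proof -
  have "cut {0..e} (cut {0..e} f) = cut {0..e} f"
    by (auto simp: cut_def)
  then show ?thesis
    unfolding V_iff fD_eq[OF assms] by (simp add: bfc_P bounded_borel_cut_continuous assms)
qed

lemma fD_D [simp]: "continuous_on UNIV f \<Longrightarrow> x \<in> D \<Longrightarrow> fD f x \<in> D"
  unfolding D_iff using fD_V by blast

lemma clinear_on_fD: "continuous_on UNIV f \<Longrightarrow> clinear_on D (fD f)"
  unfolding clinear_on_def
proof (intro conjI ballI allI)
  assume f: "continuous_on UNIV f"
  note bfc = clinear_onD[OF clinear_bfc[OF bounded_borel_cut_continuous[OF f]]]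
  fix x assume x: "x \<in> D"
  show "fD f (x + y) = fD f x + fD f y" if y: "y \<in> D" for y
  proof -
    obtain e where "x \<in> V P e" "y \<in> V P e"
      by (rule D_common[OF x y])
    then show ?thesis
      by (simp add: fD_eq[OF f, of _ e] bfc)
  qed
  show "fD f (c *\<^sub>C x) = c *\<^sub>C fD f x" for c
  proof -
    obtain e where "x \<in> V P e"
      using x unfolding D_iff by blast
    then show ?thesis
      by (simp add: fD_eq[OF f, of _ e] bfc)
  qed
qed

lemma fD_mult:
  assumes "continuous_on UNIV f" "continuous_on UNIV g" "x \<in> D"
  shows "fD f (fD g x) = fD (\<lambda>l. f l * g l) x"
proof -
  obtain e where e: "x \<in> V P e"
    using assms(3) unfolding D_iff by blast
  have fg: "continuous_on UNIV (\<lambda>l. f l * g l)"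
    by (intro continuous_intros assms)
  have cut: "cut {0..e} (\<lambda>l. f l * g l) = (\<lambda>l. cut {0..e} f l * cut {0..e} g l)"
    by (auto simp: cut_def)
  have "fD f (fD g x) = bfc (cut {0..e} f) (fD g x)"
    by (rule fD_eq[OF assms(1) fD_V[OF assms(2) e]])
  then show ?thesis
    unfolding fD_eq[OF assms(2) e] fD_eq[OF fg e] cut
    by (simp add: bfc_mult bounded_borel_cut_continuous assms)
qed

lemma fD_commute:
  "continuous_on UNIV f \<Longrightarrow> continuous_on UNIV g \<Longrightarrow> x \<in> D \<Longrightarrow> fD f (fD g x) = fD g (fD f x)"
  by (simp add: fD_mult mult.commute)

lemma fD_add:
  assumes "continuous_on UNIV f" "continuous_on UNIV g" "x \<in> D"
  shows "fD (\<lambda>l. f l + g l) x = fD f x + fD g x"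
proof -
  obtain e where e: "x \<in> V P e"
    using assms(3) unfolding D_iff by blast
  have "cut {0..e} (\<lambda>l. f l + g l) = (\<lambda>l. cut {0..e} f l + cut {0..e} g l)"
    by (auto simp: cut_def)
  moreover have "continuous_on UNIV (\<lambda>l. f l + g l)"
    by (intro continuous_intros assms)
  ultimately show ?thesis
    using e assms by (simp add: fD_eq[of _ _ e] bfc_add bounded_borel_cut_continuous)
qed

lemma fD_const:
  assumes "x \<in> D"
  shows "fD (\<lambda>l. c) x = c *\<^sub>C x"
proof -
  obtain e where e: "x \<in> V P e"
    using assms unfolding D_iff by blast
  have "cut {0..e} (\<lambda>l. c) = (\<lambda>l. c * cut {0..e} (\<lambda>_. 1) l)"
    by (auto simp: cut_def)
  then show ?thesis
    using e by (simp add: fD_eq[of _ _ e] bfc_cmult bounded_borel_cut bounded_borel_const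
        bfc_indicator V_iff)
qed

lemma fD_adjoint:
  assumes "continuous_on UNIV f" "x \<in> D" "y \<in> D"
  shows "cinner (fD f x) y = cinner x (fD (\<lambda>l. cnj (f l)) y)"
proof -
  obtain e where e: "x \<in> V P e" "y \<in> V P e"
    using D_common assms by blast
  have "cut {0..e} (\<lambda>l. cnj (f l)) = (\<lambda>l. cnj (cut {0..e} f l))"
    by (auto simp: cut_def)
  moreover have "continuous_on UNIV (\<lambda>l. cnj (f l))"
    by (intro continuous_intros assms)
  ultimately show ?thesis
    using e assms by (simp add: fD_eq[of _ _ e] bfc_adjoint bounded_borel_cut_continuous)
qed

lemma fD_bound:
  assumes "continuous_on UNIV f" "x \<in> V P e" "\<And>l. l \<in> {0..e} \<Longrightarrow> cmod (f l) \<le> M" "0 \<le> M"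
  shows "norm (fD f x) \<le> M * norm x"
  unfolding fD_eq[OF assms(1,2)]
  by (rule bfc_bound) (use assms bounded_borel_cut_continuous in \<open>auto simp: cut_def\<close>)

lemma fcalc_D_pairing:
  assumes "continuous_on UNIV f" "(z, y) \<in> fcalc P f" "x \<in> D"
  shows "cinner x y = cinner (fD (\<lambda>l. cnj (f l)) x) z"
proof -
  obtain e where e: "x \<in> V P e"
    using assms(3) unfolding D_iff by blast
  obtain M where M: "\<And>l. l \<in> {0..e} \<Longrightarrow> cmod (f l) \<le> M"
    using continuous_bound[OF assms(1)] by blast
  have "continuous_on UNIV (\<lambda>l. cnj (f l))"
    by (intro continuous_intros assms)
  then show ?thesis
    using fcalc_pairing[OF borel_continuous[OF assms(1)], of "{0..e}" M x z y] M assms(2) e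
    by (simp add: fD_eq[of _ _ e] V_iff)
qed

section \<open>The free Hamiltonian and its complex exponentials on finite-energy vectors\<close>

definition h :: "'a \<Rightarrow> 'a" where "h = fD complex_of_real"

definition ex :: "complex \<Rightarrow> 'a \<Rightarrow> 'a" where "ex z = fD (\<lambda>l. exp (\<i> * z * complex_of_real l))"

lemma continuous_id [simp]: "continuous_on UNIV complex_of_real"
  by (intro continuous_intros)

lemma continuous_exp [simp]: "continuous_on UNIV (\<lambda>l. exp (\<i> * z * complex_of_real l))"
  by (intro continuous_intros)

lemma h_V [simp]: "x \<in> V P e \<Longrightarrow> h x \<in> V P e" and h_D [simp]: "x \<in> D \<Longrightarrow> h x \<in> D"
  unfolding h_def by simp_all

lemma ex_V [simp]: "x \<in> V P e \<Longrightarrow> ex z x \<in> V P e" and ex_D [simp]: "x \<in> D \<Longrightarrow> ex z x \<in> D"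
  unfolding ex_def by simp_all

lemma clinear_on_h: "clinear_on D h" and clinear_on_ex: "clinear_on D (ex z)"
  unfolding h_def ex_def by (simp_all add: clinear_on_fD)

lemma h_mem: "x \<in> D \<Longrightarrow> (x, h x) \<in> H0"
  unfolding H0_eq h_def by (simp add: fD_mem)

lemma op_app_H0: "x \<in> D \<Longrightarrow> op_app H0 x = h x"
  by (rule op_app_eq[OF linear_opD(1)[OF linear_H0] h_mem])

lemma h_sym: "x \<in> D \<Longrightarrow> y \<in> D \<Longrightarrow> cinner (h x) y = cinner x (h y)"
  using H0_symmetric h_mem by metis

lemma h_bound: "0 \<le> e \<Longrightarrow> x \<in> V P e \<Longrightarrow> norm (h x) \<le> e * norm x"
  unfolding h_def by (rule fD_bound) auto

lemma h_ex: "x \<in> D \<Longrightarrow> h (ex z x) = ex z (h x)"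
  unfolding h_def ex_def by (rule fD_commute) simp_all

lemma ex_ex: "x \<in> D \<Longrightarrow> ex z (ex w x) = ex (z + w) x"
  unfolding ex_def by (simp add: fD_mult distrib_left distrib_right flip: exp_add)

lemma ex_0 [simp]: "x \<in> D \<Longrightarrow> ex 0 x = x"
  unfolding ex_def by (simp add: fD_const)

lemma ex_minus_ex [simp]: "x \<in> D \<Longrightarrow> ex (- z) (ex z x) = x" "x \<in> D \<Longrightarrow> ex z (ex (- z) x) = x"
  by (simp_all add: ex_ex)

lemma cnj_exp: "(\<lambda>l. cnj (exp (\<i> * z * complex_of_real l))) = (\<lambda>l. exp (\<i> * (- cnj z) * complex_of_real l))"
proof
  fix l
  have "cnj (\<i> * z * complex_of_real l) = \<i> * (- cnj z) * complex_of_real l"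
    by simp
  then show "cnj (exp (\<i> * z * complex_of_real l)) = exp (\<i> * (- cnj z) * complex_of_real l)"
    by (metis exp_cnj)
qed

lemma ex_adjoint: "x \<in> D \<Longrightarrow> y \<in> D \<Longrightarrow> cinner (ex z x) y = cinner x (ex (- cnj z) y)"
  unfolding ex_def fD_adjoint[OF continuous_exp] cnj_exp ..

lemma ex_bound:
  assumes "0 \<le> e" "x \<in> V P e"
  shows "norm (ex z x) \<le> exp (cmod z * e) * norm x"
  unfolding ex_def
proof (rule fD_bound)
  fix l assume "l \<in> {0..e}"
  then have "- (Im z * l) \<le> cmod z * e"
    using abs_Im_le_cmod[of z] mult_mono[of "\<bar>Im z\<bar>" "cmod z" l e]
    by (smt (verit) atLeastAtMost_iff mult_minus_left mult_right_mono norm_ge_zero)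
  then show "cmod (exp (\<i> * z * complex_of_real l)) \<le> exp (cmod z * e)"
    by simp
qed (use assms in auto)

lemma ex_cderiv:
  assumes "x \<in> D"
  shows "has_cderiv (\<lambda>z. ex z x) (\<i> *\<^sub>C h (ex z x)) z"
proof -
  obtain e where e: "0 \<le> e" "x \<in> V P e"
    using assms unfolding D_iff by blast
  \<comment> \<open>The remainder of the exponential after its linear term in \<open>k\<close>; it
    is quadratic in \<open>k\<close>, uniformly for \<open>l\<close> in
    \<open>{0..e}\<close>.\<close>
  let ?g = "\<lambda>k l. exp (\<i> * z * complex_of_real l) * (exp (\<i> * k * complex_of_real l) - 1 - \<i> * k * complex_of_real l)"
  show ?thesis
  proof (rule has_cderivI_quadratic)
    fix k :: complex assume k: "norm k \<le> 1"
    have [simp]: "continuous_on UNIV (\<lambda>l. \<i> * k * complex_of_real l)"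
      "continuous_on UNIV (\<lambda>l. c * complex_of_real l)" "continuous_on UNIV (?g k)" for c
      by (intro continuous_intros)+
    have "k *\<^sub>C (\<i> *\<^sub>C h (ex z x)) = fD (\<lambda>l. \<i> * k * complex_of_real l * exp (\<i> * z * complex_of_real l)) x"
    proof -
      have "k *\<^sub>C (\<i> *\<^sub>C h (ex z x)) = (\<i> * k) *\<^sub>C fD (\<lambda>l. complex_of_real l * exp (\<i> * z * complex_of_real l)) x"
        unfolding h_def ex_def fD_mult[OF continuous_id continuous_exp assms] scaleC_scaleC
          mult.commute[of k \<i>] ..
      also have "\<dots> = fD (\<lambda>l. \<i> * k) (fD (\<lambda>l. complex_of_real l * exp (\<i> * z * complex_of_real l)) x)"
        using assms by (intro fD_const[symmetric] fD_D) (auto intro!: continuous_intros)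
      also have "\<dots> = fD (\<lambda>l. (\<i> * k) * (complex_of_real l * exp (\<i> * z * complex_of_real l))) x"
        using assms by (intro fD_mult) (auto intro!: continuous_intros)
      finally show ?thesis
        by (simp add: mult.assoc)
    qed
    moreover have "fD (?g k) x + (fD (\<lambda>l. \<i> * k * complex_of_real l * exp (\<i> * z * complex_of_real l)) x + ex z x) =
        ex (z + k) x"
    proof -
      have "(\<lambda>l. ?g k l + (\<i> * k * complex_of_real l * exp (\<i> * z * complex_of_real l) + exp (\<i> * z * complex_of_real l))) =
          (\<lambda>l. exp (\<i> * (z + k) * complex_of_real l))"
        by (simp add: algebra_simps exp_add)
      then show ?thesis
        using assms unfolding ex_def
        by (subst fD_add[symmetric] | auto intro!: continuous_intros)+
    qed
    ultimately have "ex (z + k) x - ex z x - k *\<^sub>C (\<i> *\<^sub>C h (ex z x)) = fD (?g k) x"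
      by (simp add: algebra_simps)
    also have "norm \<dots> \<le> (exp (cmod z * e) * (exp e * (cmod k * e)\<^sup>2)) * norm x"
    proof (rule fD_bound[OF _ e(2)])
      fix l assume l: "l \<in> {0..e}"
      have "- (Im z * l) \<le> cmod z * e"
        using abs_Im_le_cmod[of z] l mult_mono[of "\<bar>Im z\<bar>" "cmod z" l e]
        by (smt (verit) atLeastAtMost_iff mult_minus_left mult_right_mono norm_ge_zero)
      then have 1: "cmod (exp (\<i> * z * complex_of_real l)) \<le> exp (cmod z * e)"
        by simp
      define w where "w = \<i> * k * complex_of_real l"
      have w: "cmod w \<le> cmod k * e"
        using l unfolding w_def by (simp add: norm_mult mult_left_mono)
      have "cmod (exp w - 1 - w) \<le> exp \<bar>Re w\<bar> * (cmod w)\<^sup>2"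
        using Taylor_exp[of w 1] by (simp add: power2_eq_square algebra_simps)
      also have "\<dots> \<le> exp e * (cmod k * e)\<^sup>2"
      proof (intro mult_mono power_mono)
        have "cmod k * e \<le> 1 * e"
          using k e(1) by (intro mult_right_mono) auto
        then show "exp \<bar>Re w\<bar> \<le> exp e"
          using w abs_Re_le_cmod[of w] by simp
      qed (use w in auto)
      finally show "cmod (?g k l) \<le> exp (cmod z * e) * (exp e * (cmod k * e)\<^sup>2)"
        using 1 unfolding w_def norm_mult by (intro mult_mono) auto
    qed simp_all
    finally show "norm (ex (z + k) x - ex z x - k *\<^sub>C (\<i> *\<^sub>C h (ex z x))) \<le>
        (exp (cmod z * e) * exp e * e\<^sup>2 * norm x) * (norm k)\<^sup>2"
      by (simp add: power_mult_distrib mult_ac)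
  qed
qed

text \<open>The exponential as a bounded operator on the whole space, for
  \<open>Im z \<ge> 0\<close>. It serves to handle \<open>evol_W\<close>, where the closure of
  \<open>evol_U\<close> produces vectors that need not lie in \<open>D\<close>.\<close>

definition exb :: "complex \<Rightarrow> 'a \<Rightarrow> 'a" where
  "exb z = bfc (cut {0..} (\<lambda>l. exp (\<i> * z * complex_of_real l)))"

context
  fixes z :: complex
  assumes z: "Im z \<ge> 0"
begin

lemma exp_le_1: "l \<in> {0..} \<Longrightarrow> cmod (exp (\<i> * z * complex_of_real l)) \<le> 1"
  using z by simp

lemma bounded_borel_exb: "bounded_borel (cut {0..} (\<lambda>l. exp (\<i> * z * complex_of_real l)))"
  by (rule bounded_borel_cutI[OF borel_continuous _ exp_le_1]) auto

lemma exp_op_eq_exb: "exp_op P z = {(x, exb z x) |x. True}"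
proof -
  have "(x, exb z x) \<in> exp_op P z" for x
    unfolding exp_op_def exb_def
    by (rule fcalcI[OF borel_continuous _ exp_le_1]) auto
  then show ?thesis
    using single_valued_fcalc[OF continuous_exp[of z]] unfolding exp_op_def[symmetric]
    by (auto dest: single_valuedD)
qed

lemma exb_eq_ex: "x \<in> D \<Longrightarrow> exb z x = ex z x"
  using fD_mem[OF continuous_exp[of z]] exp_op_eq_exb unfolding exp_op_def ex_def by auto

lemma bounded_linear_exb: "bounded_linear (exb z)"
  unfolding exb_def by (rule bounded_linear_bfc[OF bounded_borel_exb])

end

lemma H0_pr:
  assumes "(x, y) \<in> H0"
  shows "h (pr e x) = pr e y"
proof (rule cinner_ext)
  fix u
  have "cinner u (pr e y) = cinner (pr e u) y"
    by (simp add: pr_sym)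
  also have "\<dots> = cinner (h (pr e u)) x"
    using fcalc_D_pairing[of complex_of_real x y "pr e u"] assms unfolding H0_eq h_def by simp
  also have "\<dots> = cinner (pr e (h (pr e u))) x"
    using h_V[OF pr_V] V_iff by metis
  also have "\<dots> = cinner (pr e u) (h (pr e x))"
    by (simp add: pr_sym h_sym)
  also have "\<dots> = cinner u (h (pr e x))"
    using h_V[OF pr_V] V_iff pr_sym by metis
  finally show "cinner u (h (pr e x)) = cinner u (pr e y)" by simp
qed

subsection \<open>Operators of class \<open>C\<^sub>0\<close> on the finite-energy vectors\<close>

text \<open>What is retained of \<open>class_C0\<close>: the energy rises by at most
  \<open>b\<close>, and the norm grows like the square root of the energy. The second property leads
  to the decay \<open>1 / sqrt (n!)\<close> of the Dyson terms.\<close>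

definition tame :: "real \<Rightarrow> real \<Rightarrow> ('a \<Rightarrow> 'a) \<Rightarrow> bool" where
  "tame b c B \<longleftrightarrow> clinear_on D B \<and> 0 \<le> b \<and> 0 \<le> c \<and>
     (\<forall>e\<ge>0. \<forall>x\<in>V P e. B x \<in> V P (e + b) \<and> norm (B x) \<le> c * sqrt (e + 1) * norm x)"

lemma tame_linear: "tame b c B \<Longrightarrow> clinear_on D B"
  and tame_V: "tame b c B \<Longrightarrow> 0 \<le> e \<Longrightarrow> x \<in> V P e \<Longrightarrow> B x \<in> V P (e + b)"
  and tame_bound: "tame b c B \<Longrightarrow> 0 \<le> e \<Longrightarrow> x \<in> V P e \<Longrightarrow> norm (B x) \<le> c * sqrt (e + 1) * norm x"
  and tame_nonneg: "tame b c B \<Longrightarrow> 0 \<le> b" "tame b c B \<Longrightarrow> 0 \<le> c"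
  unfolding tame_def by blast+

lemma tame_D: "tame b c B \<Longrightarrow> x \<in> D \<Longrightarrow> B x \<in> D"
  by (metis D_iff V_D tame_V)

lemma tame_mono:
  assumes "tame b c B" "b \<le> b'" "c \<le> c'"
  shows "tame b' c' B"
  unfolding tame_def
proof (intro conjI allI impI ballI)
  fix e x assume e: "0 \<le> (e::real)" "x \<in> V P e"
  show "B x \<in> V P (e + b')"
    using V_mono[OF _ tame_V[OF assms(1) e]] assms(2) by simp
  have "c * sqrt (e + 1) * norm x \<le> c' * sqrt (e + 1) * norm x"
    using assms(3) e by (intro mult_right_mono) auto
  then show "norm (B x) \<le> c' * sqrt (e + 1) * norm x"
    using tame_bound[OF assms(1) e] by simp
qed (use assms tame_nonneg[OF assms(1)] tame_linear in auto)

lemma tame_scaleC: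
  assumes "tame b c B"
  shows "tame b (cmod k * c) (\<lambda>x. k *\<^sub>C B x)"
  unfolding tame_def
proof (intro conjI allI impI ballI)
  show "clinear_on D (\<lambda>x. k *\<^sub>C B x)"
    using tame_linear[OF assms]
    unfolding clinear_on_def by (auto simp: scaleC_add_right scaleC_scaleC mult.commute)
  fix e x assume e: "0 \<le> (e::real)" "x \<in> V P e"
  show "k *\<^sub>C B x \<in> V P (e + b)"
    using tame_V[OF assms e] by simp
  show "norm (k *\<^sub>C B x) \<le> cmod k * c * sqrt (e + 1) * norm x"
    unfolding norm_scaleC using mult_left_mono[OF tame_bound[OF assms e], of "cmod k"]
    by (simp add: mult.assoc)
qed (use tame_nonneg[OF assms] in auto)

lemma sqrt_op_D:
  assumes "0 \<le> e" "x \<in> V P e"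
  shows "x \<in> Domain (sqrt_op P)" "norm (op_app (sqrt_op P) x) \<le> sqrt e * norm x"
    "(norm (op_app (sqrt_op P) x))\<^sup>2 = Re (cinner x (h x))"
proof -
  have cont: "continuous_on UNIV (\<lambda>l. complex_of_real (sqrt l))"
    by (intro continuous_intros)
  have x: "x \<in> D"
    using assms(2) by (rule V_D)
  show "x \<in> Domain (sqrt_op P)"
    using fD_mem[OF cont x] unfolding sqrt_op_def by blast
  show "norm (op_app (sqrt_op P) x) \<le> sqrt e * norm x"
    unfolding sqrt_op_def fD_def[symmetric]
    by (rule fD_bound[OF cont assms(2)]) (use assms in auto)
  let ?s = "fD (\<lambda>l. complex_of_real (sqrt l))"
  have "cinner (?s x) (?s x) = cinner x (?s (?s x))"
    using x cont by (simp add: fD_adjoint)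
  also have "?s (?s x) = h x"
  proof -
    \<comment> \<open>The square root squares to the identity only on the half-line, so the two
      functions are compared after truncation.\<close>
    have "cut {0..e} (\<lambda>l. complex_of_real (sqrt l) * complex_of_real (sqrt l)) = cut {0..e} complex_of_real"
      by (auto simp: cut_def simp flip: of_real_mult)
    moreover have "continuous_on UNIV (\<lambda>l. complex_of_real (sqrt l) * complex_of_real (sqrt l))"
      by (intro continuous_intros)
    ultimately show ?thesis
      unfolding h_def fD_mult[OF cont cont x]
      by (simp only: fD_eq[OF _ assms(2)] continuous_id)
  qed
  finally show "(norm (op_app (sqrt_op P) x))\<^sup>2 = Re (cinner x (h x))"
    unfolding sqrt_op_def fD_def[symmetric] by (metis Re_cinner_self)
qed

lemma op_bounded_by_sqrt:
  assumes "op_bounded_by A (sqrt_op P)"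
  obtains a b where "0 \<le> a" "0 \<le> b"
    "\<And>x. x \<in> D \<Longrightarrow> norm (op_app A x) \<le> a * norm (op_app (sqrt_op P) x) + b * norm x"
  using assms sqrt_op_D(1) unfolding op_bounded_by_def D_iff by metis

lemma class_C0_tame:
  assumes "A \<in> class_C0 P"
  obtains b c where "tame b c (op_app A)"
proof -
  have lin: "linear_op A"
    using assms unfolding class_C0_def by blast
  obtain b where b: "0 \<le> b" "\<And>e. 0 \<le> e \<Longrightarrow> maps_into A (V P e) (V P (e + b))"
    using assms unfolding class_C0_def by blast
  have "op_bounded_by A (sqrt_op P)"
    using assms unfolding class_C0_def by blast
  then obtain a a' where a: "0 \<le> a" "0 \<le> a'"
    "\<And>x. x \<in> D \<Longrightarrow> norm (op_app A x) \<le> a * norm (op_app (sqrt_op P) x) + a' * norm x"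
    by (rule op_bounded_by_sqrt) blast
  have "D \<subseteq> Domain A"
    using b(2) unfolding maps_into_def by (force simp: D_iff)
  then have "clinear_on D (op_app A)"
    using lin by (rule clinear_on_op_app[rotated])
  moreover have "norm (op_app A x) \<le> (a + a') * sqrt (e + 1) * norm x" if e: "0 \<le> e" "x \<in> V P e" for e x
  proof -
    have "norm (op_app A x) \<le> a * (sqrt e * norm x) + a' * norm x"
      using a(3)[OF V_D[OF e(2)]] mult_left_mono[OF sqrt_op_D(2)[OF e] a(1)] by simp
    also have "\<dots> \<le> a * (sqrt (e + 1) * norm x) + a' * (sqrt (e + 1) * norm x)"
      using e(1) a(1,2) mult_right_mono[of 1 "sqrt (e + 1)" "norm x"]
      by (intro add_mono mult_left_mono mult_right_mono) auto
    finally show ?thesis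
      by (simp add: algebra_simps)
  qed
  ultimately have "tame b (a + a') (op_app A)"
    using a b unfolding tame_def maps_into_def by auto
  then show ?thesis
    by (rule that)
qed

lemma class_C0_mem:
  assumes "A \<in> class_C0 P" "x \<in> D"
  shows "(x, op_app A x) \<in> A"
proof -
  have "x \<in> Domain A" "single_valued A"
    using assms unfolding class_C0_def maps_into_def D_iff by (auto dest: linear_opD)
  then show ?thesis
    by (rule op_app_mem[rotated])
qed

lemma class_C0_adj_D:
  assumes "A \<in> class_C0 P" "x \<in> D"
  obtains y where "(x, y) \<in> adj A" "y \<in> D"
proof -
  obtain e b where e: "0 \<le> e" "x \<in> V P e" "0 \<le> b" "maps_into (adj A) (V P e) (V P (e + b))"
    using assms unfolding class_C0_def D_iff by blast
  have "closure (Domain A) = UNIV"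
    using assms unfolding class_C0_def densely_defined_def by blast
  then have sv: "single_valued (adj A)"
    by (rule single_valued_adj)
  have "x \<in> Domain (adj A)" and D: "op_app (adj A) x \<in> V P (e + b)"
    using e(2,4) unfolding maps_into_def by auto
  then have "(x, op_app (adj A) x) \<in> adj A"
    by (intro op_app_mem sv)
  then show ?thesis
    using V_D[OF D] by (rule that)
qed

text \<open>Since \<open>adj A\<close> maps \<open>D\<close> into \<open>D\<close>, pairing with
  \<open>u\<close> gives a closed condition on graphs. It survives the closure in
  \<open>at_time\<close>, and density of \<open>D\<close> then yields closability.\<close>

lemma closure_at_time_pairing:
  assumes A: "A \<in> class_C0 P" and u: "u \<in> D"
  obtains w where "w \<in> D" "\<And>x y. (x, y) \<in> at_time P A z \<Longrightarrow> cinner u y = cinner w x"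
proof -
  obtain v where v: "(ex (- cnj z) u, v) \<in> adj A" "v \<in> D"
    using class_C0_adj_D[OF A ex_D[OF u]] by blast
  have "cinner u y = cinner (ex (cnj z) v) x" if xy: "(x, y) \<in> op_prod [exp_op P z, A, exp_op P (- z)]" for x y
  proof -
    obtain x1 x2 where x: "(x, x1) \<in> exp_op P (- z)" "(x1, x2) \<in> A" "(x2, y) \<in> exp_op P z"
      using xy unfolding op_prod_def op_mult_def by auto
    have "cinner u y = cinner (ex (- cnj z) u) x2"
      using fcalc_D_pairing[OF continuous_exp x(3)[unfolded exp_op_def] u] unfolding cnj_exp ex_def .
    also have "\<dots> = cinner v x1"
      using v(1) x(2) unfolding adj_def by blast
    also have "\<dots> = cinner (ex (cnj z) v) x"
      using fcalc_D_pairing[OF continuous_exp x(1)[unfolded exp_op_def] v(2)]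
      unfolding cnj_exp ex_def by simp
    finally show ?thesis .
  qed
  then have "op_prod [exp_op P z, A, exp_op P (- z)] \<subseteq> {p. cinner u (snd p) = cinner (ex (cnj z) v) (fst p)}"
    by auto
  moreover have "closed {p. cinner u (snd p) = cinner (ex (cnj z) v) (fst p)}"
    by (intro closed_Collect_eq continuous_intros)
  ultimately have "at_time P A z \<subseteq> {p. cinner u (snd p) = cinner (ex (cnj z) v) (fst p)}"
    unfolding at_time_def by (rule closure_minimal)
  then show ?thesis
    by (intro that[OF ex_D[OF v(2)]]) auto
qed

lemma single_valued_at_time:
  assumes "A \<in> class_C0 P"
  shows "single_valued (at_time P A z)"
proof (rule single_valuedI)
  fix x y y' assume xy: "(x, y) \<in> at_time P A z" "(x, y') \<in> at_time P A z"
  show "y = y'"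
  proof (rule cinner_eq_dense[OF closure_D])
    fix u assume "u \<in> D"
    then show "cinner u y = cinner u y'"
      using closure_at_time_pairing[OF assms, of u z] xy by metis
  qed
qed

lemma at_time_mem:
  assumes "A \<in> class_C0 P" "x \<in> D"
  shows "(x, ex z (op_app A (ex (- z) x))) \<in> at_time P A z"
proof -
  obtain b c where "tame b c (op_app A)"
    using class_C0_tame[OF assms(1)] by blast
  then have D: "op_app A (ex (- z) x) \<in> D"
    using assms(2) tame_D by simp
  have "(x, ex (- z) x) \<in> exp_op P (- z)" "(op_app A (ex (- z) x), ex z (op_app A (ex (- z) x))) \<in> exp_op P z"
    unfolding exp_op_def ex_def using fD_mem[OF continuous_exp] assms(2) D unfolding ex_def by blast+
  moreover have "(ex (- z) x, op_app A (ex (- z) x)) \<in> A"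
    using class_C0_mem assms by simp
  ultimately have "(x, ex z (op_app A (ex (- z) x))) \<in> op_prod [exp_op P z, A, exp_op P (- z)]"
    unfolding op_prod_def op_mult_def by auto
  then show ?thesis
    unfolding at_time_def using closure_subset by blast
qed

end

section \<open>Holomorphic families of operators on the finite-energy vectors\<close>

lemma has_cderiv_unique: "has_cderiv f d z \<Longrightarrow> has_cderiv f d' z \<Longrightarrow> d = d'"
  unfolding has_cderiv_def using has_derivative_unique by (metis scaleC_one)

lemma has_cderiv_iff_lim:
  "has_cderiv f d z \<longleftrightarrow> (\<lambda>k. norm (f (z + k) - f z - k *\<^sub>C d) / norm k) \<midarrow>0\<rightarrow> 0"
  unfolding has_cderiv_def has_derivative_at by (simp add: bounded_linear_scaleC_left)

context free_hamiltonian
begin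

lemma has_cderiv_V:
  assumes "\<And>z. g z \<in> V P e" "has_cderiv g d z"
  shows "d \<in> V P e"
proof -
  have "has_cderiv (\<lambda>z. pr e (g z)) (pr e d) z"
    by (rule has_cderiv_linear[OF clinear_pr bounded_linear_pr assms(2)])
  moreover have "(\<lambda>z. pr e (g z)) = g"
    using assms(1) by (simp add: V_iff)
  ultimately have "pr e d = d"
    using has_cderiv_unique assms(2) by metis
  then show ?thesis
    by (simp only: V_iff)
qed

text \<open>Entire families of operators on \<open>D\<close>. A common energy gain and bounds on
  discs are carried along because products require differentiating \<open>K z (g z)\<close> with a
  moving argument, for which pointwise differentiability of \<open>K\<close> is not enough.\<close>

definition fam :: "(complex \<Rightarrow> 'a \<Rightarrow> 'a) \<Rightarrow> (complex \<Rightarrow> 'a \<Rightarrow> 'a) \<Rightarrow> bool" where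
  "fam K K' \<longleftrightarrow> (\<forall>z. clinear_on D (K z)) \<and>
     (\<exists>b\<ge>0. \<forall>e\<ge>0. \<forall>x\<in>V P e. \<forall>z. K z x \<in> V P (e + b)) \<and>
     (\<forall>e\<ge>0. \<forall>R. \<exists>C. \<forall>x\<in>V P e. \<forall>z. cmod z \<le> R \<longrightarrow> norm (K z x) \<le> C * norm x) \<and>
     (\<forall>x\<in>D. \<forall>z. has_cderiv (\<lambda>z. K z x) (K' z x) z)"

lemma fam_linear: "fam K K' \<Longrightarrow> clinear_on D (K z)"
  and fam_cderiv: "fam K K' \<Longrightarrow> x \<in> D \<Longrightarrow> has_cderiv (\<lambda>z. K z x) (K' z x) z"
  unfolding fam_def by blast+

lemma fam_V:
  assumes "fam K K'"
  obtains b where "0 \<le> b" "\<And>e x z. 0 \<le> e \<Longrightarrow> x \<in> V P e \<Longrightarrow> K z x \<in> V P (e + b)"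
proof -
  have "\<exists>b\<ge>0. \<forall>e\<ge>0. \<forall>x\<in>V P e. \<forall>z. K z x \<in> V P (e + b)"
    using assms unfolding fam_def by (elim conjE)
  then obtain b where "0 \<le> b" "\<forall>e\<ge>0. \<forall>x\<in>V P e. \<forall>z. K z x \<in> V P (e + b)"
    by (elim exE conjE)
  then show ?thesis
    by (intro that[of b]) simp_all
qed

lemma fam_D:
  assumes "fam K K'" "x \<in> D"
  shows "K z x \<in> D"
proof -
  obtain e where "0 \<le> e" "x \<in> V P e"
    using assms(2) unfolding D_iff by blast
  then show ?thesis
    by (metis fam_V[OF assms(1)] V_D)
qed

lemma fam_bound:
  assumes "fam K K'" "0 \<le> e"
  obtains C where "0 \<le> C" "\<And>x z. x \<in> V P e \<Longrightarrow> cmod z \<le> R \<Longrightarrow> norm (K z x) \<le> C * norm x"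
proof -
  have "\<forall>e\<ge>0. \<forall>R. \<exists>C. \<forall>x\<in>V P e. \<forall>z. cmod z \<le> R \<longrightarrow> norm (K z x) \<le> C * norm x"
    using assms(1) unfolding fam_def by (elim conjE)
  then have "\<exists>C. \<forall>x\<in>V P e. \<forall>z. cmod z \<le> R \<longrightarrow> norm (K z x) \<le> C * norm x"
    using assms(2) by simp
  then obtain C where "\<forall>x\<in>V P e. \<forall>z. cmod z \<le> R \<longrightarrow> norm (K z x) \<le> C * norm x"
    by (elim exE)
  then have C: "\<And>x z. x \<in> V P e \<Longrightarrow> cmod z \<le> R \<Longrightarrow> norm (K z x) \<le> C * norm x"
    by simp
  have "norm (K z x) \<le> max C 0 * norm x" if "x \<in> V P e" "cmod z \<le> R" for x z
    using C[OF that] mult_right_mono[of C "max C 0" "norm x"] by simp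
  then show ?thesis
    using that[of "max C 0"] by simp
qed

lemma has_cderiv_fam_apply:
  assumes K: "fam K K'" and e: "0 \<le> e" and g: "\<And>z. g z \<in> V P e" "has_cderiv g g' z"
  shows "has_cderiv (\<lambda>z. K z (g z)) (K' z (g z) + K z g') z"
proof -
  have g': "g' \<in> V P e"
    using g by (rule has_cderiv_V)
  obtain C where C: "0 \<le> C" "\<And>x w. x \<in> V P e \<Longrightarrow> cmod w \<le> cmod z + 1 \<Longrightarrow> norm (K w x) \<le> C * norm x"
    by (rule fam_bound[OF K e, where R = "cmod z + 1"]) blast
  define A where "A k = norm (g (z + k) - g z - k *\<^sub>C g') / norm k" for k
  define B where "B k = norm (K (z + k) g' - K z g')" for k
  define F where "F k = norm (K (z + k) (g z) - K z (g z) - k *\<^sub>C K' z (g z)) / norm k" for k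
  have "A \<midarrow>0\<rightarrow> 0"
    using g(2) unfolding has_cderiv_iff_lim A_def .
  moreover have "B \<midarrow>0\<rightarrow> 0"
  proof -
    have "isCont (\<lambda>z. K z g') z"
      by (rule has_cderiv_continuous[OF fam_cderiv[OF K V_D[OF g']]])
    then have "(\<lambda>k. K (z + k) g') \<midarrow>0\<rightarrow> K z g'"
      by (simp add: isCont_iff)
    then show ?thesis
      unfolding B_def by (auto intro!: tendsto_eq_intros)
  qed
  moreover have "F \<midarrow>0\<rightarrow> 0"
    using fam_cderiv[OF K V_D[OF g(1)], of z z] unfolding has_cderiv_iff_lim F_def .
  ultimately have "(\<lambda>k. C * A k + B k + F k) \<midarrow>0\<rightarrow> 0"
    by (auto intro!: tendsto_eq_intros)
  moreover have "\<forall>\<^sub>F k in at 0. norm (norm (K (z + k) (g (z + k)) - K z (g z) -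
      k *\<^sub>C (K' z (g z) + K z g')) / norm k) \<le> C * A k + B k + F k"
  proof -
    have "\<forall>\<^sub>F k in at (0::complex). norm k < 1"
      unfolding eventually_at by (intro exI[of _ 1]) simp
    then show ?thesis
    proof eventually_elim
      case (elim k)
      note lin = clinear_onD[OF fam_linear[OF K]] clinear_on_extra(3)[OF fam_linear[OF K] D_subspace]
      have D: "g w \<in> D" "g' \<in> D" for w
        using g(1) g' V_D by auto
      have in_V: "g (z + k) - g z - k *\<^sub>C g' \<in> V P e"
        using g(1) g' by simp
      \<comment> \<open>Three errors: the remainder of \<open>g\<close>, transported by the local
        bound \<open>C\<close>; the continuity of \<open>K\<close> at the fixed vector
        \<open>g'\<close>; the remainder of \<open>K\<close> at the fixed vector
        \<open>g z\<close>.\<close>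
      have "K (z + k) (g (z + k)) - K z (g z) - k *\<^sub>C (K' z (g z) + K z g') =
        K (z + k) (g (z + k) - g z - k *\<^sub>C g') + k *\<^sub>C (K (z + k) g' - K z g') +
        (K (z + k) (g z) - K z (g z) - k *\<^sub>C K' z (g z))"
        using D by (simp add: lin complex_vector.scale_right_diff_distrib scaleC_add_right)
      also have "norm \<dots> \<le> norm (K (z + k) (g (z + k) - g z - k *\<^sub>C g')) + norm k * B k +
          norm (K (z + k) (g z) - K z (g z) - k *\<^sub>C K' z (g z))"
        unfolding B_def norm_scaleC[symmetric] by (intro norm_triangle_mono order_refl)
      also have "\<dots> \<le> C * norm (g (z + k) - g z - k *\<^sub>C g') + norm k * B k +
          norm (K (z + k) (g z) - K z (g z) - k *\<^sub>C K' z (g z))"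
        using C(2)[OF in_V, of "z + k"] elim norm_triangle_ineq[of z k] by simp
      finally show ?case
        unfolding A_def F_def
        by (cases "k = 0") (simp_all add: B_def divide_simps mult_ac)
    qed
  qed
  ultimately show ?thesis
    unfolding has_cderiv_iff_lim by (rule Lim_null_comparison[rotated])
qed

lemma fam_comp:
  assumes K: "fam K K'" and L: "fam L L'"
  shows "fam (\<lambda>z x. K z (L z x)) (\<lambda>z x. K' z (L z x) + K z (L' z x))"
  unfolding fam_def
proof (intro conjI allI impI ballI)
  obtain b where b: "0 \<le> b" "\<And>e x z. 0 \<le> e \<Longrightarrow> x \<in> V P e \<Longrightarrow> K z x \<in> V P (e + b)"
    by (rule fam_V[OF K]) blast
  obtain d where d: "0 \<le> d" "\<And>e x z. 0 \<le> e \<Longrightarrow> x \<in> V P e \<Longrightarrow> L z x \<in> V P (e + d)"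
    by (rule fam_V[OF L]) blast
  show "clinear_on D (\<lambda>x. K z (L z x))" for z
    using fam_linear[OF K, of z] fam_linear[OF L, of z] fam_D[OF L]
    unfolding clinear_on_def by simp
  show "\<exists>b\<ge>0. \<forall>e\<ge>0. \<forall>x\<in>V P e. \<forall>z. K z (L z x) \<in> V P (e + b)"
    using b(2)[OF _ d(2)] b(1) d(1) by (intro exI[of _ "d + b"]) (auto simp: add.assoc)
  show "\<exists>C. \<forall>x\<in>V P e. \<forall>z. cmod z \<le> R \<longrightarrow> norm (K z (L z x)) \<le> C * norm x" if e: "0 \<le> e" for e R
  proof -
    obtain C1 where C1: "0 \<le> C1" "\<And>x z. x \<in> V P (e + d) \<Longrightarrow> cmod z \<le> R \<Longrightarrow> norm (K z x) \<le> C1 * norm x"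
      using fam_bound[OF K, of "e + d"] e d(1) by (metis add_nonneg_nonneg)
    obtain C2 where C2: "0 \<le> C2" "\<And>x z. x \<in> V P e \<Longrightarrow> cmod z \<le> R \<Longrightarrow> norm (L z x) \<le> C2 * norm x"
      using fam_bound[OF L e] by metis
    have "norm (K z (L z x)) \<le> C1 * C2 * norm x" if "x \<in> V P e" "cmod z \<le> R" for x z
      using C1(2)[OF d(2)[OF e that(1)] that(2)] mult_left_mono[OF C2(2)[OF that] C1(1)]
      by (simp add: mult.assoc) (meson order_trans)
    then show ?thesis by blast
  qed
  show "has_cderiv (\<lambda>z. K z (L z x)) (K' z (L z x) + K z (L' z x)) z" if x: "x \<in> D" for x z
  proof -
    obtain e where e: "0 \<le> e" "x \<in> V P e"
      using x unfolding D_iff by blast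
    show ?thesis
      by (rule has_cderiv_fam_apply[OF K _ d(2)[OF e] fam_cderiv[OF L x]])
        (use e d in simp)
  qed
qed

lemma fam_add:
  assumes K: "fam K K'" and L: "fam L L'"
  shows "fam (\<lambda>z x. K z x + L z x) (\<lambda>z x. K' z x + L' z x)"
  unfolding fam_def
proof (intro conjI allI impI ballI)
  obtain b where b: "0 \<le> b" "\<And>e x z. 0 \<le> e \<Longrightarrow> x \<in> V P e \<Longrightarrow> K z x \<in> V P (e + b)"
    by (rule fam_V[OF K]) blast
  obtain d where d: "0 \<le> d" "\<And>e x z. 0 \<le> e \<Longrightarrow> x \<in> V P e \<Longrightarrow> L z x \<in> V P (e + d)"
    by (rule fam_V[OF L]) blast
  show "clinear_on D (\<lambda>x. K z x + L z x)" for z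
    using fam_linear[OF K, of z] fam_linear[OF L, of z]
    unfolding clinear_on_def by (simp add: scaleC_add_right)
  have "K z x + L z x \<in> V P (e + (b + d))" if "0 \<le> e" "x \<in> V P e" for e x z
    using b(1) d(1) V_mono[OF _ b(2)[OF that], of "e + (b + d)"] V_mono[OF _ d(2)[OF that], of "e + (b + d)"]
    by simp
  then show "\<exists>b\<ge>0. \<forall>e\<ge>0. \<forall>x\<in>V P e. \<forall>z. K z x + L z x \<in> V P (e + b)"
    using b(1) d(1) by (intro exI[of _ "b + d"]) auto
  show "\<exists>C. \<forall>x\<in>V P e. \<forall>z. cmod z \<le> R \<longrightarrow> norm (K z x + L z x) \<le> C * norm x" if e: "0 \<le> e" for e R
  proof -
    obtain C1 where C1: "\<And>x z. x \<in> V P e \<Longrightarrow> cmod z \<le> R \<Longrightarrow> norm (K z x) \<le> C1 * norm x"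
      using fam_bound[OF K e] by metis
    obtain C2 where C2: "\<And>x z. x \<in> V P e \<Longrightarrow> cmod z \<le> R \<Longrightarrow> norm (L z x) \<le> C2 * norm x"
      using fam_bound[OF L e] by metis
    have "norm (K z x + L z x) \<le> (C1 + C2) * norm x" if "x \<in> V P e" "cmod z \<le> R" for x z
      using norm_triangle_mono[OF C1[OF that] C2[OF that]] by (simp add: distrib_right)
    then show ?thesis by blast
  qed
qed (intro has_cderiv_add fam_cderiv[OF K] fam_cderiv[OF L])

lemma fam_const:
  assumes "clinear_on D T" "0 \<le> b" "\<And>e x. 0 \<le> e \<Longrightarrow> x \<in> V P e \<Longrightarrow> T x \<in> V P (e + b)"
    "\<And>e. 0 \<le> e \<Longrightarrow> \<exists>C. \<forall>x\<in>V P e. norm (T x) \<le> C * norm x"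
  shows "fam (\<lambda>_. T) (\<lambda>_ _. 0)"
  unfolding fam_def using assms by (auto intro: has_cderiv_const)

lemma fam_tame: "tame b c T \<Longrightarrow> fam (\<lambda>_. T) (\<lambda>_ _. 0)"
  by (rule fam_const[of _ b]) (auto intro: tame_linear tame_nonneg tame_V tame_bound)

lemma fam_h: "fam (\<lambda>_. h) (\<lambda>_ _. 0)"
  by (rule fam_const[of _ 0]) (auto intro: clinear_on_h h_bound)

lemma fam_affine:
  assumes K: "fam K K'"
  shows "fam (\<lambda>z. K (a + k * z)) (\<lambda>z x. k *\<^sub>C K' (a + k * z) x)"
  unfolding fam_def
proof (intro conjI allI impI ballI)
  show "\<exists>b\<ge>0. \<forall>e\<ge>0. \<forall>x\<in>V P e. \<forall>z. K (a + k * z) x \<in> V P (e + b)"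
    using fam_V[OF K] by metis
  show "\<exists>C. \<forall>x\<in>V P e. \<forall>z. cmod z \<le> R \<longrightarrow> norm (K (a + k * z) x) \<le> C * norm x" if e: "0 \<le> e" for e R
  proof -
    obtain C where C: "\<And>x z. x \<in> V P e \<Longrightarrow> cmod z \<le> cmod a + cmod k * R \<Longrightarrow> norm (K z x) \<le> C * norm x"
      using fam_bound[OF K e] by metis
    have "cmod (a + k * z) \<le> cmod a + cmod k * R" if "cmod z \<le> R" for z
      using norm_triangle_ineq[of a "k * z"] mult_left_mono[OF that, of "cmod k"]
      by (simp add: norm_mult)
    then show ?thesis
      using C by blast
  qed
qed (intro has_cderiv_affine fam_cderiv[OF K] fam_linear[OF K])+

lemma fam_minus: "fam K K' \<Longrightarrow> fam (\<lambda>z. K (- z)) (\<lambda>z x. - K' (- z) x)"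
  using fam_affine[of K K' 0 "- 1"] by simp

lemma fam_scaleC:
  assumes K: "fam K K'"
  shows "fam (\<lambda>z x. k *\<^sub>C K z x) (\<lambda>z x. k *\<^sub>C K' z x)"
proof -
  have "fam (\<lambda>_ x. k *\<^sub>C x) (\<lambda>_ _. 0)"
    by (rule fam_const[of _ 0])
      (auto simp: clinear_on_def scaleC_add_right scaleC_scaleC mult.commute norm_scaleC)
  from fam_comp[OF this K] show ?thesis
    by simp
qed

lemma fam_ex: "fam ex (\<lambda>z x. \<i> *\<^sub>C h (ex z x))"
  unfolding fam_def
proof (intro conjI allI impI ballI clinear_on_ex ex_cderiv)
  show "\<exists>b\<ge>0. \<forall>e\<ge>0. \<forall>x\<in>V P e. \<forall>z. ex z x \<in> V P (e + b)"
    by (intro exI[of _ 0]) auto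
  show "\<exists>C. \<forall>x\<in>V P e. \<forall>z. cmod z \<le> R \<longrightarrow> norm (ex z x) \<le> C * norm x" if e: "0 \<le> e" for e R
  proof (intro exI[of _ "exp (R * e)"] ballI allI impI)
    fix x z assume "x \<in> V P e" "cmod z \<le> R"
    then show "norm (ex z x) \<le> exp (R * e) * norm x"
      using ex_bound[OF e, of x z] mult_right_mono[of "exp (cmod z * e)" "exp (R * e)" "norm x"]
        mult_right_mono[of "cmod z" R e] e by simp
  qed
qed

lemma segment_integral_V:
  assumes "continuous_on UNIV g" "\<And>z. g z \<in> V P e"
  shows "segment_integral a b g \<in> V P e"
proof -
  have "(\<lambda>z. pr e (g z)) = g"
    using assms(2) unfolding V_iff by (rule ext)
  then have "pr e (segment_integral a b g) = segment_integral a b g"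
    using segment_integral_linear[OF clinear_pr[of e] bounded_linear_pr[of e] assms(1), of a b] by simp
  then show ?thesis
    unfolding V_iff .
qed

lemma fam_continuous: "fam K K' \<Longrightarrow> x \<in> D \<Longrightarrow> continuous_on S (\<lambda>z. K z x)"
  by (rule has_cderiv_continuous_on[OF fam_cderiv])

lemma fam_segment_integral:
  assumes K: "fam K K'"
  shows "fam (\<lambda>z x. segment_integral 0 z (\<lambda>\<zeta>. K \<zeta> x)) K"
  unfolding fam_def
proof (intro conjI allI impI ballI)
  obtain b where b: "0 \<le> b" "\<And>e x z. 0 \<le> e \<Longrightarrow> x \<in> V P e \<Longrightarrow> K z x \<in> V P (e + b)"
    by (rule fam_V[OF K]) blast
  note cont = fam_continuous[OF K]
  show "clinear_on D (\<lambda>x. segment_integral 0 z (\<lambda>\<zeta>. K \<zeta> x))" for z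
    unfolding clinear_on_def
  proof (intro conjI ballI allI)
    fix x assume x: "x \<in> D"
    show "segment_integral 0 z (\<lambda>\<zeta>. K \<zeta> (k *\<^sub>C x)) = k *\<^sub>C segment_integral 0 z (\<lambda>\<zeta>. K \<zeta> x)" for k
      using segment_integral_linear[OF _ bounded_linear_scaleC_right cont[OF x], of k 0 z]
      by (simp add: clinear_onD[OF fam_linear[OF K]] x clinear_on_def scaleC_add_right
          scaleC_scaleC mult.commute)
    fix y assume y: "y \<in> D"
    show "segment_integral 0 z (\<lambda>\<zeta>. K \<zeta> (x + y)) =
        segment_integral 0 z (\<lambda>\<zeta>. K \<zeta> x) + segment_integral 0 z (\<lambda>\<zeta>. K \<zeta> y)"
      using segment_integral_diff[OF cont[of "x + y"] cont[OF y], of 0 z] x y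
      by (simp add: clinear_onD[OF fam_linear[OF K]] x)
  qed
  show "\<exists>b\<ge>0. \<forall>e\<ge>0. \<forall>x\<in>V P e. \<forall>z. segment_integral 0 z (\<lambda>\<zeta>. K \<zeta> x) \<in> V P (e + b)"
    using b by (intro exI[of _ b]) (auto intro!: segment_integral_V cont V_D)
  show "\<exists>C. \<forall>x\<in>V P e. \<forall>z. cmod z \<le> R \<longrightarrow> norm (segment_integral 0 z (\<lambda>\<zeta>. K \<zeta> x)) \<le> C * norm x"
    if e: "0 \<le> e" for e R
  proof -
    obtain C where C: "0 \<le> C" "\<And>x z. x \<in> V P e \<Longrightarrow> cmod z \<le> R \<Longrightarrow> norm (K z x) \<le> C * norm x"
      using fam_bound[OF K e] by metis
    have "norm (segment_integral 0 z (\<lambda>\<zeta>. K \<zeta> x)) \<le> R * C * norm x" if x: "x \<in> V P e" "cmod z \<le> R" for x z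
    proof -
      have "norm (segment_integral 0 z (\<lambda>\<zeta>. K \<zeta> x)) \<le> cmod (z - 0) * (C * norm x)"
      proof (rule segment_integral_norm_le[OF cont[OF V_D[OF x(1)]] C(2)[OF x(1)]])
        fix t :: real assume "t \<in> {0..1}"
        then have "t * cmod z \<le> 1 * cmod z"
          by (intro mult_right_mono) auto
        then show "cmod (0 + complex_of_real t * (z - 0)) \<le> R"
          using \<open>t \<in> {0..1}\<close> x(2) by (simp add: norm_mult)
      qed
      also have "\<dots> \<le> R * (C * norm x)"
        using x(2) C(1) by (intro mult_right_mono) auto
      finally show ?thesis
        by (simp add: mult.assoc)
    qed
    then show ?thesis by blast
  qed
  show "has_cderiv (\<lambda>z. segment_integral 0 z (\<lambda>\<zeta>. K \<zeta> x)) (K z x) z" if "x \<in> D" for x z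
    by (rule has_cderiv_segment_integral[OF fam_cderiv[OF K that]])
qed

text \<open>The integrating factor \<open>ex z\<close> undoes the free evolution; the common energy
  bound on \<open>g\<close> makes the product rule applicable.\<close>

lemma ode_zero:
  assumes e: "0 \<le> e" and g: "\<And>z. g z \<in> V P e" "\<And>z. has_cderiv g (- \<i> *\<^sub>C h (g z)) z" "g 0 = 0"
  shows "g z = 0"
proof -
  have D: "g z \<in> D" for z
    using V_D[OF g(1)] .
  have "has_cderiv (\<lambda>z. ex z (g z)) (\<i> *\<^sub>C h (ex z (g z)) + ex z (- \<i> *\<^sub>C h (g z))) z" for z
    by (rule has_cderiv_fam_apply[OF fam_ex e g(1,2)])
  moreover have "\<i> *\<^sub>C h (ex z (g z)) + ex z (- \<i> *\<^sub>C h (g z)) = 0" for z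
    using D by (simp add: h_ex clinear_onD[OF clinear_on_ex] clinear_on_extra(2)[OF clinear_on_ex D_subspace])
  ultimately have "has_cderiv (\<lambda>z. ex z (g z)) 0 z" for z
    by simp
  then have "ex z (g z) = ex 0 (g 0)"
    by (rule has_cderiv_zero_constant)
  then have "ex (- z) (ex z (g z)) = ex (- z) 0"
    using g(3) by simp
  then show ?thesis
    using D clinear_on_extra(1)[OF clinear_on_ex D_subspace] by simp
qed

text \<open>The bridge from graphs to functions on \<open>D\<close>; invariance of \<open>D\<close>
  is included so that products can be composed.\<close>

definition acts :: "'a oper \<Rightarrow> ('a \<Rightarrow> 'a) \<Rightarrow> bool" where
  "acts T g \<longleftrightarrow> single_valued T \<and> (\<forall>x\<in>D. (x, g x) \<in> T \<and> g x \<in> D)"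

lemma op_prod_Nil [simp]: "op_prod [] = Id" and op_prod_Cons: "op_prod (T # Ts) = op_prod Ts O T"
  unfolding op_prod_def op_mult_def by simp_all

lemma acts_cong: "acts T g \<Longrightarrow> (\<And>x. x \<in> D \<Longrightarrow> g x = g' x) \<Longrightarrow> acts T g'"
  unfolding acts_def by auto

lemma acts_op_prod_map:
  assumes "\<And>j. j \<in> set js \<Longrightarrow> acts (T j) (g j)"
  shows "acts (op_prod (map T js)) (foldr g js)"
  using assms
proof (induction js)
  case (Cons j js)
  then have "acts (T j) (g j)" "acts (op_prod (map T js)) (foldr g js)"
    by auto
  then show ?case
    unfolding acts_def list.map op_prod_Cons by (auto intro: single_valued_relcomp)
qed (auto simp: acts_def)

text \<open>Joint continuity, as \<open>texp_core\<close> demands when several times vary together: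
  the increment of the argument is controlled by the local bound, the increment of the time by
  continuity at a fixed vector.\<close>

lemma fam_continuous_comp:
  fixes f :: "'b::topological_space \<Rightarrow> 'a"
  assumes K: "fam K K'" and e: "0 \<le> e" and s: "continuous_on S s" and f: "continuous_on S f" "\<And>\<eta>. f \<eta> \<in> V P e"
  shows "continuous_on S (\<lambda>\<eta>. K (s \<eta>) (f \<eta>))"
  unfolding continuous_on_def
proof
  fix \<eta>0 assume \<eta>0: "\<eta>0 \<in> S"
  have D: "f \<eta> \<in> D" for \<eta>
    using V_D[OF f(2)] .
  obtain C where C: "0 \<le> C" "\<And>x z. x \<in> V P e \<Longrightarrow> cmod z \<le> cmod (s \<eta>0) + 1 \<Longrightarrow> norm (K z x) \<le> C * norm x"
    using fam_bound[OF K e] by metis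
  have s_lim: "(s \<longlongrightarrow> s \<eta>0) (at \<eta>0 within S)" and f_lim: "(f \<longlongrightarrow> f \<eta>0) (at \<eta>0 within S)"
    using s f(1) \<eta>0 unfolding continuous_on_def by blast+
  have "\<forall>\<^sub>F \<eta> in at \<eta>0 within S. cmod (s \<eta>) < cmod (s \<eta>0) + 1"
    by (rule order_tendstoD(2)[OF tendsto_norm[OF s_lim]]) simp
  then have "\<forall>\<^sub>F \<eta> in at \<eta>0 within S. norm (K (s \<eta>) (f \<eta> - f \<eta>0)) \<le> C * norm (f \<eta> - f \<eta>0)"
    by eventually_elim (use C(2) f(2) in auto)
  moreover have "((\<lambda>\<eta>. C * norm (f \<eta> - f \<eta>0)) \<longlongrightarrow> 0) (at \<eta>0 within S)"
    using tendsto_mult_right_zero[OF tendsto_norm_zero[OF LIM_zero[OF f_lim]]] .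
  ultimately have "((\<lambda>\<eta>. K (s \<eta>) (f \<eta> - f \<eta>0)) \<longlongrightarrow> 0) (at \<eta>0 within S)"
    by (rule Lim_null_comparison)
  moreover have "((\<lambda>\<eta>. K (s \<eta>) (f \<eta>0)) \<longlongrightarrow> K (s \<eta>0) (f \<eta>0)) (at \<eta>0 within S)"
  proof (rule isCont_tendsto_compose[OF _ s_lim])
    show "isCont (\<lambda>z. K z (f \<eta>0)) (s \<eta>0)"
      using fam_continuous[OF K D, of UNIV] by (simp add: continuous_on_eq_continuous_at)
  qed
  ultimately have "((\<lambda>\<eta>. K (s \<eta>) (f \<eta> - f \<eta>0) + K (s \<eta>) (f \<eta>0)) \<longlongrightarrow> 0 + K (s \<eta>0) (f \<eta>0)) (at \<eta>0 within S)"
    by (rule tendsto_add)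
  moreover have "K (s \<eta>) (f \<eta> - f \<eta>0) + K (s \<eta>) (f \<eta>0) = K (s \<eta>) (f \<eta>)" for \<eta>
    using clinear_on_extra(3)[OF fam_linear[OF K] D_subspace D D] by simp
  ultimately show "((\<lambda>\<eta>. K (s \<eta>) (f \<eta>)) \<longlongrightarrow> K (s \<eta>0) (f \<eta>0)) (at \<eta>0 within S)"
    by simp
qed

lemma acts_op_app: "acts T g \<Longrightarrow> x \<in> D \<Longrightarrow> op_app T x = g x"
  unfolding acts_def using op_app_eq by metis

lemma acts_at_time:
  assumes "A \<in> class_C0 P"
  shows "acts (at_time P A z) (\<lambda>x. ex z (op_app A (ex (- z) x)))"
proof -
  obtain b c where t: "tame b c (op_app A)"
    using class_C0_tame[OF assms] by blast
  show ?thesis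
    unfolding acts_def using assms by (auto intro: single_valued_at_time at_time_mem ex_D tame_D[OF t])
qed

lemma acts_op_scale: "acts T g \<Longrightarrow> acts (op_scale k T) (\<lambda>x. k *\<^sub>C g x)"
  unfolding acts_def op_scale_def single_valued_def by auto

end

section \<open>The Dyson terms\<close>

text \<open>\<open>b\<close> and \<open>c\<close> are parameters and not chosen inside, so that the
  same energy gain can later serve the operators \<open>A j\<close> too.\<close>

locale interaction = free_hamiltonian P H0
  for P :: "real set \<Rightarrow> 'a::complex_hilbert \<Rightarrow> 'a" and H0 +
  fixes H1 :: "'a oper" and b c :: real
  assumes H1_C0: "H1 \<in> class_C0 P" and tame_H1: "tame b c (op_app H1)"
begin

abbreviation v :: "'a \<Rightarrow> 'a" where "v \<equiv> op_app H1"

lemma b_nonneg [simp]: "0 \<le> b" and c_nonneg [simp]: "0 \<le> c"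
  using tame_nonneg[OF tame_H1] .

lemmas v_linear = clinear_onD[OF tame_linear[OF tame_H1]]
lemmas h_linear = clinear_onD[OF clinear_on_h]
lemmas ex_linear = clinear_onD[OF clinear_on_ex]

lemma v_D [simp]: "x \<in> D \<Longrightarrow> v x \<in> D"
  by (rule tame_D[OF tame_H1])

lemma v_0 [simp]: "v 0 = 0" and h_0 [simp]: "h 0 = 0" and ex_z_0 [simp]: "ex z 0 = 0"
  by (rule clinear_on_extra(1)[OF _ D_subspace], simp add: tame_linear[OF tame_H1] clinear_on_h clinear_on_ex)+

lemma v_minus [simp]: "x \<in> D \<Longrightarrow> v (- x) = - v x"
  and h_minus [simp]: "x \<in> D \<Longrightarrow> h (- x) = - h x"
  and ex_minus [simp]: "x \<in> D \<Longrightarrow> ex z (- x) = - ex z x"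
  by (rule clinear_on_extra(2)[OF _ D_subspace], simp_all add: tame_linear[OF tame_H1] clinear_on_h clinear_on_ex)+

definition F :: "complex \<Rightarrow> 'a \<Rightarrow> 'a" where
  "F z x = - \<i> *\<^sub>C ex z (v (ex (- z) x))"

text \<open>The terms of \<open>U(z, 0)\<close> in the interaction picture. Other starting points
  are reached through time differences in the argument of \<open>w\<close>.\<close>

fun Vn :: "nat \<Rightarrow> complex \<Rightarrow> 'a \<Rightarrow> 'a" where
  "Vn 0 z x = x"
| "Vn (Suc n) z x = segment_integral 0 z (\<lambda>\<zeta>. F \<zeta> (Vn n \<zeta> x))"

text \<open>The \<open>n\<close>-th order term of \<open>e\<^sup>-\<^sup>i\<^sup>z\<^sup>H\<close> in the interaction.\<close>

definition w :: "nat \<Rightarrow> complex \<Rightarrow> 'a \<Rightarrow> 'a" where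
  "w n z x = ex (- z) (Vn n z x)"

lemma F_V: "0 \<le> e \<Longrightarrow> x \<in> V P e \<Longrightarrow> F z x \<in> V P (e + b)"
  unfolding F_def using tame_V[OF tame_H1] by simp

lemma fam_F: "\<exists>F'. fam F F'"
  unfolding F_def[abs_def]
  using fam_scaleC[OF fam_comp[OF fam_ex fam_comp[OF fam_tame[OF tame_H1] fam_minus[OF fam_ex]]]]
  by blast

lemma fam_Vn: "\<exists>K'. fam (Vn n) K'"
proof (induction n)
  case 0
  have "fam (\<lambda>_ x. x) (\<lambda>_ _. 0)"
    by (rule fam_const[of _ 0]) (auto simp: clinear_on_def intro: exI[of _ 1])
  moreover have "Vn 0 = (\<lambda>_ x. x)"
    by (intro ext) simp
  ultimately show ?case
    by auto
next
  case (Suc n)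
  obtain F' K' where "fam F F'" "fam (Vn n) K'"
    using fam_F Suc by blast
  from fam_segment_integral[OF fam_comp[OF this]] show ?case
    by (subst (asm) Vn.simps(2)[symmetric, abs_def]) blast
qed

lemma fam_Vn_Suc: "fam (Vn (Suc n)) (\<lambda>z x. F z (Vn n z x))"
proof -
  obtain F' K' where "fam F F'" "fam (Vn n) K'"
    using fam_F fam_Vn by blast
  from fam_segment_integral[OF fam_comp[OF this]] show ?thesis
    by (subst Vn.simps(2)[abs_def])
qed

lemma Vn_D [simp]: "x \<in> D \<Longrightarrow> Vn n z x \<in> D"
  using fam_Vn fam_D by blast

lemma Vn_V: "0 \<le> e \<Longrightarrow> x \<in> V P e \<Longrightarrow> Vn n z x \<in> V P (e + n * b)"
proof (induction n arbitrary: z)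
  case (Suc n)
  obtain F' K' where "fam F F'" "fam (Vn n) K'"
    using fam_F fam_Vn by blast
  note K = fam_continuous[OF fam_comp[OF this] V_D[OF Suc.prems(2)]]
  have "F \<zeta> (Vn n \<zeta> x) \<in> V P (e + Suc n * b)" for \<zeta>
    using F_V[OF _ Suc.IH[OF Suc.prems], of \<zeta> \<zeta>] Suc.prems(1) by (simp add: algebra_simps)
  then show ?case
    using segment_integral_V[OF K] by simp
qed simp

lemma w_D [simp]: "x \<in> D \<Longrightarrow> w n z x \<in> D"
  unfolding w_def by simp

lemma w_V: "0 \<le> e \<Longrightarrow> x \<in> V P e \<Longrightarrow> w n z x \<in> V P (e + n * b)"
  unfolding w_def by (simp add: Vn_V)

lemma w_0: "w 0 z x = ex (- z) x"
  unfolding w_def by simp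

lemma w_Suc_at_0: "w (Suc n) 0 x = 0"
  unfolding w_def by (simp add: segment_integral_def)

text \<open>In \<open>vp\<close> the interaction follows a Dyson term, in \<open>pv\<close> it
  precedes one. Both are numbered by total order, hence the value 0 at order 0.\<close>

definition vp :: "nat \<Rightarrow> complex \<Rightarrow> 'a \<Rightarrow> 'a" where
  "vp n z x = (case n of 0 \<Rightarrow> 0 | Suc m \<Rightarrow> v (w m z x))"

definition pv :: "nat \<Rightarrow> complex \<Rightarrow> 'a \<Rightarrow> 'a" where
  "pv n z x = (case n of 0 \<Rightarrow> 0 | Suc m \<Rightarrow> w m z (v x))"

lemma vp_D [simp]: "x \<in> D \<Longrightarrow> vp n z x \<in> D" and pv_D [simp]: "x \<in> D \<Longrightarrow> pv n z x \<in> D"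
  unfolding vp_def pv_def by (auto split: nat.split)

definition dw :: "nat \<Rightarrow> complex \<Rightarrow> 'a \<Rightarrow> 'a" where
  "dw n z x = - \<i> *\<^sub>C (h (w n z x) + vp n z x)"

lemma fam_cong:
  assumes "fam K K'" "\<And>z x. x \<in> D \<Longrightarrow> K z x = L z x" "\<And>z x. x \<in> D \<Longrightarrow> K' z x = L' z x"
  shows "fam L L'"
proof -
  have "L z x = K z x" if "x \<in> V P e" for e z x
    using assms(2) V_D[OF that] by simp
  moreover have "has_cderiv (\<lambda>z. L z x) (L' z x) z" if "x \<in> D" for x z
    using fam_cderiv[OF assms(1) that, of z] assms(2,3)[OF that] by simp
  moreover have "clinear_on D (L z)" for z
    using fam_linear[OF assms(1), of z] assms(2) unfolding clinear_on_def by simp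
  ultimately show ?thesis
    using assms(1) unfolding fam_def by simp
qed

lemma fam_w: "fam (w n) (dw n)"
proof (cases n)
  case 0
  show ?thesis
    unfolding 0
    by (rule fam_cong[OF fam_minus[OF fam_ex]]) (auto simp: w_0 dw_def vp_def)
next
  case (Suc m)
  show ?thesis
    unfolding Suc
  proof (rule fam_cong[OF fam_comp[OF fam_minus[OF fam_ex] fam_Vn_Suc]])
    fix z x assume x: "x \<in> D"
    show "ex (- z) (Vn (Suc m) z x) = w (Suc m) z x"
      unfolding w_def ..
    have "ex (- z) (F z (Vn m z x)) = - \<i> *\<^sub>C v (w m z x)"
      unfolding F_def w_def using x by (simp add: ex_linear complex_vector.scale_minus_left del: Vn.simps)
    then show "- (\<i> *\<^sub>C h (ex (- z) (Vn (Suc m) z x))) + ex (- z) (F z (Vn m z x)) = dw (Suc m) z x"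
      unfolding dw_def vp_def w_def[of "Suc m"] by (simp add: scaleC_add_right del: Vn.simps)
  qed
qed

lemmas w_linear = clinear_onD[OF fam_linear[OF fam_w]]

lemma fam_zero: "fam (\<lambda>_ _. 0) (\<lambda>_ _. 0)"
  by (rule fam_const[of _ 0]) (auto simp: clinear_on_def intro: exI[of _ 0])

lemma fam_vp: "fam (vp n) (\<lambda>z x. case n of 0 \<Rightarrow> 0 | Suc m \<Rightarrow> v (dw m z x))"
proof (cases n)
  case 0
  then show ?thesis
    by (intro fam_cong[OF fam_zero]) (auto simp: vp_def)
next
  case (Suc m)
  then show ?thesis
    by (intro fam_cong[OF fam_comp[OF fam_tame[OF tame_H1] fam_w[of m]]]) (auto simp: vp_def)
qed

lemma fam_pv: "fam (pv n) (\<lambda>z x. case n of 0 \<Rightarrow> 0 | Suc m \<Rightarrow> dw m z (v x))"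
proof (cases n)
  case 0
  then show ?thesis
    by (intro fam_cong[OF fam_zero]) (auto simp: pv_def)
next
  case (Suc m)
  have "w m z 0 = 0" for z
    by (rule clinear_on_extra(1)[OF fam_linear[OF fam_w] D_subspace])
  with Suc show ?thesis
    by (intro fam_cong[OF fam_comp[OF fam_w[of m] fam_tame[OF tame_H1]]]) (auto simp: pv_def)
qed

text \<open>The formal series \<open>\<Sum> w n z\<close> commutes with the generator \<open>h + v\<close>, order by order.\<close>

lemma w_commute: "x \<in> D \<Longrightarrow> h (w n z x) + vp n z x = w n z (h x) + pv n z x"
proof (induction n arbitrary: z x)
  case 0
  then show ?case
    by (simp add: w_0 vp_def pv_def h_ex)
next
  case (Suc m)
  \<comment> \<open>The defect of the commutation. By the induction hypothesis it obeys the free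
    equation of \<open>ode_zero\<close>, and it vanishes at 0.\<close>
  define g where "g z = h (w (Suc m) z x) + vp (Suc m) z x - w (Suc m) z (h x) - pv (Suc m) z x" for z
  have w0: "w m z 0 = 0" for m z
    by (rule clinear_on_extra(1)[OF fam_linear[OF fam_w] D_subspace])
  have fam1: "fam (\<lambda>z x. h (w (Suc m) z x)) (\<lambda>z x. h (dw (Suc m) z x))"
    by (rule fam_cong[OF fam_comp[OF fam_h fam_w]]) auto
  have fam2: "fam (\<lambda>z x. w (Suc m) z (h x)) (\<lambda>z x. dw (Suc m) z (h x))"
    by (rule fam_cong[OF fam_comp[OF fam_w fam_h]]) (auto simp: w0)
  note fam12 = fam_add[OF fam_add[OF fam1 fam_vp[of "Suc m"]]
    fam_scaleC[OF fam_add[OF fam2 fam_pv[of "Suc m"]], of "- 1"]]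
  have g: "has_cderiv g (h (dw (Suc m) z x) + v (dw m z x) - dw (Suc m) z (h x) - dw m z (v x)) z" for z
    using fam_cderiv[OF fam12 Suc.prems, of z] unfolding g_def by (simp add: algebra_simps)
  have g_eq: "g z = h (w (Suc m) z x) + v (w m z x) - w (Suc m) z (h x) - w m z (v x)" for z
    unfolding g_def vp_def pv_def by simp
  have "h (dw (Suc m) z x) + v (dw m z x) - dw (Suc m) z (h x) - dw m z (v x) = - \<i> *\<^sub>C h (g z)" for z
  proof -
    have 1: "v (h (w m z x) + vp m z x) = v (w m z (h x)) + v (pv m z x)"
      unfolding Suc.IH[OF Suc.prems] using Suc.prems by (simp add: v_linear)
    have 2: "v (pv m z x) = vp m z (v x)"
      unfolding vp_def pv_def by (auto split: nat.split)
    have 3: "v (dw m z x) = - \<i> *\<^sub>C (v (w m z (h x)) + vp m z (v x))"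
      unfolding dw_def using Suc.prems 1 2 by (simp only: v_linear h_D w_D vp_D D_closure)
    have 4: "h (dw (Suc m) z x) = - \<i> *\<^sub>C (h (h (w (Suc m) z x)) + h (v (w m z x)))"
      unfolding dw_def vp_def using Suc.prems by (simp add: h_linear clinear_on_extra(2)[OF clinear_on_h D_subspace])
    have 5: "h (g z) = h (h (w (Suc m) z x)) + h (v (w m z x)) - h (w (Suc m) z (h x)) - h (w m z (v x))"
      unfolding g_eq using Suc.prems
      by (simp add: h_linear clinear_on_extra(3)[OF clinear_on_h D_subspace])
    show ?thesis
      unfolding 3 4 5 unfolding dw_def vp_def[of "Suc m"]
      by (simp add: scaleC_add_right complex_vector.scale_right_diff_distrib)
  qed
  then have g': "has_cderiv g (- \<i> *\<^sub>C h (g z)) z" for z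
    using g by simp
  obtain e where e: "0 \<le> e" "x \<in> V P e"
    using Suc.prems unfolding D_iff by blast
  obtain d where d: "0 \<le> d" "\<And>e x z. 0 \<le> e \<Longrightarrow> x \<in> V P e \<Longrightarrow>
    h (w (Suc m) z x) + vp (Suc m) z x + - 1 *\<^sub>C (w (Suc m) z (h x) + pv (Suc m) z x) \<in> V P (e + d)"
    by (rule fam_V[OF fam12]) blast
  have "g z = 0"
  proof (rule ode_zero[where e = "e + d", OF _ _ g'])
    show "g z \<in> V P (e + d)" for z
      using d(2)[OF e, of z] unfolding g_def by (simp add: algebra_simps)
    show "0 \<le> e + d"
      using e(1) d(1) by simp
    show "g 0 = 0"
      unfolding g_eq by (cases m) (simp_all add: w_Suc_at_0 w_0 Suc.prems)
  qed
  then show ?case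
    unfolding g_def by (simp add: algebra_simps)
qed

lemma dw_right: "x \<in> D \<Longrightarrow> dw n z x = - \<i> *\<^sub>C (w n z (h x) + pv n z x)"
  unfolding dw_def by (simp add: w_commute)

subsection \<open>Size of the Dyson terms\<close>

lemma has_integral_power_01: "((\<lambda>t::real. t ^ n) has_integral 1 / real (Suc n)) {0..1}"
proof -
  have "((\<lambda>t. t ^ Suc n / real (Suc n)) has_real_derivative t ^ n) (at t within {0..1})" for t :: real
    using DERIV_cdivide[OF DERIV_pow[of "Suc n" t "{0..1}"], of "real (Suc n)"]
    by (simp del: of_nat_Suc)
  then have "((\<lambda>t::real. t ^ n) has_integral (1 ^ Suc n / real (Suc n) - 0 ^ Suc n / real (Suc n))) {0..1}"
    by (intro fundamental_theorem_of_calculus) (auto simp: has_real_derivative_iff_has_vector_derivative)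
  then show ?thesis
    by simp
qed

text \<open>The outer free evolution is drawn under the integral, where it merges with the inner one
  into \<open>ex (\<zeta> - z)\<close>. The norm estimate needs this form.\<close>

lemma w_Suc_integral:
  assumes "x \<in> D"
  shows "w (Suc n) z x = segment_integral 0 z (\<lambda>\<zeta>. - \<i> *\<^sub>C ex (\<zeta> - z) (v (w n \<zeta> x)))"
proof -
  obtain e where e: "0 \<le> e" "x \<in> V P e"
    using assms unfolding D_iff by blast
  let ?e = "e + n * b + b"
  have "F \<zeta> (Vn n \<zeta> x) \<in> V P ?e" for \<zeta>
    by (rule F_V[OF _ Vn_V[OF e]]) (use e in simp)
  then have pr: "pr ?e (F \<zeta> (Vn n \<zeta> x)) = F \<zeta> (Vn n \<zeta> x)" for \<zeta>
    using V_iff by blast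
  obtain F' K' where "fam F F'" "fam (Vn n) K'"
    using fam_F fam_Vn by blast
  note cont = fam_continuous[OF fam_comp[OF this] assms]
  have 0: "0 \<le> ?e"
    using e by simp
  \<comment> \<open>\<open>ex (- z)\<close> alone need not be bounded; after projection to the
    energies that are reached it is, and may pass through the integral.\<close>
  have lin: "clinear (\<lambda>y. ex (- z) (pr ?e y))"
    unfolding clinear_on_def by (simp add: clinear_onD[OF clinear_pr] ex_linear)
  have "norm (ex (- z) (pr ?e y)) \<le> exp (cmod (- z) * ?e) * norm y" for y
    by (rule order_trans[OF ex_bound[OF 0 pr_V]]) (simp add: norm_pr_le mult_left_mono)
  then have bdd: "bounded_linear (\<lambda>y. ex (- z) (pr ?e y))"
    by (rule clinear_bounded_linear[OF lin])
  have "pr ?e (Vn (Suc n) z x) = Vn (Suc n) z x"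
    using Vn_V[OF e, of "Suc n" z] V_iff by (simp add: algebra_simps del: Vn.simps)
  then have "w (Suc n) z x = ex (- z) (pr ?e (segment_integral 0 z (\<lambda>\<zeta>. F \<zeta> (Vn n \<zeta> x))))"
    unfolding w_def by simp
  also have "\<dots> = segment_integral 0 z (\<lambda>\<zeta>. ex (- z) (pr ?e (F \<zeta> (Vn n \<zeta> x))))"
    by (rule segment_integral_linear[OF lin bdd cont, symmetric])
  also have "\<dots> = segment_integral 0 z (\<lambda>\<zeta>. - \<i> *\<^sub>C ex (\<zeta> - z) (v (w n \<zeta> x)))"
    unfolding pr unfolding F_def w_def
    using assms by (simp add: ex_linear ex_ex clinear_on_extra(2)[OF clinear_on_ex D_subspace])
  finally show ?thesis .
qed

text \<open>The growth factors of \<open>n\<close> successive interactions, the one with index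
  \<open>k\<close> acting at energy at most \<open>e + k * b\<close>.\<close>

definition vprod :: "nat \<Rightarrow> real \<Rightarrow> real" where
  "vprod n e = (\<Prod>k<n. c * sqrt (e + real k * b + 1))"

lemma vprod_nonneg: "0 \<le> e \<Longrightarrow> 0 \<le> vprod n e"
  unfolding vprod_def by (intro prod_nonneg) simp

text \<open>The factors \<open>e\<^sup>(\<^sup>\<zeta>\<^sup>-\<^sup>z\<^sup>)\<^sup>H\<^sub>0\<close> along the segment telescope, so that only one exponential
  of the energy appears.\<close>

lemma w_bound:
  assumes e: "0 \<le> e" "x \<in> V P e"
  shows "norm (w n z x) \<le> exp (cmod z * (e + n * b)) * (cmod z ^ n / fact n) * vprod n e * norm x"
proof (induction n arbitrary: z)
  case 0
  show ?case
    using ex_bound[OF e, of "- z"] by (simp add: w_0 vprod_def)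
next
  case (Suc n)
  let ?E = "e + Suc n * b" and ?E' = "e + n * b"
  let ?g = "\<lambda>\<zeta>. - \<i> *\<^sub>C ex (\<zeta> - z) (v (w n \<zeta> x))"
  define M where "M = exp (cmod z * ?E) * (cmod z ^ n / fact n) * vprod (Suc n) e * norm x"
  have x: "x \<in> D"
    using V_D e(2) by blast
  have "fam (\<lambda>\<zeta> x. ex (- z + 1 * \<zeta>) (v (w n \<zeta> x))) (\<lambda>\<zeta> x. 1 *\<^sub>C (\<i> *\<^sub>C h (ex (- z + 1 * \<zeta>) (v (w n \<zeta> x)))) +
      ex (- z + 1 * \<zeta>) (0 + v (dw n \<zeta> x)))"
    by (rule fam_comp[OF fam_affine[OF fam_ex] fam_comp[OF fam_tame[OF tame_H1] fam_w]])
  from fam_continuous[OF this x] have cont: "continuous_on UNIV (\<lambda>\<zeta>. ex (\<zeta> - z) (v (w n \<zeta> x)))"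
    by (simp add: add.commute)
  have bound: "norm (?g (0 + complex_of_real t * (z - 0))) \<le> M * t ^ n" if t: "t \<in> {0..1}" for t
  proof -
    let ?\<zeta> = "complex_of_real t * z"
    have cz: "cmod ?\<zeta> = t * cmod z" "cmod (?\<zeta> - z) = (1 - t) * cmod z"
    proof -
      have "?\<zeta> - z = complex_of_real (t - 1) * z"
        by (simp add: algebra_simps)
      then show "cmod (?\<zeta> - z) = (1 - t) * cmod z"
        using t by (simp only: norm_mult norm_of_real) simp
    qed (use t in \<open>simp add: norm_mult\<close>)
    have wV: "w n ?\<zeta> x \<in> V P ?E'"
      by (rule w_V[OF e])
    have "v (w n ?\<zeta> x) \<in> V P (?E' + b)"
      by (rule tame_V[OF tame_H1 _ wV]) (use e in simp)
    then have vV: "v (w n ?\<zeta> x) \<in> V P ?E"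
      by (simp add: algebra_simps)
    have "norm (?g (0 + complex_of_real t * (z - 0))) = norm (ex (?\<zeta> - z) (v (w n ?\<zeta> x)))"
      by (simp add: norm_scaleC)
    also have "\<dots> \<le> exp ((1 - t) * cmod z * ?E) * norm (v (w n ?\<zeta> x))"
      using ex_bound[OF _ vV, of "?\<zeta> - z"] e cz by simp
    also have "\<dots> \<le> exp ((1 - t) * cmod z * ?E) * (c * sqrt (?E' + 1) * norm (w n ?\<zeta> x))"
      by (intro mult_left_mono tame_bound[OF tame_H1 _ wV]) (use e in auto)
    also have "\<dots> \<le> exp ((1 - t) * cmod z * ?E) * (c * sqrt (?E' + 1) *
        (exp (cmod ?\<zeta> * ?E') * (cmod ?\<zeta> ^ n / fact n) * vprod n e * norm x))"
      using e by (intro mult_left_mono Suc.IH) auto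
    also have "\<dots> = exp ((1 - t) * cmod z * ?E + t * cmod z * ?E') *
        (c * sqrt (?E' + 1) * ((t * cmod z) ^ n / fact n) * vprod n e * norm x)"
      unfolding cz exp_add by (simp add: mult_ac)
    also have "\<dots> \<le> exp (cmod z * ?E) * (c * sqrt (?E' + 1) * ((t * cmod z) ^ n / fact n) * vprod n e * norm x)"
    proof (intro mult_right_mono)
      have "t * cmod z * ?E' \<le> t * cmod z * ?E"
        using t by (intro mult_left_mono) (auto simp: distrib_right)
      then show "exp ((1 - t) * cmod z * ?E + t * cmod z * ?E') \<le> exp (cmod z * ?E)"
        by (simp add: algebra_simps)
    qed (use e t vprod_nonneg in auto)
    also have "\<dots> = M * t ^ n"
      unfolding M_def vprod_def by (simp add: power_mult_distrib mult_ac)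
    finally show ?thesis .
  qed
  have int: "(\<lambda>t. ?g (0 + complex_of_real t * (z - 0))) integrable_on {0..1}"
    by (intro integrable_continuous_interval continuous_on_scaleC continuous_on_const
        continuous_on_compose2[OF cont]) (auto intro!: continuous_intros)
  have "norm (integral {0..1} (\<lambda>t. ?g (0 + complex_of_real t * (z - 0)))) \<le> integral {0..1} (\<lambda>t. M * t ^ n)"
    by (rule integral_norm_bound_integral[OF int _ bound])
      (use has_integral_power_01 in \<open>auto intro!: integrable_on_mult_right\<close>)
  also have "\<dots> = M / Suc n"
    using integral_unique[OF has_integral_mult_right[OF has_integral_power_01, of M n]]
    by (simp only: times_divide_eq_right mult_1_right)
  finally have "cmod (z - 0) * norm (integral {0..1} (\<lambda>t. ?g (0 + complex_of_real t * (z - 0)))) \<le>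
      cmod (z - 0) * (M / Suc n)"
    by (rule mult_left_mono) simp
  then have "norm (w (Suc n) z x) \<le> cmod z * (M / Suc n)"
    unfolding w_Suc_integral[OF x] segment_integral_def norm_scaleC by (simp only: diff_zero)
  also have "\<dots> = exp (cmod z * ?E) * (cmod z ^ Suc n / fact (Suc n)) * vprod (Suc n) e * norm x"
    unfolding M_def by (simp add: field_simps)
  finally show ?case .
qed

subsection \<open>The evolution operators\<close>

lemma iter_integral_cong:
  "(\<And>\<zeta>s. length \<zeta>s = n \<Longrightarrow> G \<zeta>s = G' \<zeta>s) \<Longrightarrow> iter_integral n a z G = iter_integral n a z G'"
proof (induction n arbitrary: z G G')
  case (Suc n)
  have "iter_integral n a \<zeta> (\<lambda>\<zeta>s. G (\<zeta> # \<zeta>s)) = iter_integral n a \<zeta> (\<lambda>\<zeta>s. G' (\<zeta> # \<zeta>s))" for \<zeta>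
    by (rule Suc.IH) (use Suc.prems in simp)
  then show ?case by simp
qed simp

definition F1 :: "complex \<Rightarrow> 'a \<Rightarrow> 'a" where
  "F1 z x = ex z (v (ex (- z) x))"

lemma F1_V: "0 \<le> e \<Longrightarrow> x \<in> V P e \<Longrightarrow> F1 z x \<in> V P (e + b)"
  unfolding F1_def using tame_V[OF tame_H1] by simp

lemma foldr_F1_V: "0 \<le> e \<Longrightarrow> x \<in> V P e \<Longrightarrow> foldr F1 \<zeta>s x \<in> V P (e + length \<zeta>s * b)"
proof (induction \<zeta>s)
  case (Cons \<zeta> \<zeta>s)
  have "F1 \<zeta> (foldr F1 \<zeta>s x) \<in> V P (e + length \<zeta>s * b + b)"
    by (rule F1_V[OF _ Cons.IH[OF Cons.prems]]) (use Cons.prems in simp)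
  then show ?case by (simp add: algebra_simps)
qed simp

text \<open>The integral is peeled from the outside while the vector is built from the inside.
  \<open>L\<close> stores the outer factors already fixed; the projection \<open>pr ?E\<close> keeps
  it bounded in the next step.\<close>

lemma iter_integral_Vn:
  assumes e: "0 \<le> e" "x \<in> V P e" and L: "clinear L" "bounded_linear L"
  shows "iter_integral n 0 z (\<lambda>\<zeta>s. L (foldr F1 \<zeta>s x)) = \<i> ^ n *\<^sub>C L (Vn n z x)"
  using L
proof (induction n arbitrary: L z)
  case (Suc n)
  let ?E = "e + n * b"
  have x: "x \<in> D" and E: "0 \<le> ?E"
    using V_D e by auto
  have *: "iter_integral n 0 \<zeta> (\<lambda>\<zeta>s. L (foldr F1 (\<zeta> # \<zeta>s) x)) = \<i> ^ Suc n *\<^sub>C L (F \<zeta> (Vn n \<zeta> x))" for \<zeta>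
  proof -
    let ?L = "\<lambda>y. L (F1 \<zeta> (pr ?E y))"
    obtain F' where "fam F F'"
      using fam_F by blast
    then obtain C where C: "0 \<le> C" "\<And>x z. x \<in> V P ?E \<Longrightarrow> cmod z \<le> cmod \<zeta> \<Longrightarrow> norm (F z x) \<le> C * norm x"
      using fam_bound[OF _ E] by metis
    have F1F: "F1 \<zeta> y = \<i> *\<^sub>C F \<zeta> y" for y
      unfolding F1_def F_def by (simp add: scaleC_scaleC)
    have lin1: "clinear (\<lambda>y. F1 \<zeta> (pr ?E y))"
      unfolding clinear_on_def F1_def by (simp add: clinear_onD[OF clinear_pr] ex_linear v_linear)
    have "norm (F1 \<zeta> (pr ?E y)) \<le> C * norm y" for y
      using C(2)[OF pr_V order_refl, of y] mult_left_mono[OF norm_pr_le C(1), of ?E y]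
      unfolding F1F norm_scaleC by simp
    then have bdd1: "bounded_linear (\<lambda>y. F1 \<zeta> (pr ?E y))"
      by (rule clinear_bounded_linear[OF lin1])
    have "iter_integral n 0 \<zeta> (\<lambda>\<zeta>s. L (foldr F1 (\<zeta> # \<zeta>s) x)) = iter_integral n 0 \<zeta> (\<lambda>\<zeta>s. ?L (foldr F1 \<zeta>s x))"
    proof (rule iter_integral_cong)
      fix \<zeta>s :: "complex list" assume "length \<zeta>s = n"
      then have "pr ?E (foldr F1 \<zeta>s x) = foldr F1 \<zeta>s x"
        using foldr_F1_V[OF e, of \<zeta>s] V_iff by simp
      then show "L (foldr F1 (\<zeta> # \<zeta>s) x) = ?L (foldr F1 \<zeta>s x)"
        by simp
    qed
    also have "\<dots> = \<i> ^ n *\<^sub>C ?L (Vn n \<zeta> x)"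
      by (intro Suc.IH clinear_comp[OF Suc.prems(1) lin1]
          bounded_linear_compose[OF Suc.prems(2) bdd1])
    also have "?L (Vn n \<zeta> x) = \<i> *\<^sub>C L (F \<zeta> (Vn n \<zeta> x))"
      using Vn_V[OF e, of n \<zeta>] unfolding V_iff F1F by (simp add: clinear_onD[OF Suc.prems(1)])
    finally show ?thesis
      by (simp add: scaleC_scaleC mult.commute)
  qed
  obtain F' K' where "fam F F'" "fam (Vn n) K'"
    using fam_F fam_Vn by blast
  note cont = fam_continuous[OF fam_comp[OF this] x]
  show ?case
    unfolding iter_integral.simps * Vn.simps
    by (rule segment_integral_linear[OF _ _ cont])
      (use Suc.prems in \<open>auto simp: clinear_on_def scaleC_add_right scaleC_scaleC mult.commute
         intro: bounded_linear_compose[OF bounded_linear_scaleC_right]\<close>)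
qed simp

lemma acts_op_prod_at_time: "acts (op_prod (map (at_time P H1) \<zeta>s)) (foldr F1 \<zeta>s)"
  unfolding F1_def[abs_def] by (rule acts_op_prod_map[OF acts_at_time[OF H1_C0]])

lemma evol_U_eq: "evol_U P H1 z 0 = {(x, y). x \<in> D \<and> (\<lambda>n. Vn n z x) sums y}"
proof -
  have "(- \<i>) ^ n *\<^sub>C iter_integral n 0 z (\<lambda>\<zeta>s. op_app (op_prod (map (at_time P H1) \<zeta>s)) x) = Vn n z x"
    if x: "x \<in> D" for x n
  proof -
    obtain e where e: "0 \<le> e" "x \<in> V P e"
      using x unfolding D_iff by blast
    have id: "clinear (\<lambda>x::'a. x)"
      by (simp add: clinear_on_def)
    have "iter_integral n 0 z (\<lambda>\<zeta>s. op_app (op_prod (map (at_time P H1) \<zeta>s)) x) = \<i> ^ n *\<^sub>C Vn n z x"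
      unfolding acts_op_app[OF acts_op_prod_at_time x]
      by (rule iter_integral_Vn[OF e id bounded_linear_ident])
    moreover have "(- \<i>) ^ n * \<i> ^ n = 1"
      by (simp flip: power_mult_distrib)
    ultimately show ?thesis
      by (simp add: scaleC_scaleC)
  qed
  then show ?thesis
    unfolding evol_U_def by (auto cong: conj_cong)
qed

end

section \<open>Rapidly decreasing sequences\<close>

text \<open>The growth of \<open>n\<close> interactions contributes \<open>sqrt (n!)\<close>, the
  ordered integration \<open>1 / n!\<close>. The class is stable under convolution with Dyson terms
  and under operators of type \<open>tame\<close>.\<close>

definition fast :: "(nat \<Rightarrow> 'a::real_normed_vector) \<Rightarrow> bool" where
  "fast f \<longleftrightarrow> (\<exists>C\<ge>0. \<exists>R\<ge>0. \<forall>n. norm (f n) \<le> C * R ^ n / sqrt (fact n))"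

lemma fastI: "0 \<le> C \<Longrightarrow> 0 \<le> R \<Longrightarrow> (\<And>n. norm (f n) \<le> C * R ^ n / sqrt (fact n)) \<Longrightarrow> fast f"
  unfolding fast_def by blast

lemma fastE:
  assumes "fast f"
  obtains C R where "0 \<le> C" "0 \<le> R" "\<And>n. norm (f n) \<le> C * R ^ n / sqrt (fact n)"
  using assms unfolding fast_def by blast

lemma summable_fast_bound:
  assumes "0 \<le> C" "0 \<le> R"
  shows "summable (\<lambda>n. C * R ^ n / sqrt (fact n))"
proof (rule summable_comparison_test')
  show "summable (\<lambda>n. C * sqrt (exp (4 * R\<^sup>2)) * (1 / 2) ^ n)"
    by (intro summable_mult summable_geometric) simp
  fix n :: nat
  \<comment> \<open>One term of the exponential series. Its square root bounds
    \<open>(2 * R) ^ n / sqrt (n!)\<close>, which leaves a geometric majorant of ratio 1/2.\<close>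
  have "(4 * R\<^sup>2) ^ n /\<^sub>R fact n \<le> exp (4 * R\<^sup>2)"
    unfolding exp_def using sum_le_suminf[OF summable_exp_generic[of "4 * R\<^sup>2"], of "{n}"] by simp
  moreover have "((2 * R) ^ n)\<^sup>2 = (4 * R\<^sup>2) ^ n"
  proof -
    have "((2 * R) ^ n)\<^sup>2 = ((2 * R)\<^sup>2) ^ n"
      by (simp only: power_mult[symmetric] mult.commute)
    then show ?thesis
      by (simp add: power_mult_distrib)
  qed
  ultimately have "sqrt (((2 * R) ^ n)\<^sup>2 / fact n) \<le> sqrt (exp (4 * R\<^sup>2))"
    by (simp add: divide_inverse mult.commute)
  moreover have "sqrt (((2 * R) ^ n)\<^sup>2 / fact n) = (2 * R) ^ n / sqrt (fact n)"
    using assms(2) by (simp add: real_sqrt_divide)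
  ultimately have "(2 * R) ^ n / sqrt (fact n) \<le> sqrt (exp (4 * R\<^sup>2))"
    by (simp only:)
  then have "2 ^ n * (R ^ n / sqrt (fact n)) \<le> sqrt (exp (4 * R\<^sup>2))"
    by (simp add: power_mult_distrib)
  then have "R ^ n / sqrt (fact n) \<le> sqrt (exp (4 * R\<^sup>2)) * (1 / 2) ^ n"
    by (simp add: field_simps power_one_over)
  from mult_left_mono[OF this assms(1)]
  show "norm (C * R ^ n / sqrt (fact n)) \<le> C * sqrt (exp (4 * R\<^sup>2)) * (1 / 2) ^ n"
    using assms by (simp add: mult.assoc)
qed

lemma fast_summable:
  assumes "fast f"
  shows "summable (\<lambda>n. norm (f n))"
proof -
  obtain C R where CR: "0 \<le> C" "0 \<le> R" "\<And>n. norm (f n) \<le> C * R ^ n / sqrt (fact n)"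
    by (rule fastE[OF assms]) blast
  then show ?thesis
    by (intro summable_comparison_test'[OF summable_fast_bound[OF CR(1,2)]]) simp
qed

lemma fast_summable': "fast f \<Longrightarrow> summable f" for f :: "nat \<Rightarrow> 'a::banach"
  using fast_summable summable_norm_cancel by blast

lemma fast_tendsto_0: "fast f \<Longrightarrow> f \<longlonglongrightarrow> 0" for f :: "nat \<Rightarrow> 'a::banach"
  by (rule summable_LIMSEQ_zero[OF fast_summable'])

text \<open>Linear growth in the order is absorbed by doubling the base \<open>R\<close>.\<close>

lemma fast_linear_factor:
  assumes f: "fast f" and "0 \<le> p" "0 \<le> q" and g: "\<And>n. norm (g n) \<le> (p + q * real n) * norm (f n)"
  shows "fast g"
proof -
  obtain C R where CR: "0 \<le> C" "0 \<le> R" "\<And>n. norm (f n) \<le> C * R ^ n / sqrt (fact n)"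
    by (rule fastE[OF f]) blast
  show ?thesis
  proof (rule fastI[where C = "(p + q) * C" and R = "2 * R"])
    fix n
    have "real n \<le> 2 ^ n" "(1::real) \<le> 2 ^ n"
      using of_nat_less_two_power[of n, where ?'a = real] by simp_all
    then have "p + q * real n \<le> (p + q) * 2 ^ n"
      using assms(2,3) mult_left_mono[of "real n" "2 ^ n" q] mult_left_mono[of 1 "2 ^ n" p]
      by (simp add: distrib_right)
    then have "norm (g n) \<le> ((p + q) * 2 ^ n) * (C * R ^ n / sqrt (fact n))"
      using g[of n] CR(3)[of n] assms(2,3) by (intro order_trans[OF g] mult_mono) auto
    then show "norm (g n) \<le> (p + q) * C * (2 * R) ^ n / sqrt (fact n)"
      by (simp add: power_mult_distrib mult_ac)
  qed (use assms CR in auto)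
qed

lemma fast_geometric_factor:
  assumes f: "fast f" and "0 \<le> p" "0 \<le> q" and g: "\<And>n. norm (g n) \<le> p * q ^ n * norm (f n)"
  shows "fast g"
proof -
  obtain C R where CR: "0 \<le> C" "0 \<le> R" "\<And>n. norm (f n) \<le> C * R ^ n / sqrt (fact n)"
    by (rule fastE[OF f]) blast
  show ?thesis
  proof (rule fastI[where C = "p * C" and R = "q * R"])
    fix n
    have "norm (g n) \<le> p * q ^ n * (C * R ^ n / sqrt (fact n))"
      using g[of n] CR(3)[of n] assms(2,3) by (intro order_trans[OF g] mult_left_mono) auto
    then show "norm (g n) \<le> p * C * (q * R) ^ n / sqrt (fact n)"
      by (simp add: power_mult_distrib mult_ac)
  qed (use assms CR in auto)
qed

text \<open>Summable majorants are asked of the derivatives only, one for each disc; the functions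
  themselves need only pointwise convergence.\<close>

lemma has_cderiv_series:
  assumes d: "\<And>n z. has_cderiv (f n) (d n z) z"
    and M: "\<And>r. \<exists>M. summable M \<and> (\<forall>n z. cmod z \<le> r \<longrightarrow> norm (d n z) \<le> M n)"
    and f: "\<And>z. summable (\<lambda>n. f n z)"
  shows "has_cderiv (\<lambda>z. \<Sum>n. f n z) (\<Sum>n. d n z) z"
proof -
  define r where "r = cmod z + 1"
  obtain M where M: "summable M" "\<And>n z. cmod z \<le> r \<Longrightarrow> norm (d n z) \<le> M n"
    using assms(2)[of r] by blast
  let ?S = "ball (0::complex) r"
  have "uniform_limit ?S (\<lambda>n z. \<Sum>i<n. d i z) (\<lambda>z. \<Sum>i. d i z) sequentially"
    by (rule Weierstrass_m_test[OF _ M(1)]) (simp add: M(2))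
  then have ul: "\<forall>\<^sub>F n in sequentially. \<forall>z\<in>?S. norm ((\<Sum>i<n. d i z) - (\<Sum>i. d i z)) < e" if "0 < e" for e
    using that unfolding uniform_limit_iff dist_norm by blast
  have z: "z \<in> ?S"
    unfolding r_def by simp
  have "\<exists>g. \<forall>x\<in>?S. (\<lambda>n. f n x) sums g x \<and> (g has_derivative (\<lambda>k. k *\<^sub>C (\<Sum>n. d n x))) (at x within ?S)"
  proof (rule has_derivative_series[OF convex_ball _ _ z summable_sums[OF f]])
    show "(f n has_derivative (\<lambda>k. k *\<^sub>C d n x)) (at x within ?S)" for n x
      using d[of n x] unfolding has_cderiv_def by (rule has_derivative_at_withinI)
    fix e :: real assume "0 < e"
    from ul[OF this] show "\<forall>\<^sub>F n in sequentially. \<forall>x\<in>?S. \<forall>k.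
        norm ((\<Sum>i<n. k *\<^sub>C d i x) - k *\<^sub>C (\<Sum>n. d n x)) \<le> e * norm k"
    proof eventually_elim
      case (elim n)
      show ?case
      proof (intro ballI allI)
        fix x k :: complex assume "x \<in> ?S"
        then have "norm ((\<Sum>i<n. d i x) - (\<Sum>n. d n x)) \<le> e"
          using elim by (meson less_imp_le)
        then have "norm ((\<Sum>i<n. d i x) - (\<Sum>n. d n x)) * norm k \<le> e * norm k"
          by (rule mult_right_mono) simp
        then show "norm ((\<Sum>i<n. k *\<^sub>C d i x) - k *\<^sub>C (\<Sum>n. d n x)) \<le> e * norm k"
          by (simp add: norm_scaleC mult.commute
              flip: complex_vector.scale_sum_right complex_vector.scale_right_diff_distrib)
      qed
    qed
  qed
  then obtain g where g: "\<And>x. x \<in> ?S \<Longrightarrow> (\<lambda>n. f n x) sums g x"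
    "(g has_derivative (\<lambda>k. k *\<^sub>C (\<Sum>n. d n z))) (at z within ?S)"
    using z by blast
  have "g x = (\<Sum>n. f n x)" if "x \<in> ?S" for x
    using g(1)[OF that] sums_unique by blast
  then show ?thesis
    using has_derivative_transform[OF z _ g(2), of "\<lambda>z. \<Sum>n. f n z"] z
    unfolding has_cderiv_def by (simp add: at_within_open[OF z open_ball])
qed

section \<open>The full Hamiltonian\<close>

locale symmetric_interaction = interaction +
  assumes symmetric_H1: "symmetric_op H1"
begin

definition H :: "'a oper" where "H = op_add H0 H1"

lemma linear_H1: "linear_op H1" and closed_H1: "closed H1"
  using H1_C0 unfolding class_C0_def by blast+

lemma H1_symmetric: "(x, y) \<in> H1 \<Longrightarrow> (u, u') \<in> H1 \<Longrightarrow> cinner x u' = cinner y u"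
  using symmetric_H1 unfolding symmetric_op_def adj_def by blast

lemma v_mem: "x \<in> D \<Longrightarrow> (x, v x) \<in> H1"
  by (rule class_C0_mem[OF H1_C0])

lemma H_iff: "(x, y) \<in> H \<longleftrightarrow> (\<exists>p q. (x, p) \<in> H0 \<and> (x, q) \<in> H1 \<and> y = p + q)"
  unfolding H_def op_add_def by auto

lemma linear_H: "linear_op H"
  unfolding linear_op_def
proof (intro conjI allI impI)
  show "single_valued H"
    using linear_opD(1)[OF linear_H0] linear_opD(1)[OF linear_H1]
    unfolding single_valued_def H_iff by metis
  show "(0, 0) \<in> H"
    using linear_opD(2)[OF linear_H0] linear_opD(2)[OF linear_H1] unfolding H_iff
    by (metis add.right_neutral)
  show "(x + u, y + u') \<in> H" if xy: "(x, y) \<in> H" "(u, u') \<in> H" for x y u u'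
  proof -
    obtain p q where pq: "(x, p) \<in> H0" "(x, q) \<in> H1" "y = p + q"
      using xy(1) unfolding H_iff by blast
    obtain p' q' where pq': "(u, p') \<in> H0" "(u, q') \<in> H1" "u' = p' + q'"
      using xy(2) unfolding H_iff by blast
    show ?thesis
      unfolding H_iff
      using linear_opD(3)[OF linear_H0 pq(1) pq'(1)] linear_opD(3)[OF linear_H1 pq(2) pq'(2)] pq pq'
      by (intro exI[of _ "p + p'"] exI[of _ "q + q'"]) auto
  qed
  show "(k *\<^sub>C x, k *\<^sub>C y) \<in> H" if xy: "(x, y) \<in> H" for k x y
  proof -
    obtain p q where pq: "(x, p) \<in> H0" "(x, q) \<in> H1" "y = p + q"
      using xy(1) unfolding H_iff by blast
    show ?thesis
      unfolding H_iff
      using linear_opD(4)[OF linear_H0 pq(1)] linear_opD(4)[OF linear_H1 pq(2)] pq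
      by (intro exI[of _ "k *\<^sub>C p"] exI[of _ "k *\<^sub>C q"]) (auto simp: scaleC_add_right)
  qed
qed

lemma H_symmetric: "(x, y) \<in> H \<Longrightarrow> (u, u') \<in> H \<Longrightarrow> cinner x u' = cinner y u"
  unfolding H_iff using H0_symmetric H1_symmetric by (auto simp: cinner_add_left cinner_add_right)

lemma H_mem: "x \<in> D \<Longrightarrow> (x, h x + v x) \<in> H"
  unfolding H_iff using h_mem v_mem by blast

lemma H_real:
  assumes "(x, y) \<in> H"
  shows "cinner x y = complex_of_real (Re (cinner x y))"
proof -
  have "cinner x y = cnj (cinner x y)"
    using H_symmetric[OF assms assms] cinner_commute by metis
  then show ?thesis
    by (metis Reals_cnj_iff of_real_Re)
qed

subsection \<open>The Kato--Rellich theorem\<close>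

text \<open>The resolvent \<open>(H0 + k)^(-1)\<close>, through the bounded calculus.\<close>

definition R0 :: "real \<Rightarrow> 'a \<Rightarrow> 'a" where
  "R0 k = bfc (cut {0..} (\<lambda>l. complex_of_real (1 / (l + k))))"

context
  fixes k :: real
  assumes k: "0 < k"
begin

lemma bounded_borel_R0: "bounded_borel (cut {0..} (\<lambda>l. complex_of_real (1 / (l + k))))"
  by (rule bounded_borel_cutI[where M = "1 / k"]) (use k in \<open>auto simp: frac_le norm_divide simp flip: of_real_add\<close>)

lemma clinear_R0: "clinear (R0 k)" and bounded_linear_R0: "bounded_linear (R0 k)"
  unfolding R0_def by (rule clinear_bfc bounded_linear_bfc, rule bounded_borel_R0)+

lemma norm_R0_le: "norm (R0 k y) \<le> norm y / k"
  using bfc_bound[OF bounded_borel_R0, of "1 / k" y] k unfolding R0_def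
  by (auto simp: cut_def frac_le norm_divide simp flip: of_real_add)

lemma R0_pr: "pr e (R0 k y) = R0 k (pr e y)"
proof -
  have "R0 k (pr e y) = bfc (cut {0..} (\<lambda>l. complex_of_real (1 / (l + k)))) (bfc (cut {0..e} (\<lambda>_. 1)) y)"
    unfolding R0_def by (simp add: bfc_indicator)
  also have "\<dots> = bfc (cut {0..e} (\<lambda>_. 1)) (R0 k y)"
    unfolding R0_def by (intro bfc_commute bounded_borel_R0 bounded_borel_cut bounded_borel_const) auto
  finally show ?thesis
    by (simp add: bfc_indicator)
qed

lemma h_R0: "h (pr e (R0 k y)) = pr e y - complex_of_real k *\<^sub>C pr e (R0 k y)"
proof -
  define f where "f = cut {0..} (\<lambda>l. complex_of_real (1 / (l + k)))"
  have bb0: "bounded_borel f"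
    unfolding f_def by (rule bounded_borel_R0)
  have bb: "bounded_borel (cut {0..e} f)" "bounded_borel (cut {0..e} complex_of_real)"
    by (intro bounded_borel_cut bb0 bounded_borel_cut_continuous; simp)+
  have pr: "pr e (R0 k y) = bfc (cut {0..e} f) y"
    unfolding R0_def f_def[symmetric] by (rule bfc_P[OF bb0]) simp
  have "h (pr e (R0 k y)) = bfc (cut {0..e} complex_of_real) (bfc (cut {0..e} f) y)"
    unfolding h_def pr[symmetric] by (rule fD_eq[OF continuous_id pr_V])
  also have "\<dots> = bfc (\<lambda>l. cut {0..e} complex_of_real l * cut {0..e} f l) y"
    by (rule bfc_mult[OF bb(2,1), symmetric])
  also have "(\<lambda>l. cut {0..e} complex_of_real l * cut {0..e} f l) =
      (\<lambda>l. cut {0..e} (\<lambda>_. 1) l - complex_of_real k * cut {0..e} f l)"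
  proof
    fix l
    have "complex_of_real l * complex_of_real (1 / (l + k)) = 1 - complex_of_real k * complex_of_real (1 / (l + k))"
      if "0 \<le> l"
    proof -
      have "l * (1 / (l + k)) = 1 - k * (1 / (l + k))"
        using that k by (simp add: field_simps)
      then show ?thesis
        by (metis of_real_1 of_real_diff of_real_mult)
    qed
    then show "cut {0..e} complex_of_real l * cut {0..e} f l =
        cut {0..e} (\<lambda>_. 1) l - complex_of_real k * cut {0..e} f l"
      by (auto simp: cut_def f_def)
  qed
  also have "bfc \<dots> y = pr e y - complex_of_real k *\<^sub>C bfc (cut {0..e} f) y"
    by (subst bfc_diff) (auto intro: bounded_borel_cut bounded_borel_const bounded_borel_cmult bb
        simp: bfc_cmult bb bfc_indicator)
  finally show ?thesis
    unfolding pr .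
qed

lemma R0_mem: "(R0 k y, y - complex_of_real k *\<^sub>C R0 k y) \<in> H0"
proof (rule closed_opD[OF closed_H0])
  show "(pr (real n) (R0 k y), pr (real n) y - complex_of_real k *\<^sub>C pr (real n) (R0 k y)) \<in> H0" for n
    using h_mem[OF pr_D, of "real n" "R0 k y"] unfolding h_R0 .
  show "(\<lambda>n. pr (real n) (R0 k y)) \<longlonglongrightarrow> R0 k y"
    by (rule pr_tendsto)
  show "(\<lambda>n. pr (real n) y - complex_of_real k *\<^sub>C pr (real n) (R0 k y)) \<longlonglongrightarrow> y - complex_of_real k *\<^sub>C R0 k y"
    by (intro tendsto_intros pr_tendsto)
qed

text \<open>Otherwise the difference of two solutions would be an eigenvector of \<open>H0\<close>
  with eigenvalue \<open>- k\<close>, against nonnegativity.\<close>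

lemma R0_unique:
  assumes "(x, y) \<in> H0"
  shows "x = R0 k (y + complex_of_real k *\<^sub>C x)"
proof -
  let ?u = "x - R0 k (y + complex_of_real k *\<^sub>C x)"
  have "(?u, y - (y + complex_of_real k *\<^sub>C x - complex_of_real k *\<^sub>C R0 k (y + complex_of_real k *\<^sub>C x))) \<in> H0"
    by (rule linear_op_diff[OF linear_H0 assms R0_mem])
  then have "(?u, - (complex_of_real k *\<^sub>C ?u)) \<in> H0"
    by (simp add: complex_vector.scale_right_diff_distrib)
  then have "0 \<le> Re (cinner ?u (- (complex_of_real k *\<^sub>C ?u)))"
    using nonneg_H0 unfolding nonneg_op_def by blast
  then have "k * (norm ?u)\<^sup>2 \<le> 0"
    by (simp add: cinner_scaleC_right cinner_norm del: of_real_power)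
  then have "(norm ?u)\<^sup>2 \<le> 0"
    using k by (simp add: mult_le_0_iff)
  then show ?thesis
    by simp
qed

end

section \<open>Smallness of the interaction relative to the free Hamiltonian\<close>

lemma v_sqrt_bound:
  obtains a a' where "0 \<le> a" "0 \<le> a'"
    "\<And>x. x \<in> D \<Longrightarrow> norm (v x) \<le> a * sqrt (Re (cinner x (h x))) + a' * norm x"
    "\<And>x. x \<in> D \<Longrightarrow> 0 \<le> Re (cinner x (h x))"
proof -
  have "op_bounded_by H1 (sqrt_op P)"
    using H1_C0 unfolding class_C0_def by blast
  then obtain a a' where a: "0 \<le> a" "0 \<le> a'"
    "\<And>x. x \<in> D \<Longrightarrow> norm (v x) \<le> a * norm (op_app (sqrt_op P) x) + a' * norm x"
    by (rule op_bounded_by_sqrt) blast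
  have s: "(norm (op_app (sqrt_op P) x))\<^sup>2 = Re (cinner x (h x))" if x: "x \<in> D" for x
    using x sqrt_op_D(3) unfolding D_iff by blast
  show ?thesis
  proof (rule that[OF a(1,2)])
    fix x assume x: "x \<in> D"
    show "norm (v x) \<le> a * sqrt (Re (cinner x (h x))) + a' * norm x"
      using a(3)[OF x] s[OF x, symmetric] by simp
    show "0 \<le> Re (cinner x (h x))"
      unfolding s[OF x, symmetric] by simp
  qed
qed

text \<open>A bound by the square root of \<open>H0\<close> makes the interaction infinitesimally
  small relative to \<open>H0\<close>: applied to \<open>R0 k y\<close> it is of order
  \<open>1 / sqrt k\<close>.\<close>

lemma v_R0_bound:
  obtains k0 where "0 < k0" "\<And>k y. k0 \<le> k \<Longrightarrow> y \<in> D \<Longrightarrow> R0 k y \<in> D \<and> norm (v (R0 k y)) \<le> norm y / 2"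
proof -
  obtain a a' where a: "0 \<le> a" "0 \<le> a'"
    "\<And>x. x \<in> D \<Longrightarrow> norm (v x) \<le> a * sqrt (Re (cinner x (h x))) + a' * norm x"
    by (rule v_sqrt_bound) blast
  \<comment> \<open>Chosen so that the terms with \<open>a\<close> and with \<open>a'\<close>
    contribute at most a quarter of \<open>norm y\<close> each.\<close>
  define k0 where "k0 = max 1 (max (16 * a\<^sup>2) (4 * a'))"
  show ?thesis
  proof (rule that)
    show "0 < k0"
      unfolding k0_def by simp
    fix k y assume k: "k0 \<le> k" and y: "y \<in> D"
    have k_pos: "0 < k" and k1: "16 * a\<^sup>2 \<le> k" and k2: "4 * a' \<le> k"
      using k unfolding k0_def by auto
    obtain e where e: "y \<in> V P e"
      using y unfolding D_iff by blast
    let ?x = "R0 k y"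
    have pr: "pr e ?x = ?x" "pr e y = y"
      using e unfolding V_iff by (simp_all add: R0_pr[OF k_pos])
    have x: "?x \<in> D"
      using pr(1) pr_D by metis
    have "h ?x = y - complex_of_real k *\<^sub>C ?x"
      using h_R0[OF k_pos, of e y] unfolding pr .
    then have "Re (cinner ?x (h ?x)) = Re (cinner ?x y) - k * (norm ?x)\<^sup>2"
      by (simp add: cinner_diff_right cinner_scaleC_right cinner_norm del: of_real_power)
    also have "\<dots> \<le> norm ?x * norm y"
      using complex_Re_le_cmod[of "cinner ?x y"] Cauchy_Schwarz[of ?x y] k_pos
      by (smt (verit) mult_nonneg_nonneg zero_le_power2)
    also have "\<dots> \<le> (norm y / k) * norm y"
      by (intro mult_right_mono norm_R0_le[OF k_pos]) simp
    finally have "sqrt (Re (cinner ?x (h ?x))) \<le> sqrt ((norm y)\<^sup>2 / k)"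
      by (simp add: power2_eq_square)
    then have s: "sqrt (Re (cinner ?x (h ?x))) \<le> norm y / sqrt k"
      by (simp add: real_sqrt_divide)
    have "4 * a \<le> sqrt k"
      using k1 a(1) by (intro real_le_rsqrt) (simp add: power_mult_distrib)
    then have "a * (norm y / sqrt k) \<le> norm y / 4"
      using k_pos mult_right_mono[of "4 * a" "sqrt k" "norm y"] by (simp add: field_simps)
    moreover have "a' * (norm y / k) \<le> norm y / 4"
      using k_pos mult_right_mono[OF k2, of "norm y"] by (simp add: field_simps)
    moreover have "norm (v ?x) \<le> a * (norm y / sqrt k) + a' * (norm y / k)"
      using a(3)[OF x] mult_left_mono[OF s a(1)] mult_left_mono[OF norm_R0_le[OF k_pos, of y] a(2)]
      by linarith
    ultimately show "?x \<in> D \<and> norm (v ?x) \<le> norm y / 2"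
      using x by linarith
  qed
qed

text \<open>Bounded maps on \<open>D\<close> are extended to the whole space along the cutoffs
  \<open>pr n\<close>, so that no approximating sequence has to be chosen.\<close>

lemma Cauchy_linear_pr:
  assumes T: "\<And>x y. x \<in> D \<Longrightarrow> y \<in> D \<Longrightarrow> T (x - y) = T x - T y"
    and bound: "\<And>x. x \<in> D \<Longrightarrow> norm (T x) \<le> C * norm x"
  shows "convergent (\<lambda>n. T (pr (real n) y) :: 'a)"
proof -
  have C: "norm (T x) \<le> (\<bar>C\<bar> + 1) * norm x" if "x \<in> D" for x
  proof -
    have "C \<le> \<bar>C\<bar> + 1"
      by linarith
    from mult_right_mono[OF this norm_ge_zero[of x]] bound[OF that] show ?thesis
      by linarith
  qed
  have "Cauchy (\<lambda>n. pr (real n) y)"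
    using pr_tendsto by (rule LIMSEQ_imp_Cauchy)
  have "Cauchy (\<lambda>n. T (pr (real n) y))"
  proof (rule metric_CauchyI)
    fix e :: real assume "0 < e"
    then have "0 < e / (\<bar>C\<bar> + 1)"
      by simp
    then obtain M where M: "\<And>m n. M \<le> m \<Longrightarrow> M \<le> n \<Longrightarrow> dist (pr (real m) y) (pr (real n) y) < e / (\<bar>C\<bar> + 1)"
      using \<open>Cauchy (\<lambda>n. pr (real n) y)\<close> unfolding Cauchy_def by meson
    have "dist (T (pr (real m) y)) (T (pr (real n) y)) < e" if "M \<le> m" "M \<le> n" for m n
    proof -
      have "dist (T (pr (real m) y)) (T (pr (real n) y)) = norm (T (pr (real m) y - pr (real n) y))"
        by (simp add: dist_norm T)
      also have "\<dots> \<le> (\<bar>C\<bar> + 1) * dist (pr (real m) y) (pr (real n) y)"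
        unfolding dist_norm by (rule C) simp
      also have "\<dots> < e"
        using M[OF that] by (simp add: field_simps)
      finally show ?thesis .
    qed
    then show "\<exists>M. \<forall>m\<ge>M. \<forall>n\<ge>M. dist (T (pr (real m) y)) (T (pr (real n) y)) < e"
      by blast
  qed
  then show ?thesis
    by (rule Cauchy_convergent)
qed

text \<open>\<open>B\<close> is \<open>H\<^sub>1 (H\<^sub>0 + k)\<^sup>-\<^sup>1\<close>.\<close>

lemma relative_bound:
  obtains k0 where "0 < k0" "\<And>k. k0 \<le> k \<Longrightarrow> \<exists>B. clinear B \<and> (\<forall>y. (R0 k y, B y) \<in> H1) \<and>
    (\<forall>y. norm (B y) \<le> norm y / 2) \<and> (\<forall>y\<in>D. B y = v (R0 k y))"
proof -
  obtain k0 where k0: "0 < k0"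
    "\<And>k y. k0 \<le> k \<Longrightarrow> y \<in> D \<Longrightarrow> R0 k y \<in> D \<and> norm (v (R0 k y)) \<le> norm y / 2"
    by (rule v_R0_bound) blast
  show ?thesis
  proof (rule that[OF k0(1)])
    fix k assume k: "k0 \<le> k"
    then have k_pos: "0 < k"
      using k0(1) by simp
    note bound = k0(2)[OF k]
    define T where "T y = v (R0 k y)" for y
    define B where "B y = lim (\<lambda>n. T (pr (real n) y))" for y
    have "T (x - y) = T x - T y" if "x \<in> D" "y \<in> D" for x y
      unfolding T_def using bound that
      by (simp add: clinear_extra[OF clinear_R0[OF k_pos]] clinear_on_extra(3)[OF tame_linear[OF tame_H1] D_subspace])
    moreover have "norm (T x) \<le> (1 / 2) * norm x" if "x \<in> D" for x
      unfolding T_def using bound that by simp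
    ultimately have conv: "(\<lambda>n. T (pr (real n) y)) \<longlonglongrightarrow> B y" for y
      unfolding B_def convergent_LIMSEQ_iff[symmetric] by (rule Cauchy_linear_pr)
    have mem: "(R0 k y, B y) \<in> H1" for y
    proof (rule closed_opD[OF closed_H1 _ _ conv])
      show "(R0 k (pr (real n) y), T (pr (real n) y)) \<in> H1" for n
        unfolding T_def using bound by (intro v_mem) simp
      show "(\<lambda>n. R0 k (pr (real n) y)) \<longlonglongrightarrow> R0 k y"
        by (intro bounded_linear.tendsto[OF bounded_linear_R0[OF k_pos]] pr_tendsto)
    qed
    have "norm (B y) \<le> norm y / 2" for y
    proof (rule LIMSEQ_le)
      show "(\<lambda>n. norm (T (pr (real n) y))) \<longlonglongrightarrow> norm (B y)"
        by (intro tendsto_norm conv)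
      show "(\<lambda>n. norm (pr (real n) y) / 2) \<longlonglongrightarrow> norm y / 2"
        by (intro tendsto_intros pr_tendsto) simp
      show "\<exists>N. \<forall>n\<ge>N. norm (T (pr (real n) y)) \<le> norm (pr (real n) y) / 2"
        unfolding T_def using bound by simp
    qed
    moreover have "B y = v (R0 k y)" if "y \<in> D" for y
      using mem v_mem[of "R0 k y"] bound[OF that] linear_opD(1)[OF linear_H1]
      unfolding single_valued_def by blast
    moreover have "clinear B"
      unfolding clinear_on_def
    proof (intro conjI ballI allI)
      note sv = linear_opD(1)[OF linear_H1, unfolded single_valued_def, rule_format]
      show "B (x + y) = B x + B y" for x y
        using linear_opD(3)[OF linear_H1 mem[of x] mem[of y]] mem[of "x + y"]
        by (auto simp: clinear_onD[OF clinear_R0[OF k_pos]] intro: sv)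
      show "B (a *\<^sub>C x) = a *\<^sub>C B x" for a x
        using linear_opD(4)[OF linear_H1 mem[of x], of a] mem[of "a *\<^sub>C x"]
        by (auto simp: clinear_onD[OF clinear_R0[OF k_pos]] intro: sv)
    qed
    ultimately show "\<exists>B. clinear B \<and> (\<forall>y. (R0 k y, B y) \<in> H1) \<and>
        (\<forall>y. norm (B y) \<le> norm y / 2) \<and> (\<forall>y\<in>D. B y = v (R0 k y))"
      using mem by blast
  qed
qed

text \<open>With \<open>u = (H0 + k) x\<close> the equation \<open>(H + k) x = y\<close> becomes
  \<open>u + B u = y\<close>. The last conclusion says that \<open>D\<close> is a core of
  \<open>H\<close>, with energy cutoffs as explicit approximants.\<close>

lemma Kato_Rellich:
  obtains k0 where "0 < k0"
    "\<And>k. k0 \<le> k \<Longrightarrow> \<exists>R. clinear R \<and> bounded_linear R \<and> H = {(R y, y - complex_of_real k *\<^sub>C R y) |y. True}"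
    "\<And>x y. (x, y) \<in> H \<Longrightarrow> (\<lambda>n. h (pr (real n) x) + v (pr (real n) x)) \<longlonglongrightarrow> y"
proof -
  obtain k0 where k0: "0 < k0" "\<And>k. k0 \<le> k \<Longrightarrow> \<exists>B. clinear B \<and> (\<forall>y. (R0 k y, B y) \<in> H1) \<and>
    (\<forall>y. norm (B y) \<le> norm y / 2) \<and> (\<forall>y\<in>D. B y = v (R0 k y))"
    by (rule relative_bound) blast
  show ?thesis
  proof (rule that[OF k0(1)])
    fix k assume k: "k0 \<le> k"
    then have k_pos: "0 < k"
      using k0(1) by simp
    obtain B where B: "clinear B" "\<And>y. (R0 k y, B y) \<in> H1" "\<And>y. norm (B y) \<le> norm y / 2"
      using k0(2)[OF k] by blast
    have sv1: "(x, y) \<in> H1 \<Longrightarrow> (x, y') \<in> H1 \<Longrightarrow> y = y'" for x y y'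
      using linear_opD(1)[OF linear_H1] unfolding single_valued_def by blast
    have H_R0: "(R0 k u, u + B u - complex_of_real k *\<^sub>C R0 k u) \<in> H" for u
      unfolding H_iff using R0_mem[OF k_pos, of u] B(2)[of u]
      by (intro exI[of _ "u - complex_of_real k *\<^sub>C R0 k u"] exI[of _ "B u"]) auto
    have H_D: "\<exists>u. x = R0 k u \<and> y + complex_of_real k *\<^sub>C x = u + B u" if xy: "(x, y) \<in> H" for x y
    proof -
      obtain p q where pq: "(x, p) \<in> H0" "(x, q) \<in> H1" "y = p + q"
        using xy unfolding H_iff by blast
      have x: "x = R0 k (p + complex_of_real k *\<^sub>C x)"
        by (rule R0_unique[OF k_pos pq(1)])
      have "q = B (p + complex_of_real k *\<^sub>C x)"
        using pq(2) B(2)[of "p + complex_of_real k *\<^sub>C x"] sv1 x by metis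
      then show ?thesis
        using x pq(3) by (intro exI[of _ "p + complex_of_real k *\<^sub>C x"]) (simp add: add_ac)
    qed
    have bound: "norm x \<le> 2 / k * norm (y + complex_of_real k *\<^sub>C x)" if "(x, y) \<in> H" for x y
    proof -
      obtain u where u: "x = R0 k u" "y + complex_of_real k *\<^sub>C x = u + B u"
        using H_D[OF \<open>(x, y) \<in> H\<close>] by blast
      have "norm u \<le> norm (u + B u) + norm (B u)"
        using norm_triangle_ineq4[of "u + B u" "B u"] by simp
      then have "norm u \<le> 2 * norm (u + B u)"
        using B(3)[of u] by simp
      then show ?thesis
        using norm_R0_le[OF k_pos, of u] k_pos u by (simp add: field_simps)
    qed
    have surj: "\<exists>x. (x, y - complex_of_real k *\<^sub>C x) \<in> H" for y
    proof -
      \<comment> \<open>The equation \<open>u + B u = y\<close> as a fixed point problem;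
        \<open>B\<close> has norm at most 1/2, so the map is a contraction.\<close>
      have "\<exists>!u. y - B u = u"
      proof (rule banach_fix_type[of "1 / 2"])
        have "dist (y - B u) (y - B u') = norm (B (u' - u))" for u u'
          by (simp add: dist_norm clinear_extra[OF B(1)])
        then show "\<forall>u u'. dist (y - B u) (y - B u') \<le> 1 / 2 * dist u u'"
          by (simp only: dist_norm[of "_::'a"]) (use B(3) in \<open>metis dist_norm dist_commute divide_inverse inverse_eq_divide mult.commute\<close>)
      qed auto
      then obtain u where "y - B u = u"
        by blast
      then have "u + B u = y"
        by (metis diff_add_cancel)
      then show ?thesis
        using H_R0[of u] by auto
    qed
    then obtain R where R: "\<And>y. (R y, y - complex_of_real k *\<^sub>C R y) \<in> H"
      by metis
    have unique: "R (y + complex_of_real k *\<^sub>C x) = x" if "(x, y) \<in> H" for x y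
    proof -
      let ?y = "y + complex_of_real k *\<^sub>C x"
      have "(R ?y - x, ?y - complex_of_real k *\<^sub>C R ?y - y) \<in> H"
        by (rule linear_op_diff[OF linear_H R that])
      from bound[OF this] show ?thesis
        by (simp add: complex_vector.scale_right_diff_distrib)
    qed
    have lin: "clinear R"
      unfolding clinear_on_def
    proof (intro conjI ballI allI)
      show "R (x + y) = R x + R y" for x y
        using unique[OF linear_opD(3)[OF linear_H R[of x] R[of y]]] by (simp add: scaleC_add_right)
      show "R (a *\<^sub>C x) = a *\<^sub>C R x" for a x
        using unique[OF linear_opD(4)[OF linear_H R[of x], of a]]
        by (simp add: complex_vector.scale_right_diff_distrib scaleC_scaleC mult.commute)
    qed
    moreover have "norm (R y) \<le> 2 / k * norm y" for y
      using bound[OF R[of y]] by simp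
    then have "bounded_linear R"
      by (rule clinear_bounded_linear[OF lin])
    moreover have "H = {(R y, y - complex_of_real k *\<^sub>C R y) |y. True}"
    proof (intro equalityI subsetI)
      fix p assume "p \<in> H"
      moreover obtain x y where "p = (x, y)"
        by (cases p)
      ultimately show "p \<in> {(R y, y - complex_of_real k *\<^sub>C R y) |y. True}"
        using unique[of x y] by (auto intro!: exI[of _ "y + complex_of_real k *\<^sub>C x"])
    qed (use R in auto)
    ultimately show "\<exists>R. clinear R \<and> bounded_linear R \<and> H = {(R y, y - complex_of_real k *\<^sub>C R y) |y. True}"
      by blast
  next
    fix x y assume "(x, y) \<in> H"
    then obtain p q where pq: "(x, p) \<in> H0" "(x, q) \<in> H1" "y = p + q"
      unfolding H_iff by blast
    obtain B where B: "clinear B" "\<And>y. (R0 k0 y, B y) \<in> H1" "\<And>y. norm (B y) \<le> norm y / 2"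
      "\<And>y. y \<in> D \<Longrightarrow> B y = v (R0 k0 y)"
      using k0(2)[OF order_refl] by blast
    \<comment> \<open>Through the bounded \<open>B\<close> the convergence of the cutoffs of
      \<open>u\<close> passes to the interaction applied to the cutoffs of \<open>x\<close>.\<close>
    define u where "u = p + complex_of_real k0 *\<^sub>C x"
    have x: "x = R0 k0 u"
      unfolding u_def by (rule R0_unique[OF k0(1) pq(1)])
    have "bounded_linear B"
      by (rule clinear_bounded_linear[OF B(1), where M = "1 / 2"]) (use B(3) in simp)
    then have "(\<lambda>n. B (pr (real n) u)) \<longlonglongrightarrow> B u"
      by (intro bounded_linear.tendsto[OF _ pr_tendsto])
    moreover have "v (pr (real n) x) = B (pr (real n) u)" for n
      unfolding x R0_pr[OF k0(1)] by (simp add: B(4))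
    moreover have "B u = q"
      using B(2)[of u] pq(2) linear_opD(1)[OF linear_H1] x unfolding single_valued_def by metis
    ultimately have "(\<lambda>n. v (pr (real n) x)) \<longlonglongrightarrow> q"
      by simp
    then have "(\<lambda>n. pr (real n) p + v (pr (real n) x)) \<longlonglongrightarrow> p + q"
      by (intro tendsto_intros pr_tendsto)
    then show "(\<lambda>n. h (pr (real n) x) + v (pr (real n) x)) \<longlonglongrightarrow> y"
      unfolding H0_pr[OF pq(1)] pq(3) .
  qed
qed

lemma H_core:
  "(x, y) \<in> H \<Longrightarrow> (\<lambda>n. h (pr (real n) x) + v (pr (real n) x)) \<longlonglongrightarrow> y"
  by (rule Kato_Rellich) blast

lemma closed_H: "closed H"
proof -
  obtain k0 where "\<And>k. k0 \<le> k \<Longrightarrow> \<exists>R. clinear R \<and> bounded_linear R \<and>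
      H = {(R y, y - complex_of_real k *\<^sub>C R y) |y. True}"
    by (rule Kato_Rellich) blast
  then obtain R where R: "bounded_linear R" "H = {(R y, y - complex_of_real k0 *\<^sub>C R y) |y. True}"
    by blast
  have "H = {p. R (snd p + complex_of_real k0 *\<^sub>C fst p) = fst p}"
  proof (intro equalityI subsetI)
    fix p assume p: "p \<in> {p. R (snd p + complex_of_real k0 *\<^sub>C fst p) = fst p}"
    then show "p \<in> H"
      unfolding R(2) by (cases p) (auto intro!: exI[of _ "snd p + complex_of_real k0 *\<^sub>C fst p"])
  qed (auto simp: R(2))
  then show ?thesis
    by (auto intro!: closed_Collect_eq continuous_intros
        continuous_on_compose2[OF linear_continuous_on[OF R(1), of UNIV]])
qed

lemma H_lower_bound:
  obtains C where "\<And>x y. (x, y) \<in> H \<Longrightarrow> - C * (norm x)\<^sup>2 \<le> Re (cinner x y)"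
proof -
  obtain a a' where a: "0 \<le> a" "0 \<le> a'"
    "\<And>x. x \<in> D \<Longrightarrow> norm (v x) \<le> a * sqrt (Re (cinner x (h x))) + a' * norm x"
    "\<And>x. x \<in> D \<Longrightarrow> 0 \<le> Re (cinner x (h x))"
    by (rule v_sqrt_bound) blast
  \<comment> \<open>From completing the square: \<open>norm x * (a * s) \<le> s\<^sup>2 + a\<^sup>2
    * (norm x)\<^sup>2 / 4\<close>, where \<open>s\<^sup>2\<close> is the free energy and
    compensates itself.\<close>
  define C where "C = a\<^sup>2 + a'"
  have D: "- C * (norm x)\<^sup>2 \<le> Re (cinner x (h x + v x))" if x: "x \<in> D" for x
  proof -
    define s where "s = sqrt (Re (cinner x (h x)))"
    have s: "s\<^sup>2 = Re (cinner x (h x))"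
      unfolding s_def using a(4)[OF x] by simp
    have "- Re (cinner x (v x)) \<le> norm x * norm (v x)"
      using abs_Re_le_cmod[of "cinner x (v x)"] Cauchy_Schwarz[of x "v x"] by linarith
    also have "\<dots> \<le> norm x * (a * s + a' * norm x)"
      unfolding s_def by (intro mult_left_mono a(3) x) simp
    also have "\<dots> \<le> s\<^sup>2 + C * (norm x)\<^sup>2"
    proof -
      have "0 \<le> (s - a * norm x / 2)\<^sup>2"
        by simp
      then have "norm x * (a * s) \<le> s\<^sup>2 + a\<^sup>2 * (norm x)\<^sup>2 / 4"
        by (simp add: power2_eq_square algebra_simps)
      moreover have "0 \<le> a\<^sup>2 * (norm x)\<^sup>2"
        by simp
      ultimately show ?thesis
        unfolding C_def by (simp add: power2_eq_square algebra_simps)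
    qed
    finally show ?thesis
      using s by (simp add: cinner_add_right)
  qed
  show ?thesis
  proof (rule that)
    fix x y assume xy: "(x, y) \<in> H"
    show "- C * (norm x)\<^sup>2 \<le> Re (cinner x y)"
    proof (rule LIMSEQ_le)
      show "(\<lambda>n. - C * (norm (pr (real n) x))\<^sup>2) \<longlonglongrightarrow> - C * (norm x)\<^sup>2"
        by (intro tendsto_intros pr_tendsto)
      show "(\<lambda>n. Re (cinner (pr (real n) x) (h (pr (real n) x) + v (pr (real n) x)))) \<longlonglongrightarrow> Re (cinner x y)"
        by (intro tendsto_intros pr_tendsto H_core xy)
    qed (use D in auto)
  qed
qed

section \<open>The bottom of the spectrum and the numerical range\<close>

lemma resolvent_set_H:
  "l \<in> resolvent_set H \<longleftrightarrow>
    (\<exists>R. bounded_linear R \<and> (\<forall>x y. (x, y + l *\<^sub>C x) \<in> H \<longleftrightarrow> x = R y))"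
proof -
  have "op_add H (op_scale (- l) Id) = {(x, y - l *\<^sub>C x) |x y. (x, y) \<in> H}"
    unfolding op_add_def op_scale_def by auto
  then have "(op_add H (op_scale (- l) Id))\<inverse> = {(y, x) |x y. (x, y + l *\<^sub>C x) \<in> H}"
    by (auto simp: converse_def) force
  then show ?thesis
    unfolding resolvent_set_def by (auto simp: set_eq_iff)
qed

lemma Re_cinner_shift:
  "Re (cinner p (q - complex_of_real m *\<^sub>C p)) = Re (cinner p q) - m * (norm p)\<^sup>2"
  by (simp add: cinner_diff_right cinner_scaleC_right cinner_norm del: of_real_power)

text \<open>The infimum of the numerical range belongs to the spectrum; this identifies \<open>E0 H\<close> without
  the spectral theorem for \<open>H\<close>.\<close>

lemma E0_le:
  assumes "(x, y) \<in> H"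
  shows "E0 H * (norm x)\<^sup>2 \<le> Re (cinner x y)"
proof (cases "x = 0")
  case True
  then show ?thesis by simp
next
  case False
  define A where "A = {Re (cinner x y) |x y. (x, y) \<in> H \<and> norm x = 1}"
  define m where "m = Inf A"
  obtain C where C: "\<And>x y. (x, y) \<in> H \<Longrightarrow> - C * (norm x)\<^sup>2 \<le> Re (cinner x y)"
    by (rule H_lower_bound) blast
  have bdd: "bdd_below A"
    using C unfolding A_def by (intro bdd_belowI[of _ "- C"]) force
  have scale: "Re (cinner p q) / (norm p)\<^sup>2 \<in> A" if "(p, q) \<in> H" "p \<noteq> 0" for p q
  proof -
    let ?k = "complex_of_real (1 / norm p)"
    have "(?k *\<^sub>C p, ?k *\<^sub>C q) \<in> H"
      using that by (intro linear_opD(4)[OF linear_H])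
    moreover have "norm (?k *\<^sub>C p) = 1"
      using that(2) unfolding norm_scaleC norm_of_real by simp
    moreover have "cinner (?k *\<^sub>C p) (?k *\<^sub>C q) = complex_of_real (1 / (norm p)\<^sup>2) * cinner p q"
      unfolding cinner_scaleC_left cinner_scaleC_right by (simp add: power2_eq_square)
    then have "Re (cinner (?k *\<^sub>C p) (?k *\<^sub>C q)) = Re (cinner p q) / (norm p)\<^sup>2"
      by (simp add: Re_complex_of_real del: of_real_power of_real_divide)
    ultimately show ?thesis
      unfolding A_def by force
  qed
  have m_le: "m * (norm p)\<^sup>2 \<le> Re (cinner p q)" if "(p, q) \<in> H" for p q
  proof (cases "p = 0")
    case False
    then have "m \<le> Re (cinner p q) / (norm p)\<^sup>2"
      unfolding m_def using scale[OF that] bdd by (intro cInf_lower)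
    then show ?thesis
      using False by (simp add: le_divide_eq)
  qed simp
  have "complex_of_real m \<in> spectrum H"
  proof (rule ccontr)
    assume "complex_of_real m \<notin> spectrum H"
    then have "complex_of_real m \<in> resolvent_set H"
      unfolding spectrum_def by simp
    then obtain R where R: "bounded_linear R" "\<forall>x y. (x, y + complex_of_real m *\<^sub>C x) \<in> H \<longleftrightarrow> x = R y"
      unfolding resolvent_set_H by (elim exE conjE)
    obtain K where K: "0 < K" "\<And>y. norm (R y) \<le> norm y * K"
      using bounded_linear.pos_bounded[OF R(1)] by blast
    have "m + 1 / K \<le> Re (cinner x y)" if xy: "(x, y) \<in> H" "norm x = 1" for x y
    proof -
      define u where "u = R x"
      have u: "(u, x + complex_of_real m *\<^sub>C u) \<in> H"
        using R(2) u_def by blast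
      \<comment> \<open>\<open>u\<close> is \<open>(H - m)^(-1) x\<close>. The step
        \<open>1 / K\<close> minimizes the bound \<open>- 2 * t + t\<^sup>2 * K\<close> on the
        change of the form. Since the form of \<open>H - m\<close> stays nonnegative at
        \<open>?p\<close>, the expectation at \<open>x\<close> exceeds \<open>m\<close> by at least
        \<open>1 / K\<close>, uniformly in \<open>x\<close>.\<close>
      let ?t = "complex_of_real (1 / K)"
      let ?p = "x - ?t *\<^sub>C u" and ?q = "y - ?t *\<^sub>C (x + complex_of_real m *\<^sub>C u)"
      have pq: "(?p, ?q) \<in> H"
        by (intro linear_op_diff[OF linear_H] linear_opD(4)[OF linear_H] xy u)
      have "0 \<le> Re (cinner ?p ?q) - m * (norm ?p)\<^sup>2"
        using m_le[OF pq] by simp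
      also have "\<dots> = Re (cinner ?p (?q - complex_of_real m *\<^sub>C ?p))"
        by (rule Re_cinner_shift[symmetric])
      also have "?q - complex_of_real m *\<^sub>C ?p = (y - complex_of_real m *\<^sub>C x) - ?t *\<^sub>C x"
        by (simp add: complex_vector.scale_right_diff_distrib scaleC_add_right scaleC_scaleC mult.commute)
      also have "Re (cinner ?p ((y - complex_of_real m *\<^sub>C x) - ?t *\<^sub>C x)) =
          (Re (cinner x y) - m) - 1 / K - 1 / K * Re (cinner u (y - complex_of_real m *\<^sub>C x)) +
          (1 / K)\<^sup>2 * Re (cinner u x)"
      proof -
        have "Re (cinner ?p (y' - ?t *\<^sub>C x)) =
            Re (cinner x y') - 1 / K * Re (cinner x x) - 1 / K * Re (cinner u y') + (1 / K)\<^sup>2 * Re (cinner u x)" for y'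
          unfolding cinner_diff_left cinner_diff_right cinner_scaleC_left cinner_scaleC_right
            complex_cnj_complex_of_real
          by (simp add: power2_eq_square right_diff_distrib del: of_real_divide)
        then show ?thesis
          using Re_cinner_shift[of x y m] by (simp add: Re_cinner_self xy(2))
      qed
      also have "cinner u y = cinner (x + complex_of_real m *\<^sub>C u) x"
        by (rule H_symmetric[OF u xy(1)])
      then have "Re (cinner u (y - complex_of_real m *\<^sub>C x)) = 1"
        by (simp add: cinner_diff_right cinner_scaleC_right cinner_add_left cinner_scaleC_left
            cinner_norm xy(2))
      also have "(1 / K)\<^sup>2 * Re (cinner u x) \<le> (1 / K)\<^sup>2 * K"
      proof (intro mult_left_mono)
        show "Re (cinner u x) \<le> K"
          using complex_Re_le_cmod[of "cinner u x"] Cauchy_Schwarz[of u x] K(2)[of x] xy(2)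
          unfolding u_def by simp
      qed simp
      finally show ?thesis
        using K(1) by (simp add: power2_eq_square)
    qed
    moreover have "A \<noteq> {}"
      using scale[OF assms False] by blast
    ultimately have "m + 1 / K \<le> m"
      unfolding m_def A_def by (intro cInf_greatest) auto
    then show False
      using K(1) by simp
  qed
  \<comment> \<open>Needed for the lower-bound property of the infimum in \<open>E0\<close>: for a
    set of reals without lower bound it would be an unspecified number.\<close>
  moreover have "bdd_below {x. complex_of_real x \<in> spectrum H}"
  proof -
    obtain k0 where k0: "0 < k0" "\<And>k. k0 \<le> k \<Longrightarrow> \<exists>R. clinear R \<and> bounded_linear R \<and>
        H = {(R y, y - complex_of_real k *\<^sub>C R y) |y. True}"
      by (rule Kato_Rellich) blast
    have res: "complex_of_real l \<in> resolvent_set H" if "l \<le> - k0" for l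
    proof -
      have "k0 \<le> - l"
        using that by simp
      then obtain R where R: "bounded_linear R" "H = {(R y, y - complex_of_real (- l) *\<^sub>C R y) |y. True}"
        using k0(2) by blast
      show ?thesis
        unfolding resolvent_set_H using R(1) by (intro exI[of _ R]) (auto simp: R(2))
    qed
    then have "- k0 \<le> x" if x: "complex_of_real x \<in> spectrum H" for x
    proof -
      have "\<not> x \<le> - k0"
        using x res unfolding spectrum_def by blast
      then show ?thesis
        by simp
    qed
    then show ?thesis
      by (intro bdd_belowI[of _ "- k0"]) auto
  qed
  ultimately have "E0 H \<le> m"
    unfolding E0_def by (intro cInf_lower) auto
  then have "E0 H * (norm x)\<^sup>2 \<le> m * (norm x)\<^sup>2"
    by (intro mult_right_mono) auto
  then show ?thesis
    using m_le[OF assms] by simp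
qed

end

section \<open>The evolution generated by the full Hamiltonian\<close>

lemma infsum_eq_suminf: "f summable_on UNIV \<Longrightarrow> infsum f UNIV = suminf f"
  for f :: "nat \<Rightarrow> 'a::banach"
  by (metis has_sum_imp_sums has_sum_infsum sums_unique)

text \<open>Absolute summability along the diagonals gives absolute summability over all pairs of
  indices; both sides are then the same unordered sum.\<close>

lemma sums_diagonal:
  fixes a :: "nat \<Rightarrow> nat \<Rightarrow> 'a::banach"
  assumes "summable (\<lambda>n. \<Sum>p\<le>n. norm (a p (n - p)))"
  shows "(\<lambda>n. \<Sum>p\<le>n. a p (n - p)) sums (\<Sum>q. \<Sum>p. a p q)"
proof -
  define g where "g = (\<lambda>(n, p). a p (n - p))"
  define f where "f = (\<lambda>(q, p). a p q)"
  define T where "T = Sigma UNIV (\<lambda>n::nat. {..n})"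
  have g: "(\<lambda>x. norm (g x)) summable_on T"
    unfolding T_def
  proof (rule Infinite_Sum.abs_summable_on_Sigma_iff[THEN iffD2], intro conjI ballI)
    have "norm (infsum (\<lambda>p. norm (g (n, p))) {..n}) = (\<Sum>p\<le>n. norm (a p (n - p)))" for n
      by (simp add: g_def sum_nonneg)
    then show "(\<lambda>n. norm (infsum (\<lambda>p. norm (g (n, p))) {..n})) summable_on UNIV"
      using norm_summable_imp_summable_on[of "\<lambda>n. \<Sum>p\<le>n. norm (a p (n - p))"] assms
      by (simp add: sum_nonneg)
  qed (simp add: summable_on_finite)
  define k where "k = (\<lambda>(q::nat, p::nat). (q + p, p))"
  have k: "bij_betw k (UNIV \<times> UNIV) T"
    unfolding bij_betw_def
  proof
    show "inj_on k (UNIV \<times> UNIV)"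
      unfolding k_def inj_on_def by auto
    have "(n, p) \<in> k ` (UNIV \<times> UNIV)" if "p \<le> n" for n p
      using that unfolding k_def by (intro image_eqI[where x = "(n - p, p)"]) auto
    then show "k ` (UNIV \<times> UNIV) = T"
      unfolding T_def k_def by auto
  qed
  have fg: "f x = g (k x)" for x
    unfolding f_def g_def k_def by (cases x) simp
  have f: "(\<lambda>x. norm (f x)) summable_on UNIV \<times> UNIV"
    unfolding fg using summable_on_reindex_bij_betw[OF k, of "\<lambda>x. norm (g x)"] g by simp
  have "infsum f (UNIV \<times> UNIV) = infsum g T"
    unfolding fg by (rule infsum_reindex_bij_betw[OF k])
  also have "infsum f (UNIV \<times> UNIV) = infsum (\<lambda>q. infsum (\<lambda>p. f (q, p)) UNIV) UNIV"
    using infsum_Sigma_banach[OF Infinite_Sum.abs_summable_summable[OF f]] by simp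
  also have "\<dots> = (\<Sum>q. \<Sum>p. a p q)"
  proof -
    have inner: "(\<lambda>p. f (q, p)) summable_on UNIV" for q
      using Infinite_Sum.abs_summable_on_Sigma_iff[THEN iffD1, OF f] by (simp add: Infinite_Sum.abs_summable_summable)
    have "(\<lambda>q. infsum (\<lambda>p. f (q, p)) UNIV) summable_on UNIV"
      by (rule summable_on_SigmaD[OF Infinite_Sum.abs_summable_summable[OF f] inner])
    then show ?thesis
      using infsum_eq_suminf[OF inner] by (subst infsum_eq_suminf) (auto simp: f_def)
  qed
  finally have eq: "infsum g T = (\<Sum>q. \<Sum>p. a p q)" by simp
  have inner: "(\<lambda>p. g (n, p)) summable_on {..n}" for n
    by (simp add: summable_on_finite)
  have "(\<lambda>n. infsum (\<lambda>p. g (n, p)) {..n}) summable_on UNIV"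
    using Infinite_Sum.abs_summable_summable[OF g] inner unfolding T_def by (rule summable_on_SigmaD)
  then have "((\<lambda>n. infsum (\<lambda>p. g (n, p)) {..n}) has_sum infsum g T) UNIV"
    using infsum_Sigma_banach[OF Infinite_Sum.abs_summable_summable[OF g[unfolded T_def]]]
    unfolding T_def[symmetric] by (metis has_sum_infsum)
  then have "((\<lambda>n. \<Sum>p\<le>n. a p (n - p)) has_sum (\<Sum>q. \<Sum>p. a p q)) UNIV"
    unfolding eq by (simp add: g_def)
  then show ?thesis
    by (rule has_sum_imp_sums)
qed

context interaction
begin

text \<open>The start is the energy reached after \<open>q\<close> interactions. By
  \<open>e + (q + n) * b + 1 \<le> (e + b + 1) * (q + n + 1)\<close> the factors multiply up to the
  root of a quotient of factorials, the form suited to convolving consecutive pieces of the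
  curve.\<close>

lemma vprod_le:
  assumes "0 \<le> e"
  shows "vprod n (e + real q * b) \<le> (c * sqrt (e + b + 1)) ^ n * sqrt (fact (q + n) / fact q)"
proof (induction n)
  case (Suc n)
  have "e + real q * b + real n * b + 1 \<le> (e + b + 1) * (q + n + 1)"
    using assms by (simp add: algebra_simps)
  then have A: "c * sqrt (e + real q * b + real n * b + 1) \<le> c * (sqrt (e + b + 1) * sqrt (q + n + 1))"
    unfolding real_sqrt_mult[symmetric] by (intro mult_left_mono) auto
  have "vprod (Suc n) (e + real q * b) = vprod n (e + real q * b) * (c * sqrt (e + real q * b + real n * b + 1))"
    unfolding vprod_def by simp
  also have "\<dots> \<le> ((c * sqrt (e + b + 1)) ^ n * sqrt (fact (q + n) / fact q)) * (c * (sqrt (e + b + 1) * sqrt (q + n + 1)))"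
    by (rule mult_mono[OF Suc.IH A]) (use assms in auto)
  also have "\<dots> = (c * sqrt (e + b + 1)) ^ Suc n * (sqrt (fact (q + n) / fact q) * sqrt (q + n + 1))"
    by (simp add: mult_ac)
  also have "sqrt (fact (q + n) / fact q) * sqrt (q + n + 1) = sqrt (fact (q + Suc n) / fact q)"
    by (simp add: real_sqrt_mult[symmetric] algebra_simps)
  finally show ?case .
qed (simp add: vprod_def)

lemma w_bound_fact:
  assumes e: "0 \<le> e" "x \<in> V P (e + real q * b)" and z: "cmod z \<le> r"
  shows "norm (w p z x) \<le> exp (r * (e + real (q + p) * b)) * ((r * (c * sqrt (e + b + 1))) ^ p / fact p) *
    sqrt (fact (q + p) / fact q) * norm x"
proof -
  have r: "0 \<le> r"
    using z norm_ge_zero order_trans by blast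
  have "norm (w p z x) \<le> exp (cmod z * (e + real q * b + p * b)) * (cmod z ^ p / fact p) *
      vprod p (e + real q * b) * norm x"
    by (rule w_bound) (use e in auto)
  also have "\<dots> \<le> exp (r * (e + real (q + p) * b)) * (r ^ p / fact p) *
      ((c * sqrt (e + b + 1)) ^ p * sqrt (fact (q + p) / fact q)) * norm x"
  proof (intro mult_right_mono mult_mono divide_right_mono power_mono vprod_le z)
    have "cmod z * (e + real q * b + p * b) \<le> r * (e + real q * b + p * b)"
      using e(1) by (intro mult_right_mono z) auto
    then show "exp (cmod z * (e + real q * b + real p * b)) \<le> exp (r * (e + real (q + p) * b))"
      by (simp add: algebra_simps)
  qed (use e r vprod_nonneg in auto)
  finally show ?thesis
    by (simp add: power_mult_distrib mult_ac)
qed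

text \<open>The binomial theorem turns the bound \<open>\<surd>(n!) / (p! q!)\<close> on the terms with \<open>p + q = n\<close> into
  \<open>R\<^sup>n / \<surd>(n!)\<close>.\<close>

lemma fast_convolution_norms:
  assumes e: "0 \<le> e" "\<And>q. x q \<in> V P (e + real q * b)" and x: "fast x"
  shows "fast (\<lambda>n. \<Sum>p\<le>n. norm (w p z (x (n - p))))"
proof -
  obtain C R where CR: "0 \<le> C" "0 \<le> R" "\<And>n. norm (x n) \<le> C * R ^ n / sqrt (fact n)"
    by (rule fastE[OF x]) blast
  define r where "r = cmod z"
  define s where "s = r * (c * sqrt (e + b + 1))"
  have r: "0 \<le> r" and s: "0 \<le> s"
    unfolding r_def s_def using e(1) by simp_all
  have term_le: "norm (w p z (x (n - p))) \<le>
      exp (r * e) * C * exp (r * b) ^ n / sqrt (fact n) * (real (n choose p) * s ^ p * R ^ (n - p))"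
    if p: "p \<le> n" for n p
  proof -
    define q where "q = n - p"
    have n: "n = q + p"
      using p unfolding q_def by simp
    have "norm (w p z (x q)) \<le> exp (r * (e + real (q + p) * b)) * (s ^ p / fact p) * sqrt (fact (q + p) / fact q) * norm (x q)"
      unfolding s_def by (rule w_bound_fact[OF e(1) e(2)]) (simp add: r_def)
    also have "\<dots> \<le> exp (r * (e + real (q + p) * b)) * (s ^ p / fact p) * sqrt (fact (q + p) / fact q) *
        (C * R ^ q / sqrt (fact q))"
      using s by (intro mult_left_mono CR(3)) auto
    also have "\<dots> = exp (r * e) * C * exp (r * b) ^ n / sqrt (fact n) *
        ((fact n / (fact p * (fact q))) * s ^ p * R ^ q)"
    proof -
      have "exp (r * (e + real (q + p) * b)) = exp (r * e) * exp (r * b) ^ n"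
        unfolding n by (simp add: exp_of_nat_mult[symmetric] algebra_simps flip: exp_add)
      moreover have "sqrt (fact (q + p) / fact q) / sqrt (fact q) = fact n / fact q / sqrt (fact n)"
      proof -
        have "sqrt (fact (q + p) / fact q) / sqrt (fact q) = sqrt (fact n) / (sqrt (fact q) * sqrt (fact q))"
          unfolding n by (simp add: real_sqrt_divide)
        also have "\<dots> = sqrt (fact n) / fact q"
          by simp
        also have "\<dots> = (sqrt (fact n) * sqrt (fact n)) / fact q / sqrt (fact n)"
          by (simp del: real_sqrt_mult_self)
        finally show ?thesis
          by simp
      qed
      ultimately show ?thesis
        by (simp add: mult_ac divide_simps)
    qed
    also have "fact n / (fact p * fact q) = real (n choose p)"
      using binomial_fact[OF p, where ?'a = real] unfolding q_def by simp
    finally show ?thesis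
      unfolding q_def .
  qed
  show ?thesis
  proof (rule fastI[where C = "exp (r * e) * C" and R = "exp (r * b) * (s + R)"])
    fix n
    have "norm (\<Sum>p\<le>n. norm (w p z (x (n - p)))) = (\<Sum>p\<le>n. norm (w p z (x (n - p))))"
      by (simp add: sum_nonneg)
    also have "\<dots> \<le> (\<Sum>p\<le>n. exp (r * e) * C * exp (r * b) ^ n / sqrt (fact n) *
        (real (n choose p) * s ^ p * R ^ (n - p)))"
      by (intro sum_mono term_le) simp
    also have "\<dots> = exp (r * e) * C * (exp (r * b) * (s + R)) ^ n / sqrt (fact n)"
      unfolding sum_distrib_left[symmetric] binomial_ring[of s R n, symmetric]
      by (simp add: power_mult_distrib)
    finally show "norm (\<Sum>p\<le>n. norm (w p z (x (n - p)))) \<le>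
        exp (r * e) * C * (exp (r * b) * (s + R)) ^ n / sqrt (fact n)" .
  qed (use CR s in auto)
qed

lemma fast_convolution:
  assumes "0 \<le> e" "\<And>q. x q \<in> V P (e + real q * b)" "fast x"
  shows "fast (\<lambda>n. \<Sum>p\<le>n. w p z (x (n - p)))"
  by (rule fast_geometric_factor[OF fast_convolution_norms[OF assms, of z], of 1 1])
    (auto intro: order_trans[OF norm_sum] simp: sum_nonneg)

lemma fast_tame:
  assumes B: "tame b' c' B" and e: "0 \<le> e" "\<And>q. x q \<in> V P (e + real q * b)" and x: "fast x"
  shows "fast (\<lambda>n. B (x n))"
proof (rule fast_linear_factor[OF x, of "c' * (e + 1)" "c' * b"])
  fix n
  have "norm (B (x n)) \<le> c' * sqrt (e + real n * b + 1) * norm (x n)"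
    by (rule tame_bound[OF B _ e(2)]) (use e in simp)
  also have "\<dots> \<le> c' * (e + real n * b + 1) * norm (x n)"
  proof (intro mult_right_mono mult_left_mono)
    have "1 \<le> e + real n * b + 1"
      using e(1) by simp
    then have "e + real n * b + 1 \<le> (e + real n * b + 1)\<^sup>2" "0 \<le> e + real n * b + 1"
      by (simp_all add: self_le_power)
    then show "sqrt (e + real n * b + 1) \<le> e + real n * b + 1"
      by (intro real_le_lsqrt)
  qed (use tame_nonneg[OF B] in auto)
  finally show "norm (B (x n)) \<le> (c' * (e + 1) + c' * b * real n) * norm (x n)"
    by (simp add: algebra_simps)
qed (use e tame_nonneg[OF B] in auto)

text \<open>The same constants serve a whole disc in \<open>z\<close>, as termwise differentiation
  requires.\<close>

lemma w_majorant:
  assumes "x \<in> D" "0 \<le> r"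
  obtains C R where "0 \<le> C" "0 \<le> R" "\<And>n z. cmod z \<le> r \<Longrightarrow> norm (w n z x) \<le> C * R ^ n / sqrt (fact n)"
proof -
  obtain e where e: "0 \<le> e" "x \<in> V P e"
    using assms(1) unfolding D_iff by blast
  define s where "s = r * (c * sqrt (e + b + 1))"
  have "norm (w n z x) \<le> (exp (r * e) * norm x) * (exp (r * b) * s) ^ n / sqrt (fact n)"
    if z: "cmod z \<le> r" for n z
  proof -
    have "norm (w n z x) \<le> exp (r * (e + real (0 + n) * b)) * (s ^ n / fact n) * sqrt (fact (0 + n) / fact 0) * norm x"
      unfolding s_def by (rule w_bound_fact) (use e z in auto)
    also have "\<dots> = (exp (r * e) * exp (r * b) ^ n) * s ^ n * norm x * (sqrt (fact n) / fact n)"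
      by (simp add: exp_of_nat_mult[symmetric] distrib_left exp_add mult_ac)
    also have "sqrt (fact n) / fact n = 1 / sqrt (fact n)"
      using real_sqrt_mult_self[of "fact n"] by (simp add: divide_simps)
    finally show ?thesis
      by (simp add: power_mult_distrib mult_ac)
  qed
  then show ?thesis
    by (intro that[of "exp (r * e) * norm x" "exp (r * b) * s"]) (use e assms(2) in \<open>auto simp: s_def\<close>)
qed

lemma fast_w: "x \<in> D \<Longrightarrow> fast (\<lambda>n. w n z x)"
  by (rule w_majorant[of x "cmod z"]) (auto intro: fastI)

lemma w_zero [simp]: "w n z 0 = 0"
  by (rule clinear_on_extra(1)[OF fam_linear[OF fam_w] D_subspace])

text \<open>\<open>exp (- i z H)\<close> on \<open>D\<close>, for all complex \<open>z\<close>; a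
  bound that permits extension to the whole space is proved for \<open>Im z \<le> 0\<close>.\<close>

definition Sf :: "complex \<Rightarrow> 'a \<Rightarrow> 'a" where
  "Sf z x = (\<Sum>n. w n z x)"

definition hv :: "'a \<Rightarrow> 'a" where
  "hv x = h x + v x"

lemma hv_D [simp]: "x \<in> D \<Longrightarrow> hv x \<in> D"
  unfolding hv_def by simp

lemma summable_w: "x \<in> D \<Longrightarrow> summable (\<lambda>n. w n z x)"
  by (rule fast_summable'[OF fast_w])

lemma clinear_on_Sf: "clinear_on D (Sf z)"
  unfolding clinear_on_def Sf_def
  by (auto simp: w_linear suminf_add summable_w bounded_linear.suminf[OF bounded_linear_scaleC_right])

lemma clinear_on_hv: "clinear_on D hv"
  unfolding clinear_on_def hv_def by (auto simp: h_linear v_linear scaleC_add_right)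

lemma Sf_0: "x \<in> D \<Longrightarrow> Sf 0 x = x"
proof -
  assume x: "x \<in> D"
  have "(\<Sum>n. w n 0 x) = (\<Sum>n\<in>{0}. w n 0 x)"
    by (rule suminf_finite) (auto simp: gr0_conv_Suc w_Suc_at_0)
  then show ?thesis
    unfolding Sf_def using x by (simp add: w_0)
qed

lemma suminf_w_pv:
  assumes "x \<in> D"
  shows "(\<lambda>n. w n z (h x) + pv n z x) sums Sf z (hv x)"
proof -
  have "(\<lambda>n. pv (Suc n) z x) sums Sf z (v x)"
    unfolding pv_def Sf_def using assms by (simp add: summable_sums summable_w)
  then have "(\<lambda>n. pv n z x) sums Sf z (v x)"
    using sums_Suc_iff[of "\<lambda>n. pv n z x"] by (simp add: pv_def)
  moreover have "(\<lambda>n. w n z (h x)) sums Sf z (h x)"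
    unfolding Sf_def using assms by (simp add: summable_sums summable_w)
  ultimately show ?thesis
    unfolding hv_def using assms by (simp add: sums_add clinear_onD[OF clinear_on_Sf])
qed

text \<open>The generator is put on the right by \<open>dw_right\<close>, since \<open>hv x\<close>
  stays in \<open>D\<close> whereas \<open>Sf z x\<close> need not lie there.\<close>

lemma has_cderiv_Sf:
  assumes x: "x \<in> D"
  shows "has_cderiv (\<lambda>z. Sf z x) (- \<i> *\<^sub>C Sf z (hv x)) z"
proof -
  have "has_cderiv (\<lambda>z. Sf z x) (\<Sum>n. dw n z x) z"
    unfolding Sf_def
  proof (rule has_cderiv_series[OF fam_cderiv[OF fam_w x] _ summable_w[OF x]])
    fix r
    obtain C1 R1 where 1: "0 \<le> C1" "0 \<le> R1" "\<And>n z. cmod z \<le> \<bar>r\<bar> \<Longrightarrow> norm (w n z (h x)) \<le> C1 * R1 ^ n / sqrt (fact n)"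
      by (rule w_majorant[of "h x" "\<bar>r\<bar>"]) (use x in auto)
    obtain C2 R2 where 2: "0 \<le> C2" "0 \<le> R2" "\<And>n z. cmod z \<le> \<bar>r\<bar> \<Longrightarrow> norm (w n z (v x)) \<le> C2 * R2 ^ n / sqrt (fact n)"
      by (rule w_majorant[of "v x" "\<bar>r\<bar>"]) (use x in auto)
    define M where "M n = C1 * R1 ^ n / sqrt (fact n) + (case n of 0 \<Rightarrow> 0 | Suc m \<Rightarrow> C2 * R2 ^ m / sqrt (fact m))" for n
    have "summable (\<lambda>n. case n of 0 \<Rightarrow> 0 | Suc m \<Rightarrow> C2 * R2 ^ m / sqrt (fact m))"
      by (subst summable_Suc_iff[symmetric]) (simp add: summable_fast_bound[OF 2(1,2)])
    then have "summable M"
      unfolding M_def by (intro summable_add summable_fast_bound 1)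
    moreover have "norm (dw n z x) \<le> M n" if z: "cmod z \<le> r" for n z
    proof -
      have z': "cmod z \<le> \<bar>r\<bar>"
        using z by simp
      have "norm (pv n z x) \<le> (case n of 0 \<Rightarrow> 0 | Suc m \<Rightarrow> C2 * R2 ^ m / sqrt (fact m))"
        unfolding pv_def using 2(3)[OF z'] by (auto split: nat.split)
      then show ?thesis
        unfolding dw_right[OF x] M_def norm_scaleC
        using norm_triangle_mono[OF 1(3)[OF z']] by simp
    qed
    ultimately show "\<exists>M. summable M \<and> (\<forall>n z. cmod z \<le> r \<longrightarrow> norm (dw n z x) \<le> M n)"
      by blast
  qed
  also have "(\<Sum>n. dw n z x) = - \<i> *\<^sub>C Sf z (hv x)"
    unfolding dw_right[OF x]
    by (rule sums_unique[symmetric], rule bounded_linear.sums[OF bounded_linear_scaleC_right suminf_w_pv[OF x]])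
  finally show ?thesis .
qed

end

context symmetric_interaction
begin

section \<open>The summed Dyson series as the evolution generated by \<open>H\<close>\<close>

lemma H_hv: "x \<in> D \<Longrightarrow> (x, hv x) \<in> H"
  unfolding hv_def by (rule H_mem)

lemma Sf_H:
  assumes x: "x \<in> D"
  shows "(Sf z x, Sf z (hv x)) \<in> H"
proof -
  obtain e where e: "0 \<le> e" "x \<in> V P e"
    using x unfolding D_iff by blast
  have sum_D: "(\<Sum>n<N. w n z x) \<in> D" for N
    by (rule complex_vector.subspace_sum[OF D_subspace]) (use x in simp)
  \<comment> \<open>Applying the generator to a partial sum leaves a single boundary term
    \<open>v (w N z x)\<close>. It tends to zero, and closedness of \<open>H\<close> completes the
    argument.\<close>
  have eq: "hv (\<Sum>n<Suc N. w n z x) = (\<Sum>n<Suc N. w n z (h x) + pv n z x) + v (w N z x)" for N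
  proof (induction N)
    case 0
    show ?case
      using x w_commute[OF x, of 0 z] by (simp add: hv_def vp_def pv_def)
  next
    case (Suc N)
    have "hv (\<Sum>n<Suc (Suc N). w n z x) = hv (\<Sum>n<Suc N. w n z x) + hv (w (Suc N) z x)"
      by (subst sum.lessThan_Suc[of _ "Suc N"]) (rule clinear_onD(1)[OF clinear_on_hv sum_D w_D[OF x]])
    also have "hv (w (Suc N) z x) = h (w (Suc N) z x) + v (w (Suc N) z x)"
      unfolding hv_def ..
    finally show ?case
      unfolding Suc.IH sum.lessThan_Suc[of _ "Suc N"] using w_commute[OF x, of "Suc N" z]
      by (simp add: vp_def algebra_simps)
  qed
  show ?thesis
  proof (rule closed_opD[OF closed_H])
    show "(\<Sum>n<Suc N. w n z x, (\<Sum>n<Suc N. w n z (h x) + pv n z x) + v (w N z x)) \<in> H" for N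
      using H_hv[OF sum_D[of "Suc N"]] unfolding eq .
    show "(\<lambda>N. \<Sum>n<Suc N. w n z x) \<longlonglongrightarrow> Sf z x"
      using summable_LIMSEQ[OF summable_w[OF x]] unfolding Sf_def by (rule LIMSEQ_Suc)
    have "fast (\<lambda>n. v (w n z x))"
      by (rule fast_tame[OF tame_H1 e(1) w_V[OF e] fast_w[OF x]])
    then have "(\<lambda>n. v (w n z x)) \<longlonglongrightarrow> 0"
      by (rule fast_tendsto_0)
    moreover have "(\<lambda>N. \<Sum>n<Suc N. w n z (h x) + pv n z x) \<longlonglongrightarrow> Sf z (hv x)"
      using suminf_w_pv[OF x] unfolding sums_def by (rule LIMSEQ_Suc)
    ultimately show "(\<lambda>N. (\<Sum>n<Suc N. w n z (h x) + pv n z x) + v (w N z x)) \<longlonglongrightarrow> Sf z (hv x)"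
      using tendsto_add by fastforce
  qed
qed

lemma has_vector_derivative_line: "((\<lambda>s::real. a + of_real s * z) has_vector_derivative z) (at s within S)"
  for a z :: complex
  unfolding has_vector_derivative_def
  by (auto intro!: derivative_eq_intros simp: scaleR_conv_of_real)

lemma Sf_vector_derivative:
  "x \<in> D \<Longrightarrow> ((\<lambda>s. Sf (a + of_real s * z) x) has_vector_derivative
    z *\<^sub>C (- \<i> *\<^sub>C Sf (a + of_real s * z) (hv x))) (at s within S)"
  by (rule has_cderiv_vector_derivative[OF has_cderiv_Sf has_vector_derivative_line])

lemma cinner_vector_derivative:
  assumes "(f has_vector_derivative f') (at s within S)" "(g has_vector_derivative g') (at s within S)"
  shows "((\<lambda>s. cinner (f s) (g s)) has_vector_derivative cinner (f s) g' + cinner f' (g s)) (at s within S)"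
  using bounded_bilinear.has_vector_derivative[OF bounded_bilinear_cinner assms] .

lemma Sf_pairing:
  assumes x: "x \<in> D" and y: "y \<in> D"
  shows "cinner (Sf (- cnj z) y) (Sf a x) = cinner y (Sf (a + z) x)"
proof -
  \<comment> \<open>Both time arguments move by conjugate amounts, the left one to 0 and the right
    one to \<open>a + z\<close>. Symmetry of \<open>H\<close> makes the derivative vanish, and the
    endpoints are the two sides of the claim.\<close>
  define g where "g s = cinner (Sf (- cnj z + of_real s * cnj z) y) (Sf (a + of_real s * z) x)" for s :: real
  have "(g has_vector_derivative 0) (at s within {0..1})" for s
  proof -
    let ?p = "- cnj z + of_real s * cnj z" and ?q = "a + of_real s * z"
    have "(g has_vector_derivative cinner (Sf ?p y) (z *\<^sub>C (- \<i> *\<^sub>C Sf ?q (hv x))) +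
        cinner (cnj z *\<^sub>C (- \<i> *\<^sub>C Sf ?p (hv y))) (Sf ?q x)) (at s within {0..1})"
      unfolding g_def by (intro cinner_vector_derivative Sf_vector_derivative x y)
    moreover have "cinner (Sf ?p y) (Sf ?q (hv x)) = cinner (Sf ?p (hv y)) (Sf ?q x)"
      by (rule H_symmetric[OF Sf_H[OF y] Sf_H[OF x]])
    ultimately show ?thesis
      by (simp add: cinner_scaleC_left cinner_scaleC_right)
  qed
  then have "(\<And>s. s \<in> {0..1} \<Longrightarrow> (g has_vector_derivative 0) (at s within {0..1}))"
    by blast
  from has_vector_derivative_zero_constant[OF convex_real_interval(5) this]
  obtain k where "\<And>s. s \<in> {0..1} \<Longrightarrow> g s = k"
    by blast
  then have "g 0 = g 1"
    by simp
  then show ?thesis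
    unfolding g_def using y by (simp add: Sf_0)
qed

lemma norm_Sf_le:
  assumes x: "x \<in> D" and z: "Im z \<le> 0"
  shows "norm (Sf z x) \<le> exp (E0 H * Im z) * norm x"
proof -
  let ?E = "E0 H"
  \<comment> \<open>The weight compensates the rate \<open>2 * E0 H * Im z\<close> at which the
    squared norm may change along the ray to \<open>z\<close>. As \<open>Im z \<le> 0\<close> and
    \<open>E0 H\<close> bounds the form from below, \<phi> is nonincreasing.\<close>
  define \<phi> where "\<phi> t = exp (- 2 * ?E * Im z * t) * Re (cinner (Sf (0 + of_real t * z) x) (Sf (0 + of_real t * z) x))" for t :: real
  have "\<phi> 1 \<le> \<phi> 0"
  proof (rule DERIV_nonpos_imp_nonincreasing[of 0 1 \<phi>])
    fix t :: real
    let ?S = "Sf (0 + of_real t * z) x" and ?T = "Sf (0 + of_real t * z) (hv x)"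
    let ?e = "exp (- 2 * ?E * Im z * t)"
    have ST: "(?S, ?T) \<in> H"
      by (rule Sf_H[OF x])
    have "((\<lambda>t. cinner (Sf (0 + of_real t * z) x) (Sf (0 + of_real t * z) x)) has_vector_derivative
        cinner ?S (z *\<^sub>C (- \<i> *\<^sub>C ?T)) + cinner (z *\<^sub>C (- \<i> *\<^sub>C ?T)) ?S) (at t within UNIV)"
      by (intro cinner_vector_derivative Sf_vector_derivative x)
    then have "((\<lambda>t. Re (cinner (Sf (0 + of_real t * z) x) (Sf (0 + of_real t * z) x))) has_vector_derivative
        Re (cinner ?S (z *\<^sub>C (- \<i> *\<^sub>C ?T)) + cinner (z *\<^sub>C (- \<i> *\<^sub>C ?T)) ?S)) (at t within UNIV)"
      by (rule bounded_linear.has_vector_derivative[OF bounded_linear_Re])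
    moreover have "Re (cinner ?S (z *\<^sub>C (- \<i> *\<^sub>C ?T)) + cinner (z *\<^sub>C (- \<i> *\<^sub>C ?T)) ?S) = 2 * Im z * Re (cinner ?S ?T)"
    proof -
      have "cinner ?T ?S = cnj (cinner ?S ?T)"
        by (rule cinner_commute)
      moreover have "Im (cinner ?S ?T) = 0"
        using H_real[OF ST] by (metis Im_complex_of_real)
      ultimately show ?thesis
        by (simp add: cinner_scaleC_left cinner_scaleC_right)
    qed
    ultimately have d: "((\<lambda>t. Re (cinner (Sf (0 + of_real t * z) x) (Sf (0 + of_real t * z) x))) has_real_derivative
        2 * Im z * Re (cinner ?S ?T)) (at t)"
      by (simp add: has_real_derivative_iff_has_vector_derivative)
    have "((\<lambda>t. exp (- 2 * ?E * Im z * t)) has_real_derivative ?e * (- 2 * ?E * Im z)) (at t)"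
      by (auto intro!: derivative_eq_intros)
    from DERIV_mult[OF this d]
    have "(\<phi> has_real_derivative ?e * (- 2 * ?E * Im z) * Re (cinner ?S ?S) + 2 * Im z * Re (cinner ?S ?T) * ?e) (at t)"
      unfolding \<phi>_def .
    moreover have "?e * (- 2 * ?E * Im z) * Re (cinner ?S ?S) + 2 * Im z * Re (cinner ?S ?T) * ?e =
        ?e * (2 * Im z * (Re (cinner ?S ?T) - ?E * (norm ?S)\<^sup>2))"
      by (simp add: Re_cinner_self algebra_simps)
    moreover have "?e * (2 * Im z * (Re (cinner ?S ?T) - ?E * (norm ?S)\<^sup>2)) \<le> 0"
      using E0_le[OF ST] z by (intro mult_nonneg_nonpos mult_nonpos_nonneg) auto
    ultimately show "\<exists>y. (\<phi> has_real_derivative y) (at t) \<and> y \<le> 0"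
      by metis
  qed simp
  then have "exp (- 2 * ?E * Im z) * (norm (Sf z x))\<^sup>2 \<le> (norm x)\<^sup>2"
    unfolding \<phi>_def Re_cinner_self using x by (simp add: Sf_0)
  then have "exp (2 * ?E * Im z) * (exp (- 2 * ?E * Im z) * (norm (Sf z x))\<^sup>2) \<le> exp (2 * ?E * Im z) * (norm x)\<^sup>2"
    by (rule mult_left_mono) simp
  then have "(norm (Sf z x))\<^sup>2 \<le> exp (2 * ?E * Im z) * (norm x)\<^sup>2"
    by (simp add: mult.assoc[symmetric] flip: exp_add)
  also have "\<dots> = (exp (?E * Im z) * norm x)\<^sup>2"
    by (simp add: power_mult_distrib power2_eq_square flip: exp_add)
  finally show ?thesis
    by (meson exp_ge_zero mult_nonneg_nonneg norm_ge_zero power2_le_imp_le)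
qed

text \<open>\<open>S z\<close> is \<open>e\<^sup>-\<^sup>i\<^sup>z\<^sup>H\<close>.\<close>

definition S :: "complex \<Rightarrow> 'a \<Rightarrow> 'a" where
  "S z x = lim (\<lambda>n. Sf z (pr (real n) x))"

context
  fixes z :: complex
  assumes z: "Im z \<le> 0"
begin

lemma S_tendsto: "(\<lambda>n. Sf z (pr (real n) x)) \<longlonglongrightarrow> S z x"
  unfolding S_def convergent_LIMSEQ_iff[symmetric]
  by (rule Cauchy_linear_pr[OF clinear_on_extra(3)[OF clinear_on_Sf D_subspace] norm_Sf_le[OF _ z]])

lemma S_eq_Sf:
  assumes "x \<in> D"
  shows "S z x = Sf z x"
proof -
  obtain e where e: "0 \<le> e" "x \<in> V P e"
    using assms unfolding D_iff by blast
  have "pr (real n) x = x" if "n \<ge> nat \<lceil>e\<rceil>" for n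
    using V_mono[OF _ e(2), of "real n"] that unfolding V_iff by (simp add: nat_ceiling_le_eq)
  then have "(\<lambda>n. Sf z (pr (real n) x)) \<longlonglongrightarrow> Sf z x"
    by (intro tendsto_eventually eventually_sequentiallyI[of "nat \<lceil>e\<rceil>"]) simp
  then show ?thesis
    using S_tendsto LIMSEQ_unique by blast
qed

lemma clinear_S: "clinear (S z)"
  unfolding clinear_on_def
proof (intro conjI ballI allI)
  note lin = clinear_onD[OF clinear_on_Sf] and prl = clinear_onD(1)[OF clinear_pr UNIV_I UNIV_I]
    clinear_onD(2)[OF clinear_pr UNIV_I]
  show "S z (x + y) = S z x + S z y" for x y
    using tendsto_add[OF S_tendsto[of x] S_tendsto[of y]] S_tendsto[of "x + y"] LIMSEQ_unique
    by (simp add: lin prl)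
  show "S z (k *\<^sub>C x) = k *\<^sub>C S z x" for k x
    using tendsto_scaleC[OF tendsto_const[of k] S_tendsto[of x]] S_tendsto[of "k *\<^sub>C x"] LIMSEQ_unique
    by (simp add: lin prl)
qed

lemma norm_S_le: "norm (S z x) \<le> exp (E0 H * Im z) * norm x"
proof (rule LIMSEQ_le)
  show "(\<lambda>n. norm (Sf z (pr (real n) x))) \<longlonglongrightarrow> norm (S z x)"
    by (intro tendsto_norm S_tendsto)
  show "(\<lambda>n. exp (E0 H * Im z) * norm (pr (real n) x)) \<longlonglongrightarrow> exp (E0 H * Im z) * norm x"
    by (intro tendsto_intros pr_tendsto)
qed (use norm_Sf_le[OF _ z] in auto)

lemma bounded_linear_S: "bounded_linear (S z)"
  by (rule clinear_bounded_linear[OF clinear_S norm_S_le])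

lemma S_H:
  assumes "(x, y) \<in> H"
  shows "(S z x, S z y) \<in> H"
proof (rule closed_opD[OF closed_H])
  show "(Sf z (pr (real n) x), Sf z (hv (pr (real n) x))) \<in> H" for n
    by (rule Sf_H) simp
  show "(\<lambda>n. Sf z (pr (real n) x)) \<longlonglongrightarrow> S z x"
    by (rule S_tendsto)
  have "(\<lambda>n. S z (hv (pr (real n) x))) \<longlonglongrightarrow> S z y"
    unfolding hv_def by (intro bounded_linear.tendsto[OF bounded_linear_S] H_core assms)
  then show "(\<lambda>n. Sf z (hv (pr (real n) x))) \<longlonglongrightarrow> S z y"
    by (simp add: S_eq_Sf)
qed

end

lemma S_adjoint:
  assumes z: "Im z \<le> 0"
  shows "cinner (S (- cnj z) y) x = cinner y (S z x)"
proof (rule LIMSEQ_unique)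
  have z': "Im (- cnj z) \<le> 0"
    using z by simp
  show "(\<lambda>n. cinner (Sf (- cnj z) (pr (real n) y)) (pr (real n) x)) \<longlonglongrightarrow> cinner (S (- cnj z) y) x"
    by (intro tendsto_intros S_tendsto[OF z'] pr_tendsto)
  have "cinner (Sf (- cnj z) (pr (real n) y)) (pr (real n) x) = cinner (pr (real n) y) (Sf z (pr (real n) x))" for n
    using Sf_pairing[of "pr (real n) x" "pr (real n) y" z 0] by (simp add: Sf_0)
  then show "(\<lambda>n. cinner (Sf (- cnj z) (pr (real n) y)) (pr (real n) x)) \<longlonglongrightarrow> cinner y (S z x)"
    by (simp only:) (intro tendsto_intros S_tendsto[OF z] pr_tendsto)
qed

text \<open>On \<open>D\<close> the law is \<open>Sf_pairing\<close> read through
  \<open>S_adjoint\<close>; this avoids evolving \<open>Sf a x\<close>, which may lie outside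
  \<open>D\<close>, by the series.\<close>

lemma S_add:
  assumes z: "Im z \<le> 0" "Im a \<le> 0"
  shows "S z (S a x) = S (a + z) x"
proof -
  have za: "Im (a + z) \<le> 0" and z': "Im (- cnj z) \<le> 0"
    using z by simp_all
  have D: "S z (S a x) = S (a + z) x" if x: "x \<in> D" for x
  proof (rule cinner_eq_dense[OF closure_D])
    fix y assume y: "y \<in> D"
    have "cinner y (S z (S a x)) = cinner (Sf (- cnj z) y) (Sf a x)"
      unfolding S_adjoint[OF z(1), symmetric] using x y z z' by (simp add: S_eq_Sf)
    also have "\<dots> = cinner y (S (a + z) x)"
      using x y za by (simp add: Sf_pairing S_eq_Sf)
    finally show "cinner y (S z (S a x)) = cinner y (S (a + z) x)" .
  qed
  have "(\<lambda>n. S z (S a (pr (real n) x))) \<longlonglongrightarrow> S z (S a x)"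
    by (intro bounded_linear.tendsto[OF bounded_linear_S[OF z(1)]] bounded_linear.tendsto[OF bounded_linear_S[OF z(2)]] pr_tendsto)
  moreover have "(\<lambda>n. S (a + z) (pr (real n) x)) \<longlonglongrightarrow> S (a + z) x"
    by (intro bounded_linear.tendsto[OF bounded_linear_S[OF za]] pr_tendsto)
  ultimately show ?thesis
    unfolding D[OF pr_D] using LIMSEQ_unique by blast
qed

section \<open>Identification with the closed evolution operators \<open>evol_W\<close>\<close>

lemma fast_Vn:
  assumes "x \<in> D"
  shows "fast (\<lambda>n. Vn n z x)"
proof -
  obtain e where e: "0 \<le> e" "x \<in> V P e"
    using assms unfolding D_iff by blast
  show ?thesis
  proof (rule fast_geometric_factor[OF fast_w[OF assms, of z], of "exp (cmod z * e)" "exp (cmod z * b)"])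
    fix n
    have "Vn n z x = ex z (w n z x)"
      unfolding w_def using assms by simp
    then have "norm (Vn n z x) \<le> exp (cmod z * (e + real n * b)) * norm (w n z x)"
      using ex_bound[OF _ w_V[OF e], of n z z] e(1) by simp
    also have "exp (cmod z * (e + real n * b)) = exp (cmod z * e) * exp (cmod z * b) ^ n"
      by (simp add: exp_of_nat_mult[symmetric] algebra_simps flip: exp_add)
    finally show "norm (Vn n z x) \<le> exp (cmod z * e) * exp (cmod z * b) ^ n * norm (w n z x)" .
  qed auto
qed

text \<open>The domain of the closure of \<open>evol_U\<close> may reach beyond \<open>D\<close>. On
  \<open>evol_U\<close> itself the bounded \<open>exb (- z)\<close> turns the series of
  \<open>Vn\<close> into that of \<open>w\<close>; the resulting relation is closed in the graph and
  so extends to the closure.\<close>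

lemma closure_evol_W:
  assumes z: "Im z \<le> 0"
  shows "closure (evol_W P H1 z) = {(x, S z x) |x. True}"
proof -
  have z': "0 \<le> Im (- z)"
    using z by simp
  note exb = exp_op_eq_exb[OF z'] bounded_linear_exb[OF z']
  have U: "exb (- z) y = S z x" if xy: "(x, y) \<in> evol_U P H1 z 0" for x y
  proof -
    have x: "x \<in> D" "(\<lambda>n. Vn n z x) sums y"
      using xy unfolding evol_U_eq by auto
    have "(\<lambda>n. exb (- z) (Vn n z x)) sums exb (- z) y"
      by (rule bounded_linear.sums[OF exb(2) x(2)])
    then have "(\<lambda>n. w n z x) sums exb (- z) y"
      using x(1) by (simp add: exb_eq_ex[OF z'] w_def)
    then show ?thesis
      using x(1) by (simp add: S_eq_Sf[OF z] Sf_def sums_iff)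
  qed
  have closed_S: "closed {p. snd p = S z (fst p)}"
    by (intro closed_Collect_eq continuous_intros continuous_on_compose2[OF linear_continuous_on[OF bounded_linear_S[OF z], of UNIV]]) auto
  have "closed {p. exb (- z) (snd p) = S z (fst p)}"
    by (intro closed_Collect_eq continuous_intros
        continuous_on_compose2[OF linear_continuous_on[OF bounded_linear_S[OF z], of UNIV]]
        continuous_on_compose2[OF linear_continuous_on[OF exb(2), of UNIV]]) auto
  then have "closure (evol_U P H1 z 0) \<subseteq> {p. exb (- z) (snd p) = S z (fst p)}"
    by (intro closure_minimal) (use U in auto)
  then have "evol_W P H1 z \<subseteq> {p. snd p = S z (fst p)}"
    unfolding evol_W_def op_mult_def exb(1) by auto
  then have "closure (evol_W P H1 z) \<subseteq> {p. snd p = S z (fst p)}"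
    by (rule closure_minimal[OF _ closed_S])
  then have 1: "closure (evol_W P H1 z) \<subseteq> {(x, S z x) |x. True}"
    by auto
  have D: "(x, S z x) \<in> evol_W P H1 z" if x: "x \<in> D" for x
  proof -
    have "(x, \<Sum>n. Vn n z x) \<in> evol_U P H1 z 0"
      unfolding evol_U_eq using x by (simp add: summable_sums fast_summable'[OF fast_Vn])
    moreover from U[OF this] have "(\<Sum>n. Vn n z x, S z x) \<in> exp_op P (- z)"
      unfolding exb(1) by auto
    ultimately show ?thesis
      unfolding evol_W_def op_mult_def using closure_subset by blast
  qed
  have "(x, S z x) \<in> closure (evol_W P H1 z)" for x
  proof (rule closed_opD[OF closed_closure _ pr_tendsto])
    show "(pr (real n) x, S z (pr (real n) x)) \<in> closure (evol_W P H1 z)" for n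
      using D[OF pr_D] closure_subset by blast
    show "(\<lambda>n. S z (pr (real n) x)) \<longlonglongrightarrow> S z x"
      by (intro bounded_linear.tendsto[OF bounded_linear_S[OF z]] pr_tendsto)
  qed
  with 1 show ?thesis
    by auto
qed

end

section \<open>Uniform boundedness\<close>

text \<open>A gliding hump argument for a family of vectors that act as functionals through the
  inner product.\<close>

lemma uniform_boundedness:
  fixes W :: "'a::complex_hilbert set"
  assumes "\<And>y. \<exists>M. \<forall>w\<in>W. cmod (cinner w y) \<le> M"
  shows "\<exists>C. \<forall>w\<in>W. norm w \<le> C"
proof (rule ccontr)
  assume "\<nexists>C. \<forall>w\<in>W. norm w \<le> C"
  \<comment> \<open>Growth \<open>4 ^ n\<close> against steps of length \<open>(1 / 3) ^ n\<close>:
    the hump at stage \<open>n\<close> exceeds \<open>(4 / 3) ^ n\<close>, and all later steps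
    together can remove at most half of it.\<close>
  then have "\<forall>n::nat. \<exists>w\<in>W. 4 ^ n < norm w"
    by (meson not_le_imp_less)
  then obtain u where u: "\<And>n. u n \<in> W" "\<And>n::nat. 4 ^ n < norm (u n)"
    by metis
  define d where "d n = complex_of_real (1 / (3 ^ n * norm (u n))) *\<^sub>C u n" for n
  have nu: "0 < norm (u n)" for n
    using u(2)[of n] by (meson less_trans zero_less_numeral zero_less_power)
  have norm_d: "norm (d n) = (1 / 3) ^ n" for n
    using nu[of n] unfolding d_def norm_scaleC norm_of_real by (simp add: power_one_over)
  have ud: "cmod (cinner (u n) (d n)) = norm (u n) / 3 ^ n" for n
    using nu[of n] unfolding d_def cinner_scaleC_right cinner_norm
    by (simp add: norm_mult norm_divide norm_power power2_eq_square del: of_real_power)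
  text \<open>At each step one of \<open>x \<plusminus> d\<close> pairs well with \<open>u n\<close>, and later steps are too short to undo this.\<close>
  define x where "x = rec_nat 0 (\<lambda>n p. if cmod (cinner (u n) (d n)) \<le> cmod (cinner (u n) (p + d n)) then p + d n else p - d n)"
  have x_Suc: "x (Suc n) = (if cmod (cinner (u n) (d n)) \<le> cmod (cinner (u n) (x n + d n)) then x n + d n else x n - d n)" for n
    unfolding x_def by simp
  have x_big: "norm (u n) / 3 ^ n \<le> cmod (cinner (u n) (x (Suc n)))" for n
  proof -
    have "2 * cmod (cinner (u n) (d n)) = cmod (cinner (u n) (x n + d n) - cinner (u n) (x n - d n))"
      by (simp add: cinner_add_right cinner_diff_right norm_mult flip: mult_2)
    also have "\<dots> \<le> cmod (cinner (u n) (x n + d n)) + cmod (cinner (u n) (x n - d n))"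
      by (rule norm_triangle_ineq4)
    finally show ?thesis
      unfolding ud[symmetric] x_Suc by auto
  qed
  have step: "norm (x (Suc n) - x n) = (1 / 3) ^ n" for n
    unfolding x_Suc norm_d[symmetric] by simp
  define y where "y n = x (Suc n) - x n" for n
  have sy: "summable y"
    by (rule summable_comparison_test'[of "\<lambda>n. (1 / 3) ^ n"]) (auto simp: y_def step summable_geometric)
  have x_sum: "x n = (\<Sum>i<n. y i)" for n
    unfolding y_def by (subst sum_lessThan_telescope) (simp add: x_def)
  have close: "norm (suminf y - x (Suc n)) \<le> (1 / 3) ^ n / 2" for n
  proof -
    have "suminf y - x (Suc n) = (\<Sum>i. y (i + Suc n))"
      unfolding x_sum by (rule suminf_minus_initial_segment[OF sy, symmetric])
    also have "norm \<dots> \<le> (\<Sum>i. (1 / 3) ^ (i + Suc n))"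
    proof (rule norm_suminf_le)
      show "summable (\<lambda>i. (1 / 3 :: real) ^ (i + Suc n))"
        unfolding power_add by (intro summable_mult2 summable_geometric) simp
    qed (simp add: y_def step)
    also have "\<dots> = (\<Sum>i. (1 / 3) ^ i) * (1 / 3 :: real) ^ Suc n"
      unfolding power_add by (rule suminf_mult2[symmetric]) (simp add: summable_geometric)
    also have "\<dots> = (1 / 3) ^ n / 2"
      by (subst suminf_geometric) auto
    finally show ?thesis .
  qed
  obtain M where M: "\<And>w. w \<in> W \<Longrightarrow> cmod (cinner w (suminf y)) \<le> M"
    using assms by blast
  have "(4 / 3) ^ n / 2 \<le> M" for n :: nat
  proof -
    have "cmod (cinner (u n) (suminf y - x (Suc n))) \<le> norm (u n) * ((1 / 3) ^ n / 2)"
      by (rule order_trans[OF Cauchy_Schwarz]) (intro mult_left_mono close norm_ge_zero)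
    moreover have "cmod (cinner (u n) (x (Suc n))) \<le> cmod (cinner (u n) (suminf y)) + cmod (cinner (u n) (suminf y - x (Suc n)))"
      unfolding cinner_diff_right using norm_triangle_ineq4[of "cinner (u n) (suminf y)" "cinner (u n) (suminf y) - cinner (u n) (x (Suc n))"]
      by simp
    ultimately have "norm (u n) / 3 ^ n \<le> M + norm (u n) / 3 ^ n / 2"
      using x_big[of n] M[OF u(1), of n] by (simp add: power_one_over)
    then have "norm (u n) / 3 ^ n / 2 \<le> M"
      by simp
    moreover have "4 ^ n / 3 ^ n / 2 \<le> norm (u n) / 3 ^ n / 2"
      using u(2)[of n] by (intro divide_right_mono) auto
    ultimately show ?thesis
      by (simp add: power_divide)
  qed
  moreover obtain n where "2 * M < (4 / 3) ^ n"
    using real_arch_pow[of "4 / 3" "2 * M"] by auto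
  ultimately show False
    by (metis linorder_not_less mult.commute divide_le_eq_numeral1(1))
qed

section \<open>Convergence to the ground state\<close>

locale ground = symmetric_interaction +
  fixes \<Omega> :: 'a
  assumes unique_ground: "unique_ground_state H \<Omega>" and norm_ground: "norm \<Omega> = 1"
begin

abbreviation E :: real where "E \<equiv> E0 H"

lemma ground_H: "(\<Omega>, complex_of_real E *\<^sub>C \<Omega>) \<in> H"
  using unique_ground unfolding unique_ground_state_def ground_state_def ground_space_def by blast

lemma ground_space_span:
  assumes "(y, complex_of_real E *\<^sub>C y) \<in> H"
  shows "y = cinner \<Omega> y *\<^sub>C \<Omega>"
proof -
  have dim: "cdim (ground_space H) = 1"
    using unique_ground unfolding unique_ground_state_def by blast
  obtain B where B: "B \<subseteq> ground_space H" "ground_space H \<subseteq> cspan B" "card B = cdim (ground_space H)"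
    using complex_vector.basis_exists by metis
  obtain \<psi> where \<psi>: "B = {\<psi>}"
    using B(3) dim by (auto simp: card_1_singleton_iff)
  have span: "\<exists>k. x = k *\<^sub>C \<psi>" if "x \<in> ground_space H" for x
    using that B(2) unfolding \<psi> by (auto simp: complex_vector.span_singleton)
  obtain k where k: "\<Omega> = k *\<^sub>C \<psi>"
    using span ground_H unfolding ground_space_def by blast
  obtain l where l: "y = l *\<^sub>C \<psi>"
    using span assms unfolding ground_space_def by blast
  have "k \<noteq> 0"
    using k norm_ground by auto
  then have y: "y = (l / k) *\<^sub>C \<Omega>"
    unfolding k l by (simp add: scaleC_scaleC)
  then have "cinner \<Omega> y = l / k"
    using norm_ground by (simp add: cinner_scaleC_right cinner_norm)
  with y show ?thesis by simp
qed

text \<open>The evolution acts on \<open>x\<close> and not on \<open>y\<close>, since an eigenvector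
  of \<open>H\<close> need not have finite energy; \<open>S_ground\<close> transfers the phase to
  \<open>y\<close> by duality.\<close>

lemma Sf_ground:
  assumes x: "x \<in> D" and y: "(y, complex_of_real E *\<^sub>C y) \<in> H"
  shows "cinner y (Sf z x) = exp (- \<i> * z * E) * cinner y x"
proof -
  define \<psi> where "\<psi> z = exp (\<i> * z * E) * cinner y (Sf z x)" for z
  have "(\<psi> has_field_derivative 0) (at z)" for z
  proof -
    have "((\<lambda>z. cinner y (Sf z x)) has_field_derivative cinner y (- \<i> *\<^sub>C Sf z (hv x))) (at z)"
      by (rule has_cderiv_cinner[OF has_cderiv_Sf[OF x]])
    moreover have "cinner y (Sf z (hv x)) = E * cinner y (Sf z x)"
      using H_symmetric[OF y Sf_H[OF x]] by (simp add: cinner_scaleC_left)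
    ultimately have "((\<lambda>z. cinner y (Sf z x)) has_field_derivative - \<i> * (E * cinner y (Sf z x))) (at z)"
      by (simp only: cinner_scaleC_right)
    moreover have "((\<lambda>z. exp (\<i> * z * E)) has_field_derivative exp (\<i> * z * E) * (\<i> * E)) (at z)"
      by (auto intro!: derivative_eq_intros)
    ultimately show ?thesis
      unfolding \<psi>_def by (auto intro!: derivative_eq_intros simp: algebra_simps)
  qed
  then have "\<psi> z = \<psi> 0"
    using has_field_derivative_zero_constant[of UNIV \<psi>] by (metis UNIV_I convex_UNIV)
  then have "exp (- \<i> * z * E) * \<psi> z = exp (- \<i> * z * E) * cinner y x"
    unfolding \<psi>_def using x by (simp add: Sf_0)
  then show ?thesis
    unfolding \<psi>_def mult.assoc[symmetric] by (simp flip: exp_add)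
qed

lemma S_ground:
  assumes z: "Im z \<le> 0" and y: "(y, complex_of_real E *\<^sub>C y) \<in> H"
  shows "S z y = exp (- \<i> * z * E) *\<^sub>C y"
proof (rule cinner_eq_dense[OF closure_D])
  fix x assume x: "x \<in> D"
  have z': "Im (- cnj z) \<le> 0"
    using z by simp
  have "cinner x (S z y) = cinner (Sf (- cnj z) x) y"
    using S_adjoint[OF z, of x y] S_eq_Sf[OF z' x] by simp
  also have "\<dots> = cnj (cinner y (Sf (- cnj z) x))"
    by (rule cinner_commute)
  also have "\<dots> = exp (- \<i> * z * E) * cnj (cinner y x)"
    unfolding Sf_ground[OF x y] by (simp add: exp_cnj)
  also have "\<dots> = cinner x (exp (- \<i> * z * E) *\<^sub>C y)"
    unfolding cinner_scaleC_right using cinner_commute[of x y] by simp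
  finally show "cinner x (S z y) = cinner x (exp (- \<i> * z * E) *\<^sub>C y)" .
qed

text \<open>\<open>K s\<close> is \<open>e\<^sup>-\<^sup>s\<^sup>(\<^sup>H\<^sup>-\<^sup>E\<^sup>)\<close>.\<close>

definition K :: "real \<Rightarrow> 'a \<Rightarrow> 'a" where
  "K s x = complex_of_real (exp (s * E)) *\<^sub>C S (- \<i> * of_real s) x"

context
  fixes s :: real
  assumes s: "0 \<le> s"
begin

lemma Im_K: "Im (- \<i> * of_real s) \<le> 0"
  using s by simp

lemma clinear_K: "clinear (K s)"
  using clinear_onD[OF clinear_S[OF Im_K]] unfolding clinear_on_def K_def
  by (auto simp: scaleC_add_right scaleC_scaleC mult.commute)

lemma norm_K_le: "norm (K s x) \<le> norm x"
proof -
  have "exp (s * E) * norm (S (- \<i> * of_real s) x) \<le> exp (s * E) * (exp (E * Im (- \<i> * of_real s)) * norm x)"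
    by (intro mult_left_mono norm_S_le Im_K) simp
  also have "\<dots> = norm x"
    by (simp add: exp_minus field_simps)
  finally show ?thesis
    unfolding K_def norm_scaleC norm_of_real by simp
qed

lemma bounded_linear_K: "bounded_linear (K s)"
  by (rule clinear_bounded_linear[OF clinear_K, of 1]) (simp add: norm_K_le)

lemma K_selfadjoint: "cinner (K s x) y = cinner x (K s y)"
  using S_adjoint[OF Im_K, of x y] unfolding K_def by (simp add: cinner_scaleC_left cinner_scaleC_right)

lemma K_ground: "(y, complex_of_real E *\<^sub>C y) \<in> H \<Longrightarrow> K s y = y"
  unfolding K_def by (subst S_ground[OF Im_K]) (simp_all add: scaleC_scaleC exp_minus flip: exp_of_real)

end

section \<open>The semigroup in imaginary time and its limit\<close>

lemma K_add:
  assumes "0 \<le> s" "0 \<le> t"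
  shows "K s (K t x) = K (s + t) x"
proof -
  have "S (- \<i> * of_real s) (S (- \<i> * of_real t) x) = S (- \<i> * of_real (s + t)) x"
    using S_add[OF Im_K[OF assms(1)] Im_K[OF assms(2)], of x] by (simp add: algebra_simps)
  then show ?thesis
    unfolding K_def using clinear_onD(2)[OF clinear_S[OF Im_K[OF assms(1)]]]
    by (simp add: scaleC_scaleC distrib_right exp_add)
qed

lemma K_halves:
  assumes s: "0 \<le> s"
  shows "cinner x (K (2 * s) x) = complex_of_real ((norm (K s x))\<^sup>2)"
proof -
  have "cinner x (K (2 * s) x) = cinner x (K s (K s x))"
    using K_add[OF s s, of x] by (simp only: mult_2)
  then show ?thesis
    unfolding K_selfadjoint[OF s, symmetric] cinner_norm .
qed

text \<open>By self-adjointness and the semigroup law the cross term depends on \<open>s + t\<close>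
  only. Convergence of the decreasing squared norms thus forces \<open>K s x\<close> to be
  Cauchy.\<close>

lemma norm_K_diff_square:
  assumes "0 \<le> s" "0 \<le> t"
  shows "(norm (K s x - K t x))\<^sup>2 = (norm (K s x))\<^sup>2 - 2 * (norm (K ((s + t) / 2) x))\<^sup>2 + (norm (K t x))\<^sup>2"
proof -
  have "2 * ((s + t) / 2) = s + t"
    by simp
  then have "cinner (K s x) (K t x) = cinner x (K (2 * ((s + t) / 2)) x)"
    using assms by (simp only: K_selfadjoint K_add)
  also have "\<dots> = complex_of_real ((norm (K ((s + t) / 2) x))\<^sup>2)"
    by (rule K_halves) (use assms in simp)
  finally show ?thesis
    unfolding norm_diff_square by simp
qed

lemma norm_K_antimono:
  assumes "0 \<le> s" "s \<le> t"
  shows "norm (K t x) \<le> norm (K s x)"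
  using norm_K_le[of "t - s" "K s x"] K_add[of "t - s" s x] assms by simp

text \<open>A substitute for the spectral theorem: the strong limit exists by monotonicity, is fixed
  by the semigroup, hence lies in the ground space, and is pinned down there by its overlap with
  \<Omega>.\<close>

lemma K_limit: "((\<lambda>s. K s x) \<longlongrightarrow> cinner \<Omega> x *\<^sub>C \<Omega>) at_top"
proof -
  define a where "a s = (norm (K s x))\<^sup>2" for s
  have a_anti: "a t \<le> a s" if "0 \<le> s" "s \<le> t" for s t
    unfolding a_def using norm_K_antimono[OF that] by (intro power_mono) auto
  define l where "l = (INF n. a (real n))"
  have bdd: "bdd_below (range (\<lambda>n::nat. a (real n)))"
    by (rule bdd_belowI[of _ 0]) (auto simp: a_def)
  have l_le: "l \<le> a s" if "0 \<le> s" for s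
  proof -
    have "l \<le> a (real (nat \<lceil>s\<rceil>))"
      unfolding l_def by (rule cINF_lower[OF bdd]) simp
    also have "\<dots> \<le> a s"
      using that by (intro a_anti) (auto simp: real_nat_ceiling_ge)
    finally show ?thesis .
  qed
  have near: "\<exists>s0\<ge>0. \<forall>s\<ge>s0. \<forall>t\<ge>s0. norm (K s x - K t x) < e" if e: "0 < e" for e
  proof -
    \<comment> \<open>The two endpoint terms will exceed \<open>l\<close> by less than
      \<open>e\<^sup>2 / 2\<close> each, while the midpoint term is at least
      \<open>l\<close>.\<close>
    have "\<exists>n::nat. a (real n) < l + e\<^sup>2 / 2"
      using cINF_less_iff[OF _ bdd, of "l + e\<^sup>2 / 2"] e unfolding l_def by auto
    then obtain n :: nat where n: "a (real n) < l + e\<^sup>2 / 2"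
      by blast
    have "norm (K s x - K t x) < e" if st: "real n \<le> s" "real n \<le> t" for s t
    proof -
      have nn: "0 \<le> s" "0 \<le> t"
        using st of_nat_0_le_iff order_trans by blast+
      have "(norm (K s x - K t x))\<^sup>2 = a s - 2 * a ((s + t) / 2) + a t"
        unfolding a_def by (rule norm_K_diff_square[OF nn])
      also have "\<dots> \<le> a (real n) - 2 * l + a (real n)"
        using a_anti[OF _ st(1)] a_anti[OF _ st(2)] l_le[of "(s + t) / 2"] nn by simp
      also have "\<dots> < e\<^sup>2"
        using n by simp
      finally show ?thesis
        using e by (meson less_imp_le power_less_imp_less_base)
    qed
    then show ?thesis
      by (intro exI[of _ "real n"]) auto
  qed
  have "Cauchy (\<lambda>n. K (real n) x)"
  proof (rule metric_CauchyI)
    fix e :: real assume "0 < e"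
    from near[OF this] obtain s0 where s0: "0 \<le> s0" "\<And>s t. s0 \<le> s \<Longrightarrow> s0 \<le> t \<Longrightarrow> norm (K s x - K t x) < e"
      by blast
    have "s0 \<le> real m" if "nat \<lceil>s0\<rceil> \<le> m" for m
      using that by (simp add: nat_ceiling_le_eq)
    then show "\<exists>M. \<forall>m\<ge>M. \<forall>n\<ge>M. dist (K (real m) x) (K (real n) x) < e"
      unfolding dist_norm using s0(2) by blast
  qed
  then obtain y where y: "(\<lambda>n. K (real n) x) \<longlonglongrightarrow> y"
    using Cauchy_convergent convergent_def by blast
  have lim: "((\<lambda>s. K s x) \<longlongrightarrow> y) at_top"
  proof (rule tendstoI)
    fix e :: real assume e: "0 < e"
    then obtain s0 where s0: "0 \<le> s0" "\<And>s t. s0 \<le> s \<Longrightarrow> s0 \<le> t \<Longrightarrow> norm (K s x - K t x) < e / 2"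
      using near[of "e / 2"] by auto
    have "dist (K s x) y < e" if s: "s0 \<le> s" for s
    proof -
      have "norm (K s x - y) \<le> e / 2"
      proof (rule LIMSEQ_le_const2[of "\<lambda>n. norm (K s x - K (real n) x)"])
        show "(\<lambda>n. norm (K s x - K (real n) x)) \<longlonglongrightarrow> norm (K s x - y)"
          by (intro tendsto_intros y)
        have "norm (K s x - K (real n) x) \<le> e / 2" if "nat \<lceil>s0\<rceil> \<le> n" for n
          using that s0(2)[OF s, of "real n"] by (simp add: nat_ceiling_le_eq)
        then show "\<exists>N. \<forall>n\<ge>N. norm (K s x - K (real n) x) \<le> e / 2"
          by blast
      qed
      then show ?thesis
        using e by (simp add: dist_norm)
    qed
    then show "\<forall>\<^sub>F s in at_top. dist (K s x) y < e"
      unfolding eventually_at_top_linorder by blast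
  qed
  have fixed: "K t y = y" if t: "0 \<le> t" for t
  proof (rule tendsto_unique[OF trivial_limit_at_top_linorder])
    show "((\<lambda>s. K t (K s x)) \<longlongrightarrow> K t y) at_top"
      by (rule bounded_linear.tendsto[OF bounded_linear_K[OF t] lim])
    have "((\<lambda>s. K (t + s) x) \<longlongrightarrow> y) at_top"
      by (rule filterlim_compose[OF lim filterlim_tendsto_add_at_top[OF tendsto_const filterlim_ident]])
    moreover have "\<forall>\<^sub>F s in at_top. K (t + s) x = K t (K s x)"
      using eventually_ge_at_top[of 0] by eventually_elim (simp add: K_add t)
    ultimately show "((\<lambda>s. K t (K s x)) \<longlongrightarrow> y) at_top"
      by (rule Lim_transform_eventually)
  qed
  \<comment> \<open>The invariance of \<open>y\<close> is differentiated at time 0. The derivative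
    is made to fall on \<open>u\<close> in \<open>D\<close>, whose evolution is holomorphic, and is
    evaluated along the negative imaginary axis, where the weighted pairing is constant.\<close>
  have y_D: "cinner (hv u) y = E * cinner u y" if u: "u \<in> D" for u
  proof -
    define \<psi> where "\<psi> z = exp (\<i> * z * E) * cinner y (Sf z u)" for z
    have "((\<lambda>z. cinner y (Sf z u)) has_field_derivative cinner y (- \<i> *\<^sub>C Sf 0 (hv u))) (at 0)"
      by (rule has_cderiv_cinner[OF has_cderiv_Sf[OF u]])
    then have "((\<lambda>z. cinner y (Sf z u)) has_field_derivative - \<i> * cinner y (hv u)) (at 0)"
      using u by (simp only: cinner_scaleC_right Sf_0 hv_D)
    moreover have "((\<lambda>z. exp (\<i> * z * E)) has_field_derivative \<i> * E) (at 0)"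
      by (auto intro!: derivative_eq_intros)
    ultimately have "(\<psi> has_field_derivative \<i> * E * cinner y u - \<i> * cinner y (hv u)) (at 0)"
      unfolding \<psi>_def using u by (auto intro!: derivative_eq_intros simp: Sf_0 algebra_simps)
    then have "(\<lambda>h. (\<psi> (0 + h) - \<psi> 0) / h) \<midarrow>0\<rightarrow> \<i> * E * cinner y u - \<i> * cinner y (hv u)"
      unfolding DERIV_def .
    moreover have "filterlim (\<lambda>n. - \<i> * of_real (1 / real (Suc n))) (at 0) sequentially"
    proof (rule filterlim_atI)
      have "(\<lambda>n. of_real (1 / real (Suc n)) :: complex) \<longlonglongrightarrow> of_real 0"
        by (intro tendsto_of_real LIMSEQ_Suc[OF lim_1_over_n])
      then show "(\<lambda>n. - \<i> * of_real (1 / real (Suc n))) \<longlonglongrightarrow> 0"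
        by (intro tendsto_mult_right_zero) simp
      show "\<forall>\<^sub>F n in sequentially. - \<i> * of_real (1 / real (Suc n)) \<noteq> 0"
        by (intro always_eventually allI) (simp del: of_nat_Suc)
    qed
    ultimately have "(\<lambda>n. (\<psi> (0 + - \<i> * of_real (1 / real (Suc n))) - \<psi> 0) / (- \<i> * of_real (1 / real (Suc n))))
        \<longlonglongrightarrow> \<i> * E * cinner y u - \<i> * cinner y (hv u)"
      by (rule filterlim_compose)
    moreover have const: "\<psi> (0 + - \<i> * of_real t) = \<psi> 0" if t: "0 \<le> t" for t
    proof -
      have "\<psi> (0 + - \<i> * of_real t) = cinner y (K t u)"
        unfolding \<psi>_def K_def S_eq_Sf[OF Im_K[OF t] u] cinner_scaleC_right
        by (simp add: mult.commute exp_of_real flip: of_real_mult)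
      also have "\<dots> = cinner y u"
        using K_selfadjoint[OF t, of y u] fixed[OF t] by simp
      finally show ?thesis
        unfolding \<psi>_def using u by (simp add: Sf_0)
    qed
    then have "\<psi> (0 + - \<i> * of_real (1 / real (Suc n))) = \<psi> 0" for n
      by (intro const) simp
    ultimately have "(\<lambda>n::nat. 0) \<longlonglongrightarrow> \<i> * E * cinner y u - \<i> * cinner y (hv u)"
      by (simp only: diff_self div_0)
    then have "\<i> * E * cinner y u - \<i> * cinner y (hv u) = 0"
      by (simp add: LIMSEQ_const_iff)
    then have "\<i> * (E * cinner y u - cinner y (hv u)) = 0"
      by (simp add: algebra_simps)
    then have "cinner y (hv u) = E * cinner y u"
      by simp
    then have "cnj (cinner y (hv u)) = cnj (E * cinner y u)"
      by simp
    then show ?thesis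
      by (simp add: cinner_commute[symmetric])
  qed
  have y_H: "cinner q y = E * cinner p y" if pq: "(p, q) \<in> H" for p q
  proof (rule LIMSEQ_unique)
    show "(\<lambda>n. cinner (hv (pr (real n) p)) y) \<longlonglongrightarrow> cinner q y"
      unfolding hv_def by (intro tendsto_intros H_core pq)
    show "(\<lambda>n. cinner (hv (pr (real n) p)) y) \<longlonglongrightarrow> E * cinner p y"
      unfolding y_D[OF pr_D] by (intro tendsto_intros pr_tendsto)
  qed
  \<comment> \<open>So far \<open>y\<close> is an eigenvector only in the weak sense. Exhibiting it
    as a value of the symmetric resolvent puts it into the domain of \<open>H\<close>.\<close>
  have "(y, complex_of_real E *\<^sub>C y) \<in> H"
  proof -
    obtain k0 where "0 < k0" "\<And>k. k0 \<le> k \<Longrightarrow> \<exists>R. clinear R \<and> bounded_linear R \<and>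
        H = {(R y, y - complex_of_real k *\<^sub>C R y) |y. True}"
      by (rule Kato_Rellich) blast
    then obtain R where R: "H = {(R y, y - complex_of_real k0 *\<^sub>C R y) |y. True}"
      by blast
    have mem: "(R u, u - complex_of_real k0 *\<^sub>C R u) \<in> H" for u
      unfolding R by blast
    define q where "q = complex_of_real (E + k0) *\<^sub>C y"
    have "y = R q"
    proof (rule cinner_ext)
      fix u
      have "cinner u y = complex_of_real (E + k0) * cinner (R u) y"
        using y_H[OF mem[of u]] by (simp add: cinner_diff_left cinner_scaleC_left algebra_simps)
      also have "\<dots> = cinner (R u) q"
        unfolding q_def cinner_scaleC_right ..
      also have "\<dots> = cinner u (R q)"
        using H_symmetric[OF mem[of u] mem[of q]]
        by (simp add: cinner_diff_left cinner_diff_right cinner_scaleC_left cinner_scaleC_right)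
      finally show "cinner u y = cinner u (R q)" .
    qed
    then have "(y, q - complex_of_real k0 *\<^sub>C y) \<in> H"
      using mem[of q] by simp
    moreover have "q - complex_of_real k0 *\<^sub>C y = complex_of_real E *\<^sub>C y"
      unfolding q_def by (simp add: scaleC_add_left)
    ultimately show ?thesis
      by simp
  qed
  then have y_eq: "y = cinner \<Omega> y *\<^sub>C \<Omega>"
    by (rule ground_space_span)
  have "cinner \<Omega> y = cinner \<Omega> x"
  proof (rule LIMSEQ_unique)
    show "(\<lambda>n. cinner \<Omega> (K (real n) x)) \<longlonglongrightarrow> cinner \<Omega> y"
      by (intro tendsto_intros y)
    have "cinner \<Omega> (K (real n) x) = cinner \<Omega> x" for n
      using K_selfadjoint[of "real n" \<Omega> x] K_ground[OF _ ground_H, of "real n"] by simp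
    then show "(\<lambda>n. cinner \<Omega> (K (real n) x)) \<longlonglongrightarrow> cinner \<Omega> x"
      by simp
  qed
  then show ?thesis
    using lim y_eq by simp
qed

lemma S_limit:
  assumes f: "filterlim (\<lambda>t. Im (f t)) at_bot Fl"
  shows "((\<lambda>t. exp (\<i> * f t * E) *\<^sub>C S (f t) x) \<longlongrightarrow> cinner \<Omega> x *\<^sub>C \<Omega>) Fl"
proof -
  let ?y = "cinner \<Omega> x *\<^sub>C \<Omega>"
  have yH: "(?y, complex_of_real E *\<^sub>C ?y) \<in> H"
    using linear_opD(4)[OF linear_H ground_H, of "cinner \<Omega> x"] by (simp add: scaleC_scaleC mult.commute)
  have "filterlim (\<lambda>t. - Im (f t)) at_top Fl"
    using f by (simp add: filterlim_uminus_at_bot)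
  then have "((\<lambda>t. K (- Im (f t)) x) \<longlongrightarrow> ?y) Fl"
    by (rule filterlim_compose[OF K_limit])
  then have "((\<lambda>t. norm (K (- Im (f t)) x - ?y)) \<longlongrightarrow> 0) Fl"
    by (metis tendsto_norm_zero LIM_zero)
  moreover have "\<forall>\<^sub>F t in Fl. norm (exp (\<i> * f t * E) *\<^sub>C S (f t) x - ?y) \<le> norm (K (- Im (f t)) x - ?y)"
  proof -
    have "\<forall>\<^sub>F t in Fl. Im (f t) \<le> 0"
      using f by (simp add: filterlim_at_bot)
    then show ?thesis
    proof eventually_elim
      case (elim t)
      \<comment> \<open>The real part of the time acts by a contraction that multiplies the limit
        vector by a phase, which \<open>u\<close> below cancels. Only the imaginary part decides,
        and the real part may vary freely.\<close>
      define r s where "r = Re (f t)" and "s = - Im (f t)"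
      have ft: "f t = - \<i> * of_real s + of_real r"
        unfolding r_def s_def by (simp add: complex_eq_iff)
      have s: "0 \<le> s" and r: "Im (complex_of_real r) \<le> 0"
        using elim unfolding s_def by simp_all
      define u where "u = exp (\<i> * r * E)"
      have u1: "cmod u = 1"
        unfolding u_def by simp
      have "exp (\<i> * f t * E) *\<^sub>C S (f t) x = u *\<^sub>C S (of_real r) (K s x)"
      proof -
        have "S (f t) x = S (of_real r) (S (- \<i> * of_real s) x)"
          unfolding ft by (rule S_add[OF r Im_K[OF s], symmetric])
        moreover have "exp (\<i> * f t * E) = u * complex_of_real (exp (s * E))"
        proof -
          have "\<i> * f t * E = \<i> * r * E + complex_of_real (s * E)"
            unfolding ft by (simp add: algebra_simps)
          then show ?thesis
            unfolding u_def by (simp only: exp_add exp_of_real)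
        qed
        ultimately show ?thesis
          unfolding K_def using clinear_onD(2)[OF clinear_S[OF r]] by (simp add: scaleC_scaleC)
      qed
      moreover have "?y = u *\<^sub>C S (of_real r) ?y"
        unfolding S_ground[OF r yH] scaleC_scaleC u_def by (simp flip: exp_add add: mult_ac)
      ultimately have "exp (\<i> * f t * E) *\<^sub>C S (f t) x - ?y = u *\<^sub>C S (of_real r) (K s x - ?y)"
        by (simp add: clinear_extra(3)[OF clinear_S[OF r]] complex_vector.scale_right_diff_distrib)
      then have "norm (exp (\<i> * f t * E) *\<^sub>C S (f t) x - ?y) = norm (S (of_real r) (K s x - ?y))"
        by (simp only: norm_scaleC u1 mult_1)
      also have "\<dots> \<le> norm (K s x - ?y)"
        using norm_S_le[OF r, of "K s x - ?y"] by simp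
      finally show ?case
        unfolding s_def .
    qed
  qed
  ultimately have "((\<lambda>t. exp (\<i> * f t * E) *\<^sub>C S (f t) x - ?y) \<longlongrightarrow> 0) Fl"
    by (rule Lim_null_comparison[rotated])
  then show ?thesis
    using LIM_zero_iff by blast
qed

end

section \<open>Smooth vectors\<close>

context symmetric_interaction
begin

text \<open>\<open>R\<close> is \<open>(H + k)^(-1)\<close>. Its powers parametrize the domains of
  the powers of \<open>H\<close>, which turns graph-norm estimates into bounds for everywhere
  defined operators.\<close>

definition resolvent_at :: "real \<Rightarrow> ('a \<Rightarrow> 'a) \<Rightarrow> bool" where
  "resolvent_at k R \<longleftrightarrow> clinear R \<and> bounded_linear R \<and> H = {(R y, y - complex_of_real k *\<^sub>C R y) |y. True}"

context
  fixes k :: real and R :: "'a \<Rightarrow> 'a"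
  assumes R: "resolvent_at k R"
begin

lemma clinear_R: "clinear R" and bounded_linear_R: "bounded_linear R"
  and R_mem: "(R y, y - complex_of_real k *\<^sub>C R y) \<in> H"
  using R unfolding resolvent_at_def by auto

lemma R_unique: "(x, y) \<in> H \<Longrightarrow> x = R (y + complex_of_real k *\<^sub>C x)"
  using R unfolding resolvent_at_def by auto

lemma R_symmetric: "cinner (R x) y = cinner x (R y)"
  using H_symmetric[OF R_mem[of x] R_mem[of y]]
  by (simp add: cinner_diff_left cinner_diff_right cinner_scaleC_left cinner_scaleC_right)

lemma R_inj: "R x = R y \<Longrightarrow> x = y"
  using R_mem[of x] R_mem[of y] linear_opD(1)[OF linear_H] unfolding single_valued_def
  by (metis diff_add_cancel)

lemma clinear_Rn: "clinear (R ^^ n)"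
  by (induction n) (simp_all add: clinear_on_def clinear_onD[OF clinear_R])

lemma bounded_linear_Rn: "bounded_linear (R ^^ n)"
proof (induction n)
  case (Suc n)
  show ?case
    using bounded_linear_compose[OF bounded_linear_R Suc.IH] by (simp add: o_def)
qed (simp add: id_def)

lemma Rn_symmetric: "cinner ((R ^^ n) x) y = cinner x ((R ^^ n) y)"
  by (induction n arbitrary: x y) (simp_all add: R_symmetric funpow_swap1)

lemma Rn_inj: "(R ^^ n) x = (R ^^ n) y \<Longrightarrow> x = y"
  by (induction n arbitrary: x y) (auto dest: R_inj)

lemma Domain_H_power: "Domain (H ^^ n) = range (R ^^ n)"
proof (induction n)
  case (Suc n)
  have anti: "range (R ^^ Suc n) \<subseteq> range (R ^^ n)"
    by (auto simp: funpow_swap1[symmetric] simp del: funpow.simps(2)) (simp add: funpow_swap1)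
  have Suc_iff: "x \<in> Domain (H ^^ Suc n) \<longleftrightarrow> (\<exists>y. (x, y) \<in> H \<and> y \<in> range (R ^^ n))" for x
    unfolding Suc.IH[symmetric] by (auto simp: Domain_iff relpow_commute[symmetric])
  \<comment> \<open>Recovering \<open>x\<close> as \<open>R (y + k x)\<close> needs \<open>x\<close>
    itself, besides \<open>y\<close>, in the range of \<open>R ^^ n\<close>.\<close>
  have sub: "x \<in> range (R ^^ n)" if "x \<in> Domain (H ^^ Suc n)" for x
    using that unfolding Suc.IH[symmetric] by (auto intro: relpow_Suc_E)
  show ?case
  proof (intro equalityI subsetI)
    fix x assume x: "x \<in> Domain (H ^^ Suc n)"
    then obtain y where y: "(x, y) \<in> H" "y \<in> range (R ^^ n)"
      unfolding Suc_iff by blast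
    obtain p q where "y = (R ^^ n) p" "x = (R ^^ n) q"
      using y(2) sub[OF x] by blast
    then have "x = R ((R ^^ n) (p + complex_of_real k *\<^sub>C q))"
      using R_unique[OF y(1)] by (simp add: clinear_onD[OF clinear_Rn])
    then show "x \<in> range (R ^^ Suc n)"
      by auto
  next
    fix x assume "x \<in> range (R ^^ Suc n)"
    then obtain u where u: "x = R ((R ^^ n) u)"
      by auto
    have "(R ^^ n) u - complex_of_real k *\<^sub>C R ((R ^^ n) u) = (R ^^ n) (u - complex_of_real k *\<^sub>C R u)"
      by (simp add: clinear_extra(3)[OF clinear_Rn] clinear_onD[OF clinear_Rn] funpow_swap1)
    then have "(x, (R ^^ n) (u - complex_of_real k *\<^sub>C R u)) \<in> H"
      using R_mem[of "(R ^^ n) u"] unfolding u by simp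
    then show "x \<in> Domain (H ^^ Suc n)"
      unfolding Suc_iff by blast
  qed
qed simp

text \<open>\<open>D\<close> is invariant under \<open>H + k\<close>, so \<open>R\<close> can be
  divided out any number of times without leaving \<open>D\<close>.\<close>

lemma D_in_Rn: "u \<in> D \<Longrightarrow> \<exists>q\<in>D. u = (R ^^ n) q"
proof (induction n arbitrary: u)
  case (Suc n)
  then have "u = R (hv u + complex_of_real k *\<^sub>C u)" "hv u + complex_of_real k *\<^sub>C u \<in> D"
    using R_unique[OF H_hv] by simp_all
  then show ?case
    using Suc.IH by (metis comp_apply funpow.simps(2))
qed simp

lemma S_Rn:
  assumes z: "Im z \<le> 0"
  shows "S z ((R ^^ n) x) = (R ^^ n) (S z x)"
proof (induction n arbitrary: x)
  case (Suc n)
  have S_R: "S z (R y) = R (S z y)" for y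
  proof -
    have "(S z (R y), S z (y - complex_of_real k *\<^sub>C R y)) \<in> H"
      by (rule S_H[OF z R_mem])
    from R_unique[OF this] show ?thesis
      by (simp add: clinear_extra(3)[OF clinear_S[OF z]] clinear_onD[OF clinear_S[OF z]])
  qed
  show ?case
    using Suc.IH S_R by simp
qed simp

text \<open>\<open>(H + k)\<^sup>n A (H + k)\<^sup>-\<^sup>n\<^sup>-\<^sup>r\<close> is everywhere defined and has a densely defined adjoint, so it is
  bounded by the uniform boundedness principle.\<close>

lemma smooth_bounded:
  assumes A: "A \<in> class_C0 P"
    and maps: "maps_into A (Domain (H ^^ (n + r))) (Domain (H ^^ n))"
  obtains T where "bounded_linear T" "\<And>y. op_app A ((R ^^ (n + r)) y) = (R ^^ n) (T y)"
proof -
  have dom: "(R ^^ (n + r)) y \<in> Domain A" and rng: "op_app A ((R ^^ (n + r)) y) \<in> range (R ^^ n)" for y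
    using maps unfolding maps_into_def Domain_H_power by auto
  have "\<exists>T. \<forall>y. op_app A ((R ^^ (n + r)) y) = (R ^^ n) (T y)"
    using rng by (intro choice allI) blast
  then obtain T where T: "\<And>y. op_app A ((R ^^ (n + r)) y) = (R ^^ n) (T y)"
    by (elim exE) simp
  have lin_A: "linear_op A"
    using A unfolding class_C0_def by blast
  note sv = linear_opD(1)[OF lin_A]
  have mem: "((R ^^ (n + r)) y, (R ^^ n) (T y)) \<in> A" for y
    using op_app_mem[OF sv dom] unfolding T .
  have "clinear T"
    unfolding clinear_on_def
  proof (intro conjI ballI allI)
    show "T (x + y) = T x + T y" for x y
    proof (rule Rn_inj[of n])
      have "((R ^^ (n + r)) (x + y), (R ^^ n) (T x + T y)) \<in> A"
        using linear_opD(3)[OF lin_A mem[of x] mem[of y]] by (simp only: clinear_onD[OF clinear_Rn] UNIV_I)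
      then show "(R ^^ n) (T (x + y)) = (R ^^ n) (T x + T y)"
        using mem sv unfolding single_valued_def by blast
    qed
    show "T (a *\<^sub>C x) = a *\<^sub>C T x" for a x
    proof (rule Rn_inj[of n])
      have "((R ^^ (n + r)) (a *\<^sub>C x), (R ^^ n) (a *\<^sub>C T x)) \<in> A"
        using linear_opD(4)[OF lin_A mem[of x], of a] by (simp only: clinear_onD[OF clinear_Rn] UNIV_I)
      then show "(R ^^ n) (T (a *\<^sub>C x)) = (R ^^ n) (a *\<^sub>C T x)"
        using mem sv unfolding single_valued_def by blast
    qed
  qed
  \<comment> \<open>The adjoint of \<open>T\<close> is computed on \<open>D\<close>, where
    \<open>R ^^ n\<close> can be divided out and \<open>adj A\<close> is defined.\<close>
  have adj: "\<exists>t. \<forall>y. cinner u (T y) = cinner t y" if u: "u \<in> D" for u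
  proof -
    obtain q where q: "q \<in> D" "u = (R ^^ n) q"
      using D_in_Rn[OF u] by blast
    obtain t where t: "(q, t) \<in> adj A"
      using class_C0_adj_D[OF A q(1)] by blast
    have "cinner u (T y) = cinner ((R ^^ (n + r)) t) y" for y
    proof -
      have "cinner u (T y) = cinner q ((R ^^ n) (T y))"
        unfolding q(2) by (rule Rn_symmetric)
      also have "\<dots> = cinner t ((R ^^ (n + r)) y)"
        using t mem[of y] unfolding adj_def by blast
      finally show ?thesis
        by (simp only: Rn_symmetric)
    qed
    then show ?thesis
      by blast
  qed
  \<comment> \<open>The unit ball of \<open>D\<close> under the adjoint of \<open>T\<close>: paired
    with \<open>y\<close> it is bounded by \<open>norm (T y)\<close>, and a uniform bound on it
    bounds \<open>T\<close>.\<close>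
  define W where "W = {t. \<exists>u\<in>D. norm u \<le> 1 \<and> (\<forall>y. cinner u (T y) = cinner t y)}"
  have "\<exists>C. \<forall>t\<in>W. norm t \<le> C"
  proof (rule uniform_boundedness)
    fix y
    have "cmod (cinner t y) \<le> norm (T y)" if "t \<in> W" for t
    proof -
      obtain u where u: "norm u \<le> 1" "cinner u (T y) = cinner t y"
        using \<open>t \<in> W\<close> unfolding W_def by blast
      have "cmod (cinner t y) \<le> norm u * norm (T y)"
        unfolding u(2)[symmetric] by (rule Cauchy_Schwarz)
      then show ?thesis
        using mult_right_mono[OF u(1), of "norm (T y)"] by simp
    qed
    then show "\<exists>M. \<forall>w\<in>W. cmod (cinner w y) \<le> M"
      by blast
  qed
  then obtain C where C: "\<And>t. t \<in> W \<Longrightarrow> norm t \<le> C"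
    by blast
  have "norm (T y) \<le> max C 0 * norm y" for y
  proof (rule norm_le_dense[OF closure_D])
    fix u assume u: "u \<in> D"
    show "cmod (cinner u (T y)) \<le> max C 0 * norm y * norm u"
    proof (cases "u = 0")
      case False
      let ?a = "complex_of_real (1 / norm u)"
      have u': "?a *\<^sub>C u \<in> D" "norm (?a *\<^sub>C u) \<le> 1"
        using u False unfolding norm_scaleC norm_of_real by simp_all
      then obtain t where t: "\<forall>y. cinner (?a *\<^sub>C u) (T y) = cinner t y"
        using adj by blast
      then have "t \<in> W"
        unfolding W_def using u' by blast
      then have "cmod (cinner t y) \<le> max C 0 * norm y"
        using Cauchy_Schwarz[of t y] mult_right_mono[of "norm t" "max C 0" "norm y"] C[of t]
        by (simp add: le_max_iff_disj)
      moreover have "cinner t y = ?a * cinner u (T y)"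
        using t by (metis cinner_scaleC_left complex_cnj_complex_of_real)
      then have "cmod (cinner t y) = cmod (cinner u (T y)) / norm u"
        by (simp only: norm_mult norm_of_real) simp
      ultimately show ?thesis
        using False by (simp add: divide_le_eq)
    qed simp
  qed simp
  then have "bounded_linear T"
    by (rule clinear_bounded_linear[OF \<open>clinear T\<close>])
  then show ?thesis
    using T by (rule that)
qed

text \<open>Convergence in the graph norms of all powers of \<open>H\<close>.\<close>

definition sconv :: "('b \<Rightarrow> 'a) \<Rightarrow> 'a \<Rightarrow> 'b filter \<Rightarrow> bool" where
  "sconv f l Fl \<longleftrightarrow> (\<forall>n. \<exists>g g'. (\<forall>\<^sub>F t in Fl. f t = (R ^^ n) (g t)) \<and> l = (R ^^ n) g' \<and> (g \<longlongrightarrow> g') Fl)"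

lemma sconv_tendsto:
  assumes "sconv f l Fl"
  shows "(f \<longlongrightarrow> l) Fl"
proof -
  obtain g g' where g: "\<forall>\<^sub>F t in Fl. f t = (R ^^ 0) (g t)" "l = (R ^^ 0) g'" "(g \<longlongrightarrow> g') Fl"
    using assms unfolding sconv_def by blast
  then have "\<forall>\<^sub>F t in Fl. g t = f t"
    by (auto elim: eventually_mono)
  with g(3) show ?thesis
    unfolding g(2) by (simp add: Lim_transform_eventually)
qed

text \<open>Convergence of order \<open>n\<close> after \<open>A\<close> uses order
  \<open>n + r\<close> before it. Demanding all orders at once makes the notion stable under
  repeated application.\<close>

lemma sconv_A:
  assumes A: "A \<in> class_C0 P"
    and r: "\<And>n. maps_into A (Domain (H ^^ (n + r))) (Domain (H ^^ n))"
    and f: "sconv f l Fl"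
  shows "sconv (\<lambda>t. op_app A (f t)) (op_app A l) Fl"
  unfolding sconv_def
proof
  fix n
  obtain T where T: "bounded_linear T" "\<And>y. op_app A ((R ^^ (n + r)) y) = (R ^^ n) (T y)"
    using smooth_bounded[OF A r] by blast
  obtain g g' where g: "\<forall>\<^sub>F t in Fl. f t = (R ^^ (n + r)) (g t)" "l = (R ^^ (n + r)) g'" "(g \<longlongrightarrow> g') Fl"
    using f unfolding sconv_def by blast
  show "\<exists>g g'. (\<forall>\<^sub>F t in Fl. op_app A (f t) = (R ^^ n) (g t)) \<and> op_app A l = (R ^^ n) g' \<and> (g \<longlongrightarrow> g') Fl"
  proof (intro exI conjI)
    show "\<forall>\<^sub>F t in Fl. op_app A (f t) = (R ^^ n) (T (g t))"
      using g(1) by eventually_elim (simp only: T(2))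
    show "op_app A l = (R ^^ n) (T g')"
      by (simp only: g(2) T(2))
    show "((\<lambda>t. T (g t)) \<longlongrightarrow> T g') Fl"
      by (rule bounded_linear.tendsto[OF T(1) g(3)])
  qed
qed

lemma sconv_S:
  assumes z: "Im z \<le> 0" and f: "sconv f l Fl"
  shows "sconv (\<lambda>t. S z (f t)) (S z l) Fl"
  unfolding sconv_def
proof
  fix n
  obtain g g' where g: "\<forall>\<^sub>F t in Fl. f t = (R ^^ n) (g t)" "l = (R ^^ n) g'" "(g \<longlongrightarrow> g') Fl"
    using f unfolding sconv_def by blast
  show "\<exists>g g'. (\<forall>\<^sub>F t in Fl. S z (f t) = (R ^^ n) (g t)) \<and> S z l = (R ^^ n) g' \<and> (g \<longlongrightarrow> g') Fl"
  proof (intro exI conjI)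
    show "\<forall>\<^sub>F t in Fl. S z (f t) = (R ^^ n) (S z (g t))"
      using g(1) by eventually_elim (simp only: S_Rn[OF z])
    show "S z l = (R ^^ n) (S z g')"
      by (simp only: g(2) S_Rn[OF z])
    show "((\<lambda>t. S z (g t)) \<longlongrightarrow> S z g') Fl"
      by (rule bounded_linear.tendsto[OF bounded_linear_S[OF z] g(3)])
  qed
qed

end

end

section \<open>Integrals along curves\<close>

lemma partition_interval:
  fixes t :: "nat \<Rightarrow> real"
  assumes "t 0 \<le> x" "x \<le> t N" "t 0 < t N"
  shows "\<exists>i<N. t i \<le> x \<and> x \<le> t (Suc i)"
proof -
  define i where "i = (LEAST j. x \<le> t (Suc j) \<or> Suc j \<ge> N)"
  have N: "0 < N"
    using assms(3) by (cases N) auto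
  have ex: "x \<le> t (Suc (N - 1)) \<or> Suc (N - 1) \<ge> N"
    using N by simp
  have i: "x \<le> t (Suc i) \<or> Suc i \<ge> N"
    unfolding i_def by (rule LeastI[where P = "\<lambda>j. x \<le> t (Suc j) \<or> Suc j \<ge> N", OF ex])
  have "i \<le> N - 1"
    unfolding i_def by (rule Least_le[where P = "\<lambda>j. x \<le> t (Suc j) \<or> Suc j \<ge> N", OF ex])
  then have iN: "i < N"
    using N by simp
  have "x \<le> t (Suc i)"
    using i iN assms(2) by (metis Suc_leI le_antisym)
  moreover have "t i \<le> x"
  proof (cases i)
    case (Suc j)
    then have "\<not> (x \<le> t (Suc j) \<or> Suc j \<ge> N)"
      using not_less_Least[of j "\<lambda>j. x \<le> t (Suc j) \<or> Suc j \<ge> N"] unfolding i_def by simp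
    then show ?thesis
      using Suc by simp
  qed (use assms in simp)
  ultimately show ?thesis
    using iN by blast
qed

text \<open>The curve may lack a derivative at its break points; these are finitely many, which the
  fundamental theorem tolerates for a continuous composite.\<close>

lemma curve_FTC:
  assumes \<Gamma>: "piecewise_C1 \<Gamma> a b" and f: "\<And>z. has_cderiv f (f' z) z"
    and st: "a \<le> s" "s \<le> t" "t \<le> b"
  shows "((\<lambda>u. vector_derivative \<Gamma> (at u within {a..b}) *\<^sub>C f' (\<Gamma> u)) has_integral f (\<Gamma> t) - f (\<Gamma> s)) {s..t}"
proof (cases "s = t")
  case False
  then have less: "a < b"
    using st by simp
  obtain N p where N: "p (0::nat) = a" "p N = b"
    and p: "\<And>i. i < N \<Longrightarrow> p i < p (Suc i) \<and> (\<exists>d. continuous_on {p i..p (Suc i)} d \<and>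
      (\<forall>s\<in>{p i..p (Suc i)}. (\<Gamma> has_vector_derivative d s) (at s within {p i..p (Suc i)})))"
    and cont: "continuous_on {a..b} \<Gamma>"
    using \<Gamma> unfolding piecewise_C1_def by blast
  show ?thesis
  proof (rule fundamental_theorem_of_calculus_interior_strong[of "p ` {..N}"])
    show "continuous_on {s..t} (\<lambda>u. f (\<Gamma> u))"
      by (rule continuous_on_compose2[OF has_cderiv_continuous_on[OF f, of UNIV] continuous_on_subset[OF cont]])
        (use st in auto)
    fix u assume u: "u \<in> {s<..<t} - p ` {..N}"
    then have "p 0 \<le> u" "u \<le> p N" "p 0 < p N"
      using N st less by auto
    from partition_interval[OF this] obtain i where i: "i < N" "p i \<le> u" "u \<le> p (Suc i)"
      by blast
    obtain d where d: "\<forall>s\<in>{p i..p (Suc i)}. (\<Gamma> has_vector_derivative d s) (at s within {p i..p (Suc i)})"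
      using p[OF i(1)] by blast
    have "p i \<noteq> u" "p (Suc i) \<noteq> u"
      using u i(1) by auto
    then have int: "p i < u" "u < p (Suc i)"
      using i by auto
    then have \<Gamma>': "(\<Gamma> has_vector_derivative d u) (at u)"
      using bspec[OF d, of u] at_within_Icc_at[OF int] by simp
    have "at u within {a..b} = at u"
      by (rule at_within_Icc_at) (use u st in auto)
    then have "vector_derivative \<Gamma> (at u within {a..b}) = d u"
      using vector_derivative_at[OF \<Gamma>'] by simp
    then show "((\<lambda>u. f (\<Gamma> u)) has_vector_derivative vector_derivative \<Gamma> (at u within {a..b}) *\<^sub>C f' (\<Gamma> u)) (at u)"
      using has_cderiv_vector_derivative[OF f \<Gamma>'] by simp
  qed (use st in auto)
qed (simp add: has_integral_refl)

text \<open>Each \<open>m\<close> is a sum \<open>p + q\<close> in \<open>m + 1\<close>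
  ways.\<close>

lemma sum_triangle:
  fixes g :: "nat \<Rightarrow> 'b::real_vector"
  shows "(\<Sum>p\<le>n. \<Sum>q\<le>n - p. g (p + q)) = (\<Sum>m\<le>n. real (Suc m) *\<^sub>R g m)"
proof (induction n)
  case (Suc n)
  have "(\<Sum>p\<le>Suc n. \<Sum>q\<le>Suc n - p. g (p + q)) = (\<Sum>p\<le>n. \<Sum>q\<le>Suc n - p. g (p + q)) + g (Suc n)"
    by simp
  also have "(\<Sum>p\<le>n. \<Sum>q\<le>Suc n - p. g (p + q)) = (\<Sum>p\<le>n. (\<Sum>q\<le>n - p. g (p + q)) + g (Suc n))"
    by (rule sum.cong) (auto simp: Suc_diff_le)
  also have "\<dots> = (\<Sum>m\<le>n. real (Suc m) *\<^sub>R g m) + real (Suc n) *\<^sub>R g (Suc n)"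
    unfolding sum.distrib Suc.IH by (simp add: sum_constant_scaleR)
  finally show ?case
    by (simp add: algebra_simps)
qed simp

section \<open>Time ordering\<close>

fun insert_index :: "(nat \<Rightarrow> real) \<Rightarrow> nat \<Rightarrow> nat list \<Rightarrow> nat list" where
  "insert_index t k [] = [k]"
| "insert_index t k (j # js) = (if t j < t k then k # j # js else j # insert_index t k js)"

text \<open>Insertion sort by decreasing time. The largest index comes last, in step with the
  iterated integral, whose innermost variable has the largest index.\<close>

fun time_list :: "(nat \<Rightarrow> real) \<Rightarrow> nat \<Rightarrow> nat list" where
  "time_list t 0 = []"
| "time_list t (Suc k) = insert_index t (Suc k) (time_list t k)"

lemma set_insert_index [simp]: "set (insert_index t k js) = insert k (set js)"
  by (induction js) auto

lemma set_time_list: "set (time_list t k) = {1..k}"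
  by (induction k) auto

lemma insert_index_cong: "(\<And>j. j \<in> insert k (set js) \<Longrightarrow> t j = t' j) \<Longrightarrow> insert_index t k js = insert_index t' k js"
  by (induction js) auto

lemma time_list_cong: "(\<And>j. j \<in> {1..k} \<Longrightarrow> t j = t' j) \<Longrightarrow> time_list t k = time_list t' k"
proof (induction k)
  case (Suc k)
  then have "time_list t k = time_list t' k"
    by simp
  then show ?case
    using Suc.prems by (auto simp: set_time_list intro!: insert_index_cong)
qed simp

lemma distinct_insert_index: "distinct js \<Longrightarrow> k \<notin> set js \<Longrightarrow> distinct (insert_index t k js)"
  by (induction js) auto

lemma sorted_insert_index:
  assumes "sorted_wrt (\<lambda>i j. t j < t i) js" "\<And>j. j \<in> set js \<Longrightarrow> t j \<noteq> t k"
  shows "sorted_wrt (\<lambda>i j. t j < t i) (insert_index t k js)"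
  using assms by (induction js) force+

lemma distinct_time_list: "distinct (time_list t k)"
  by (induction k) (auto intro: distinct_insert_index simp: set_time_list)

lemma sorted_time_list: "inj_on t {1..k} \<Longrightarrow> sorted_wrt (\<lambda>i j. t j < t i) (time_list t k)"
proof (induction k)
  case (Suc k)
  have "inj_on t {1..k}"
    using Suc.prems by (rule inj_on_subset) auto
  moreover have "t j \<noteq> t (Suc k)" if "j \<in> set (time_list t k)" for j
    using that Suc.prems unfolding set_time_list inj_on_def by fastforce
  ultimately show ?case
    using Suc.IH by (auto intro: sorted_insert_index)
qed simp

lemma insert_index_last: "(\<And>j. j \<in> set js \<Longrightarrow> t k < t j) \<Longrightarrow> insert_index t k js = js @ [k]"
  by (induction js) force+

lemma time_list_decreasing:
  "(\<And>i j. 1 \<le> i \<Longrightarrow> i < j \<Longrightarrow> j \<le> k \<Longrightarrow> t j < t i) \<Longrightarrow> time_list t k = [1..<Suc k]"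
proof (induction k)
  case (Suc k)
  have "time_list t k = [1..<Suc k]"
    by (rule Suc.IH) (use Suc.prems in simp)
  then have "time_list t (Suc k) = insert_index t (Suc k) [1..<Suc k]"
    by simp
  also have "\<dots> = [1..<Suc k] @ [Suc k]"
    by (rule insert_index_last) (use Suc.prems in auto)
  finally show ?case
    by simp
qed simp

lemma sorted_unique:
  fixes t :: "nat \<Rightarrow> real"
  assumes "sorted_wrt (\<lambda>i j. t j < t i) js" "sorted_wrt (\<lambda>i j. t j < t i) ks" "set js = set ks"
  shows "js = ks"
  using assms
proof (induction js arbitrary: ks)
  case (Cons j js)
  obtain k ks' where ks: "ks = k # ks'"
    using Cons.prems(3) by (cases ks) auto
  have js: "\<And>i. i \<in> set js \<Longrightarrow> t i < t j" and ks': "\<And>i. i \<in> set ks' \<Longrightarrow> t i < t k"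
    using Cons.prems(1,2) unfolding ks by auto
  have "j \<in> insert k (set ks')" "k \<in> insert j (set js)"
    using Cons.prems(3) unfolding ks by auto
  then have "j = k"
    using js ks' by (metis insertE less_asym)
  moreover have "set js = set ks'"
  proof -
    have "j \<notin> set js" "k \<notin> set ks'"
      using js ks' by blast+
    then show ?thesis
      using Cons.prems(3) \<open>j = k\<close> unfolding ks by auto
  qed
  ultimately show ?case
    using Cons.IH[of ks'] Cons.prems unfolding ks by auto
qed simp

lemma sorted_wrt_map_permutation:
  fixes t :: "nat \<Rightarrow> real"
  assumes "\<And>i. i \<in> {1..<N} \<Longrightarrow> t (\<sigma> (Suc i)) < t (\<sigma> i)"
  shows "sorted_wrt (\<lambda>i j. t j < t i) (map \<sigma> [1..<Suc N])"
proof -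
  have "transp (\<lambda>i j. t j < t i)"
    by (auto simp: transp_def)
  then show ?thesis
    unfolding sorted_wrt_iff_nth_Suc_transp[OF \<open>transp _\<close>]
    using assms by (auto simp del: upt_Suc)
qed

section \<open>Dyson terms along a curve\<close>

context interaction
begin

definition vi :: "'a \<Rightarrow> 'a" where "vi x = - \<i> *\<^sub>C v x"

lemma tame_vi: "tame b c vi"
  using tame_scaleC[OF tame_H1, of "- \<i>"] unfolding vi_def[abs_def] by simp

lemma vi_D [simp]: "x \<in> D \<Longrightarrow> vi x \<in> D"
  by (rule tame_D[OF tame_vi])

lemma w_at_0: "x \<in> D \<Longrightarrow> w n 0 x = (if n = 0 then x else 0)"
  by (cases n) (simp_all add: w_Suc_at_0 w_0)

lemma w_minus: "x \<in> D \<Longrightarrow> w n z (- x) = - w n z x"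
  by (rule clinear_on_extra(2)[OF fam_linear[OF fam_w] D_subspace])

text \<open>The left factor is differentiated with its generator on the right, the right factor with
  its generator on the left. Both generators meet in the middle, and their free parts
  cancel.\<close>

lemma insertion_cderiv:
  assumes y: "y \<in> D"
  shows "has_cderiv (\<lambda>\<zeta>. w p (z - \<zeta>) (w q (\<zeta> - z') y))
    ((case q of 0 \<Rightarrow> 0 | Suc q' \<Rightarrow> w p (z - \<zeta>) (vi (w q' (\<zeta> - z') y))) -
     (case p of 0 \<Rightarrow> 0 | Suc p' \<Rightarrow> w p' (z - \<zeta>) (vi (w q (\<zeta> - z') y)))) \<zeta>"
proof -
  let ?X = "w q (\<zeta> - z') y"
  have X: "?X \<in> D"
    using y by simp
  have "has_cderiv (\<lambda>\<zeta>. w p (z + - 1 * \<zeta>) (w q (- z' + 1 * \<zeta>) y))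
      (- 1 *\<^sub>C dw p (z + - 1 * \<zeta>) (w q (- z' + 1 * \<zeta>) y) + w p (z + - 1 * \<zeta>) (1 *\<^sub>C dw q (- z' + 1 * \<zeta>) y)) \<zeta>"
    by (rule fam_cderiv[OF fam_comp[OF fam_affine[OF fam_w] fam_affine[OF fam_w]] y])
  then have *: "has_cderiv (\<lambda>\<zeta>. w p (z - \<zeta>) (w q (\<zeta> - z') y))
      (- dw p (z - \<zeta>) ?X + w p (z - \<zeta>) (dw q (\<zeta> - z') y)) \<zeta>"
    by simp
  have 1: "- dw p (z - \<zeta>) ?X = \<i> *\<^sub>C w p (z - \<zeta>) (h ?X) + \<i> *\<^sub>C pv p (z - \<zeta>) ?X"
    unfolding dw_right[OF X] by (simp add: scaleC_add_right)
  have 2: "w p (z - \<zeta>) (dw q (\<zeta> - z') y) =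
      - (\<i> *\<^sub>C w p (z - \<zeta>) (h ?X)) - \<i> *\<^sub>C w p (z - \<zeta>) (vp q (\<zeta> - z') y)"
    unfolding dw_def using y
    by (simp only: w_linear D_closure h_D vp_D w_D) (simp add: scaleC_add_right)
  have 3: "\<i> *\<^sub>C pv p (z - \<zeta>) ?X = - (case p of 0 \<Rightarrow> 0 | Suc p' \<Rightarrow> w p' (z - \<zeta>) (vi ?X))"
    unfolding pv_def vi_def using X by (simp add: w_linear w_minus split: nat.split)
  have 4: "- (\<i> *\<^sub>C w p (z - \<zeta>) (vp q (\<zeta> - z') y)) =
      (case q of 0 \<Rightarrow> 0 | Suc q' \<Rightarrow> w p (z - \<zeta>) (vi (w q' (\<zeta> - z') y)))"
    unfolding vp_def vi_def using y by (simp add: w_linear w_minus split: nat.split)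
  have "- dw p (z - \<zeta>) ?X + w p (z - \<zeta>) (dw q (\<zeta> - z') y) =
      \<i> *\<^sub>C pv p (z - \<zeta>) ?X - \<i> *\<^sub>C w p (z - \<zeta>) (vp q (\<zeta> - z') y)"
    unfolding 1 2 by simp
  also have "\<dots> = (case q of 0 \<Rightarrow> 0 | Suc q' \<Rightarrow> w p (z - \<zeta>) (vi (w q' (\<zeta> - z') y))) -
      (case p of 0 \<Rightarrow> 0 | Suc p' \<Rightarrow> w p' (z - \<zeta>) (vi ?X))"
    unfolding 4[symmetric] 3 by simp
  finally show ?thesis
    using * by simp
qed

end

text \<open>\<open>c'\<close> is a common growth constant for the interaction and the inserted
  operators, which share the energy gain \<open>b\<close>.\<close>

locale dyson_curve = interaction +
  fixes \<Gamma> :: "real \<Rightarrow> complex" and \<alpha> \<beta> :: real and x0 :: 'a and c' e0 :: real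
  assumes curve: "simple_curve \<Gamma> \<alpha> \<beta>" and x0: "x0 \<in> V P e0" and e0: "0 \<le> e0" and c'_ge: "c \<le> c'"
begin

lemma C1: "piecewise_C1 \<Gamma> \<alpha> \<beta>" and \<alpha>_less: "\<alpha> < \<beta>" and inj_\<Gamma>: "inj_on \<Gamma> {\<alpha>..\<beta>}"
  using curve unfolding simple_curve_def by blast+

abbreviation \<gamma>' :: "real \<Rightarrow> complex" where
  "\<gamma>' s \<equiv> vector_derivative \<Gamma> (at s within {\<alpha>..\<beta>})"

text \<open>Marking one of the interaction times of a Dyson term: the derivative of
  \<open>w p (z - \<zeta>) (w q (\<zeta> - z') y)\<close> moves one interaction from the left factor to the right one.\<close>

lemma insertion_integral:
  assumes y: "y \<in> D" and r: "\<alpha> \<le> r" "r \<le> u" "u \<le> \<beta>"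
  shows "((\<lambda>s. \<gamma>' s *\<^sub>C w p (\<Gamma> u - \<Gamma> s) (vi (w q (\<Gamma> s - \<Gamma> r) y))) has_integral
    w (Suc (p + q)) (\<Gamma> u - \<Gamma> r) y) {r..u}"
proof (induction p arbitrary: q)
  case 0
  have "((\<lambda>s. \<gamma>' s *\<^sub>C w 0 (\<Gamma> u - \<Gamma> s) (vi (w q (\<Gamma> s - \<Gamma> r) y))) has_integral
      w 0 (\<Gamma> u - \<Gamma> u) (w (Suc q) (\<Gamma> u - \<Gamma> r) y) - w 0 (\<Gamma> u - \<Gamma> r) (w (Suc q) (\<Gamma> r - \<Gamma> r) y)) {r..u}"
    using curve_FTC[OF C1 insertion_cderiv[OF y, of 0 "\<Gamma> u" "Suc q" "\<Gamma> r"] r] by simp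
  then show ?case
    using y by (simp add: w_at_0)
next
  \<comment> \<open>With both orders positive the primitive vanishes at both ends, so moving one
    interaction from the left factor to the right one leaves the integral unchanged.\<close>
  case (Suc p)
  have "((\<lambda>s. \<gamma>' s *\<^sub>C (w (Suc p) (\<Gamma> u - \<Gamma> s) (vi (w q (\<Gamma> s - \<Gamma> r) y)) -
        w p (\<Gamma> u - \<Gamma> s) (vi (w (Suc q) (\<Gamma> s - \<Gamma> r) y)))) has_integral
      w (Suc p) (\<Gamma> u - \<Gamma> u) (w (Suc q) (\<Gamma> u - \<Gamma> r) y) - w (Suc p) (\<Gamma> u - \<Gamma> r) (w (Suc q) (\<Gamma> r - \<Gamma> r) y)) {r..u}"
    using curve_FTC[OF C1 insertion_cderiv[OF y, of "Suc p" "\<Gamma> u" "Suc q" "\<Gamma> r"] r] by simp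
  from has_integral_add[OF this Suc.IH[of "Suc q"]] show ?case
    using y by (simp add: w_at_0 complex_vector.scale_right_diff_distrib)
qed

text \<open>\<open>Kt n u L\<close> is the sum of all Dyson terms of order \<open>n\<close> from \<open>\<Gamma> \<alpha>\<close> to \<open>\<Gamma> u\<close> with the operators
  of \<open>L\<close> inserted at their times, up to the free evolution to \<open>\<Gamma> u\<close>.\<close>

fun Kt :: "nat \<Rightarrow> real \<Rightarrow> (real \<times> ('a \<Rightarrow> 'a)) list \<Rightarrow> 'a" where
  "Kt n u [] = w n (\<Gamma> u - \<Gamma> \<alpha>) x0"
| "Kt n u ((t, B) # L) = (\<Sum>p\<le>n. w p (\<Gamma> u - \<Gamma> t) (B (Kt (n - p) t L)))"

text \<open>The tie rule agrees with that of \<open>insert_index\<close>, as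
  \<open>map_insert_index\<close> requires.\<close>

fun ins :: "real \<Rightarrow> (real \<times> ('a \<Rightarrow> 'a)) list \<Rightarrow> (real \<times> ('a \<Rightarrow> 'a)) list" where
  "ins s [] = [(s, vi)]"
| "ins s ((t, B) # L) = (if t < s then (s, vi) # (t, B) # L else (t, B) # ins s L)"

fun descending :: "real \<Rightarrow> (real \<times> ('a \<Rightarrow> 'a)) list \<Rightarrow> bool" where
  "descending u [] \<longleftrightarrow> \<alpha> \<le> u"
| "descending u ((t, B) # L) \<longleftrightarrow> t \<le> u \<and> descending t L"

definition tame_list :: "(real \<times> ('a \<Rightarrow> 'a)) list \<Rightarrow> bool" where
  "tame_list L \<longleftrightarrow> (\<forall>(t, B)\<in>set L. tame b c' B)"

lemma tame_list_simps [simp]: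
  "tame_list []" "tame_list ((t, B) # L) \<longleftrightarrow> tame b c' B \<and> tame_list L"
  unfolding tame_list_def by auto

lemma tame_vi': "tame b c' vi"
  using tame_mono[OF tame_vi order_refl c'_ge] .

lemma tame_ins: "tame_list L \<Longrightarrow> tame_list (ins s L)" and length_ins: "length (ins s L) = Suc (length L)"
  by (induction s L rule: ins.induct) (auto simp: tame_vi')

lemma descending_\<alpha>: "descending u L \<Longrightarrow> \<alpha> \<le> u"
  by (induction u L rule: descending.induct) auto

lemma Kt_V: "tame_list L \<Longrightarrow> Kt n u L \<in> V P (e0 + real (length L) * b + real n * b)"
proof (induction n u L rule: Kt.induct)
  case (1 n u)
  then show ?case
    using w_V[OF e0 x0] by simp
next
  case (2 n u t B L)
  have "w p (\<Gamma> u - \<Gamma> t) (B (Kt (n - p) t L)) \<in> V P (e0 + real (length ((t, B) # L)) * b + real n * b)" if p: "p \<in> {..n}" for p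
  proof -
    let ?e = "e0 + real (length L) * b + real (n - p) * b"
    have "B (Kt (n - p) t L) \<in> V P (?e + b)"
      by (rule tame_V[of b c' B, OF _ _ 2(1)[OF p]]) (use 2(2) e0 in auto)
    then have "w p (\<Gamma> u - \<Gamma> t) (B (Kt (n - p) t L)) \<in> V P (?e + b + p * b)"
      by (rule w_V[rotated]) (use e0 in simp)
    moreover have "?e + b + p * b = e0 + real (length ((t, B) # L)) * b + real n * b"
      using p by (simp add: of_nat_diff algebra_simps)
    ultimately show ?thesis
      by simp
  qed
  then show ?case
    unfolding Kt.simps by (rule complex_vector.subspace_sum[OF V_subspace])
qed

lemma Kt_D: "tame_list L \<Longrightarrow> Kt n u L \<in> D"
  using Kt_V V_D by blast

text \<open>Any of the \<open>n + 1\<close> interactions in a term of order \<open>n + 1\<close> can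
  be the marked one. The induction cuts the curve at the latest marked time \<open>t\<close>:
  insertions above \<open>t\<close> are counted by \<open>insertion_integral\<close>, those below by
  the induction hypothesis.\<close>

lemma Kt_insertion:
  assumes "descending u L" "u \<le> \<beta>" "tame_list L"
  shows "((\<lambda>s. \<gamma>' s *\<^sub>C Kt n u (ins s L)) has_integral real (Suc n) *\<^sub>R Kt (Suc n) u L) {\<alpha>..u}"
  using assms
proof (induction L arbitrary: n u)
  case Nil
  have x0D: "x0 \<in> D"
    using x0 V_D by blast
  have "((\<lambda>s. \<Sum>p\<le>n. \<gamma>' s *\<^sub>C w p (\<Gamma> u - \<Gamma> s) (vi (w (n - p) (\<Gamma> s - \<Gamma> \<alpha>) x0))) has_integral
      (\<Sum>p\<le>n. w (Suc (p + (n - p))) (\<Gamma> u - \<Gamma> \<alpha>) x0)) {\<alpha>..u}"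
    by (intro has_integral_sum insertion_integral[OF x0D]) (use Nil in auto)
  then show ?case
    by (simp add: complex_vector.scale_sum_right sum_constant_scaleR)
next
  case (Cons tB L)
  obtain t B where tB: "tB = (t, B)"
    by (cases tB)
  have t: "t \<le> u" "descending t L" "\<alpha> \<le> t" "tame b c' B" "tame_list L"
    using Cons.prems descending_\<alpha> unfolding tB by auto
  note linB = tame_linear[OF t(4)] and linv = tame_linear[OF tame_vi] and linw = fam_linear[OF fam_w]
  define Y where "Y m = B (Kt m t L)" for m
  have Y: "Y m \<in> D" for m
    unfolding Y_def by (rule tame_D[OF t(4) Kt_D[OF t(5)]])
  define g where "g m = w m (\<Gamma> u - \<Gamma> t) (Y (Suc n - m))" for m
  \<comment> \<open>Above \<open>t\<close> a factor of order \<open>m + 1\<close> to the left of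
    \<open>B\<close> arises from the \<open>m + 1\<close> splittings
    \<open>p + q = m\<close>.\<close>
  have upper: "((\<lambda>s. \<gamma>' s *\<^sub>C Kt n u (ins s ((t, B) # L))) has_integral (\<Sum>m\<le>n. real (Suc m) *\<^sub>R g (Suc m))) {t..u}"
  proof (rule has_integral_spike_finite[of "{t}"])
    have "((\<lambda>s. \<Sum>p\<le>n. \<Sum>q\<le>n - p. \<gamma>' s *\<^sub>C w p (\<Gamma> u - \<Gamma> s) (vi (w q (\<Gamma> s - \<Gamma> t) (Y (n - p - q))))) has_integral
        (\<Sum>p\<le>n. \<Sum>q\<le>n - p. w (Suc (p + q)) (\<Gamma> u - \<Gamma> t) (Y (n - p - q)))) {t..u}"
      by (intro has_integral_sum insertion_integral[OF Y] t Cons.prems(2)) auto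
    also have "(\<Sum>p\<le>n. \<Sum>q\<le>n - p. w (Suc (p + q)) (\<Gamma> u - \<Gamma> t) (Y (n - p - q))) =
        (\<Sum>p\<le>n. \<Sum>q\<le>n - p. g (Suc (p + q)))"
      unfolding g_def by simp
    also have "\<dots> = (\<Sum>m\<le>n. real (Suc m) *\<^sub>R g (Suc m))"
      by (rule sum_triangle[of "\<lambda>m. g (Suc m)"])
    finally show "((\<lambda>s. \<Sum>p\<le>n. \<Sum>q\<le>n - p. \<gamma>' s *\<^sub>C w p (\<Gamma> u - \<Gamma> s) (vi (w q (\<Gamma> s - \<Gamma> t) (Y (n - p - q))))) has_integral
        (\<Sum>m\<le>n. real (Suc m) *\<^sub>R g (Suc m))) {t..u}" .
    fix s assume s: "s \<in> {t..u} - {t}"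
    then have "ins s ((t, B) # L) = (s, vi) # (t, B) # L"
      by auto
    moreover have "w p (\<Gamma> u - \<Gamma> s) (vi (\<Sum>q\<le>n - p. w q (\<Gamma> s - \<Gamma> t) (Y (n - p - q)))) =
        (\<Sum>q\<le>n - p. w p (\<Gamma> u - \<Gamma> s) (vi (w q (\<Gamma> s - \<Gamma> t) (Y (n - p - q)))))" for p
      using Y by (simp add: clinear_on_extra(4)[OF linv D_subspace] clinear_on_extra(4)[OF linw D_subspace])
    ultimately show "\<gamma>' s *\<^sub>C Kt n u (ins s ((t, B) # L)) =
        (\<Sum>p\<le>n. \<Sum>q\<le>n - p. \<gamma>' s *\<^sub>C w p (\<Gamma> u - \<Gamma> s) (vi (w q (\<Gamma> s - \<Gamma> t) (Y (n - p - q)))))"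
      by (simp add: complex_vector.scale_sum_right Y_def[symmetric])
  qed simp
  \<comment> \<open>Below \<open>t\<close> the insertion goes into the inner list, whose order
    \<open>n - p\<close> becomes \<open>n - p + 1\<close>.\<close>
  have lower: "((\<lambda>s. \<gamma>' s *\<^sub>C Kt n u (ins s ((t, B) # L))) has_integral
      (\<Sum>p\<le>n. real (Suc (n - p)) *\<^sub>R g p)) {\<alpha>..t}"
  proof (rule has_integral_eq[rotated])
    have "((\<lambda>s. \<gamma>' s *\<^sub>C w p (\<Gamma> u - \<Gamma> t) (B (Kt (n - p) t (ins s L)))) has_integral
        real (Suc (n - p)) *\<^sub>R g p) {\<alpha>..t}" if p: "p \<in> {..n}" for p
    proof -
      let ?E = "e0 + real (Suc (length L)) * b + real (n - p) * b"
      have E: "0 \<le> ?E"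
        using e0 by simp
      \<comment> \<open>The projection makes this map bounded, so that it passes through the
        integral; on the vectors that occur it changes nothing.\<close>
      define T where "T y = w p (\<Gamma> u - \<Gamma> t) (B (pr ?E y))" for y
      have linT: "clinear T"
        unfolding clinear_on_def T_def
        by (simp add: clinear_onD[OF clinear_pr] clinear_onD[OF linB] clinear_onD[OF linw] tame_D[OF t(4)])
      have "bounded_linear T"
      proof -
        obtain C where C: "0 \<le> C" "\<And>x z. x \<in> V P (?E + b) \<Longrightarrow> cmod z \<le> cmod (\<Gamma> u - \<Gamma> t) \<Longrightarrow> norm (w p z x) \<le> C * norm x"
          using fam_bound[OF fam_w, where e = "?E + b" and R = "cmod (\<Gamma> u - \<Gamma> t)"] E
          by (metis add_nonneg_nonneg b_nonneg)
        have "norm (T y) \<le> (C * (c' * sqrt (?E + 1))) * norm y" for y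
        proof -
          have "norm (T y) \<le> C * norm (B (pr ?E y))"
            unfolding T_def by (rule C(2)[OF tame_V[OF t(4) E pr_V] order_refl])
          also have "\<dots> \<le> C * (c' * sqrt (?E + 1) * norm (pr ?E y))"
            by (intro mult_left_mono tame_bound[OF t(4) E pr_V] C(1))
          also have "\<dots> \<le> C * (c' * sqrt (?E + 1) * norm y)"
            using tame_nonneg[OF t(4)] C(1) E by (intro mult_left_mono norm_pr_le mult_nonneg_nonneg) auto
          finally show ?thesis
            by (simp add: mult.assoc)
        qed
        then show ?thesis
          by (rule clinear_bounded_linear[OF linT])
      qed
      from has_integral_linear[OF Cons.IH[OF t(2) order_trans[OF t(1) Cons.prems(2)] t(5), of "n - p"] this]
      have "((\<lambda>s. T (\<gamma>' s *\<^sub>C Kt (n - p) t (ins s L))) has_integral T (real (Suc (n - p)) *\<^sub>R Kt (Suc (n - p)) t L)) {\<alpha>..t}"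
        unfolding o_def .
      moreover have "pr ?E (Kt (n - p) t (ins s L)) = Kt (n - p) t (ins s L)" for s
        using Kt_V[OF tame_ins[OF t(5)], of "n - p" t s] unfolding V_iff length_ins .
      then have "T (\<gamma>' s *\<^sub>C Kt (n - p) t (ins s L)) = \<gamma>' s *\<^sub>C w p (\<Gamma> u - \<Gamma> t) (B (Kt (n - p) t (ins s L)))" for s
        using clinear_onD(2)[OF linT UNIV_I] unfolding T_def by simp
      moreover have "T (real (Suc (n - p)) *\<^sub>R Kt (Suc (n - p)) t L) = real (Suc (n - p)) *\<^sub>R g p"
      proof -
        have "Kt (Suc (n - p)) t L \<in> V P ?E"
          using Kt_V[OF t(5), of "Suc (n - p)" t] by (simp add: algebra_simps)
        then have "pr ?E (Kt (Suc (n - p)) t L) = Kt (Suc (n - p)) t L"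
          unfolding V_iff .
        then have "T (Kt (Suc (n - p)) t L) = g p"
          unfolding T_def g_def Y_def using p by (simp add: Suc_diff_le)
        then show ?thesis
          unfolding scaleR_scaleC clinear_onD(2)[OF linT UNIV_I] by simp
      qed
      ultimately show ?thesis
        by simp
    qed
    then show "((\<lambda>s. \<Sum>p\<le>n. \<gamma>' s *\<^sub>C w p (\<Gamma> u - \<Gamma> t) (B (Kt (n - p) t (ins s L)))) has_integral
        (\<Sum>p\<le>n. real (Suc (n - p)) *\<^sub>R g p)) {\<alpha>..t}"
      by (intro has_integral_sum) auto
    fix s assume "s \<in> {\<alpha>..t}"
    then show "(\<Sum>p\<le>n. \<gamma>' s *\<^sub>C w p (\<Gamma> u - \<Gamma> t) (B (Kt (n - p) t (ins s L)))) =
        \<gamma>' s *\<^sub>C Kt n u (ins s ((t, B) # L))"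
      by (simp add: complex_vector.scale_sum_right)
  qed
  \<comment> \<open>The weights \<open>n + 1 - p\<close> from below and \<open>p\<close> from above
    add up to \<open>n + 1\<close> in every term.\<close>
  have "(\<Sum>p\<le>n. real (Suc (n - p)) *\<^sub>R g p) + (\<Sum>m\<le>n. real (Suc m) *\<^sub>R g (Suc m)) =
      real (Suc n) *\<^sub>R (\<Sum>p\<le>Suc n. g p)"
  proof -
    have "(\<Sum>p\<le>n. real (Suc (n - p)) *\<^sub>R g p) = (\<Sum>p\<le>n. real (Suc n - p) *\<^sub>R g p)"
      by (rule sum.cong) (auto simp: Suc_diff_le)
    then have "(\<Sum>p\<le>n. real (Suc (n - p)) *\<^sub>R g p) = (\<Sum>p\<le>Suc n. real (Suc n - p) *\<^sub>R g p)"
      by simp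
    moreover have "(\<Sum>m\<le>n. real (Suc m) *\<^sub>R g (Suc m)) = (\<Sum>p\<le>Suc n. real p *\<^sub>R g p)"
      by (subst sum.atMost_Suc_shift) simp
    ultimately have "(\<Sum>p\<le>n. real (Suc (n - p)) *\<^sub>R g p) + (\<Sum>m\<le>n. real (Suc m) *\<^sub>R g (Suc m)) =
        (\<Sum>p\<le>Suc n. real (Suc n - p) *\<^sub>R g p + real p *\<^sub>R g p)"
      by (simp only: sum.distrib)
    also have "\<dots> = (\<Sum>p\<le>Suc n. real (Suc n) *\<^sub>R g p)"
      by (intro sum.cong) (auto simp: scaleR_left.add[symmetric] of_nat_add[symmetric] simp del: of_nat_Suc of_nat_add)
    finally show ?thesis
      by (simp only: scaleR_sum_right)
  qed
  then show ?case
    using has_integral_combine[OF t(3,1) lower upper] unfolding tB by (simp add: g_def Y_def)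
qed

lemma Kt_fast: "tame_list L \<Longrightarrow> fast (\<lambda>n. Kt n u L)"
proof (induction L arbitrary: u)
  case Nil
  show ?case
    using fast_w[OF V_D[OF x0]] by simp
next
  case (Cons tB L)
  obtain t B where tB: "tB = (t, B)"
    by (cases tB)
  have B: "tame b c' B" and L: "tame_list L"
    using Cons.prems unfolding tB by auto
  let ?e = "e0 + real (length L) * b"
  have e: "0 \<le> ?e"
    using e0 by simp
  have "fast (\<lambda>n. B (Kt n t L))"
    by (rule fast_tame[OF B e Kt_V[OF L] Cons.IH[OF L]])
  moreover have "B (Kt q t L) \<in> V P (?e + b + real q * b)" for q
  proof -
    have "0 \<le> ?e + real q * b"
      using e by simp
    from tame_V[OF B this Kt_V[OF L]] show ?thesis
      by (simp add: algebra_simps)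
  qed
  ultimately show ?case
    unfolding tB Kt.simps using e by (intro fast_convolution[of "?e + b"]) auto
qed

section \<open>Evaluation of time-ordered products at distinct times\<close>

lemma curve_succ_iff:
  assumes "s \<in> {\<alpha>..\<beta>}" "t \<in> {\<alpha>..\<beta>}"
  shows "curve_succ \<Gamma> \<alpha> \<beta> (\<Gamma> s) (\<Gamma> t) \<longleftrightarrow> t < s"
proof
  assume "curve_succ \<Gamma> \<alpha> \<beta> (\<Gamma> s) (\<Gamma> t)"
  then obtain s' t' where "s' \<in> {\<alpha>..\<beta>}" "t' \<in> {\<alpha>..\<beta>}" "\<Gamma> s' = \<Gamma> s" "\<Gamma> t' = \<Gamma> t" "t' < s'"
    unfolding curve_succ_def by blast
  then show "t < s"
    using inj_onD[OF inj_\<Gamma>] assms by metis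
qed (use assms in \<open>unfold curve_succ_def, blast\<close>)

text \<open>At distinct times exactly one permutation passes the chronological test, the one that
  sorts; the other summands are zero.\<close>

lemma time_ordered_eq:
  assumes Fs: "\<And>j \<zeta>. j \<in> {1..N} \<Longrightarrow> acts (Fs j \<zeta>) (g j \<zeta>)" and x: "x \<in> D"
    and t: "inj_on t {1..N}" "t ` {1..N} \<subseteq> {\<alpha>..\<beta>}" "\<And>j. j \<in> {1..N} \<Longrightarrow> \<eta> j = \<Gamma> (t j)"
  shows "op_app (time_ordered \<Gamma> \<alpha> \<beta> N Fs \<eta>) x = foldr (\<lambda>j. g j (\<eta> j)) (time_list t N) x"
proof -
  let ?js = "time_list t N"
  have perm_list: "set (map \<sigma> [1..<Suc N]) = {1..N}" if "\<sigma> permutes {1..N}" for \<sigma>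
  proof -
    have "set (map \<sigma> [1..<Suc N]) = \<sigma> ` {1..N}"
      by (simp add: atLeastLessThanSuc_atLeastAtMost del: upt_Suc)
    then show ?thesis
      using permutes_image[OF that] by simp
  qed
  have acts_list: "acts (op_prod (map (\<lambda>j. Fs j (\<eta> j)) js)) (foldr (\<lambda>j. g j (\<eta> j)) js)"
    if "set js \<subseteq> {1..N}" for js
    by (rule acts_op_prod_map) (use that Fs in blast)
  have perm_prod: "perm_prod N Fs \<sigma> \<eta> = op_prod (map (\<lambda>j. Fs j (\<eta> j)) (map \<sigma> [1..<Suc N]))" for \<sigma>
    unfolding perm_prod_def by (simp add: o_def del: upt_Suc)
  have dom: "x \<in> Domain (perm_prod N Fs \<sigma> \<eta>)" if "\<sigma> permutes {1..N}" for \<sigma>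
    using acts_list[of "map \<sigma> [1..<Suc N]"] perm_list[OF that] x unfolding perm_prod acts_def by blast
  have js: "set ?js = {1..N}" "distinct ?js" "sorted_wrt (\<lambda>i j. t j < t i) ?js"
    using set_time_list distinct_time_list sorted_time_list[OF t(1)] by auto
  have len: "length ?js = N"
    using distinct_card[OF js(2)] js(1) by simp
  \<comment> \<open>List positions start at 0 and the permuted indices at 1; outside
    \<open>{1..N}\<close> a permutation has to be the identity.\<close>
  define \<sigma>0 where "\<sigma>0 j = (if j \<in> {1..N} then ?js ! (j - 1) else j)" for j
  have map_\<sigma>0: "map \<sigma>0 [1..<Suc N] = ?js"
    by (rule nth_equalityI) (auto simp: len \<sigma>0_def simp del: upt_Suc)
  have \<sigma>0: "\<sigma>0 permutes {1..N}"
  proof (rule bij_imp_permutes)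
    have "set (map \<sigma>0 [1..<Suc N]) = {1..N}" "distinct (map \<sigma>0 [1..<Suc N])"
      unfolding map_\<sigma>0 using js by auto
    then show "bij_betw \<sigma>0 {1..N} {1..N}"
      unfolding bij_betw_def distinct_map by (simp add: atLeastLessThanSuc_atLeastAtMost del: upt_Suc)
  qed (auto simp: \<sigma>0_def)
  have cond: "(\<forall>i\<in>{1..<N}. curve_succ \<Gamma> \<alpha> \<beta> (\<eta> (\<sigma> i)) (\<eta> (\<sigma> (Suc i)))) \<longleftrightarrow> \<sigma> = \<sigma>0" if \<sigma>: "\<sigma> permutes {1..N}" for \<sigma>
  proof -
    have in_N: "\<sigma> i \<in> {1..N}" if "i \<in> {1..N}" for i
      using permutes_in_image[OF \<sigma>] that by blast
    have "curve_succ \<Gamma> \<alpha> \<beta> (\<eta> (\<sigma> i)) (\<eta> (\<sigma> (Suc i))) \<longleftrightarrow> t (\<sigma> (Suc i)) < t (\<sigma> i)" if "i \<in> {1..<N}" for i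
    proof -
      have i: "\<sigma> i \<in> {1..N}" "\<sigma> (Suc i) \<in> {1..N}"
        using in_N[of i] in_N[of "Suc i"] that by auto
      show ?thesis
        unfolding t(3)[OF i(1)] t(3)[OF i(2)] by (rule curve_succ_iff) (use i t(2) in blast)+
    qed
    then have "(\<forall>i\<in>{1..<N}. curve_succ \<Gamma> \<alpha> \<beta> (\<eta> (\<sigma> i)) (\<eta> (\<sigma> (Suc i)))) \<longleftrightarrow>
        (\<forall>i\<in>{1..<N}. t (\<sigma> (Suc i)) < t (\<sigma> i))"
      by simp
    also have "\<dots> \<longleftrightarrow> \<sigma> = \<sigma>0"
    proof
      assume "\<forall>i\<in>{1..<N}. t (\<sigma> (Suc i)) < t (\<sigma> i)"
      then have "sorted_wrt (\<lambda>i j. t j < t i) (map \<sigma> [1..<Suc N])"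
        by (intro sorted_wrt_map_permutation) auto
      then have eq: "map \<sigma> [1..<Suc N] = map \<sigma>0 [1..<Suc N]"
        unfolding map_\<sigma>0 using js perm_list[OF \<sigma>] by (intro sorted_unique) auto
      show "\<sigma> = \<sigma>0"
      proof
        fix j
        show "\<sigma> j = \<sigma>0 j"
        proof (cases "j \<in> {1..N}")
          case True
          then show ?thesis
            using eq by (simp add: map_eq_conv atLeastLessThanSuc_atLeastAtMost del: upt_Suc)
        next
          case False
          then show ?thesis
            using permutes_not_in[OF \<sigma>] permutes_not_in[OF \<sigma>0] by simp
        qed
      qed
    next
      assume \<sigma>_eq: "\<sigma> = \<sigma>0"
      show "\<forall>i\<in>{1..<N}. t (\<sigma> (Suc i)) < t (\<sigma> i)"
      proof
        fix i assume i: "i \<in> {1..<N}"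
        have "t (?js ! i) < t (?js ! (i - 1))"
          by (rule sorted_wrt_nth_less[OF js(3)]) (use i len in auto)
        then show "t (\<sigma> (Suc i)) < t (\<sigma> i)"
          unfolding \<sigma>_eq \<sigma>0_def using i by simp
      qed
    qed
    finally show ?thesis .
  qed
  have "(\<Sum>\<sigma> | \<sigma> permutes {1..N}.
      if \<forall>i\<in>{1..<N}. curve_succ \<Gamma> \<alpha> \<beta> (\<eta> (\<sigma> i)) (\<eta> (\<sigma> (Suc i))) then op_app (perm_prod N Fs \<sigma> \<eta>) x else 0) =
      (\<Sum>\<sigma> | \<sigma> permutes {1..N}. if \<sigma> = \<sigma>0 then op_app (perm_prod N Fs \<sigma>0 \<eta>) x else 0)"
    using cond by (intro sum.cong refl) (metis (mono_tags, lifting) mem_Collect_eq)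
  also have "\<dots> = op_app (perm_prod N Fs \<sigma>0 \<eta>) x"
    using \<sigma>0 by (simp add: finite_permutations sum.delta)
  also have "\<dots> = foldr (\<lambda>j. g j (\<eta> j)) ?js x"
    unfolding perm_prod map_\<sigma>0 by (rule acts_op_app[OF acts_list x]) (simp add: js)
  finally have "(x, y) \<in> time_ordered \<Gamma> \<alpha> \<beta> N Fs \<eta> \<longleftrightarrow> y = foldr (\<lambda>j. g j (\<eta> j)) ?js x" for y
    unfolding time_ordered_def using dom by simp
  then show ?thesis
    unfolding op_app_def by simp
qed

end

locale dyson_insertions = dyson_curve +
  fixes m :: nat and A :: "nat \<Rightarrow> 'a oper" and z :: "nat \<Rightarrow> complex" and \<tau> :: "nat \<Rightarrow> real"
  assumes A_C0: "j \<in> {1..m} \<Longrightarrow> A j \<in> class_C0 P" and tame_A: "j \<in> {1..m} \<Longrightarrow> tame b c' (op_app (A j))"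
    and inj_\<tau>: "inj_on \<tau> {1..m}" and \<tau>_mem: "j \<in> {1..m} \<Longrightarrow> \<tau> j \<in> {\<alpha>..\<beta>}"
    and z_eq: "j \<in> {1..m} \<Longrightarrow> z j = \<Gamma> (\<tau> j)"
begin

definition ot :: "nat \<Rightarrow> 'a \<Rightarrow> 'a" where
  "ot j = (if j \<le> m then op_app (A j) else vi)"

definition gt :: "nat \<Rightarrow> complex \<Rightarrow> 'a \<Rightarrow> 'a" where
  "gt j \<zeta> y = ex \<zeta> (ot j (ex (- \<zeta>) y))"

abbreviation factors :: "nat \<Rightarrow> complex \<Rightarrow> 'a oper" where
  "factors \<equiv> factor_seq m (\<lambda>j. at_time P (A j)) (\<lambda>\<zeta>. op_scale (- \<i>) (at_time P H1 \<zeta>))"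

text \<open>The factor \<open>ex (\<Gamma> \<alpha>)\<close> cancels the free evolution from
  \<open>\<Gamma> \<alpha>\<close> that begins every \<open>Kt\<close>.\<close>

abbreviation x1 :: 'a where "x1 \<equiv> ex (\<Gamma> \<alpha>) x0"

lemma x0_D: "x0 \<in> D" and x1_V: "x1 \<in> V P e0" and x1_D: "x1 \<in> D"
  using x0 V_D by auto

lemma tame_ot: "1 \<le> j \<Longrightarrow> tame b c' (ot j)"
  unfolding ot_def using tame_A tame_vi' by simp

lemma ot_D: "1 \<le> j \<Longrightarrow> y \<in> D \<Longrightarrow> ot j y \<in> D"
  by (rule tame_D[OF tame_ot])

lemma acts_factors:
  assumes j: "1 \<le> j"
  shows "acts (factors j \<zeta>) (gt j \<zeta>)"
proof (cases "j \<le> m")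
  case True
  then show ?thesis
    using acts_at_time[OF A_C0, of j \<zeta>] j unfolding factor_seq_def gt_def[abs_def] ot_def by simp
next
  case False
  then have "factors j = (\<lambda>\<zeta>. op_scale (- \<i>) (at_time P H1 \<zeta>))"
    unfolding factor_seq_def by simp
  moreover have "- \<i> *\<^sub>C ex \<zeta> (v (ex (- \<zeta>) x)) = gt j \<zeta> x" if "x \<in> D" for x
    unfolding gt_def ot_def vi_def using False that ex_linear(2)[of "v (ex (- \<zeta>) x)" \<zeta> "- \<i>"] by simp
  ultimately show ?thesis
    using acts_cong[OF acts_op_scale[OF acts_at_time[OF H1_C0, of \<zeta>], of "- \<i>"]] by metis
qed

lemma fam_gt:
  assumes "1 \<le> j"
  shows "\<exists>K'. fam (gt j) K'"
  unfolding gt_def[abs_def] using fam_comp[OF fam_ex fam_comp[OF fam_tame[OF tame_ot[OF assms]] fam_minus[OF fam_ex]]]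
  by blast

lemma gt_V: "1 \<le> j \<Longrightarrow> 0 \<le> e \<Longrightarrow> y \<in> V P e \<Longrightarrow> gt j \<zeta> y \<in> V P (e + b)"
  unfolding gt_def using tame_V[OF tame_ot] by simp

lemma foldr_gt_V:
  assumes "set js \<subseteq> {1..}"
  shows "foldr (\<lambda>j. gt j (\<eta> j)) js x1 \<in> V P (e0 + real (length js) * b)"
  using assms
proof (induction js)
  case (Cons j js)
  have "gt j (\<eta> j) (foldr (\<lambda>j. gt j (\<eta> j)) js x1) \<in> V P (e0 + real (length js) * b + b)"
    by (rule gt_V) (use Cons e0 in auto)
  then show ?case
    by (simp add: algebra_simps)
qed (simp add: x1_V)

lemma continuous_foldr_gt:
  assumes "set js \<subseteq> {1..}" and p: "\<And>j. continuous_on S (\<lambda>\<eta>. p \<eta> j)"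
  shows "continuous_on S (\<lambda>\<eta>. foldr (\<lambda>j. gt j (p \<eta> j)) js x1)"
  using assms(1)
proof (induction js)
  case (Cons j js)
  then obtain K' where "fam (gt j) K'"
    using fam_gt[of j] by auto
  then show ?case
    unfolding foldr.simps o_def
    by (rule fam_continuous_comp[OF _ _ p, where e = "e0 + real (length js) * b"])
      (use Cons e0 foldr_gt_V in auto)
qed simp

text \<open>At order zero all interactions present are marked ones, and the free evolutions between
  neighbouring times telescope.\<close>

lemma foldr_gt_Kt:
  assumes "set js \<subseteq> {1..}"
  shows "foldr (\<lambda>j. gt j (\<Gamma> (t j))) js x1 = ex (\<Gamma> u) (Kt 0 u (map (\<lambda>j. (t j, ot j)) js))"
  using assms
proof (induction js arbitrary: u)
  case Nil
  then show ?case
    using x0_D by (simp add: w_0 ex_ex)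
next
  case (Cons j js)
  let ?L = "map (\<lambda>j. (t j, ot j)) js"
  have "tame_list ?L"
    using Cons.prems tame_ot unfolding tame_list_def by auto
  then have D: "Kt 0 (t j) ?L \<in> D"
    by (rule Kt_D)
  have IH: "foldr (\<lambda>j. gt j (\<Gamma> (t j))) js x1 = ex (\<Gamma> (t j)) (Kt 0 (t j) ?L)"
    by (rule Cons.IH) (use Cons.prems in simp)
  have "foldr (\<lambda>j. gt j (\<Gamma> (t j))) (j # js) x1 = ex (\<Gamma> (t j)) (ot j (Kt 0 (t j) ?L))"
    unfolding foldr.simps o_def IH gt_def[of j] using D by simp
  then show ?case
    using Cons.prems D ot_D[of j] by (simp add: w_0 ex_ex)
qed

abbreviation marked :: "(nat \<Rightarrow> real) \<Rightarrow> nat \<Rightarrow> (real \<times> ('a \<Rightarrow> 'a)) list" where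
  "marked t k \<equiv> map (\<lambda>j. (t j, ot j)) (time_list t k)"

lemma tame_marked: "tame_list (marked t k)"
  using tame_ot set_time_list[of t k] unfolding tame_list_def by auto

lemma map_insert_index:
  assumes "m < k"
  shows "map (\<lambda>j. (t j, ot j)) (insert_index t k js) = ins (t k) (map (\<lambda>j. (t j, ot j)) js)"
  using assms by (induction js) (auto simp: ot_def)

lemma marked_Suc:
  assumes "m \<le> k"
  shows "marked (t(Suc k := s)) (Suc k) = ins s (marked t k)"
proof -
  let ?t = "t(Suc k := s)"
  have "time_list ?t k = time_list t k"
    by (rule time_list_cong) auto
  moreover have "map (\<lambda>j. (?t j, ot j)) (time_list t k) = marked t k"
    by (rule map_cong) (auto simp: set_time_list)
  moreover have "map (\<lambda>j. (?t j, ot j)) (insert_index ?t (Suc k) (time_list t k)) =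
      ins (?t (Suc k)) (map (\<lambda>j. (?t j, ot j)) (time_list t k))"
    by (rule map_insert_index) (use assms in simp)
  ultimately show ?thesis
    by (simp only: time_list.simps fun_upd_same)
qed

lemma descending_map:
  assumes "sorted_wrt (\<lambda>i j. t j < t i) js" "\<And>j. j \<in> set js \<Longrightarrow> \<alpha> \<le> t j \<and> t j \<le> u" "\<alpha> \<le> u"
  shows "descending u (map (\<lambda>j. (t j, B j)) js)"
  using assms by (induction js arbitrary: u) (auto simp: less_imp_le)

lemma ex_pr_bounded:
  assumes "0 \<le> e"
  shows "clinear (\<lambda>y. ex a (pr e y))" "bounded_linear (\<lambda>y. ex a (pr e y))"
proof -
  show lin: "clinear (\<lambda>y. ex a (pr e y))"
    unfolding clinear_on_def by (simp add: clinear_onD[OF clinear_pr] ex_linear)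
  have "norm (ex a (pr e y)) \<le> exp (cmod a * e) * norm y" for y
    by (rule order_trans[OF ex_bound[OF assms pr_V] mult_left_mono[OF norm_pr_le]]) simp
  then show "bounded_linear (\<lambda>y. ex a (pr e y))"
    by (rule clinear_bounded_linear[OF lin])
qed

text \<open>Fixed and integrated factors are entries of one marked list. Each integration removes a
  marked interaction, raises the order of \<open>Kt\<close> by one and multiplies by the new order;
  these numbers multiply up to \<open>fact n\<close>.\<close>

lemma curve_iter_integral_Kt:
  assumes "k + n = N" "m \<le> k" "inj_on t {1..k}" "t ` {1..k} \<subseteq> {\<alpha>..\<beta>}" "\<And>j. j \<in> {1..k} \<Longrightarrow> \<zeta> j = \<Gamma> (t j)"
  shows "curve_iter_integral \<Gamma> \<alpha> \<beta> k n (\<lambda>\<eta>. op_app (time_ordered \<Gamma> \<alpha> \<beta> N factors \<eta>) x1) \<zeta> =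
    fact n *\<^sub>R ex (\<Gamma> \<beta>) (Kt n \<beta> (marked t k))"
  using assms
proof (induction n arbitrary: k t \<zeta>)
  case 0
  have "op_app (time_ordered \<Gamma> \<alpha> \<beta> N factors \<zeta>) x1 = foldr (\<lambda>j. gt j (\<zeta> j)) (time_list t N) x1"
    by (rule time_ordered_eq) (use 0 acts_factors x1_D in auto)
  also have "\<dots> = foldr (\<lambda>j. gt j (\<Gamma> (t j))) (time_list t k) x1"
    by (rule foldr_cong) (use 0 set_time_list in auto)
  also have "\<dots> = ex (\<Gamma> \<beta>) (Kt 0 \<beta> (marked t k))"
    by (rule foldr_gt_Kt) (auto simp: set_time_list)
  finally show ?case
    by simp
next
  case (Suc n)
  let ?G = "\<lambda>\<eta>. op_app (time_ordered \<Gamma> \<alpha> \<beta> N factors \<eta>) x1"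
  let ?L = "marked t k"
  let ?e = "e0 + real (Suc (length ?L)) * b + real n * b"
  let ?T = "\<lambda>y. fact n *\<^sub>R ex (\<Gamma> \<beta>) (pr ?e y)"
  have e: "0 \<le> ?e"
    using e0 by simp
  have pr_Kt: "pr ?e (Kt n \<beta> (ins s ?L)) = Kt n \<beta> (ins s ?L)" for s
    using Kt_V[OF tame_ins[OF tame_marked], of n \<beta> s] unfolding length_ins V_iff .
  have pr_Kt': "pr ?e (Kt (Suc n) \<beta> ?L) = Kt (Suc n) \<beta> ?L"
    using Kt_V[OF tame_marked, of "Suc n" \<beta> t k] unfolding V_iff[symmetric] by (simp add: algebra_simps)
  have "\<alpha> \<le> t j \<and> t j \<le> \<beta>" if "j \<in> set (time_list t k)" for j
    using that Suc.prems(4) unfolding set_time_list image_subset_iff by simp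
  then have "descending \<beta> ?L"
    by (rule descending_map[OF sorted_time_list[OF Suc.prems(3)]]) (use \<alpha>_less in auto)
  note Kt_int = Kt_insertion[OF this order_refl tame_marked, of n]
  have scale: "ex a (pr ?e (r *\<^sub>C y)) = r *\<^sub>C ex a (pr ?e y)" for a r y
    by (rule clinear_onD(2)[OF ex_pr_bounded(1)[OF e] UNIV_I])
  have "bounded_linear ?T"
    by (rule bounded_linear_compose[OF bounded_linear_scaleR_right ex_pr_bounded(2)[OF e]])
  from has_integral_linear[OF Kt_int this] have "((\<lambda>s. ?T (\<gamma>' s *\<^sub>C Kt n \<beta> (ins s ?L))) has_integral ?T (real (Suc n) *\<^sub>R Kt (Suc n) \<beta> ?L)) {\<alpha>..\<beta>}"
    unfolding o_def .
  moreover have "?T (\<gamma>' s *\<^sub>C Kt n \<beta> (ins s ?L)) = \<gamma>' s *\<^sub>C fact n *\<^sub>R ex (\<Gamma> \<beta>) (Kt n \<beta> (ins s ?L))" for s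
    unfolding scaleR_scaleC scale pr_Kt by (simp add: scaleC_scaleC mult.commute)
  moreover have "?T (real (Suc n) *\<^sub>R Kt (Suc n) \<beta> ?L) = fact (Suc n) *\<^sub>R ex (\<Gamma> \<beta>) (Kt (Suc n) \<beta> ?L)"
    unfolding scaleR_scaleC scale pr_Kt' by (simp add: scaleC_scaleC mult.commute)
  ultimately have int: "((\<lambda>s. \<gamma>' s *\<^sub>C fact n *\<^sub>R ex (\<Gamma> \<beta>) (Kt n \<beta> (ins s ?L))) has_integral
      fact (Suc n) *\<^sub>R ex (\<Gamma> \<beta>) (Kt (Suc n) \<beta> ?L)) {\<alpha>..\<beta>}"
    by simp
  have "((\<lambda>s. \<gamma>' s *\<^sub>C curve_iter_integral \<Gamma> \<alpha> \<beta> (Suc k) n ?G (\<zeta>(Suc k := \<Gamma> s))) has_integral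
      fact (Suc n) *\<^sub>R ex (\<Gamma> \<beta>) (Kt (Suc n) \<beta> ?L)) {\<alpha>..\<beta>}"
  \<comment> \<open>Coinciding times are excluded: there the strict order on the curve admits no
    permutation and the time-ordered product is zero.\<close>
  proof (rule has_integral_spike_finite[OF _ _ int])
    show "finite (t ` {1..k})"
      by simp
    fix s assume s: "s \<in> {\<alpha>..\<beta>} - t ` {1..k}"
    have "curve_iter_integral \<Gamma> \<alpha> \<beta> (Suc k) n ?G (\<zeta>(Suc k := \<Gamma> s)) =
        fact n *\<^sub>R ex (\<Gamma> \<beta>) (Kt n \<beta> (marked (t(Suc k := s)) (Suc k)))"
    proof (rule Suc.IH)
      have img: "(t(Suc k := s)) ` {1..k} = t ` {1..k}"
        by (rule image_cong) auto
      have "inj_on (t(Suc k := s)) {1..k}"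
        using Suc.prems(3) by (rule inj_on_cong[THEN iffD1, rotated]) auto
      moreover have "{1..Suc k} = insert (Suc k) {1..k}"
        by auto
      ultimately show "inj_on (t(Suc k := s)) {1..Suc k}" "(t(Suc k := s)) ` {1..Suc k} \<subseteq> {\<alpha>..\<beta>}"
        using s Suc.prems(4) img by auto
    qed (use Suc.prems in auto)
    then show "\<gamma>' s *\<^sub>C curve_iter_integral \<Gamma> \<alpha> \<beta> (Suc k) n ?G (\<zeta>(Suc k := \<Gamma> s)) =
        \<gamma>' s *\<^sub>C fact n *\<^sub>R ex (\<Gamma> \<beta>) (Kt n \<beta> (ins s ?L))"
      unfolding marked_Suc[OF Suc.prems(2)] by simp
  qed
  then show ?case
    unfolding curve_iter_integral.simps curve_integral_def by (rule integral_unique)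
qed

text \<open>\<open>x1\<close> belongs to the spanning set itself: a vector of bounded energy admits
  the factors in every order, with joint continuity in the times.\<close>

lemma x1_texp_core:
  "x1 \<in> texp_core \<Gamma> \<alpha> \<beta> m (\<lambda>j. at_time P (A j)) z (\<lambda>\<zeta>. op_scale (- \<i>) (at_time P H1 \<zeta>))"
  unfolding texp_core_def Let_def
proof (intro complex_vector.span_base CollectI allI impI conjI ballI)
  fix n \<sigma> assume \<sigma>: "\<sigma> permutes {1..m + n}"
  let ?js = "map \<sigma> [1..<Suc (m + n)]"
  have "set ?js = \<sigma> ` {1..m + n}"
    by (simp add: atLeastLessThanSuc_atLeastAtMost del: upt_Suc)
  then have js: "set ?js \<subseteq> {1..}"
    using permutes_image[OF \<sigma>] by auto
  have acts: "acts (perm_prod (m + n) factors \<sigma> \<eta>) (foldr (\<lambda>j. gt j (\<eta> j)) ?js)" for \<eta>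
  proof -
    have "acts (op_prod (map (\<lambda>j. factors j (\<eta> j)) ?js)) (foldr (\<lambda>j. gt j (\<eta> j)) ?js)"
      by (rule acts_op_prod_map) (use js acts_factors in auto)
    then show ?thesis
      unfolding perm_prod_def by (simp add: o_def del: upt_Suc)
  qed
  show "x1 \<in> Domain (perm_prod (m + n) factors \<sigma> (join_points m z \<eta>))" for \<eta>
    using acts x1_D unfolding acts_def by blast
  show "continuous_on (PiE {m + 1..m + n} (\<lambda>_. \<Gamma> ` {\<alpha>..\<beta>}))
      (\<lambda>\<eta>. op_app (perm_prod (m + n) factors \<sigma> (join_points m z \<eta>)) x1)"
    unfolding acts_op_app[OF acts x1_D]
  proof (rule continuous_foldr_gt[OF js])
    show "continuous_on (PiE {m + 1..m + n} (\<lambda>_. \<Gamma> ` {\<alpha>..\<beta>})) (\<lambda>\<eta>. join_points m z \<eta> j)" for j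
      unfolding join_points_def
      by (cases "j \<le> m") (auto intro: continuous_on_subset[OF continuous_on_product_coordinates])
  qed
qed

lemma texp_term_Kt:
  "texp_term \<Gamma> \<alpha> \<beta> m (\<lambda>j. at_time P (A j)) z (\<lambda>\<zeta>. op_scale (- \<i>) (at_time P H1 \<zeta>)) x1 =
    (\<lambda>n. ex (\<Gamma> \<beta>) (Kt n \<beta> (marked \<tau> m)))"
proof
  fix n
  have "curve_iter_integral \<Gamma> \<alpha> \<beta> m n (\<lambda>\<eta>. op_app (time_ordered \<Gamma> \<alpha> \<beta> (m + n) factors \<eta>) x1) z =
      fact n *\<^sub>R ex (\<Gamma> \<beta>) (Kt n \<beta> (marked \<tau> m))"
    by (rule curve_iter_integral_Kt) (use inj_\<tau> \<tau>_mem z_eq in auto)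
  then show "texp_term \<Gamma> \<alpha> \<beta> m (\<lambda>j. at_time P (A j)) z (\<lambda>\<zeta>. op_scale (- \<i>) (at_time P H1 \<zeta>)) x1 n =
      ex (\<Gamma> \<beta>) (Kt n \<beta> (marked \<tau> m))"
    unfolding texp_term_def by (simp add: scaleR_scaleC scaleC_scaleC)
qed

lemma fast_ex_Kt: "fast (\<lambda>n. ex (\<Gamma> \<beta>) (Kt n \<beta> (marked \<tau> m)))"
proof (rule fast_geometric_factor[OF Kt_fast[OF tame_marked]])
  let ?e = "e0 + real (length (marked \<tau> m)) * b"
  fix n
  have "norm (ex (\<Gamma> \<beta>) (Kt n \<beta> (marked \<tau> m))) \<le> exp (cmod (\<Gamma> \<beta>) * (?e + real n * b)) * norm (Kt n \<beta> (marked \<tau> m))"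
    by (rule ex_bound[OF _ Kt_V[OF tame_marked]]) (use e0 in auto)
  also have "exp (cmod (\<Gamma> \<beta>) * (?e + real n * b)) = exp (cmod (\<Gamma> \<beta>) * ?e) * exp (cmod (\<Gamma> \<beta>) * b) ^ n"
    by (simp add: exp_add[symmetric] exp_of_nat_mult[symmetric] algebra_simps)
  finally show "norm (ex (\<Gamma> \<beta>) (Kt n \<beta> (marked \<tau> m))) \<le>
      exp (cmod (\<Gamma> \<beta>) * ?e) * exp (cmod (\<Gamma> \<beta>) * b) ^ n * norm (Kt n \<beta> (marked \<tau> m))" .
qed auto

lemma dyson_texp_eq:
  "x1 \<in> Domain (dyson_texp P H1 \<Gamma> \<alpha> \<beta> m A z)"
  "op_app (dyson_texp P H1 \<Gamma> \<alpha> \<beta> m A z) x1 = (\<Sum>n. ex (\<Gamma> \<beta>) (Kt n \<beta> (marked \<tau> m)))"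
proof -
  have "(x1, y) \<in> dyson_texp P H1 \<Gamma> \<alpha> \<beta> m A z \<longleftrightarrow> y = (\<Sum>n. ex (\<Gamma> \<beta>) (Kt n \<beta> (marked \<tau> m)))" for y
    unfolding dyson_texp_def texp_def using x1_texp_core fast_summable[OF fast_ex_Kt] by (simp add: texp_term_Kt)
  then show "x1 \<in> Domain (dyson_texp P H1 \<Gamma> \<alpha> \<beta> m A z)"
    "op_app (dyson_texp P H1 \<Gamma> \<alpha> \<beta> m A z) x1 = (\<Sum>n. ex (\<Gamma> \<beta>) (Kt n \<beta> (marked \<tau> m)))"
    unfolding op_app_def by auto
qed

text \<open>Pairing with a vector that the free evolution fixes removes the final
  \<open>ex (\<Gamma> \<beta>)\<close> from every term.\<close>

lemma cinner_dyson_texp: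
  assumes u: "u \<in> D" "\<And>a. ex a u = u"
  shows "cinner u (op_app (dyson_texp P H1 \<Gamma> \<alpha> \<beta> m A z) x1) = cinner u (\<Sum>n. Kt n \<beta> (marked \<tau> m))"
proof -
  have lin: "bounded_linear (cinner u)"
    by (rule bounded_linear_cinner_right)
  have "cinner u (ex a y) = cinner u y" if "y \<in> D" for a y
    using ex_adjoint[OF u(1) that, of "- cnj a"] by (simp add: u(2))
  then have "cinner u (ex (\<Gamma> \<beta>) (Kt n \<beta> (marked \<tau> m))) = cinner u (Kt n \<beta> (marked \<tau> m))" for n
    using Kt_D[OF tame_marked] by blast
  then show ?thesis
    unfolding dyson_texp_eq(2) bounded_linear.suminf[OF lin fast_summable'[OF fast_ex_Kt]]
      bounded_linear.suminf[OF lin fast_summable'[OF Kt_fast[OF tame_marked]]] by simp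
qed

end

section \<open>Summation of the Dyson terms\<close>

context symmetric_interaction
begin

lemma zero_energy:
  assumes "(x, 0) \<in> H0"
  shows "x \<in> V P 1" "ex z x = x"
proof -
  have R0: "R0 1 x = x"
    using R0_unique[OF _ assms, of 1] by simp
  \<comment> \<open>On energies above 1 the resolvent \<open>R0 1\<close> has norm at most 1/2, yet
    it fixes \<open>x\<close>, so this part of \<open>x\<close> vanishes. Any positive threshold
    would do.\<close>
  let ?B = "{1<..} :: real set" and ?f = "cut {0..} (\<lambda>l. complex_of_real (1 / (l + 1)))"
  define y where "y = P ?B x"
  have "R0 1 y = bfc ?f (bfc (cut ?B (\<lambda>_. 1)) x)"
    unfolding R0_def y_def by (simp add: bfc_indicator)
  also have "\<dots> = bfc (cut ?B (\<lambda>_. 1)) (R0 1 x)"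
    unfolding R0_def by (intro bfc_commute bounded_borel_R0 bounded_borel_cut bounded_borel_const) auto
  also have "\<dots> = y"
    unfolding R0 y_def by (simp add: bfc_indicator)
  finally have "norm y = norm (bfc ?f y)"
    unfolding R0_def by simp
  also have "\<dots> \<le> 1 / 2 * norm y"
  proof (rule bfc_bound_on[of _ ?B])
    show "P ?B y = y"
      unfolding y_def by (rule P_idem) simp
    show "cmod (?f l) \<le> 1 / 2" if "l \<in> ?B" for l
      using that by (simp add: cut_def norm_divide frac_le flip: of_real_add of_real_divide)
    show "bounded_borel ?f"
      by (rule bounded_borel_R0) simp
  qed auto
  finally have "y = 0"
    by simp
  moreover have "P ({0..1} \<union> ?B) x = P {0..1} x + P ?B x"
    by (rule P_Un) auto
  moreover have "{0..1} \<union> ?B = {0..}"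
    by auto
  ultimately have "P {0..1} x = x"
    unfolding y_def by (metis P_nonneg add.right_neutral)
  then show V: "x \<in> V P 1"
    unfolding V_iff .
  then have D: "x \<in> D"
    by (rule V_D)
  have "h x = 0"
    using op_app_H0[OF D] op_app_eq[OF linear_opD(1)[OF linear_H0] assms] by simp
  then have "h (ex z x) = 0" for z
    unfolding h_ex[OF D] by simp
  then have "has_cderiv (\<lambda>z. ex z x) 0 z" for z
    using ex_cderiv[OF D, of z] by simp
  then have "ex z x = ex 0 x"
    by (rule has_cderiv_zero_constant)
  then show "ex z x = x"
    using D by simp
qed

text \<open>No evolution stands at the right end: it is contained in \<open>y\<close>, and the limit
  is taken in \<open>y\<close>.\<close>

fun chain :: "(nat \<Rightarrow> 'a oper) \<Rightarrow> (nat \<Rightarrow> complex) \<Rightarrow> nat list \<Rightarrow> 'a \<Rightarrow> 'a" where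
  "chain A z [] y = y"
| "chain A z [j] y = op_app (A j) y"
| "chain A z (j # k # js) y = op_app (A j) (S (z j - z k) (chain A z (k # js) y))"

end

locale symmetric_dyson = symmetric_interaction P H0 H1 b c + dyson_insertions P H0 H1 b c \<Gamma> \<alpha> \<beta> x0 c' e0 m A z \<tau>
  for P :: "real set \<Rightarrow> 'a::complex_hilbert \<Rightarrow> 'a" and H0 H1 b c \<Gamma> \<alpha> \<beta> x0 c' e0 m A z \<tau>
begin

text \<open>\<open>S\<close> is controlled in the lower half-plane only, so the time differences
  between marked points have to lie there; the curve between these points is not restricted.\<close>

fun Im_descending :: "real \<Rightarrow> (real \<times> ('a \<Rightarrow> 'a)) list \<Rightarrow> bool" where
  "Im_descending u [] \<longleftrightarrow> Im (\<Gamma> u - \<Gamma> \<alpha>) \<le> 0"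
| "Im_descending u ((t, B) # L) \<longleftrightarrow> Im (\<Gamma> u - \<Gamma> t) \<le> 0 \<and> Im_descending t L"

fun SA :: "real \<Rightarrow> (real \<times> ('a \<Rightarrow> 'a)) list \<Rightarrow> 'a" where
  "SA u [] = S (\<Gamma> u - \<Gamma> \<alpha>) x0"
| "SA u ((t, B) # L) = S (\<Gamma> u - \<Gamma> t) (B (SA t L))"

text \<open>The third assumption is closedness of each \<open>B\<close> along sequences in
  \<open>D\<close>. It moves \<open>B\<close> past the sum over all orders, which may leave
  \<open>D\<close>.\<close>

lemma suminf_Kt:
  assumes "tame_list L" "Im_descending u L"
    and "\<And>t B X x y. (t, B) \<in> set L \<Longrightarrow> (\<And>n. X n \<in> D) \<Longrightarrow> X \<longlonglongrightarrow> x \<Longrightarrow> (\<lambda>n::nat. B (X n)) \<longlonglongrightarrow> y \<Longrightarrow> B x = y"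
  shows "(\<Sum>n. Kt n u L) = SA u L"
  using assms
proof (induction L arbitrary: u)
  case Nil
  then show ?case
    using S_eq_Sf[OF _ x0_D, of "\<Gamma> u - \<Gamma> \<alpha>"] unfolding Sf_def by simp
next
  case (Cons tB L)
  obtain t B where tB: "tB = (t, B)"
    by (cases tB)
  have B: "tame b c' B" and L: "tame_list L" and Im: "Im (\<Gamma> u - \<Gamma> t) \<le> 0" "Im_descending t L"
    using Cons.prems(1,2) unfolding tB by auto
  have IH: "(\<Sum>n. Kt n t L) = SA t L"
  proof (rule Cons.IH[OF L Im(2)])
    fix t B X x y
    assume "(t, B) \<in> set L" and X: "\<And>n. X n \<in> D" "X \<longlonglongrightarrow> x" "(\<lambda>n::nat. B (X n)) \<longlonglongrightarrow> y"
    then have "(t, B) \<in> set (tB # L)"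
      by simp
    then show "B x = y"
      by (rule Cons.prems(3)[OF _ X])
  qed
  let ?e = "e0 + real (length L) * b"
  have e: "0 \<le> ?e" "0 \<le> ?e + b"
    using e0 by simp_all
  define x where "x q = B (Kt q t L)" for q
  have fast_x: "fast x"
    unfolding x_def by (rule fast_tame[OF B e(1) Kt_V[OF L] Kt_fast[OF L]])
  have x_V: "x q \<in> V P (?e + b + real q * b)" for q
  proof -
    have "0 \<le> ?e + real q * b"
      using e by simp
    from tame_V[OF B this Kt_V[OF L]] show ?thesis
      unfolding x_def by (simp add: algebra_simps)
  qed
  have x_D: "x q \<in> D" for q
    using V_D[OF x_V] .
  \<comment> \<open>Absolute summability along diagonals allows summing the orders of the outer
    \<open>w\<close> and of the remaining list separately.\<close>
  have "(\<lambda>n. \<Sum>p\<le>n. w p (\<Gamma> u - \<Gamma> t) (x (n - p))) sums (\<Sum>q. \<Sum>p. w p (\<Gamma> u - \<Gamma> t) (x q))"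
    by (rule sums_diagonal[of "\<lambda>p q. w p (\<Gamma> u - \<Gamma> t) (x q)"])
      (rule fast_summable'[OF fast_convolution_norms[OF e(2) x_V fast_x]])
  then have "(\<Sum>n. Kt n u (tB # L)) = (\<Sum>q. \<Sum>p. w p (\<Gamma> u - \<Gamma> t) (x q))"
    unfolding tB Kt.simps x_def by (rule sums_unique[symmetric])
  also have "\<dots> = (\<Sum>q. S (\<Gamma> u - \<Gamma> t) (x q))"
    using S_eq_Sf[OF Im(1) x_D] unfolding Sf_def by simp
  also have "\<dots> = S (\<Gamma> u - \<Gamma> t) (suminf x)"
    by (rule bounded_linear.suminf[OF bounded_linear_S[OF Im(1)] fast_summable'[OF fast_x], symmetric])
  also have "suminf x = B (SA t L)"
  proof -
    have "(\<lambda>N. \<Sum>n<N. Kt n t L) \<longlonglongrightarrow> SA t L"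
      using summable_LIMSEQ[OF fast_summable'[OF Kt_fast[OF L, of t]]] unfolding IH .
    moreover have "(\<lambda>N. B (\<Sum>n<N. Kt n t L)) \<longlonglongrightarrow> suminf x"
    proof -
      have "B (\<Sum>n<N. Kt n t L) = (\<Sum>n<N. x n)" for N
        unfolding x_def by (rule clinear_on_extra(4)[OF tame_linear[OF B] D_subspace Kt_D[OF L]])
      then show ?thesis
        using summable_LIMSEQ[OF fast_summable'[OF fast_x]] by simp
    qed
    moreover have "(\<Sum>n<N. Kt n t L) \<in> D" for N
      by (rule complex_vector.subspace_sum[OF D_subspace Kt_D[OF L]])
    ultimately show ?thesis
      using Cons.prems(3)[of t B] unfolding tB by (metis list.set_intros(1))
  qed
  finally show ?case
    unfolding tB by simp
qed

lemma SA_chain: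
  assumes "js \<noteq> []" "\<And>j. j \<in> set js \<Longrightarrow> z j = \<Gamma> (\<tau> j)"
  shows "SA u (map (\<lambda>j. (\<tau> j, op_app (A j))) js) =
    S (\<Gamma> u - z (hd js)) (chain A z js (S (z (last js) - \<Gamma> \<alpha>) x0))"
  using assms
proof (induction A z js "S (z (last js) - \<Gamma> \<alpha>) x0" arbitrary: u rule: chain.induct)
  case (3 A z j k js)
  then show ?case
    by simp
qed simp_all

text \<open>The case \<open>m = 0\<close> is kept because it is the denominator.\<close>

lemma expectation_dyson_texp:
  assumes u: "u \<in> D" "\<And>a. ex a u = u" and decreasing: "\<And>i j. 1 \<le> i \<Longrightarrow> i < j \<Longrightarrow> j \<le> m \<Longrightarrow> \<tau> j < \<tau> i"
    and Im_z: "\<And>j. j \<in> {1..<m} \<Longrightarrow> Im (z j) \<le> Im (z (Suc j))"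
    and Im_\<beta>: "Im (\<Gamma> \<beta>) \<le> Im (if m = 0 then \<Gamma> \<alpha> else z 1)" and Im_\<alpha>: "m \<noteq> 0 \<Longrightarrow> Im (z m) \<le> Im (\<Gamma> \<alpha>)"
  shows "cinner u (op_app (dyson_texp P H1 \<Gamma> \<alpha> \<beta> m A z) x1) =
    cinner u (if m = 0 then S (\<Gamma> \<beta> - \<Gamma> \<alpha>) x0
      else S (\<Gamma> \<beta> - z 1) (chain A z [1..<Suc m] (S (z m - \<Gamma> \<alpha>) x0)))"
proof -
  let ?L = "map (\<lambda>j. (\<tau> j, op_app (A j))) [1..<Suc m]"
  have marked: "marked \<tau> m = ?L"
  proof -
    have "time_list \<tau> m = [1..<Suc m]"
      by (rule time_list_decreasing) (use decreasing in auto)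
    then show ?thesis
      by (auto simp: ot_def simp del: upt_Suc)
  qed
  have Im_L: "Im_descending t (map (\<lambda>j. (\<tau> j, op_app (A j))) [i..<Suc m])"
    if "1 \<le> i" "i \<le> Suc m" "Im (\<Gamma> t) \<le> Im (if i = Suc m then \<Gamma> \<alpha> else z i)" for i t
    using that(2,1,3)
  proof (induction arbitrary: t rule: inc_induct)
    case (step i)
    have "Im (\<Gamma> (\<tau> i)) \<le> Im (if Suc i = Suc m then \<Gamma> \<alpha> else z (Suc i))"
      using z_eq[of i] step Im_z[of i] Im_\<alpha> by auto
    moreover have "[i..<Suc m] = i # [Suc i..<Suc m]"
      using step by (simp add: upt_conv_Cons del: upt_Suc)
    ultimately show ?case
      using step z_eq[of i] by (simp del: upt_Suc)
  qed simp
  have "(\<Sum>n. Kt n \<beta> ?L) = SA \<beta> ?L"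
  proof (rule suminf_Kt)
    show "tame_list ?L"
      using tame_marked[of \<tau> m] unfolding marked .
    show "Im_descending \<beta> ?L"
      by (rule Im_L) (use Im_\<beta> in auto)
    fix t B X x y assume "(t, B) \<in> set ?L" and X: "\<And>n. X n \<in> D" "X \<longlonglongrightarrow> x" "(\<lambda>n::nat. B (X n)) \<longlonglongrightarrow> y"
    then obtain j where "j \<in> set [1..<Suc m]" and B: "B = op_app (A j)"
      by (auto simp del: upt_Suc set_upt)
    then have j: "j \<in> {1..m}"
      by auto
    have A: "closed (A j)" "linear_op (A j)"
      using A_C0[OF j] unfolding class_C0_def by auto
    have "(x, y) \<in> A j"
      by (rule closed_opD[OF A(1) class_C0_mem[OF A_C0[OF j] X(1)] X(2)]) (use X(3) in \<open>simp add: B\<close>)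
    then show "B x = y"
      unfolding B by (rule op_app_eq[OF linear_opD(1)[OF A(2)]])
  qed
  also have "\<dots> = (if m = 0 then S (\<Gamma> \<beta> - \<Gamma> \<alpha>) x0
      else S (\<Gamma> \<beta> - z 1) (chain A z [1..<Suc m] (S (z m - \<Gamma> \<alpha>) x0)))"
  proof (cases "m = 0")
    case False
    have "hd [1..<Suc m] = 1" "last [1..<Suc m] = m"
      using False by (simp_all add: hd_upt del: upt_Suc)
    then show ?thesis
      using SA_chain[of "[1..<Suc m]" \<beta>] z_eq False by (simp del: upt_Suc)
  qed simp
  finally show ?thesis
    unfolding cinner_dyson_texp[OF u] marked by simp
qed

end

section \<open>Green's functions\<close>

context ground
begin

context
  fixes k :: real and R :: "'a \<Rightarrow> 'a"
  assumes R: "resolvent_at k R"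
begin

text \<open>For \<open>u\<close> in \<open>D\<close> the power \<open>R ^^ n\<close> can be divided
  out and \<open>S_limit\<close> applied to the quotient; continuity of \<open>R ^^ n\<close>
  identifies the limits.\<close>

lemma sconv_ground:
  assumes u: "u \<in> D" and f: "filterlim (\<lambda>t. Im (f t)) at_bot Fl" and Fl: "Fl \<noteq> bot"
  shows "sconv R (\<lambda>t. exp (\<i> * f t * E) *\<^sub>C S (f t) u) (cinner \<Omega> u *\<^sub>C \<Omega>) Fl"
  unfolding sconv_def[OF R]
proof
  fix n
  obtain q where q: "u = (R ^^ n) q"
    using D_in_Rn[OF R u] by blast
  let ?g = "\<lambda>t. exp (\<i> * f t * E) *\<^sub>C S (f t) q" and ?g' = "cinner \<Omega> q *\<^sub>C \<Omega>"
  have g: "(?g \<longlongrightarrow> ?g') Fl"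
    by (rule S_limit[OF f])
  have "\<forall>\<^sub>F t in Fl. Im (f t) \<le> 0"
    using f unfolding filterlim_at_bot by blast
  then have eq: "\<forall>\<^sub>F t in Fl. exp (\<i> * f t * E) *\<^sub>C S (f t) u = (R ^^ n) (?g t)"
    by eventually_elim (simp add: q S_Rn[OF R] clinear_onD(2)[OF clinear_Rn[OF R]])
  have "((\<lambda>t. (R ^^ n) (?g t)) \<longlongrightarrow> (R ^^ n) ?g') Fl"
    by (rule bounded_linear.tendsto[OF bounded_linear_Rn[OF R] g])
  moreover have "((\<lambda>t. (R ^^ n) (?g t)) \<longlongrightarrow> cinner \<Omega> u *\<^sub>C \<Omega>) Fl"
    by (rule Lim_transform_eventually[OF S_limit[OF f] eq])
  ultimately have "cinner \<Omega> u *\<^sub>C \<Omega> = (R ^^ n) ?g'"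
    using tendsto_unique[OF Fl] by blast
  then show "\<exists>g g'. (\<forall>\<^sub>F t in Fl. exp (\<i> * f t * E) *\<^sub>C S (f t) u = (R ^^ n) (g t)) \<and>
      cinner \<Omega> u *\<^sub>C \<Omega> = (R ^^ n) g' \<and> (g \<longlongrightarrow> g') Fl"
    using eq g by (intro exI[of _ ?g] exI[of _ ?g'] conjI)
qed

lemma sconv_mem:
  assumes A: "A \<in> class_C0 P"
    and r: "\<And>n. maps_into A (Domain (H ^^ (n + r))) (Domain (H ^^ n))"
    and f: "sconv R f l Fl"
  shows "(l, op_app A l) \<in> A"
proof -
  have "l \<in> range (R ^^ r)"
    using f unfolding sconv_def[OF R] by blast
  then have "l \<in> Domain A"
    using r[of 0] unfolding maps_into_def Domain_H_power[OF R, symmetric] by auto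
  moreover have "single_valued A"
    using A unfolding class_C0_def by (auto dest: linear_opD)
  ultimately show ?thesis
    by (rule op_app_mem[rotated])
qed

end

end

locale green = ground P H0 H1 b c \<Omega>
  for P :: "real set \<Rightarrow> 'a::complex_hilbert \<Rightarrow> 'a" and H0 H1 b c \<Omega> +
  fixes c' :: real and m :: nat and A :: "nat \<Rightarrow> 'a oper" and z :: "nat \<Rightarrow> complex"
  assumes m_pos: "1 \<le> m" and c'_ge: "c \<le> c'"
    and A_C0: "j \<in> {1..m} \<Longrightarrow> A j \<in> class_C0 P" and tame_A: "j \<in> {1..m} \<Longrightarrow> tame b c' (op_app (A j))"
    and A_smooth: "j \<in> {1..m} \<Longrightarrow> \<exists>r. \<forall>n. maps_into (A j) (Domain (H ^^ (n + r))) (Domain (H ^^ n))"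
    and Im_z: "j \<in> {1..<m} \<Longrightarrow> Im (z j) \<le> Im (z (Suc j))"
begin

abbreviation chain_from :: "nat \<Rightarrow> 'a \<Rightarrow> 'a" where
  "chain_from i \<equiv> chain A z [i..<Suc m]"

lemma chain_from_m: "chain_from m y = op_app (A m) y"
  and chain_from_step: "i < m \<Longrightarrow> chain_from i y = op_app (A i) (S (z i - z (Suc i)) (chain_from (Suc i) y))"
  by (simp_all add: upt_conv_Cons del: upt_Suc)

lemma Im_diff: "1 \<le> i \<Longrightarrow> i < m \<Longrightarrow> Im (z i - z (Suc i)) \<le> 0"
  using Im_z[of i] by simp

abbreviation green_from :: "nat \<Rightarrow> 'a oper" where
  "green_from i \<equiv> op_prod (A i #
     concat (map (\<lambda>j. [closure (evol_W P H1 (z j - z (Suc j))), A (Suc j)]) [i..<m]))"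

lemma green_from_step:
  assumes "1 \<le> i" "i < m"
  shows "green_from i = {(x, S (z i - z (Suc i)) y) |x y. (x, y) \<in> green_from (Suc i)} O A i"
proof -
  have "[i..<m] = i # [Suc i..<m]"
    using assms by (simp add: upt_conv_Cons)
  then show ?thesis
    unfolding op_prod_Cons closure_evol_W[OF Im_diff[OF assms]]
    by (auto simp: op_prod_Cons closure_evol_W[OF Im_diff[OF assms]])
qed

context
  fixes k :: real and R :: "'a \<Rightarrow> 'a"
  assumes R: "resolvent_at k R"
begin

lemma sconv_op:
  assumes "j \<in> {1..m}" "sconv R f l Fl"
  shows "sconv R (\<lambda>t. op_app (A j) (f t)) (op_app (A j) l) Fl" "(l, op_app (A j) l) \<in> A j"
proof -
  obtain r where r: "\<And>n. maps_into (A j) (Domain (H ^^ (n + r))) (Domain (H ^^ n))"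
    using A_smooth[OF assms(1)] by blast
  show "sconv R (\<lambda>t. op_app (A j) (f t)) (op_app (A j) l) Fl"
    by (rule sconv_A[OF R A_C0[OF assms(1)] r assms(2)])
  show "(l, op_app (A j) l) \<in> A j"
    by (rule sconv_mem[OF R A_C0[OF assms(1)] r assms(2)])
qed

lemma linear_A: "j \<in> {1..m} \<Longrightarrow> linear_op (A j)"
  using A_C0 unfolding class_C0_def by blast

lemma op_app_scale:
  assumes "j \<in> {1..m}" "sconv R f l Fl"
  shows "op_app (A j) (s *\<^sub>C l) = s *\<^sub>C op_app (A j) l"
  using op_app_eq[OF linear_opD(1)[OF linear_A] linear_opD(4)[OF linear_A sconv_op(2)]] assms by blast

text \<open>Homogeneity is carried along because \<open>op_app (A i)\<close> respects scalars only
  on the domain of \<open>A i\<close>, and membership there is itself a consequence of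
  \<open>sconv\<close>.\<close>

lemma chain_from:
  assumes "i \<le> m" "1 \<le> i" and f: "sconv R f l Fl"
  shows "sconv R (\<lambda>t. chain_from i (f t)) (chain_from i l) Fl \<and>
    chain_from i (s *\<^sub>C l) = s *\<^sub>C chain_from i l \<and> (l, chain_from i l) \<in> green_from i \<and>
    single_valued (green_from i)"
  using assms(1,2)
proof (induction rule: inc_induct)
  case base
  have m: "m \<in> {1..m}"
    using m_pos by simp
  show ?case
    unfolding chain_from_m
    using sconv_op[OF m f] op_app_scale[OF m f] linear_opD(1)[OF linear_A[OF m]]
    by (simp add: op_prod_Cons)
next
  case (step i)
  let ?S = "S (z i - z (Suc i))"
  have i: "i \<in> {1..m}" "1 \<le> i" "i < m"
    using step by auto
  note Im = Im_diff[OF i(2,3)]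
  have IH: "sconv R (\<lambda>t. chain_from (Suc i) (f t)) (chain_from (Suc i) l) Fl"
    "chain_from (Suc i) (s *\<^sub>C l) = s *\<^sub>C chain_from (Suc i) l" "(l, chain_from (Suc i) l) \<in> green_from (Suc i)"
    "single_valued (green_from (Suc i))"
    using step.IH by auto
  note S = sconv_S[OF R Im IH(1)]
  have "?S (s *\<^sub>C chain_from (Suc i) l) = s *\<^sub>C ?S (chain_from (Suc i) l)"
    by (rule clinear_onD(2)[OF clinear_S[OF Im] UNIV_I])
  moreover have "single_valued {(x, ?S y) |x y. (x, y) \<in> green_from (Suc i)}"
    using IH(4) unfolding single_valued_def by blast
  ultimately show ?case
    unfolding chain_from_step[OF i(3)] green_from_step[OF i(2,3)] IH(2)
    using sconv_op[OF i(1) S] op_app_scale[OF i(1) S, of s] IH(3) linear_opD(1)[OF linear_A[OF i(1)]]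
    by (intro conjI) (blast, simp only:, blast, blast intro: single_valued_relcomp)
qed

end

end

locale vacuum_green = green +
  fixes \<Omega>0 :: 'a and \<epsilon> :: real
  assumes vacuum: "(\<Omega>0, 0) \<in> H0" and overlap: "cinner \<Omega> \<Omega>0 \<noteq> 0" and \<epsilon>_pos: "0 < \<epsilon>"
begin

lemma vacuum_V: "\<Omega>0 \<in> V P 1" and ex_vacuum [simp]: "ex a \<Omega>0 = \<Omega>0"
  using zero_energy[OF vacuum] by blast+

lemma vacuum_D: "\<Omega>0 \<in> D"
  using vacuum_V by (rule V_D)

lemma
  assumes curve: "simple_curve \<Gamma> \<alpha> \<beta>" and ends: "\<Gamma> \<alpha> = - T" "\<Gamma> \<beta> = T"
    and z_mem: "\<forall>j\<in>{1..m}. z j \<in> \<Gamma> ` {\<alpha>..\<beta>}" and z_succ: "\<forall>j\<in>{1..<m}. curve_succ \<Gamma> \<alpha> \<beta> (z j) (z (Suc j))"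
    and Im_T: "Im T \<le> 0" "Im T \<le> Im (z 1)" "Im T \<le> - Im (z m)"
  shows dyson_numerator: "\<Omega>0 \<in> Domain (dyson_texp P H1 \<Gamma> \<alpha> \<beta> m A z)"
      "cinner \<Omega>0 (op_app (dyson_texp P H1 \<Gamma> \<alpha> \<beta> m A z) \<Omega>0) =
        cinner \<Omega>0 (S (T - z 1) (chain_from 1 (S (z m + T) \<Omega>0)))"
    and dyson_denominator: "\<Omega>0 \<in> Domain (dyson_texp P H1 \<Gamma> \<alpha> \<beta> 0 A z)"
      "cinner \<Omega>0 (op_app (dyson_texp P H1 \<Gamma> \<alpha> \<beta> 0 A z) \<Omega>0) = cinner \<Omega>0 (S (2 * T) \<Omega>0)"
proof -
  \<comment> \<open>With the vacuum as initial vector, at energy bound 1, the vector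
    \<open>x1\<close> is the vacuum again, since the free evolution fixes it.\<close>
  interpret curve: dyson_curve P H0 H1 b c \<Gamma> \<alpha> \<beta> \<Omega>0 c' 1
    by unfold_locales (use curve vacuum_V c'_ge in auto)
  have "\<forall>j\<in>{1..m}. \<exists>t\<in>{\<alpha>..\<beta>}. z j = \<Gamma> t"
    using z_mem by blast
  then obtain \<tau> where \<tau>: "\<And>j. j \<in> {1..m} \<Longrightarrow> \<tau> j \<in> {\<alpha>..\<beta>} \<and> z j = \<Gamma> (\<tau> j)"
    by metis
  have step: "\<tau> (Suc j) < \<tau> j" if "1 \<le> j" "j < m" for j
  proof -
    have j: "j \<in> {1..m}" "Suc j \<in> {1..m}" "j \<in> {1..<m}"
      using that by auto
    show ?thesis
      using bspec[OF z_succ j(3)] \<tau>[OF j(1)] \<tau>[OF j(2)] curve.curve_succ_iff by metis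
  qed
  have decreasing: "\<tau> j < \<tau> i" if "1 \<le> i" "i < j" "j \<le> m" for i j
    using that(2,3)
  proof (induction j)
    case (Suc j)
    show ?case
    proof (cases "i = j")
      case False
      then have "\<tau> j < \<tau> i"
        using Suc by simp
      then show ?thesis
        using step[of j] Suc.prems that(1) by simp
    qed (use step Suc.prems that(1) in simp)
  qed simp
  have inj: "inj_on \<tau> {1..m}"
    by (rule linorder_inj_onI) (use decreasing in \<open>force+\<close>)
  interpret num: symmetric_dyson P H0 H1 b c \<Gamma> \<alpha> \<beta> \<Omega>0 c' 1 m A z \<tau>
    by unfold_locales (use \<tau> A_C0 tame_A inj in auto)
  \<comment> \<open>The denominator is the case without insertions on the same curve.\<close>
  interpret den: symmetric_dyson P H0 H1 b c \<Gamma> \<alpha> \<beta> \<Omega>0 c' 1 0 A z \<tau>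
    by unfold_locales auto
  show "\<Omega>0 \<in> Domain (dyson_texp P H1 \<Gamma> \<alpha> \<beta> m A z)" "\<Omega>0 \<in> Domain (dyson_texp P H1 \<Gamma> \<alpha> \<beta> 0 A z)"
    using num.dyson_texp_eq(1) den.dyson_texp_eq(1) by simp_all
  show "cinner \<Omega>0 (op_app (dyson_texp P H1 \<Gamma> \<alpha> \<beta> m A z) \<Omega>0) =
      cinner \<Omega>0 (S (T - z 1) (chain_from 1 (S (z m + T) \<Omega>0)))"
    using num.expectation_dyson_texp[OF vacuum_D ex_vacuum decreasing Im_z] ends Im_T m_pos by simp
  show "cinner \<Omega>0 (op_app (dyson_texp P H1 \<Gamma> \<alpha> \<beta> 0 A z) \<Omega>0) = cinner \<Omega>0 (S (2 * T) \<Omega>0)"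
    using den.expectation_dyson_texp[OF vacuum_D ex_vacuum] ends Im_T by simp
qed

section \<open>The limit of large \<open>T\<close>\<close>

lemma Im_at_bot: "filterlim (\<lambda>T::real. a - T * \<epsilon>) at_bot at_top"
  unfolding filterlim_at_bot
proof
  fix Z
  show "\<forall>\<^sub>F T::real in at_top. a - T * \<epsilon> \<le> Z"
    using eventually_ge_at_top[of "(a - Z) / \<epsilon>"] by eventually_elim (use \<epsilon>_pos in \<open>simp add: field_simps\<close>)
qed

abbreviation \<theta> :: "real \<Rightarrow> complex" where
  "\<theta> T \<equiv> complex_of_real T * (1 - \<i> * complex_of_real \<epsilon>)"

lemma eventually_Im: "\<forall>\<^sub>F T in at_top. Im (\<theta> T) \<le> a"
  using Im_at_bot[of 0] unfolding filterlim_at_bot by simp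

definition numerator :: "real \<Rightarrow> complex" where
  "numerator T = cinner \<Omega>0 (S (\<theta> T - z 1) (chain_from 1 (S (z m + \<theta> T) \<Omega>0)))"

definition denominator :: "real \<Rightarrow> complex" where
  "denominator T = cinner \<Omega>0 (S (2 * \<theta> T) \<Omega>0)"

lemma denominator_limit:
  "((\<lambda>T. exp (\<i> * (2 * \<theta> T) * E) * denominator T) \<longlongrightarrow> cinner \<Omega> \<Omega>0 * cinner \<Omega>0 \<Omega>) at_top"
proof -
  have "filterlim (\<lambda>T. Im (2 * \<theta> T)) at_bot at_top"
    unfolding filterlim_at_bot
  proof
    show "\<forall>\<^sub>F T in at_top. Im (2 * \<theta> T) \<le> a" for a
      using eventually_Im[of "a / 2"] by eventually_elim simp
  qed
  from tendsto_cinner[OF tendsto_const[of \<Omega>0] S_limit[OF this, of \<Omega>0]]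
  show ?thesis
    unfolding denominator_def by (simp add: cinner_scaleC_right)
qed

lemma green_limit:
  "\<Omega> \<in> Domain (green_op P H1 m A z)"
  "((\<lambda>T. exp (\<i> * (2 * \<theta> T + z m - z 1) * E) * numerator T) \<longlongrightarrow>
    cinner \<Omega> \<Omega>0 * cinner \<Omega>0 \<Omega> * cinner \<Omega> (op_app (green_op P H1 m A z) \<Omega>)) at_top"
proof -
  obtain k R where R: "resolvent_at k R"
  proof (rule Kato_Rellich)
    fix k assume "\<And>k'. k \<le> k' \<Longrightarrow> \<exists>R. clinear R \<and> bounded_linear R \<and>
      H = {(R y, y - complex_of_real k' *\<^sub>C R y) |y. True}"
    from this[OF order_refl] show thesis
      using that unfolding resolvent_at_def by blast
  qed
  have sconv_const: "sconv R (\<lambda>_::real. y) y at_top" if y: "\<And>n. \<exists>x. y = (R ^^ n) x" for y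
    unfolding sconv_def[OF R]
  proof
    fix n
    obtain x where "y = (R ^^ n) x"
      using y by blast
    then show "\<exists>g g'. (\<forall>\<^sub>F t::real in at_top. y = (R ^^ n) (g t)) \<and> y = (R ^^ n) g' \<and> (g \<longlongrightarrow> g') at_top"
      by (intro exI[of _ "\<lambda>_. x"] exI[of _ x]) simp
  qed
  let ?s = "complex_of_real E + complex_of_real k"
  have "\<Omega> = R (?s *\<^sub>C \<Omega>)"
    using R_unique[OF R ground_H] by (simp add: scaleC_add_left)
  then have "\<Omega> = (R ^^ n) (?s ^ n *\<^sub>C \<Omega>)" for n
  proof (induction n)
    case (Suc n)
    have "(R ^^ Suc n) (?s ^ Suc n *\<^sub>C \<Omega>) = R ((R ^^ n) (?s *\<^sub>C ?s ^ n *\<^sub>C \<Omega>))"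
      by (simp add: scaleC_scaleC)
    also have "\<dots> = R (?s *\<^sub>C (R ^^ n) (?s ^ n *\<^sub>C \<Omega>))"
      by (simp only: clinear_onD(2)[OF clinear_Rn[OF R] UNIV_I])
    also have "\<dots> = \<Omega>"
      using Suc by metis
    finally show ?case
      by simp
  qed simp
  then have sconv_\<Omega>: "sconv R (\<lambda>_::real. \<Omega>) \<Omega> at_top"
    by (intro sconv_const) blast
  have green_op: "green_op P H1 m A z = green_from 1"
    unfolding green_op_def ..
  have \<Omega>_green: "(\<Omega>, chain_from 1 \<Omega>) \<in> green_op P H1 m A z" "single_valued (green_op P H1 m A z)"
    and chain_\<Omega>: "\<And>s. chain_from 1 (s *\<^sub>C \<Omega>) = s *\<^sub>C chain_from 1 \<Omega>"
    using chain_from[OF R m_pos order_refl sconv_\<Omega>] unfolding green_op by blast+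
  then show "\<Omega> \<in> Domain (green_op P H1 m A z)"
    by blast
  have green_\<Omega>: "op_app (green_op P H1 m A z) \<Omega> = chain_from 1 \<Omega>"
    using \<Omega>_green by (rule op_app_eq[rotated])
  let ?l = "cinner \<Omega> \<Omega>0 *\<^sub>C \<Omega>"
  \<comment> \<open>\<open>?g\<close> is the adjoint time of the left evolution, which
    \<open>S_adjoint\<close> moves to the vacuum on the left. The two ends then converge separately
    and meet in the inner product.\<close>
  let ?f = "\<lambda>T. z m + \<theta> T" and ?g = "\<lambda>T. - cnj (\<theta> T - z 1)"
  have f: "filterlim (\<lambda>T. Im (?f T)) at_bot at_top" and g: "filterlim (\<lambda>T. Im (?g T)) at_bot at_top"
    using Im_at_bot[of "Im (z m)"] Im_at_bot[of "- Im (z 1)"] by (simp_all add: algebra_simps)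
  have X: "((\<lambda>T. chain_from 1 (exp (\<i> * ?f T * E) *\<^sub>C S (?f T) \<Omega>0)) \<longlongrightarrow> cinner \<Omega> \<Omega>0 *\<^sub>C chain_from 1 \<Omega>) at_top"
    unfolding chain_\<Omega>[symmetric]
    by (rule sconv_tendsto[OF R])
      (use chain_from[OF R m_pos order_refl sconv_ground[OF R vacuum_D f]] in simp)
  have Y: "((\<lambda>T. exp (\<i> * ?g T * E) *\<^sub>C S (?g T) \<Omega>0) \<longlongrightarrow> ?l) at_top"
    by (rule S_limit[OF g])
  have "((\<lambda>T. cinner (exp (\<i> * ?g T * E) *\<^sub>C S (?g T) \<Omega>0)
      (chain_from 1 (exp (\<i> * ?f T * E) *\<^sub>C S (?f T) \<Omega>0))) \<longlongrightarrow> cinner ?l (cinner \<Omega> \<Omega>0 *\<^sub>C chain_from 1 \<Omega>)) at_top"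
    by (rule tendsto_cinner[OF Y X])
  also have "cinner ?l (cinner \<Omega> \<Omega>0 *\<^sub>C chain_from 1 \<Omega>) =
      cinner \<Omega> \<Omega>0 * cinner \<Omega>0 \<Omega> * cinner \<Omega> (op_app (green_op P H1 m A z) \<Omega>)"
    unfolding green_\<Omega> cinner_scaleC_left cinner_scaleC_right cinner_commute[of \<Omega>0 \<Omega>] by simp
  finally show "((\<lambda>T. exp (\<i> * (2 * \<theta> T + z m - z 1) * E) * numerator T) \<longlongrightarrow>
      cinner \<Omega> \<Omega>0 * cinner \<Omega>0 \<Omega> * cinner \<Omega> (op_app (green_op P H1 m A z) \<Omega>)) at_top"
  proof (rule Lim_transform_eventually)
    have "\<forall>\<^sub>F T in at_top. Im (\<theta> T) \<le> Im (z 1) \<and> Im (\<theta> T) \<le> - Im (z m)"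
      by (intro eventually_conj eventually_Im)
    then show "\<forall>\<^sub>F T in at_top. cinner (exp (\<i> * ?g T * E) *\<^sub>C S (?g T) \<Omega>0)
        (chain_from 1 (exp (\<i> * ?f T * E) *\<^sub>C S (?f T) \<Omega>0)) = exp (\<i> * (2 * \<theta> T + z m - z 1) * E) * numerator T"
    proof eventually_elim
      case (elim T)
      have Im: "Im (?f T) \<le> 0" "Im (\<theta> T - z 1) \<le> 0"
        using elim by auto
      \<comment> \<open>At fixed \<open>T\<close> the vector lies in the range of every
        \<open>R ^^ n\<close>. As a constant family it converges in the sense of
        \<open>sconv\<close>, which lets the scalar phase pass through the chain.\<close>
      have "\<exists>x. S (?f T) \<Omega>0 = (R ^^ n) x" for n
        using D_in_Rn[OF R vacuum_D, of n] S_Rn[OF R Im(1)] by metis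
      note smooth = sconv_const[OF this]
      have "chain_from 1 (exp (\<i> * ?f T * E) *\<^sub>C S (?f T) \<Omega>0) = exp (\<i> * ?f T * E) *\<^sub>C chain_from 1 (S (?f T) \<Omega>0)"
        using chain_from[OF R m_pos order_refl smooth] by blast
      moreover have "cnj (exp (\<i> * (- cnj a) * E)) = exp (\<i> * a * E)" for a
        by (simp add: exp_cnj)
      moreover have "exp (\<i> * ?f T * E) * exp (\<i> * (\<theta> T - z 1) * E) = exp (\<i> * (2 * \<theta> T + z m - z 1) * E)"
        unfolding exp_add[symmetric] by (rule arg_cong[of _ _ exp]) (simp add: algebra_simps)
      ultimately show ?case
        unfolding numerator_def by (simp only: cinner_scaleC_left cinner_scaleC_right S_adjoint[OF Im(2)] mult.assoc[symmetric])
    qed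
  qed
qed

text \<open>Numerator and denominator are controlled only after multiplication by exponentials in
  \<open>T\<close>. The two exponentials differ by the factor
  \<open>exp (\<i> * (z 1 - z m) * E)\<close>, the prefactor of the Green function.\<close>

lemma quotient_limit:
  "\<forall>\<^sub>F T in at_top. denominator T \<noteq> 0"
  "((\<lambda>T. numerator T / denominator T) \<longlongrightarrow> green_fun P H0 H1 \<Omega> m A z) at_top"
proof -
  have nonzero: "cinner \<Omega> \<Omega>0 * cinner \<Omega>0 \<Omega> \<noteq> 0"
    using overlap cinner_commute[of \<Omega>0 \<Omega>] by simp
  show "\<forall>\<^sub>F T in at_top. denominator T \<noteq> 0"
    using tendsto_imp_eventually_ne[OF denominator_limit nonzero] by eventually_elim simp
  let ?G = "cinner \<Omega> (op_app (green_op P H1 m A z) \<Omega>)"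
  let ?a = "\<lambda>T. exp (\<i> * (2 * \<theta> T + z m - z 1) * E)" and ?d = "\<lambda>T. exp (\<i> * (2 * \<theta> T) * E)"
  have "((\<lambda>T. exp (\<i> * (z 1 - z m) * E) * (?a T * numerator T / (?d T * denominator T))) \<longlongrightarrow>
      exp (\<i> * (z 1 - z m) * E) * (cinner \<Omega> \<Omega>0 * cinner \<Omega>0 \<Omega> * ?G / (cinner \<Omega> \<Omega>0 * cinner \<Omega>0 \<Omega>))) at_top"
    by (intro tendsto_mult_left tendsto_divide green_limit(2) denominator_limit nonzero)
  moreover have "exp (\<i> * (z 1 - z m) * E) * (?a T * numerator T / (?d T * denominator T)) =
      numerator T / denominator T" for T
  proof -
    have "exp (\<i> * (z 1 - z m) * E) * ?a T = ?d T"
      unfolding exp_add[symmetric] by (rule arg_cong[of _ _ exp]) (simp add: algebra_simps)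
    then have "exp (\<i> * (z 1 - z m) * E) * (?a T * numerator T / (?d T * denominator T)) =
        ?d T * numerator T / (?d T * denominator T)"
      by (simp only: times_divide_eq_right mult.assoc[symmetric])
    then show ?thesis
      by simp
  qed
  ultimately show "((\<lambda>T. numerator T / denominator T) \<longlongrightarrow> green_fun P H0 H1 \<Omega> m A z) at_top"
    unfolding green_fun_def H_def[symmetric] using nonzero by simp
qed

lemma Gell_Mann_Low:
  assumes curves: "\<forall>\<^sub>F T in at_top.
          simple_curve (\<Gamma> T) (\<alpha> T) (\<beta> T) \<and>
          \<Gamma> T (\<alpha> T) = - complex_of_real T * (1 - \<i> * complex_of_real \<epsilon>) \<and>
          \<Gamma> T (\<beta> T) = complex_of_real T * (1 - \<i> * complex_of_real \<epsilon>) \<and>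
          (\<forall>j\<in>{1..m}. z j \<in> \<Gamma> T ` {\<alpha> T..\<beta> T}) \<and>
          (\<forall>j\<in>{1..<m}. curve_succ (\<Gamma> T) (\<alpha> T) (\<beta> T) (z j) (z (Suc j)))"
  shows "\<forall>\<^sub>F T in at_top.
      \<Omega>0 \<in> Domain (dyson_texp P H1 (\<Gamma> T) (\<alpha> T) (\<beta> T) m A z) \<and>
      \<Omega>0 \<in> Domain (dyson_texp P H1 (\<Gamma> T) (\<alpha> T) (\<beta> T) 0 A z) \<and>
      cinner \<Omega>0 (op_app (dyson_texp P H1 (\<Gamma> T) (\<alpha> T) (\<beta> T) 0 A z) \<Omega>0) \<noteq> 0" (is ?domain)
    and "((\<lambda>T. cinner \<Omega>0 (op_app (dyson_texp P H1 (\<Gamma> T) (\<alpha> T) (\<beta> T) m A z) \<Omega>0) /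
      cinner \<Omega>0 (op_app (dyson_texp P H1 (\<Gamma> T) (\<alpha> T) (\<beta> T) 0 A z) \<Omega>0)) \<longlongrightarrow> green_fun P H0 H1 \<Omega> m A z) at_top"
proof -
  let ?N = "\<lambda>T. dyson_texp P H1 (\<Gamma> T) (\<alpha> T) (\<beta> T) m A z"
  let ?D = "\<lambda>T. dyson_texp P H1 (\<Gamma> T) (\<alpha> T) (\<beta> T) 0 A z"
  have "\<forall>\<^sub>F T in at_top. Im (\<theta> T) \<le> 0 \<and> Im (\<theta> T) \<le> Im (z 1) \<and> Im (\<theta> T) \<le> - Im (z m)"
    by (intro eventually_conj eventually_Im)
  with curves have *: "\<forall>\<^sub>F T in at_top. \<Omega>0 \<in> Domain (?N T) \<and> \<Omega>0 \<in> Domain (?D T) \<and>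
      cinner \<Omega>0 (op_app (?N T) \<Omega>0) = numerator T \<and> cinner \<Omega>0 (op_app (?D T) \<Omega>0) = denominator T"
  proof eventually_elim
    case (elim T)
    have "simple_curve (\<Gamma> T) (\<alpha> T) (\<beta> T)" "\<Gamma> T (\<alpha> T) = - \<theta> T" "\<Gamma> T (\<beta> T) = \<theta> T"
      "\<forall>j\<in>{1..m}. z j \<in> \<Gamma> T ` {\<alpha> T..\<beta> T}"
      "\<forall>j\<in>{1..<m}. curve_succ (\<Gamma> T) (\<alpha> T) (\<beta> T) (z j) (z (Suc j))"
      "Im (\<theta> T) \<le> 0" "Im (\<theta> T) \<le> Im (z 1)" "Im (\<theta> T) \<le> - Im (z m)"
      using elim unfolding mult_minus_left by blast+
    note T = this
    show ?case
      using dyson_numerator[OF T] dyson_denominator[OF T] unfolding numerator_def denominator_def by (intro conjI)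
  qed
  with quotient_limit(1) show ?domain
    by eventually_elim simp
  have "\<forall>\<^sub>F T in at_top. numerator T / denominator T = cinner \<Omega>0 (op_app (?N T) \<Omega>0) / cinner \<Omega>0 (op_app (?D T) \<Omega>0)"
    using * by eventually_elim simp
  from Lim_transform_eventually[OF quotient_limit(2) this]
  show "((\<lambda>T. cinner \<Omega>0 (op_app (?N T) \<Omega>0) / cinner \<Omega>0 (op_app (?D T) \<Omega>0)) \<longlongrightarrow>
      green_fun P H0 H1 \<Omega> m A z) at_top" .
qed

end

theorem theorem3p3:
  fixes H0 H1 H :: "'a::complex_hilbert oper"
    and P :: "real set \<Rightarrow> 'a \<Rightarrow> 'a"
    and \<Omega>0 \<Omega> :: 'a
    and m :: nat and A :: "nat \<Rightarrow> 'a oper" and z :: "nat \<Rightarrow> complex"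
    and \<epsilon> :: real
    and \<Gamma> :: "real \<Rightarrow> real \<Rightarrow> complex" and \<alpha> \<beta> :: "real \<Rightarrow> real"
  assumes "selfadjoint_op H0" and "nonneg_op H0" and "spectral_measure_of H0 P"
    and "H1 \<in> class_C0 P" and "symmetric_op H1"
    and H: "H = op_add H0 H1"
    and A1: "unique_ground_state H0 \<Omega>0" "norm \<Omega>0 = 1" "E0 H0 = 0"
    and A2: "unique_ground_state H \<Omega>" "norm \<Omega> = 1"
    and A3: "cinner \<Omega> \<Omega>0 \<noteq> 0"
    and "m \<ge> 1"
    and I: "\<And>k. k \<in> {1..m} \<Longrightarrow> A k \<in> class_C0 P"
    and II: "\<And>k. k \<in> {1..m} \<Longrightarrow>
               \<exists>r. \<forall>n. maps_into (A k) (Domain (H ^^ (n + r))) (Domain (H ^^ n))"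
    and Im_z: "\<And>j. j \<in> {1..<m} \<Longrightarrow> Im (z j) \<le> Im (z (Suc j))"
    and "\<epsilon> > 0"
    and curves: "\<forall>\<^sub>F T in at_top.
          simple_curve (\<Gamma> T) (\<alpha> T) (\<beta> T) \<and>
          \<Gamma> T (\<alpha> T) = - complex_of_real T * (1 - \<i> * complex_of_real \<epsilon>) \<and>
          \<Gamma> T (\<beta> T) = complex_of_real T * (1 - \<i> * complex_of_real \<epsilon>) \<and>
          (\<forall>j\<in>{1..m}. z j \<in> \<Gamma> T ` {\<alpha> T..\<beta> T}) \<and>
          (\<forall>j\<in>{1..<m}. curve_succ (\<Gamma> T) (\<alpha> T) (\<beta> T) (z j) (z (Suc j)))"
  shows "\<Omega> \<in> Domain (green_op P H1 m A z) \<and>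
         (\<forall>\<^sub>F T in at_top.
            \<Omega>0 \<in> Domain (dyson_texp P H1 (\<Gamma> T) (\<alpha> T) (\<beta> T) m A z) \<and>
            \<Omega>0 \<in> Domain (dyson_texp P H1 (\<Gamma> T) (\<alpha> T) (\<beta> T) 0 A z) \<and>
            cinner \<Omega>0 (op_app (dyson_texp P H1 (\<Gamma> T) (\<alpha> T) (\<beta> T) 0 A z) \<Omega>0) \<noteq> 0) \<and>
         ((\<lambda>T. cinner \<Omega>0 (op_app (dyson_texp P H1 (\<Gamma> T) (\<alpha> T) (\<beta> T) m A z) \<Omega>0) /
               cinner \<Omega>0 (op_app (dyson_texp P H1 (\<Gamma> T) (\<alpha> T) (\<beta> T) 0 A z) \<Omega>0))
            \<longlongrightarrow> green_fun P H0 H1 \<Omega> m A z) at_top"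
proof -
  interpret projection_measure P
    by unfold_locales (use assms(3) in \<open>simp add: spectral_measure_of_def\<close>)
  interpret free_hamiltonian P H0
    by unfold_locales (use assms(1-3) in \<open>simp_all add: spectral_measure_of_def\<close>)
  obtain b0 c0 where H1: "tame b0 c0 (op_app H1)"
    using class_C0_tame[OF assms(4)] by blast
  have "\<forall>k\<in>{1..m}. \<exists>p. tame (fst p) (snd p) (op_app (A k))"
    using class_C0_tame[OF I] by (metis fst_conv snd_conv)
  then obtain p where p: "\<And>k. k \<in> {1..m} \<Longrightarrow> tame (fst (p k)) (snd (p k)) (op_app (A k))"
    by metis
  \<comment> \<open>Nonnegative summands are dominated by their sum, so one pair \<open>b\<close>,
    \<open>c\<close> serves \<open>H1\<close> and all the \<open>A k\<close>; \<open>c\<close> is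
    used for \<open>c'\<close> too.\<close>
  define b where "b = b0 + (\<Sum>k\<in>{1..m}. fst (p k))"
  define c where "c = c0 + (\<Sum>k\<in>{1..m}. snd (p k))"
  have nonneg: "0 \<le> b0" "0 \<le> c0" "\<And>k. k \<in> {1..m} \<Longrightarrow> 0 \<le> fst (p k)" "\<And>k. k \<in> {1..m} \<Longrightarrow> 0 \<le> snd (p k)"
    using tame_nonneg[OF H1] tame_nonneg[OF p] by blast+
  have "b0 \<le> b" "c0 \<le> c"
    unfolding b_def c_def using sum_nonneg[of "{1..m}" "\<lambda>k. fst (p k)"] sum_nonneg[of "{1..m}" "\<lambda>k. snd (p k)"] nonneg
    by simp_all
  with H1 have tame_H1: "tame b c (op_app H1)"
    by (rule tame_mono)
  have tame_A: "tame b c (op_app (A k))" if k: "k \<in> {1..m}" for k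
  proof (rule tame_mono[OF p[OF k]])
    show "fst (p k) \<le> b" "snd (p k) \<le> c"
      unfolding b_def c_def
      using member_le_sum[OF k, of "\<lambda>k. fst (p k)"] member_le_sum[OF k, of "\<lambda>k. snd (p k)"] nonneg by auto
  qed
  interpret symm: symmetric_interaction P H0 H1 b c
    by unfold_locales (use assms(4,5) tame_H1 in auto)
  have H_eq: "H = symm.H"
    unfolding H symm.H_def ..
  have vacuum: "(\<Omega>0, 0) \<in> H0"
    using A1 unfolding unique_ground_state_def ground_state_def ground_space_def by simp
  interpret vacuum_green P H0 H1 b c \<Omega> c m A z \<Omega>0 \<epsilon>
    by unfold_locales (use A2 A3 I II Im_z tame_A vacuum \<open>m \<ge> 1\<close> \<open>\<epsilon> > 0\<close> in \<open>simp_all add: H_eq\<close>)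
  show ?thesis
    using green_limit(1) Gell_Mann_Low[OF curves] by (intro conjI)
qed

end
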